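(* Let $\mathcal V$ be equipped with a $\mathcal V$-enriched lax orthogonal factorisation system (LOFS) $(\mathsf E,\mathsf M)$, and let $\mathcal C$ be a complete and cocomplete $\mathcal V$-category. Then any $\mathcal V$-enriched AWFS on $\mathcal C$ that is cofibrantly $(\mathsf E,\mathsf M)$-generated by a small $\mathcal V$-category is lax orthogonal. In particular, any AWFS on $\mathcal C$ that is cofibrantly KZ-generated by a small $\mathcal V$-category is lax orthogonal.
   Context: Base. $\mathcal V$ is a full sub-2-category of $\mathbf{Cat}$, closed under limits and exponentials in $\mathbf{Cat}$, cocomplete, and containing the arrow category $\mathbf 2=(0\to 1)$ (the inclusion is not assumed to preserve colimits). It is regarded as a cartesian closed category, so a $\mathcal V$-category is a 2-category with hom-categories in $\mathcal V$. $\mathcal C^{\mathbf 2}$ is the $\mathcal V$-category of arrows of $\mathcal C$. $\mathbb S\mathrm q(\mathcal C)$ is the category internal to $\mathcal V$-categories with object part $\mathcal C$ and arrow part $\mathcal C^{\mathbf 2}$. AWFS. A $\mathcal V$-enriched algebraic weak factorisation system (AWFS) $(\mathsf L,\mathsf R)$ on $\mathcal C$ is a $\mathcal V$-functorial factorisation $f=(A\xrightarrow{Lf}Kf\xrightarrow{Rf}B)$ of arrows $f\colon A\to B$, with $\mathcal V$-natural $\Sigma_f=(1,\sigma_f)\colon Lf\to L^2f$ and $\Pi_f=(\pi_f,1)\colon R^2f\to Rf$ making $\mathsf L=(L,\Phi,\Sigma)$ a $\mathcal V$-comonad and $\mathsf R=(R,\Lambda,\Pi)$ a $\mathcal V$-monad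 on $\mathcal C^{\mathbf 2}$, where $\Phi_f=(1,Rf)\colon Lf\to f$ and $\Lambda_f=(Lf,1)\colon f\to Rf$, and such that $(\sigma_f,\pi_f)\colon LRf\to RLf$ is a mixed distributive law. Then $\mathsf R$-algebras compose, and $\mathsf R\text-\mathrm{Alg}\rightrightarrows\mathcal C$ is an internal category $\mathsf R\text-\mathbb A\mathrm{lg}$ with a forgetful internal functor to $\mathbb S\mathrm q(\mathcal C)$. Lax orthogonality. A 2-monad $(T,i,m)$ is lax idempotent if $Ti\dashv m$ with identity unit (equivalently $m\dashv iT$ with identity counit); a 2-comonad is lax idempotent if the corresponding 2-monad on the 2-category with reversed 1-cells is. An AWFS is a LOFS, or lax orthogonal, if $\mathsf L$ and $\mathsf R$ are lax idempotent (equivalently, one of them is). Lifting. Let $(\mathsf E,\mathsf M)$ be a $\mathcal V$-enriched AWFS on $\mathcal V$; it induces one pointwise on each $[\mathcal J^{\mathrm{op}},\mathcal V]$. For a small $\mathcal V$-category $\mathcal J$ over $\mathcal C^{\mathbf 2}$, i.e. with a $\mathcal V$-functor $U\colon\mathcal J\to\mathcal C^{\mathbf 2}$, let $W_U\colon\mathcal C^{\mathbf 2}\to[\mathcal J^{\mathrm{op}},\mathcal V]^{\mathbf 2}$ send $f\colon A\to B$ to the comparison $\mathcal C(\mathrm{cod}\,Uj,A)\to\mathcal C^{\mathbf 2}(Uj,f)=\mathcal C(\mathrm{dom}\,Uj,A)\times_{\mathcal C(\mathrm{dom}\,Uj,B)}\mathcal C(\mathrm{cod}\,Uj,B)$. The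 $\mathcal V$-category $\mathcal J^{\pitchfork_{\mathsf M}}$ is the pullback of the forgetful $\mathsf M\text-\mathrm{Alg}\to[\mathcal J^{\mathrm{op}},\mathcal V]^{\mathbf 2}$ along $W_U$. It is the arrow part of an internal category with object part $\mathcal C$: the comparison of a composite $g\cdot f$ is the composite of the comparison of $f$ with a pullback of the comparison of $g$, and $\mathsf M$-algebras are canonically stable under pullback and composition. An AWFS $(\mathsf L,\mathsf R)$ on $\mathcal C$ is cofibrantly $(\mathsf E,\mathsf M)$-generated by $\mathcal J$ if $\mathsf R\text-\mathbb A\mathrm{lg}\cong\mathcal J^{\pitchfork_{\mathsf M}}$ as internal categories over $\mathbb S\mathrm q(\mathcal C)$. KZ-generation is the case where $(\mathsf E,\mathsf M)$ is the LOFS on $\mathcal V$ whose $\mathsf M$-algebras are RALIs: morphisms $f$ equipped with a left adjoint $\ell\dashv f$ with identity unit (so $f\ell=1$). Here $Ef\colon A\to\mathrm{col}_\ell f$ is the coprojection into the lax colimit of $f$, and $Mf\colon\mathrm{col}_\ell f\to B$ is induced by the identity 2-cell of $f$. *)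

theory Defs
  imports Main "HOL-Library.FuncSet" "HOL-Library.Equipollence"
begin

section \<open>Categories and strict 2-categories\<close>

text \<open>
  Categories are single-sorted: an object is identified with its identity arrow. The operations are
  only meaningful on \<open>arrs\<close>, and a composite \<open>cmp X g f\<close> only when \<open>src X g = tgt X f\<close>.
\<close>

record 'a cat =
  arrs :: "'a set"
  src :: "'a \<Rightarrow> 'a"
  tgt :: "'a \<Rightarrow> 'a"
  cmp :: "'a \<Rightarrow> 'a \<Rightarrow> 'a"

definition category :: "'a cat \<Rightarrow> bool" where
  "category X \<longleftrightarrow>
     (\<forall>f\<in>arrs X. src X f \<in> arrs X \<and> tgt X f \<in> arrs X \<and>
        src X (src X f) = src X f \<and> tgt X (src X f) = src X f \<and>
        src X (tgt X f) = tgt X f \<and> tgt X (tgt X f) = tgt X f \<and>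
        cmp X f (src X f) = f \<and> cmp X (tgt X f) f = f) \<and>
     (\<forall>f\<in>arrs X. \<forall>g\<in>arrs X. src X g = tgt X f \<longrightarrow>
        cmp X g f \<in> arrs X \<and> src X (cmp X g f) = src X f \<and> tgt X (cmp X g f) = tgt X g) \<and>
     (\<forall>f\<in>arrs X. \<forall>g\<in>arrs X. \<forall>h\<in>arrs X. src X g = tgt X f \<and> src X h = tgt X g \<longrightarrow>
        cmp X h (cmp X g f) = cmp X (cmp X h g) f)"

definition objs :: "'a cat \<Rightarrow> 'a set" where
  "objs X = {a \<in> arrs X. src X a = a}"

definition dual :: "'a cat \<Rightarrow> 'a cat" where
  "dual X = \<lparr>arrs = arrs X, src = tgt X, tgt = src X, cmp = (\<lambda>g f. cmp X f g)\<rparr>"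

definition is_functor :: "'a cat \<Rightarrow> 'b cat \<Rightarrow> ('a \<Rightarrow> 'b) \<Rightarrow> bool" where
  "is_functor X Y F \<longleftrightarrow>
     (\<forall>f\<in>arrs X. F f \<in> arrs Y \<and> F (src X f) = src Y (F f) \<and> F (tgt X f) = tgt Y (F f)) \<and>
     (\<forall>f\<in>arrs X. \<forall>g\<in>arrs X. src X g = tgt X f \<longrightarrow> F (cmp X g f) = cmp Y (F g) (F f))"

definition iso_functor :: "'a cat \<Rightarrow> 'b cat \<Rightarrow> ('a \<Rightarrow> 'b) \<Rightarrow> bool" where
  "iso_functor X Y F \<longleftrightarrow> is_functor X Y F \<and> bij_betw F (arrs X) (arrs Y)"

definition nat_trans ::
    "'a cat \<Rightarrow> 'b cat \<Rightarrow> ('a \<Rightarrow> 'b) \<Rightarrow> ('a \<Rightarrow> 'b) \<Rightarrow> ('a \<Rightarrow> 'b) \<Rightarrow> bool" where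
  "nat_trans X Y F G t \<longleftrightarrow>
     (\<forall>a\<in>objs X. t a \<in> arrs Y \<and> src Y (t a) = F a \<and> tgt Y (t a) = G a) \<and>
     (\<forall>f\<in>arrs X. cmp Y (t (tgt X f)) (F f) = cmp Y (G f) (t (src X f)))"

definition is_limit ::
    "'k cat \<Rightarrow> 'i cat \<Rightarrow> ('i \<Rightarrow> 'k) \<Rightarrow> 'k \<Rightarrow> ('i \<Rightarrow> 'k) \<Rightarrow> bool" where
  "is_limit K I D v p \<longleftrightarrow>
     (let cone = (\<lambda>w q. w \<in> objs K \<and>
            (\<forall>i\<in>objs I. q i \<in> arrs K \<and> src K (q i) = w \<and> tgt K (q i) = D i) \<and>
            (\<forall>f\<in>arrs I. cmp K (D f) (q (src I f)) = q (tgt I f)))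
      in cone v p \<and>
         (\<forall>w q. cone w q \<longrightarrow>
            (\<exists>!h. h \<in> arrs K \<and> src K h = w \<and> tgt K h = v \<and> (\<forall>i\<in>objs I. cmp K (p i) h = q i))))"

text \<open>
  A strict 2-category is a set of 2-cells with two commuting category structures, \<open>hor\<close> (composition
  along 0-cells) and \<open>ver\<close> (composition along 1-cells). A 1-cell is identified with its identity
  2-cell, and a 0-cell with its identity 1-cell, so \<open>\<star>\<close> also expresses whiskering and the action of
  1-cells on 2-cells.
\<close>

record 'c twocat =
  hor :: "'c cat"
  ver :: "'c cat"

abbreviation cells :: "'c twocat \<Rightarrow> 'c set" where "cells C \<equiv> arrs (hor C)"
abbreviation s0 :: "'c twocat \<Rightarrow> 'c \<Rightarrow> 'c" where "s0 C \<equiv> src (hor C)"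
abbreviation t0 :: "'c twocat \<Rightarrow> 'c \<Rightarrow> 'c" where "t0 C \<equiv> tgt (hor C)"
abbreviation s1 :: "'c twocat \<Rightarrow> 'c \<Rightarrow> 'c" where "s1 C \<equiv> src (ver C)"
abbreviation t1 :: "'c twocat \<Rightarrow> 'c \<Rightarrow> 'c" where "t1 C \<equiv> tgt (ver C)"
abbreviation zero_cells :: "'c twocat \<Rightarrow> 'c set" where "zero_cells C \<equiv> objs (hor C)"
abbreviation one_cells :: "'c twocat \<Rightarrow> 'c set" where "one_cells C \<equiv> objs (ver C)"

abbreviation hcomp :: "'c \<Rightarrow> 'c twocat \<Rightarrow> 'c \<Rightarrow> 'c" ("(_ \<star>\<^bsub>_\<^esub>/ _)" [71, 0, 70] 70) where
  "y \<star>\<^bsub>C\<^esub> x \<equiv> cmp (hor C) y x"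
abbreviation vcomp :: "'c \<Rightarrow> 'c twocat \<Rightarrow> 'c \<Rightarrow> 'c" ("(_ \<bullet>\<^bsub>_\<^esub>/ _)" [66, 0, 65] 65) where
  "y \<bullet>\<^bsub>C\<^esub> x \<equiv> cmp (ver C) y x"

definition two_category :: "'c twocat \<Rightarrow> bool" where
  "two_category C \<longleftrightarrow>
     category (hor C) \<and> category (ver C) \<and> arrs (ver C) = cells C \<and>
     (\<forall>x\<in>cells C.
        s0 C (s1 C x) = s0 C x \<and> s0 C (t1 C x) = s0 C x \<and>
        t0 C (s1 C x) = t0 C x \<and> t0 C (t1 C x) = t0 C x \<and>
        s1 C (s0 C x) = s0 C x \<and> s1 C (t0 C x) = t0 C x) \<and>
     (\<forall>x\<in>cells C. \<forall>y\<in>cells C. s0 C y = t0 C x \<longrightarrow>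
        s1 C (y \<star>\<^bsub>C\<^esub> x) = s1 C y \<star>\<^bsub>C\<^esub> s1 C x \<and> t1 C (y \<star>\<^bsub>C\<^esub> x) = t1 C y \<star>\<^bsub>C\<^esub> t1 C x) \<and>
     (\<forall>x\<in>cells C. \<forall>x'\<in>cells C. \<forall>y\<in>cells C. \<forall>y'\<in>cells C.
        s0 C y = t0 C x \<and> s1 C x' = t1 C x \<and> s1 C y' = t1 C y \<longrightarrow>
        (y' \<bullet>\<^bsub>C\<^esub> y) \<star>\<^bsub>C\<^esub> (x' \<bullet>\<^bsub>C\<^esub> x) = (y' \<star>\<^bsub>C\<^esub> x') \<bullet>\<^bsub>C\<^esub> (y \<star>\<^bsub>C\<^esub> x))"

definition Hom :: "'c twocat \<Rightarrow> 'c \<Rightarrow> 'c \<Rightarrow> 'c cat" where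
  "Hom C A B = ver C\<lparr>arrs := {x \<in> cells C. s0 C x = A \<and> t0 C x = B}\<rparr>"

definition underlying :: "'c twocat \<Rightarrow> 'c cat" where
  "underlying C = hor C\<lparr>arrs := one_cells C\<rparr>"

text \<open>The dual that reverses 1-cells only.\<close>

definition op :: "'c twocat \<Rightarrow> 'c twocat" where
  "op C = \<lparr>hor = dual (hor C), ver = ver C\<rparr>"

definition two_functor :: "'c twocat \<Rightarrow> 'd twocat \<Rightarrow> ('c \<Rightarrow> 'd) \<Rightarrow> bool" where
  "two_functor C D F \<longleftrightarrow> is_functor (hor C) (hor D) F \<and> is_functor (ver C) (ver D) F"

definition two_natural ::
    "'c twocat \<Rightarrow> 'd twocat \<Rightarrow> ('c \<Rightarrow> 'd) \<Rightarrow> ('c \<Rightarrow> 'd) \<Rightarrow> ('c \<Rightarrow> 'd) \<Rightarrow> bool" where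
  "two_natural C D F G t \<longleftrightarrow>
     (\<forall>A\<in>zero_cells C. t A \<in> one_cells D \<and> s0 D (t A) = F A \<and> t0 D (t A) = G A) \<and>
     (\<forall>x\<in>cells C. t (t0 C x) \<star>\<^bsub>D\<^esub> F x = G x \<star>\<^bsub>D\<^esub> t (s0 C x))"

subsection \<open>The 2-category of arrows\<close>

text \<open>
  \<open>Sq f a b g\<close> is a 2-cell of the 2-category of arrows from \<open>f\<close> to \<open>g\<close>, with domain part \<open>a\<close> and
  codomain part \<open>b\<close>. The object given by a 1-cell \<open>f\<close> is the identity square \<open>ob C f\<close>.
\<close>

datatype 'c sq = Sq (left: 'c) (top: 'c) (bot: 'c) (right: 'c)

definition ob :: "'c twocat \<Rightarrow> 'c \<Rightarrow> 'c sq" where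
  "ob C f = Sq f (s0 C f) (t0 C f) f"

definition Arr :: "'c twocat \<Rightarrow> 'c sq twocat" where
  "Arr C =
     (let S = {Sq f a b g | f a b g.
                 f \<in> one_cells C \<and> g \<in> one_cells C \<and> a \<in> cells C \<and> b \<in> cells C \<and>
                 s0 C a = s0 C f \<and> t0 C a = s0 C g \<and> s0 C b = t0 C f \<and> t0 C b = t0 C g \<and>
                 g \<star>\<^bsub>C\<^esub> a = b \<star>\<^bsub>C\<^esub> f}
      in \<lparr>hor = \<lparr>arrs = S,
                 src = (\<lambda>x. ob C (left x)),
                 tgt = (\<lambda>x. ob C (right x)),
                 cmp = (\<lambda>y x. Sq (left x) (top y \<star>\<^bsub>C\<^esub> top x) (bot y \<star>\<^bsub>C\<^esub> bot x) (right y))\<rparr>,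
          ver = \<lparr>arrs = S,
                 src = (\<lambda>x. Sq (left x) (s1 C (top x)) (s1 C (bot x)) (right x)),
                 tgt = (\<lambda>x. Sq (left x) (t1 C (top x)) (t1 C (bot x)) (right x)),
                 cmp = (\<lambda>y x. Sq (left x) (top y \<bullet>\<^bsub>C\<^esub> top x) (bot y \<bullet>\<^bsub>C\<^esub> bot x) (right x))\<rparr>\<rparr>)"

subsection \<open>The 2-category of 2-functors\<close>

text \<open>
  \<open>Mdf F \<mu> G\<close> is a modification with components \<open>\<mu> A\<close>; its source and target are the 2-natural
  transformations with components \<open>s1 (\<mu> A)\<close> and \<open>t1 (\<mu> A)\<close>. Functions are taken extensional, so
  that equality of cells is equality of values.
\<close>

datatype ('p, 'q) mdf = Mdf (mfrom: "'p \<Rightarrow> 'q") (mat: "'p \<Rightarrow> 'q") (mto: "'p \<Rightarrow> 'q")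

definition Fun2 :: "'p twocat \<Rightarrow> 'q twocat \<Rightarrow> ('p, 'q) mdf twocat" where
  "Fun2 P Q =
     (let S = {Mdf F \<mu> G | F \<mu> G.
                 two_functor P Q F \<and> F \<in> extensional (cells P) \<and>
                 two_functor P Q G \<and> G \<in> extensional (cells P) \<and>
                 \<mu> \<in> extensional (zero_cells P) \<and> (\<forall>A\<in>zero_cells P. \<mu> A \<in> cells Q) \<and>
                 two_natural P Q F G (\<lambda>A. s1 Q (\<mu> A)) \<and> two_natural P Q F G (\<lambda>A. t1 Q (\<mu> A)) \<and>
                 (\<forall>x\<in>one_cells P. \<mu> (t0 P x) \<star>\<^bsub>Q\<^esub> F x = G x \<star>\<^bsub>Q\<^esub> \<mu> (s0 P x))}
      in \<lparr>hor = \<lparr>arrs = S,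
                 src = (\<lambda>x. Mdf (mfrom x) (\<lambda>A\<in>zero_cells P. mfrom x A) (mfrom x)),
                 tgt = (\<lambda>x. Mdf (mto x) (\<lambda>A\<in>zero_cells P. mto x A) (mto x)),
                 cmp = (\<lambda>y x. Mdf (mfrom x) (\<lambda>A\<in>zero_cells P. mat y A \<star>\<^bsub>Q\<^esub> mat x A) (mto y))\<rparr>,
          ver = \<lparr>arrs = S,
                 src = (\<lambda>x. Mdf (mfrom x) (\<lambda>A\<in>zero_cells P. s1 Q (mat x A)) (mto x)),
                 tgt = (\<lambda>x. Mdf (mfrom x) (\<lambda>A\<in>zero_cells P. t1 Q (mat x A)) (mto x)),
                 cmp = (\<lambda>y x. Mdf (mfrom x) (\<lambda>A\<in>zero_cells P. mat y A \<bullet>\<^bsub>Q\<^esub> mat x A) (mto x))\<rparr>\<rparr>)"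

subsection \<open>The 2-category of a class of categories\<close>

text \<open>\<open>Nt X F G t Y\<close> is a natural transformation \<open>t\<close> between functors \<open>F\<close>, \<open>G\<close> from \<open>X\<close> to \<open>Y\<close>.\<close>

datatype 'u nt =
  Nt (nsrc: "'u cat") (nfrom: "'u \<Rightarrow> 'u") (nto: "'u \<Rightarrow> 'u") (nat_at: "'u \<Rightarrow> 'u") (ntgt: "'u cat")

definition idnt :: "'u cat \<Rightarrow> 'u nt" where
  "idnt X = Nt X (\<lambda>f\<in>arrs X. f) (\<lambda>f\<in>arrs X. f) (\<lambda>a\<in>objs X. a) X"

definition Cat2 :: "'u cat set \<Rightarrow> 'u nt twocat" where
  "Cat2 V =
     (let S = {Nt X F G t Y | X F G t Y.
                 X \<in> V \<and> Y \<in> V \<and> is_functor X Y F \<and> is_functor X Y G \<and> nat_trans X Y F G t \<and>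
                 F \<in> extensional (arrs X) \<and> G \<in> extensional (arrs X) \<and> t \<in> extensional (objs X)}
      in \<lparr>hor = \<lparr>arrs = S,
                 src = (\<lambda>x. idnt (nsrc x)),
                 tgt = (\<lambda>x. idnt (ntgt x)),
                 cmp = (\<lambda>y x. Nt (nsrc x)
                   (\<lambda>f\<in>arrs (nsrc x). nfrom y (nfrom x f))
                   (\<lambda>f\<in>arrs (nsrc x). nto y (nto x f))
                   (\<lambda>a\<in>objs (nsrc x). cmp (ntgt y) (nat_at y (nto x a)) (nfrom y (nat_at x a)))
                   (ntgt y))\<rparr>,
          ver = \<lparr>arrs = S,
                 src = (\<lambda>x. Nt (nsrc x) (nfrom x) (nfrom x) (\<lambda>a\<in>objs (nsrc x). nfrom x a) (ntgt x)),
                 tgt = (\<lambda>x. Nt (nsrc x) (nto x) (nto x) (\<lambda>a\<in>objs (nsrc x). nto x a) (ntgt x)),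
                 cmp = (\<lambda>y x. Nt (nsrc x) (nfrom x) (nto y)
                   (\<lambda>a\<in>objs (nsrc x). cmp (ntgt x) (nat_at y a) (nat_at x a)) (ntgt x))\<rparr>\<rparr>)"

section \<open>The base and categories enriched in it\<close>

text \<open>
  The type \<open>'u\<close> plays the role of a universe: a set (of any type) is small if it has fewer elements
  than \<open>'u\<close>, whose cardinality is required to be regular and a strong limit. An inaccessible
  cardinality gives the usual notion of smallness; the countable case, where small means finite, is
  not excluded.
\<close>

definition universe :: "'u itself \<Rightarrow> bool" where
  "universe _ \<longleftrightarrow>
     (\<forall>A :: 'u set. A \<prec> (UNIV :: 'u set) \<longrightarrow> Pow A \<prec> (UNIV :: 'u set)) \<and>
     (\<forall>(A :: 'u set) (F :: 'u \<Rightarrow> 'u set).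
        A \<prec> (UNIV :: 'u set) \<and> (\<forall>a\<in>A. F a \<prec> (UNIV :: 'u set)) \<longrightarrow>
        (\<Union>a\<in>A. F a) \<prec> (UNIV :: 'u set))"

definition small_cats :: "'u cat set" where
  "small_cats = {X. category X \<and> arrs X \<prec> (UNIV :: 'u set)}"

definition in_base :: "'u cat set \<Rightarrow> 'x cat \<Rightarrow> bool" where
  "in_base V X \<longleftrightarrow> (\<exists>Y\<in>V. \<exists>\<phi>. iso_functor X Y \<phi>)"

text \<open>The category with two objects and one non-identity arrow: \<open>(i, j)\<close> is the arrow \<open>i \<le> j\<close>.\<close>

definition arrow_cat :: "(bool \<times> bool) cat" where
  "arrow_cat = \<lparr>arrs = {(i, j). i \<le> j}, src = (\<lambda>(i, j). (i, i)), tgt = (\<lambda>(i, j). (j, j)),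
     cmp = (\<lambda>g f. (fst f, snd g))\<rparr>"

text \<open>
  The full sub-2-category on \<open>V\<close> is not assumed replete; closure conditions are up to isomorphism.
  The exponential of \<open>X\<close> and \<open>Y\<close> is the hom-category from \<open>X\<close> to \<open>Y\<close>, that is, the functor category.
\<close>

definition base_2category :: "'u cat set \<Rightarrow> bool" where
  "base_2category V \<longleftrightarrow>
     universe TYPE('u) \<and> V \<subseteq> small_cats \<and>
     (\<forall>I\<in>small_cats. \<forall>D :: 'u \<Rightarrow> 'u nt. is_functor I (underlying (Cat2 V)) D \<longrightarrow>
        (\<exists>X\<in>V. \<exists>p. is_limit (underlying (Cat2 small_cats)) I D (idnt X) p)) \<and>
     (\<forall>X\<in>V. \<forall>Y\<in>V. in_base V (Hom (Cat2 V) (idnt X) (idnt Y))) \<and>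
     (\<forall>I\<in>small_cats. \<forall>D :: 'u \<Rightarrow> 'u nt. is_functor I (underlying (Cat2 V)) D \<longrightarrow>
        (\<exists>v p. is_limit (dual (underlying (Cat2 V))) (dual I) D v p)) \<and>
     in_base V arrow_cat"

text \<open>
  As the base is a full sub-2-category of the 2-category of small categories, a category enriched in
  it is a 2-category whose hom-categories belong to \<open>V\<close> (up to isomorphism), and enriched functors
  and transformations are 2-functors and 2-natural transformations.
\<close>

definition V_category :: "'u cat set \<Rightarrow> 'c twocat \<Rightarrow> bool" where
  "V_category V C \<longleftrightarrow>
     two_category C \<and> (\<forall>A\<in>zero_cells C. \<forall>B\<in>zero_cells C. in_base V (Hom C A B))"

definition small_V_category :: "'u cat set \<Rightarrow> 'c twocat \<Rightarrow> bool" where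
  "small_V_category V J \<longleftrightarrow> V_category V J \<and> cells J \<prec> (UNIV :: 'u set)"

text \<open>
  A chosen object of \<open>V\<close> isomorphic to a category \<open>X\<close>, with the isomorphism \<open>enc V X\<close> and its inverse
  \<open>dec V X\<close>; \<open>vcell\<close> transports a natural transformation along these isomorphisms.
\<close>

definition rep :: "'u cat set \<Rightarrow> 'x cat \<Rightarrow> 'u cat \<times> ('x \<Rightarrow> 'u)" where
  "rep V X = (SOME p. fst p \<in> V \<and> iso_functor X (fst p) (snd p))"

definition robj :: "'u cat set \<Rightarrow> 'x cat \<Rightarrow> 'u cat" where
  "robj V X = fst (rep V X)"

definition enc :: "'u cat set \<Rightarrow> 'x cat \<Rightarrow> 'x \<Rightarrow> 'u" where
  "enc V X = snd (rep V X)"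

definition dec :: "'u cat set \<Rightarrow> 'x cat \<Rightarrow> 'u \<Rightarrow> 'x" where
  "dec V X = inv_into (arrs X) (enc V X)"

definition vcell ::
    "'u cat set \<Rightarrow> 'x cat \<Rightarrow> 'y cat \<Rightarrow> ('x \<Rightarrow> 'y) \<Rightarrow> ('x \<Rightarrow> 'y) \<Rightarrow> ('x \<Rightarrow> 'y) \<Rightarrow> 'u nt" where
  "vcell V X Y F G t = Nt (robj V X)
     (\<lambda>f\<in>arrs (robj V X). enc V Y (F (dec V X f)))
     (\<lambda>f\<in>arrs (robj V X). enc V Y (G (dec V X f)))
     (\<lambda>a\<in>objs (robj V X). enc V Y (t (dec V X a)))
     (robj V Y)"

text \<open>The presheaf 2-category \<open>[J\<^sup>o\<^sup>p, V]\<close>.\<close>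

definition Psh :: "'u cat set \<Rightarrow> 'j twocat \<Rightarrow> ('j, 'u nt) mdf twocat" where
  "Psh V J = Fun2 (op J) (Cat2 V)"

text \<open>
  For a 2-functor \<open>D\<close> from \<open>J\<close> to \<open>K\<close>, \<open>nerve V J K D\<close> is the 2-functor from \<open>K\<close> to \<open>[J\<^sup>o\<^sup>p, V]\<close>
  sending \<open>X\<close> to \<open>K(D-, X)\<close>, given on all 2-cells of \<open>K\<close>.
\<close>

definition nerve_ob ::
    "'u cat set \<Rightarrow> 'j twocat \<Rightarrow> 'k twocat \<Rightarrow> ('j \<Rightarrow> 'k) \<Rightarrow> 'k \<Rightarrow> 'j \<Rightarrow> 'u nt" where
  "nerve_ob V J K D X = (\<lambda>y\<in>cells J.
     vcell V (Hom K (D (t0 J y)) X) (Hom K (D (s0 J y)) X)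
       (\<lambda>h. h \<star>\<^bsub>K\<^esub> D (s1 J y)) (\<lambda>h. h \<star>\<^bsub>K\<^esub> D (t1 J y)) (\<lambda>h. h \<star>\<^bsub>K\<^esub> D y))"

definition nerve ::
    "'u cat set \<Rightarrow> 'j twocat \<Rightarrow> 'k twocat \<Rightarrow> ('j \<Rightarrow> 'k) \<Rightarrow> 'k \<Rightarrow> ('j, 'u nt) mdf" where
  "nerve V J K D x = Mdf
     (nerve_ob V J K D (s0 K x))
     (\<lambda>j\<in>zero_cells J. vcell V (Hom K (D j) (s0 K x)) (Hom K (D j) (t0 K x))
        (\<lambda>h. s1 K x \<star>\<^bsub>K\<^esub> h) (\<lambda>h. t1 K x \<star>\<^bsub>K\<^esub> h) (\<lambda>h. x \<star>\<^bsub>K\<^esub> h))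
     (nerve_ob V J K D (t0 K x))"

text \<open>
  \<open>c\<close> is a colimit of \<open>D\<close> weighted by \<open>\<phi>\<close> with unit \<open>\<eta>\<close>: composition with \<open>\<eta>\<close> is an isomorphism
  between \<open>K(c, X)\<close> and \<open>[J\<^sup>o\<^sup>p, V](\<phi>, K(D-, X))\<close>. Weighted limits are weighted colimits in the dual.
\<close>

definition is_weighted_colimit ::
    "'u cat set \<Rightarrow> 'j twocat \<Rightarrow> 'k twocat \<Rightarrow> ('j \<Rightarrow> 'k) \<Rightarrow> ('j, 'u nt) mdf \<Rightarrow>
     'k \<Rightarrow> ('j, 'u nt) mdf \<Rightarrow> bool" where
  "is_weighted_colimit V J K D \<phi> c \<eta> \<longleftrightarrow>
     c \<in> zero_cells K \<and> \<eta> \<in> one_cells (Psh V J) \<and>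
     s0 (Psh V J) \<eta> = \<phi> \<and> t0 (Psh V J) \<eta> = nerve V J K D c \<and>
     (\<forall>X\<in>zero_cells K.
        iso_functor (Hom K c X) (Hom (Psh V J) \<phi> (nerve V J K D X))
          (\<lambda>x. nerve V J K D x \<star>\<^bsub>Psh V J\<^esub> \<eta>))"

definition V_cocomplete :: "'u cat set \<Rightarrow> 'k twocat \<Rightarrow> bool" where
  "V_cocomplete V K \<longleftrightarrow>
     (\<forall>(J :: 'u twocat) D \<phi>.
        small_V_category V J \<and> two_functor J K D \<and> \<phi> \<in> zero_cells (Psh V J) \<longrightarrow>
        (\<exists>c \<eta>. is_weighted_colimit V J K D \<phi> c \<eta>))"

definition V_complete :: "'u cat set \<Rightarrow> 'k twocat \<Rightarrow> bool" where
  "V_complete V K \<longleftrightarrow> V_cocomplete V (op K)"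

section \<open>2-monads and lax idempotency\<close>

definition two_monad ::
    "'k twocat \<Rightarrow> ('k \<Rightarrow> 'k) \<Rightarrow> ('k \<Rightarrow> 'k) \<Rightarrow> ('k \<Rightarrow> 'k) \<Rightarrow> bool" where
  "two_monad K T i m \<longleftrightarrow>
     two_functor K K T \<and> two_natural K K (\<lambda>x. x) T i \<and> two_natural K K (\<lambda>x. T (T x)) T m \<and>
     (\<forall>A\<in>zero_cells K.
        m A \<star>\<^bsub>K\<^esub> T (i A) = T A \<and> m A \<star>\<^bsub>K\<^esub> i (T A) = T A \<and>
        m A \<star>\<^bsub>K\<^esub> T (m A) = m A \<star>\<^bsub>K\<^esub> m (T A))"

definition two_comonad ::
    "'k twocat \<Rightarrow> ('k \<Rightarrow> 'k) \<Rightarrow> ('k \<Rightarrow> 'k) \<Rightarrow> ('k \<Rightarrow> 'k) \<Rightarrow> bool" where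
  "two_comonad K G e d \<longleftrightarrow> two_monad (op K) G e d"

text \<open>A distributive law of the comonad \<open>(G, e, d)\<close> over the monad \<open>(T, i, m)\<close>, from \<open>GT\<close> to \<open>TG\<close>.\<close>

definition mixed_distributive_law ::
    "'k twocat \<Rightarrow> ('k \<Rightarrow> 'k) \<Rightarrow> ('k \<Rightarrow> 'k) \<Rightarrow> ('k \<Rightarrow> 'k) \<Rightarrow>
     ('k \<Rightarrow> 'k) \<Rightarrow> ('k \<Rightarrow> 'k) \<Rightarrow> ('k \<Rightarrow> 'k) \<Rightarrow> ('k \<Rightarrow> 'k) \<Rightarrow> bool" where
  "mixed_distributive_law K G e d T i m \<delta> \<longleftrightarrow>
     two_natural K K (\<lambda>x. G (T x)) (\<lambda>x. T (G x)) \<delta> \<and>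
     (\<forall>A\<in>zero_cells K.
        \<delta> A \<star>\<^bsub>K\<^esub> G (i A) = i (G A) \<and>
        \<delta> A \<star>\<^bsub>K\<^esub> G (m A) = m (G A) \<star>\<^bsub>K\<^esub> T (\<delta> A) \<star>\<^bsub>K\<^esub> \<delta> (T A) \<and>
        T (e A) \<star>\<^bsub>K\<^esub> \<delta> A = e (T A) \<and>
        T (d A) \<star>\<^bsub>K\<^esub> \<delta> A = \<delta> (G A) \<star>\<^bsub>K\<^esub> G (\<delta> A) \<star>\<^bsub>K\<^esub> d (T A))"

text \<open>\<open>rali K r l e\<close>: \<open>l\<close> is left adjoint to \<open>r\<close> with identity unit and counit \<open>e\<close>.\<close>

definition rali :: "'k twocat \<Rightarrow> 'k \<Rightarrow> 'k \<Rightarrow> 'k \<Rightarrow> bool" where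
  "rali K r l e \<longleftrightarrow>
     r \<in> one_cells K \<and> l \<in> one_cells K \<and> s0 K l = t0 K r \<and> t0 K l = s0 K r \<and>
     r \<star>\<^bsub>K\<^esub> l = t0 K r \<and>
     e \<in> cells K \<and> s1 K e = l \<star>\<^bsub>K\<^esub> r \<and> t1 K e = s0 K r \<and>
     r \<star>\<^bsub>K\<^esub> e = r \<and> e \<star>\<^bsub>K\<^esub> l = l"

text \<open>
  The adjunction between \<open>T i\<close> and \<open>m\<close> lives in the 2-category of endo-2-functors, so its counit is a
  modification.
\<close>

definition lax_idempotent_monad ::
    "'k twocat \<Rightarrow> ('k \<Rightarrow> 'k) \<Rightarrow> ('k \<Rightarrow> 'k) \<Rightarrow> ('k \<Rightarrow> 'k) \<Rightarrow> bool" where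
  "lax_idempotent_monad K T i m \<longleftrightarrow>
     (\<exists>e. (\<forall>A\<in>zero_cells K. rali K (m A) (T (i A)) (e A)) \<and>
          (\<forall>x\<in>one_cells K. e (t0 K x) \<star>\<^bsub>K\<^esub> T (T x) = T (T x) \<star>\<^bsub>K\<^esub> e (s0 K x)))"

definition lax_idempotent_comonad ::
    "'k twocat \<Rightarrow> ('k \<Rightarrow> 'k) \<Rightarrow> ('k \<Rightarrow> 'k) \<Rightarrow> ('k \<Rightarrow> 'k) \<Rightarrow> bool" where
  "lax_idempotent_comonad K G e d \<longleftrightarrow> lax_idempotent_monad (op K) G e d"

text \<open>\<open>AlgC a x b\<close> is a 2-cell \<open>x\<close> of strict morphisms from the algebra \<open>a\<close> to the algebra \<open>b\<close>.\<close>

datatype 'k algc = AlgC (alg_src: 'k) (alg_cell: 'k) (alg_tgt: 'k)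

definition algebra ::
    "'k twocat \<Rightarrow> ('k \<Rightarrow> 'k) \<Rightarrow> ('k \<Rightarrow> 'k) \<Rightarrow> ('k \<Rightarrow> 'k) \<Rightarrow> 'k \<Rightarrow> bool" where
  "algebra K T i m a \<longleftrightarrow>
     a \<in> one_cells K \<and> s0 K a = T (t0 K a) \<and>
     a \<star>\<^bsub>K\<^esub> i (t0 K a) = t0 K a \<and> a \<star>\<^bsub>K\<^esub> T a = a \<star>\<^bsub>K\<^esub> m (t0 K a)"

definition Alg ::
    "'k twocat \<Rightarrow> ('k \<Rightarrow> 'k) \<Rightarrow> ('k \<Rightarrow> 'k) \<Rightarrow> ('k \<Rightarrow> 'k) \<Rightarrow> 'k algc twocat" where
  "Alg K T i m =
     (let S = {AlgC a x b | a x b. algebra K T i m a \<and> algebra K T i m b \<and>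
                 x \<in> cells K \<and> s0 K x = t0 K a \<and> t0 K x = t0 K b \<and> x \<star>\<^bsub>K\<^esub> a = b \<star>\<^bsub>K\<^esub> T x}
      in \<lparr>hor = \<lparr>arrs = S,
                 src = (\<lambda>x. AlgC (alg_src x) (t0 K (alg_src x)) (alg_src x)),
                 tgt = (\<lambda>x. AlgC (alg_tgt x) (t0 K (alg_tgt x)) (alg_tgt x)),
                 cmp = (\<lambda>y x. AlgC (alg_src x) (alg_cell y \<star>\<^bsub>K\<^esub> alg_cell x) (alg_tgt y))\<rparr>,
          ver = \<lparr>arrs = S,
                 src = (\<lambda>x. AlgC (alg_src x) (s1 K (alg_cell x)) (alg_tgt x)),
                 tgt = (\<lambda>x. AlgC (alg_src x) (t1 K (alg_cell x)) (alg_tgt x)),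
                 cmp = (\<lambda>y x. AlgC (alg_src x) (alg_cell y \<bullet>\<^bsub>K\<^esub> alg_cell x) (alg_tgt x))\<rparr>\<rparr>)"

section \<open>Algebraic weak factorisation systems\<close>

text \<open>
  A factorisation of \<open>f\<close> is \<open>rho f \<star> lam f\<close>, through \<open>Kf (ob C f)\<close>, functorially in squares and their
  2-cells; \<open>sig\<close> and \<open>pim\<close> are the components of the comultiplication and of the multiplication.
\<close>

record 'c awfs_data =
  Kf :: "'c sq \<Rightarrow> 'c"
  lam :: "'c \<Rightarrow> 'c"
  rho :: "'c \<Rightarrow> 'c"
  sig :: "'c \<Rightarrow> 'c"
  pim :: "'c \<Rightarrow> 'c"

definition Lfun :: "'c awfs_data \<Rightarrow> 'c sq \<Rightarrow> 'c sq" where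
  "Lfun W s = Sq (lam W (left s)) (top s) (Kf W s) (lam W (right s))"

definition Rfun :: "'c awfs_data \<Rightarrow> 'c sq \<Rightarrow> 'c sq" where
  "Rfun W s = Sq (rho W (left s)) (Kf W s) (bot s) (rho W (right s))"

text \<open>The following take as argument an object \<open>ob C f\<close> of the 2-category of arrows.\<close>

definition Phi :: "'c twocat \<Rightarrow> 'c awfs_data \<Rightarrow> 'c sq \<Rightarrow> 'c sq" where
  "Phi C W s = (let f = left s in Sq (lam W f) (s0 C f) (rho W f) f)"

definition Lambda :: "'c twocat \<Rightarrow> 'c awfs_data \<Rightarrow> 'c sq \<Rightarrow> 'c sq" where
  "Lambda C W s = (let f = left s in Sq f (lam W f) (t0 C f) (rho W f))"

definition Sigma :: "'c twocat \<Rightarrow> 'c awfs_data \<Rightarrow> 'c sq \<Rightarrow> 'c sq" where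
  "Sigma C W s = (let f = left s in Sq (lam W f) (s0 C f) (sig W f) (lam W (lam W f)))"

definition Pi_mult :: "'c twocat \<Rightarrow> 'c awfs_data \<Rightarrow> 'c sq \<Rightarrow> 'c sq" where
  "Pi_mult C W s = (let f = left s in Sq (rho W (rho W f)) (pim W f) (t0 C f) (rho W f))"

definition Delta :: "'c awfs_data \<Rightarrow> 'c sq \<Rightarrow> 'c sq" where
  "Delta W s = (let f = left s in Sq (lam W (rho W f)) (sig W f) (pim W f) (rho W (lam W f)))"

definition awfs :: "'c twocat \<Rightarrow> 'c awfs_data \<Rightarrow> bool" where
  "awfs C W \<longleftrightarrow>
     two_functor (Arr C) C (Kf W) \<and>
     (\<forall>f\<in>one_cells C. lam W f \<in> one_cells C \<and> rho W f \<in> one_cells C \<and>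
        s0 C (lam W f) = s0 C f \<and> t0 C (lam W f) = Kf W (ob C f) \<and>
        s0 C (rho W f) = Kf W (ob C f) \<and> t0 C (rho W f) = t0 C f \<and>
        rho W f \<star>\<^bsub>C\<^esub> lam W f = f) \<and>
     two_comonad (Arr C) (Lfun W) (Phi C W) (Sigma C W) \<and>
     two_monad (Arr C) (Rfun W) (Lambda C W) (Pi_mult C W) \<and>
     mixed_distributive_law (Arr C) (Lfun W) (Phi C W) (Sigma C W)
       (Rfun W) (Lambda C W) (Pi_mult C W) (Delta W)"

definition lax_orthogonal :: "'c twocat \<Rightarrow> 'c awfs_data \<Rightarrow> bool" where
  "lax_orthogonal C W \<longleftrightarrow>
     lax_idempotent_comonad (Arr C) (Lfun W) (Phi C W) (Sigma C W) \<and>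
     lax_idempotent_monad (Arr C) (Rfun W) (Lambda C W) (Pi_mult C W)"

definition lofs :: "'c twocat \<Rightarrow> 'c awfs_data \<Rightarrow> bool" where
  "lofs C W \<longleftrightarrow> awfs C W \<and> lax_orthogonal C W"

definition Ralgebra :: "'c twocat \<Rightarrow> 'c awfs_data \<Rightarrow> 'c sq \<Rightarrow> bool" where
  "Ralgebra C W = algebra (Arr C) (Rfun W) (Lambda C W) (Pi_mult C W)"

definition RAlg :: "'c twocat \<Rightarrow> 'c awfs_data \<Rightarrow> 'c sq algc twocat" where
  "RAlg C W = Alg (Arr C) (Rfun W) (Lambda C W) (Pi_mult C W)"

subsection \<open>Internal categories over the category of squares\<close>

definition sq_id :: "'c twocat \<Rightarrow> 'c \<Rightarrow> 'c sq" where
  "sq_id C x = Sq (s0 C x) x x (t0 C x)"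

definition sq_comp :: "'c twocat \<Rightarrow> 'c sq \<Rightarrow> 'c sq \<Rightarrow> 'c sq" where
  "sq_comp C y x = Sq (left y \<star>\<^bsub>C\<^esub> left x) (top x) (bot y) (right y \<star>\<^bsub>C\<^esub> right x)"

text \<open>
  An internal category with object part \<open>C\<close> together with a forgetful internal functor to the
  category of squares of \<open>C\<close> that is the identity on object parts. Its source and target are then
  \<open>top\<close> and \<open>bot\<close> of \<open>forget\<close>, and \<open>icmp y x\<close> is meaningful if \<open>top (forget y) = bot (forget x)\<close>.
  An isomorphism of such over the category of squares is the identity on object parts.
\<close>

record ('c, 'b) int_over_sq =
  arrow_part :: "'b twocat"
  forget :: "'b \<Rightarrow> 'c sq"
  iid :: "'c \<Rightarrow> 'b"
  icmp :: "'b \<Rightarrow> 'b \<Rightarrow> 'b"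

definition int_iso_over_sq ::
    "'c twocat \<Rightarrow> ('c, 'a) int_over_sq \<Rightarrow> ('c, 'b) int_over_sq \<Rightarrow> ('a \<Rightarrow> 'b) \<Rightarrow> bool" where
  "int_iso_over_sq C X Y F \<longleftrightarrow>
     two_functor (arrow_part X) (arrow_part Y) F \<and>
     bij_betw F (cells (arrow_part X)) (cells (arrow_part Y)) \<and>
     (\<forall>x\<in>cells (arrow_part X). forget Y (F x) = forget X x) \<and>
     (\<forall>a\<in>cells C. F (iid X a) = iid Y a) \<and>
     (\<forall>x\<in>cells (arrow_part X). \<forall>y\<in>cells (arrow_part X). top (forget X y) = bot (forget X x) \<longrightarrow>
        F (icmp X y x) = icmp Y (F y) (F x))"

text \<open>
  An algebra structure on \<open>f\<close> for the monad has the form \<open>Sq (rho f) p (t0 f) f\<close>. The composite of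
  structures \<open>p\<close> on \<open>f\<close> and \<open>q\<close> on \<open>g\<close> is \<open>p \<star> K(1, q \<star> K(f, 1)) \<star> sig (g f)\<close>: it fills the square
  from the cofree coalgebra on \<open>g f\<close> to \<open>g f\<close> by filling first against \<open>g\<close> and then against \<open>f\<close>.
\<close>

definition ralg_comp :: "'c twocat \<Rightarrow> 'c awfs_data \<Rightarrow> 'c sq \<Rightarrow> 'c sq \<Rightarrow> 'c sq" where
  "ralg_comp C W b a =
     (let f = right a; p = top a; g = right b; q = top b; gf = g \<star>\<^bsub>C\<^esub> f;
          j = q \<star>\<^bsub>C\<^esub> Kf W (Sq gf f (t0 C g) g)
      in Sq (rho W gf) (p \<star>\<^bsub>C\<^esub> Kf W (Sq (lam W gf) (s0 C f) j f) \<star>\<^bsub>C\<^esub> sig W gf) (t0 C g) gf)"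

definition ralg_id :: "'c twocat \<Rightarrow> 'c awfs_data \<Rightarrow> 'c \<Rightarrow> 'c sq" where
  "ralg_id C W A = Sq (rho W A) (rho W A) A A"

definition RAlg_int :: "'c twocat \<Rightarrow> 'c awfs_data \<Rightarrow> ('c, 'c sq algc) int_over_sq" where
  "RAlg_int C W = \<lparr>
     arrow_part = RAlg C W,
     forget = alg_cell,
     iid = (\<lambda>x. AlgC (ralg_id C W (s0 C x)) (sq_id C x) (ralg_id C W (t0 C x))),
     icmp = (\<lambda>y x. AlgC (ralg_comp C W (alg_src y) (alg_src x))
                        (sq_comp C (alg_cell y) (alg_cell x))
                        (ralg_comp C W (alg_tgt y) (alg_tgt x)))\<rparr>"

subsection \<open>The pointwise factorisation system\<close>

text \<open>The factorisation system on \<open>Fun2 P Q\<close> induced by one on \<open>Q\<close>.\<close>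

definition pw_mid :: "'p twocat \<Rightarrow> 'q awfs_data \<Rightarrow> ('p, 'q) mdf \<Rightarrow> 'p \<Rightarrow> 'q" where
  "pw_mid P W \<phi> = (\<lambda>x\<in>cells P. Kf W (Sq (mat \<phi> (s0 P x)) (mfrom \<phi> x) (mto \<phi> x) (mat \<phi> (t0 P x))))"

definition pointwise :: "'p twocat \<Rightarrow> 'q awfs_data \<Rightarrow> ('p, 'q) mdf awfs_data" where
  "pointwise P W = \<lparr>
     Kf = (\<lambda>s. Mdf (pw_mid P W (left s))
       (\<lambda>A\<in>zero_cells P. Kf W (Sq (mat (left s) A) (mat (top s) A) (mat (bot s) A) (mat (right s) A)))
       (pw_mid P W (right s))),
     lam = (\<lambda>\<phi>. Mdf (mfrom \<phi>) (\<lambda>A\<in>zero_cells P. lam W (mat \<phi> A)) (pw_mid P W \<phi>)),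
     rho = (\<lambda>\<phi>. Mdf (pw_mid P W \<phi>) (\<lambda>A\<in>zero_cells P. rho W (mat \<phi> A)) (mto \<phi>)),
     sig = (\<lambda>\<phi>. Mdf (pw_mid P W \<phi>) (\<lambda>A\<in>zero_cells P. sig W (mat \<phi> A))
       (pw_mid P W (Mdf (mfrom \<phi>) (\<lambda>A\<in>zero_cells P. lam W (mat \<phi> A)) (pw_mid P W \<phi>)))),
     pim = (\<lambda>\<phi>. Mdf
       (pw_mid P W (Mdf (pw_mid P W \<phi>) (\<lambda>A\<in>zero_cells P. rho W (mat \<phi> A)) (mto \<phi>)))
       (\<lambda>A\<in>zero_cells P. pim W (mat \<phi> A)) (pw_mid P W \<phi>))\<rparr>"

subsection \<open>Lifting and cofibrant generation\<close>

text \<open>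
  For \<open>U\<close> from \<open>J\<close> to the 2-category of arrows of \<open>C\<close>: \<open>cod_nerve\<close> is \<open>A \<mapsto> C(cod U-, A)\<close>,
  \<open>sq_nerve\<close> is \<open>f \<mapsto> C\<^sup>2(U-, f)\<close>, \<open>comparison\<close> is the natural map from \<open>C(cod U-, dom f)\<close> to
  \<open>C\<^sup>2(U-, f)\<close>, and \<open>cod_proj\<close> the projection from \<open>C\<^sup>2(U-, f)\<close> to \<open>C(cod U-, cod f)\<close>.
\<close>

definition cod_nerve ::
    "'u cat set \<Rightarrow> 'j twocat \<Rightarrow> ('j \<Rightarrow> 'c sq) \<Rightarrow> 'c twocat \<Rightarrow> 'c \<Rightarrow> ('j, 'u nt) mdf" where
  "cod_nerve V J U C = nerve V J C (\<lambda>y. bot (U y))"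

definition sq_nerve ::
    "'u cat set \<Rightarrow> 'j twocat \<Rightarrow> ('j \<Rightarrow> 'c sq) \<Rightarrow> 'c twocat \<Rightarrow> 'c sq \<Rightarrow> ('j, 'u nt) mdf" where
  "sq_nerve V J U C = nerve V J (Arr C) U"

definition comparison ::
    "'u cat set \<Rightarrow> 'j twocat \<Rightarrow> ('j \<Rightarrow> 'c sq) \<Rightarrow> 'c twocat \<Rightarrow> 'c \<Rightarrow> ('j, 'u nt) mdf" where
  "comparison V J U C f = Mdf
     (mfrom (cod_nerve V J U C (s0 C f)))
     (\<lambda>j\<in>zero_cells J.
        let u = left (U j); F = (\<lambda>h. Sq u (h \<star>\<^bsub>C\<^esub> u) (f \<star>\<^bsub>C\<^esub> h) f)
        in vcell V (Hom C (t0 C u) (s0 C f)) (Hom (Arr C) (U j) (ob C f)) F F F)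
     (mfrom (sq_nerve V J U C (ob C f)))"

definition cod_proj ::
    "'u cat set \<Rightarrow> 'j twocat \<Rightarrow> ('j \<Rightarrow> 'c sq) \<Rightarrow> 'c twocat \<Rightarrow> 'c \<Rightarrow> ('j, 'u nt) mdf" where
  "cod_proj V J U C f = Mdf
     (mfrom (sq_nerve V J U C (ob C f)))
     (\<lambda>j\<in>zero_cells J.
        vcell V (Hom (Arr C) (U j) (ob C f)) (Hom C (t0 C (left (U j))) (t0 C f)) bot bot bot)
     (mfrom (cod_nerve V J U C (t0 C f)))"

definition W_fun ::
    "'u cat set \<Rightarrow> 'j twocat \<Rightarrow> ('j \<Rightarrow> 'c sq) \<Rightarrow> 'c twocat \<Rightarrow> 'c sq \<Rightarrow> ('j, 'u nt) mdf sq" where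
  "W_fun V J U C x = Sq (comparison V J U C (left x)) (cod_nerve V J U C (top x))
     (sq_nerve V J U C x) (comparison V J U C (right x))"

definition pullback_2cat ::
    "'a twocat \<Rightarrow> 'b twocat \<Rightarrow> ('a \<Rightarrow> 'k) \<Rightarrow> ('b \<Rightarrow> 'k) \<Rightarrow> ('a \<times> 'b) twocat" where
  "pullback_2cat A B F G =
     (let S = {(x, y). x \<in> cells A \<and> y \<in> cells B \<and> F x = G y}
      in \<lparr>hor = \<lparr>arrs = S, src = map_prod (s0 A) (s0 B), tgt = map_prod (t0 A) (t0 B),
                 cmp = (\<lambda>y x. (fst y \<star>\<^bsub>A\<^esub> fst x, snd y \<star>\<^bsub>B\<^esub> snd x))\<rparr>,
          ver = \<lparr>arrs = S, src = map_prod (s1 A) (s1 B), tgt = map_prod (t1 A) (t1 B),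
                 cmp = (\<lambda>y x. (fst y \<bullet>\<^bsub>A\<^esub> fst x, snd y \<bullet>\<^bsub>B\<^esub> snd x))\<rparr>\<rparr>)"

text \<open>
  For an algebra \<open>b\<close> and a pullback square \<open>s\<close> into its underlying object \<open>t0 b\<close>: the unique algebra
  structure on the source of \<open>s\<close> that makes \<open>s\<close> a strict morphism.
\<close>

definition pb_alg :: "'c twocat \<Rightarrow> 'c awfs_data \<Rightarrow> 'c sq \<Rightarrow> 'c sq \<Rightarrow> 'c sq" where
  "pb_alg C W b s = (THE a. Ralgebra C W a \<and> t0 (Arr C) a = ob C (left s) \<and>
     AlgC a s b \<in> cells (RAlg C W))"

text \<open>
  The comparison of \<open>g f\<close> is that of \<open>f\<close> followed by the map \<open>C\<^sup>2(U-, (1, g))\<close>, which is the pullback of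
  the comparison of \<open>g\<close> along \<open>C\<^sup>2(U-, (f, 1))\<close>, the other projection being \<open>cod_proj f\<close>. The comparison
  of an identity is invertible, so it carries exactly one algebra structure.
\<close>

definition lift_comp ::
    "'u cat set \<Rightarrow> 'u nt awfs_data \<Rightarrow> 'j twocat \<Rightarrow> ('j \<Rightarrow> 'c sq) \<Rightarrow> 'c twocat \<Rightarrow> 'c \<Rightarrow> 'c \<Rightarrow>
     ('j, 'u nt) mdf sq \<Rightarrow> ('j, 'u nt) mdf sq \<Rightarrow> ('j, 'u nt) mdf sq" where
  "lift_comp V EM J U C g f b a =
     (let P = Psh V J; M = pointwise (op J) EM; gf = g \<star>\<^bsub>C\<^esub> f;
          s = Sq (sq_nerve V J U C (Sq f (s0 C f) g gf)) (cod_proj V J U C f)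
                 (sq_nerve V J U C (Sq gf f (t0 C g) g)) (comparison V J U C g)
      in ralg_comp P M (pb_alg P M b s) a)"

definition lift_id ::
    "'u cat set \<Rightarrow> 'u nt awfs_data \<Rightarrow> 'j twocat \<Rightarrow> ('j \<Rightarrow> 'c sq) \<Rightarrow> 'c twocat \<Rightarrow> 'c \<Rightarrow>
     ('j, 'u nt) mdf sq" where
  "lift_id V EM J U C A = (THE a. Ralgebra (Psh V J) (pointwise (op J) EM) a \<and>
     t0 (Arr (Psh V J)) a = ob (Psh V J) (comparison V J U C A))"

definition Lift_int ::
    "'u cat set \<Rightarrow> 'u nt awfs_data \<Rightarrow> 'j twocat \<Rightarrow> ('j \<Rightarrow> 'c sq) \<Rightarrow> 'c twocat \<Rightarrow>
     ('c, 'c sq \<times> ('j, 'u nt) mdf sq algc) int_over_sq" where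
  "Lift_int V EM J U C = \<lparr>
     arrow_part = pullback_2cat (Arr C) (RAlg (Psh V J) (pointwise (op J) EM))
       (W_fun V J U C) alg_cell,
     forget = fst,
     iid = (\<lambda>x. (sq_id C x,
       AlgC (lift_id V EM J U C (s0 C x)) (W_fun V J U C (sq_id C x)) (lift_id V EM J U C (t0 C x)))),
     icmp = (\<lambda>y x. (sq_comp C (fst y) (fst x),
       AlgC (lift_comp V EM J U C (left (fst y)) (left (fst x)) (alg_src (snd y)) (alg_src (snd x)))
            (W_fun V J U C (sq_comp C (fst y) (fst x)))
            (lift_comp V EM J U C (right (fst y)) (right (fst x)) (alg_tgt (snd y)) (alg_tgt (snd x)))))\<rparr>"

definition cofibrantly_generated ::
    "'u cat set \<Rightarrow> 'u nt awfs_data \<Rightarrow> 'j twocat \<Rightarrow> ('j \<Rightarrow> 'c sq) \<Rightarrow> 'c twocat \<Rightarrow> 'c awfs_data \<Rightarrow> bool" where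
  "cofibrantly_generated V EM J U C W \<longleftrightarrow>
     (\<exists>F. int_iso_over_sq C (RAlg_int C W) (Lift_int V EM J U C) F)"

subsection \<open>KZ-generation\<close>

text \<open>
  The lax colimit of a 1-cell \<open>f\<close>: coprojections \<open>i\<close> and \<open>j\<close> from its domain and codomain and a
  universal 2-cell \<open>t\<close> from \<open>j f\<close> to \<open>i\<close>. This direction is the one for which a map out of the lax
  colimit can encode a counit from \<open>l f\<close> to the identity.
\<close>

definition is_lax_colimit :: "'k twocat \<Rightarrow> 'k \<Rightarrow> 'k \<Rightarrow> 'k \<Rightarrow> 'k \<Rightarrow> bool" where
  "is_lax_colimit K f i j t \<longleftrightarrow>
     i \<in> one_cells K \<and> j \<in> one_cells K \<and> t \<in> cells K \<and>
     s0 K i = s0 K f \<and> s0 K j = t0 K f \<and> t0 K i = t0 K j \<and> s1 K t = j \<star>\<^bsub>K\<^esub> f \<and> t1 K t = i \<and>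
     (\<forall>u\<in>one_cells K. \<forall>v\<in>one_cells K. \<forall>w\<in>cells K.
        s0 K u = s0 K f \<and> s0 K v = t0 K f \<and> t0 K u = t0 K v \<and> s1 K w = v \<star>\<^bsub>K\<^esub> f \<and> t1 K w = u \<longrightarrow>
        (\<exists>!h. h \<in> one_cells K \<and> s0 K h = t0 K i \<and> h \<star>\<^bsub>K\<^esub> i = u \<and> h \<star>\<^bsub>K\<^esub> j = v \<and> h \<star>\<^bsub>K\<^esub> t = w)) \<and>
     (\<forall>h\<in>one_cells K. \<forall>k\<in>one_cells K. \<forall>a\<in>cells K. \<forall>b\<in>cells K.
        s0 K h = t0 K i \<and> s0 K k = t0 K i \<and> t0 K h = t0 K k \<and>
        s1 K a = h \<star>\<^bsub>K\<^esub> i \<and> t1 K a = k \<star>\<^bsub>K\<^esub> i \<and> s1 K b = h \<star>\<^bsub>K\<^esub> j \<and> t1 K b = k \<star>\<^bsub>K\<^esub> j \<and>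
        a \<bullet>\<^bsub>K\<^esub> (h \<star>\<^bsub>K\<^esub> t) = (k \<star>\<^bsub>K\<^esub> t) \<bullet>\<^bsub>K\<^esub> (b \<star>\<^bsub>K\<^esub> f) \<longrightarrow>
        (\<exists>!c. c \<in> cells K \<and> s1 K c = h \<and> t1 K c = k \<and> c \<star>\<^bsub>K\<^esub> i = a \<and> c \<star>\<^bsub>K\<^esub> j = b))"

text \<open>
  \<open>Ralic l e x l' e'\<close> is a 2-cell \<open>x\<close> of squares commuting with the adjunctions \<open>(l, e)\<close> on \<open>left x\<close> and
  \<open>(l', e')\<close> on \<open>right x\<close>.
\<close>

datatype 'k ralic =
  Ralic (ladj_src: 'k) (counit_src: 'k) (rali_cell: "'k sq") (ladj_tgt: 'k) (counit_tgt: 'k)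

definition Rali :: "'k twocat \<Rightarrow> 'k ralic twocat" where
  "Rali K =
     (let S = {Ralic l e x l' e' | l e x l' e'.
                 x \<in> cells (Arr K) \<and> rali K (left x) l e \<and> rali K (right x) l' e' \<and>
                 top x \<star>\<^bsub>K\<^esub> l = l' \<star>\<^bsub>K\<^esub> bot x \<and> top x \<star>\<^bsub>K\<^esub> e = e' \<star>\<^bsub>K\<^esub> top x}
      in \<lparr>hor = \<lparr>arrs = S,
                 src = (\<lambda>x. Ralic (ladj_src x) (counit_src x) (s0 (Arr K) (rali_cell x))
                              (ladj_src x) (counit_src x)),
                 tgt = (\<lambda>x. Ralic (ladj_tgt x) (counit_tgt x) (t0 (Arr K) (rali_cell x))
                              (ladj_tgt x) (counit_tgt x)),
                 cmp = (\<lambda>y x. Ralic (ladj_src x) (counit_src x)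
                              (rali_cell y \<star>\<^bsub>Arr K\<^esub> rali_cell x) (ladj_tgt y) (counit_tgt y))\<rparr>,
          ver = \<lparr>arrs = S,
                 src = (\<lambda>x. Ralic (ladj_src x) (counit_src x) (s1 (Arr K) (rali_cell x))
                              (ladj_tgt x) (counit_tgt x)),
                 tgt = (\<lambda>x. Ralic (ladj_src x) (counit_src x) (t1 (Arr K) (rali_cell x))
                              (ladj_tgt x) (counit_tgt x)),
                 cmp = (\<lambda>y x. Ralic (ladj_src x) (counit_src x)
                              (rali_cell y \<bullet>\<^bsub>Arr K\<^esub> rali_cell x) (ladj_tgt x) (counit_tgt x))\<rparr>\<rparr>)"

definition Rali_int :: "'k twocat \<Rightarrow> ('k, 'k ralic) int_over_sq" where
  "Rali_int K = \<lparr>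
     arrow_part = Rali K,
     forget = rali_cell,
     iid = (\<lambda>x. Ralic (s0 K x) (s0 K x) (sq_id K x) (t0 K x) (t0 K x)),
     icmp = (\<lambda>y x. Ralic
       (ladj_src x \<star>\<^bsub>K\<^esub> ladj_src y)
       (counit_src x \<bullet>\<^bsub>K\<^esub> (ladj_src x \<star>\<^bsub>K\<^esub> counit_src y \<star>\<^bsub>K\<^esub> left (rali_cell x)))
       (sq_comp K (rali_cell y) (rali_cell x))
       (ladj_tgt x \<star>\<^bsub>K\<^esub> ladj_tgt y)
       (counit_tgt x \<bullet>\<^bsub>K\<^esub> (ladj_tgt x \<star>\<^bsub>K\<^esub> counit_tgt y \<star>\<^bsub>K\<^esub> right (rali_cell x))))\<rparr>"

text \<open>
  The factorisation system on the base whose right algebras are RALIs, with factorisation through the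
  lax colimit. Lax orthogonality is a consequence and is not part of the definition.
\<close>

definition KZ_awfs :: "'u cat set \<Rightarrow> 'u nt awfs_data \<Rightarrow> bool" where
  "KZ_awfs V EM \<longleftrightarrow>
     awfs (Cat2 V) EM \<and>
     (\<forall>f\<in>one_cells (Cat2 V). \<exists>j t. is_lax_colimit (Cat2 V) f (lam EM f) j t \<and>
        rho EM f \<star>\<^bsub>Cat2 V\<^esub> lam EM f = f \<and> rho EM f \<star>\<^bsub>Cat2 V\<^esub> j = t0 (Cat2 V) f \<and>
        rho EM f \<star>\<^bsub>Cat2 V\<^esub> t = f) \<and>
     (\<exists>F. int_iso_over_sq (Cat2 V) (RAlg_int (Cat2 V) EM) (Rali_int (Cat2 V)) F)"

end

theory Submission
  imports Defs
begin

text \<open>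
  Let \<open>M\<close> be the monad of the lax orthogonal system on the base. By cofibrant generation an \<open>R\<close>-algebra
  structure on \<open>f\<close> is a family, natural in \<open>u\<close>, of \<open>M\<close>-algebra structures on the comparisons
  \<open>C(cod u, dom f) \<rightarrow> C\<^sup>2(u, f)\<close>, and strict morphisms are detected on these. Comma objects in \<open>C\<^sup>2\<close> exist
  and are preserved by the representable \<open>W\<^sub>U\<close>. Since \<open>M\<close> is lax idempotent, a map \<open>h\<close> of \<open>M\<close>-algebras is
  uniquely a lax morphism, so its comma object (with 2-cell from \<open>q\<close> to \<open>h p\<close>) carries an \<open>M\<close>-algebra structure
  with strict projections, natural in the algebras; hence so do comma objects of \<open>R\<close>-algebras.
  For the free algebra \<open>R A\<close> and \<open>h = i (R A)\<close>, the identity 2-cell on \<open>R i \<star> i = i R \<star> i\<close> is a map from \<open>A\<close> to the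
  comma object. Its strict extension to \<open>R A\<close> is a 2-cell from \<open>R i\<close> to \<open>i R\<close> that makes \<open>R\<close> lax idempotent;
  lax idempotency of \<open>L\<close> follows. For KZ-generation, the corresponding 2-cell for \<open>M\<close> comes from the universal
  property of the lax colimit.
\<close>

section \<open>Rewriting rules and interchange in a strict 2-category\<close>

section \<open>Strict 2-categories\<close>

text \<open>Freeness of \<open>R A\<close> extends a 2-cell given on \<open>A\<close> only if both
  its ends are strict, and \<open>i R\<close> is not strict. The comma object turns the wanted
  2-cell \<open>\<delta>\<close> from \<open>R i\<close> to \<open>i R\<close> into a 1-cell with
  values in an algebra, and to such a 1-cell freeness applies. The price is the equation
  \<open>m \<delta> = 1\<close>, as the universal 2-cell is compatible with the structures only in
  the lax sense. Since \<open>m\<close> is strict and \<open>m (i R) = 1\<close>, composing with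
  \<open>m\<close> trivialises the lax structure of \<open>i R\<close>; then
  \<open>m \<delta>\<close> is a strict endo-2-cell of a free algebra, and freeness applies again.
  Hom-categories lie in the base only up to isomorphism, so representables are transported along
  chosen isomorphisms. The base is known only through its closure properties. From these a terminal
  category, an empty category and pullbacks are extracted: the first two serve to write the comma
  object as a weighted limit, the last to show that \<open>C\<^sup>2\<close> is enriched.\<close>

lemma zero_cells_iff: "x \<in> zero_cells C \<longleftrightarrow> x \<in> cells C \<and> s0 C x = x"
  by (simp add: objs_def)

text \<open>The unit laws take the identity as a variable with an equation, so that rewriting also
  applies when the identity is written in another form. Associativity is oriented so that composites
  nest to the right.\<close>

lemma category_simps:
  assumes "category X"
  shows "f \<in> arrs X \<Longrightarrow> src X f \<in> arrs X"
    and "f \<in> arrs X \<Longrightarrow> tgt X f \<in> arrs X"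
    and "f \<in> arrs X \<Longrightarrow> src X (src X f) = src X f"
    and "f \<in> arrs X \<Longrightarrow> tgt X (src X f) = src X f"
    and "f \<in> arrs X \<Longrightarrow> src X (tgt X f) = tgt X f"
    and "f \<in> arrs X \<Longrightarrow> tgt X (tgt X f) = tgt X f"
    and "f \<in> arrs X \<Longrightarrow> src X f = A \<Longrightarrow> cmp X f A = f"
    and "f \<in> arrs X \<Longrightarrow> tgt X f = B \<Longrightarrow> cmp X B f = f"
    and cat_cmp: "f \<in> arrs X \<Longrightarrow> g \<in> arrs X \<Longrightarrow> src X g = tgt X f \<Longrightarrow> cmp X g f \<in> arrs X"
    and "f \<in> arrs X \<Longrightarrow> g \<in> arrs X \<Longrightarrow> src X g = tgt X f \<Longrightarrow> src X (cmp X g f) = src X f"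
    and "f \<in> arrs X \<Longrightarrow> g \<in> arrs X \<Longrightarrow> src X g = tgt X f \<Longrightarrow> tgt X (cmp X g f) = tgt X g"
    and "f \<in> arrs X \<Longrightarrow> g \<in> arrs X \<Longrightarrow> h \<in> arrs X \<Longrightarrow> src X g = tgt X f \<Longrightarrow>
       src X h = tgt X g \<Longrightarrow> cmp X (cmp X h g) f = cmp X h (cmp X g f)"
  using assms unfolding category_def by auto

locale twocat =
  fixes C :: "'c twocat"
  assumes two_cat: "two_category C"
begin

lemma hor_cat: "category (hor C)" and ver_cat: "category (ver C)"
  and arrs_ver [simp]: "arrs (ver C) = cells C"
  using two_cat unfolding two_category_def by auto

lemmas hcat = category_simps[OF hor_cat]
lemmas vcat = category_simps[OF ver_cat, unfolded arrs_ver]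
declare hcat(1-11) [simp] vcat(1-11) [simp]
lemmas hassoc = hcat(12)
lemmas vassoc = vcat(12)

lemma mixed [simp]:
  assumes "x \<in> cells C"
  shows "s0 C (s1 C x) = s0 C x" "s0 C (t1 C x) = s0 C x" "t0 C (s1 C x) = t0 C x"
    "t0 C (t1 C x) = t0 C x" "s1 C (s0 C x) = s0 C x" "s1 C (t0 C x) = t0 C x"
  using assms two_cat unfolding two_category_def by auto

lemma one_cells_iff: "x \<in> one_cells C \<longleftrightarrow> x \<in> cells C \<and> s1 C x = x"
  by (auto simp: objs_def)

lemma one_cellD:
  assumes "x \<in> one_cells C"
  shows "x \<in> cells C" "s1 C x = x" "t1 C x = x"
  using assms vcat(4)[of x] unfolding one_cells_iff by auto

lemma zero_cellD:
  assumes "x \<in> zero_cells C"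
  shows "x \<in> cells C" "s0 C x = x" "t0 C x = x" "s1 C x = x" "t1 C x = x" "x \<in> one_cells C"
proof -
  show x: "x \<in> cells C" "s0 C x = x" using assms by (auto simp: zero_cells_iff)
  show "t0 C x = x" "s1 C x = x" using x hcat(4)[of x] mixed(5)[of x] by auto
  then show "t1 C x = x" "x \<in> one_cells C" using x vcat(4)[of x] by (auto simp: one_cells_iff)
qed

lemma t1_01 [simp]:
  assumes "x \<in> cells C"
  shows "t1 C (s0 C x) = s0 C x" "t1 C (t0 C x) = t0 C x"
  using vcat(4)[of "s0 C x"] vcat(4)[of "t0 C x"] assms by auto

lemma zero_s0: "x \<in> cells C \<Longrightarrow> s0 C x \<in> zero_cells C"
  and zero_t0: "x \<in> cells C \<Longrightarrow> t0 C x \<in> zero_cells C"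
  and one_s1: "x \<in> cells C \<Longrightarrow> s1 C x \<in> one_cells C"
  and one_t1: "x \<in> cells C \<Longrightarrow> t1 C x \<in> one_cells C"
  by (auto simp: zero_cells_iff one_cells_iff)

lemma s1_hcomp [simp]:
  "x \<in> cells C \<Longrightarrow> y \<in> cells C \<Longrightarrow> s0 C y = t0 C x \<Longrightarrow> s1 C (y \<star>\<^bsub>C\<^esub> x) = s1 C y \<star>\<^bsub>C\<^esub> s1 C x"
  and t1_hcomp [simp]:
  "x \<in> cells C \<Longrightarrow> y \<in> cells C \<Longrightarrow> s0 C y = t0 C x \<Longrightarrow> t1 C (y \<star>\<^bsub>C\<^esub> x) = t1 C y \<star>\<^bsub>C\<^esub> t1 C x"
  using two_cat unfolding two_category_def by auto

lemma interchange:
  "x \<in> cells C \<Longrightarrow> x' \<in> cells C \<Longrightarrow> y \<in> cells C \<Longrightarrow> y' \<in> cells C \<Longrightarrow> s0 C y = t0 C x \<Longrightarrow>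
   s1 C x' = t1 C x \<Longrightarrow> s1 C y' = t1 C y \<Longrightarrow>
   (y' \<bullet>\<^bsub>C\<^esub> y) \<star>\<^bsub>C\<^esub> (x' \<bullet>\<^bsub>C\<^esub> x) = (y' \<star>\<^bsub>C\<^esub> x') \<bullet>\<^bsub>C\<^esub> (y \<star>\<^bsub>C\<^esub> x)"
  using two_cat unfolding two_category_def by auto

lemma parallel01:
  "x \<in> cells C \<Longrightarrow> y \<in> cells C \<Longrightarrow> s1 C y = t1 C x \<Longrightarrow> s0 C y = s0 C x \<and> t0 C y = t0 C x"
  by (metis mixed(1-4))

lemma vcomp_s0 [simp]:
  "x \<in> cells C \<Longrightarrow> y \<in> cells C \<Longrightarrow> s1 C y = t1 C x \<Longrightarrow> s0 C (y \<bullet>\<^bsub>C\<^esub> x) = s0 C x"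
  by (metis mixed(1) vcat(9,10))

lemma vcomp_t0 [simp]:
  "x \<in> cells C \<Longrightarrow> y \<in> cells C \<Longrightarrow> s1 C y = t1 C x \<Longrightarrow> t0 C (y \<bullet>\<^bsub>C\<^esub> x) = t0 C x"
  by (metis mixed(3) vcat(9,10))

lemma whisker_left:
  assumes "x \<in> cells C" "x' \<in> cells C" "f \<in> cells C" "s1 C f = f" "s0 C f = t0 C x" "s1 C x' = t1 C x"
  shows "f \<star>\<^bsub>C\<^esub> (x' \<bullet>\<^bsub>C\<^esub> x) = (f \<star>\<^bsub>C\<^esub> x') \<bullet>\<^bsub>C\<^esub> (f \<star>\<^bsub>C\<^esub> x)"
proof -
  have "t1 C f = f" using assms vcat(4)[of f] by simp
  then have "f \<bullet>\<^bsub>C\<^esub> f = f" using assms by simp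
  then show ?thesis using interchange[of x x' f f] assms \<open>t1 C f = f\<close> by simp
qed

lemma whisker_right:
  assumes "y \<in> cells C" "y' \<in> cells C" "f \<in> cells C" "s1 C f = f" "s0 C y = t0 C f" "s1 C y' = t1 C y"
  shows "(y' \<bullet>\<^bsub>C\<^esub> y) \<star>\<^bsub>C\<^esub> f = (y' \<star>\<^bsub>C\<^esub> f) \<bullet>\<^bsub>C\<^esub> (y \<star>\<^bsub>C\<^esub> f)"
proof -
  have "t1 C f = f" using assms vcat(4)[of f] by simp
  then have "f \<bullet>\<^bsub>C\<^esub> f = f" using assms by simp
  then show ?thesis using interchange[of f f y y'] assms \<open>t1 C f = f\<close> by simp
qed

text \<open>Interchange with an identity 2-cell inserted on either side. Equating the two
  factorisations says that whiskering is natural. Most 2-cell computations below rest on this: when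
  three of the four whiskered cells are identities, so is the fourth.\<close>

lemma hcomp_left_right:
  assumes "x \<in> cells C" "y \<in> cells C" "s0 C y = t0 C x"
  shows "y \<star>\<^bsub>C\<^esub> x = (y \<star>\<^bsub>C\<^esub> t1 C x) \<bullet>\<^bsub>C\<^esub> (s1 C y \<star>\<^bsub>C\<^esub> x)"
    and "y \<star>\<^bsub>C\<^esub> x = (t1 C y \<star>\<^bsub>C\<^esub> x) \<bullet>\<^bsub>C\<^esub> (y \<star>\<^bsub>C\<^esub> s1 C x)"
  using interchange[of x "t1 C x" "s1 C y" y] interchange[of "s1 C x" x y "t1 C y"] assms by simp_all

end

lemma twocat_op: assumes "twocat C" shows "twocat (op C)"
proof -
  interpret twocat C by fact
  show ?thesis
    unfolding twocat_def two_category_def category_def op_def dual_def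
    by (auto simp: hassoc vassoc interchange)
qed

lemma op_simps [simp]:
  "cells (op C) = cells C" "s0 (op C) = t0 C" "t0 (op C) = s0 C" "s1 (op C) = s1 C" "t1 (op C) = t1 C"
  "y \<star>\<^bsub>op C\<^esub> x = x \<star>\<^bsub>C\<^esub> y" "y \<bullet>\<^bsub>op C\<^esub> x = y \<bullet>\<^bsub>C\<^esub> x" "one_cells (op C) = one_cells C"
  by (simp_all add: op_def dual_def)

lemma op_op [simp]: "op (op C) = C"
  by (simp add: op_def dual_def)

lemma (in twocat) op_zero_cells [simp]: "zero_cells (op C) = zero_cells C"
  using zero_cellD(3) hcat(5) by (auto simp: zero_cells_iff) (metis hcat(5))

text \<open>Both sides equal \<open>e' \<star> u \<star> e\<close>. One factorisation of this cell
  has a trivial factor because \<open>r' u e = v r e = v r\<close>, the other because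
  \<open>e' u l = e' l' v = l' v\<close>. So a square that commutes with both adjoints commutes with
  the counits.\<close>

lemma rali_mates:
  assumes "two_category C" "rali C r l e" "rali C r' l' e'"
    and "u \<in> one_cells C" "v \<in> one_cells C" "s0 C u = s0 C r" "t0 C u = s0 C r'" "s0 C v = t0 C r" "t0 C v = t0 C r'"
    and "r' \<star>\<^bsub>C\<^esub> u = v \<star>\<^bsub>C\<^esub> r" "u \<star>\<^bsub>C\<^esub> l = l' \<star>\<^bsub>C\<^esub> v"
  shows "e' \<star>\<^bsub>C\<^esub> u = u \<star>\<^bsub>C\<^esub> e"
proof -
  interpret twocat C using assms(1) by unfold_locales
  note [simp] = assms(4-9) one_cellD[OF assms(4)] one_cellD[OF assms(5)]
  have R: "r \<in> cells C" "s1 C r = r" "t1 C r = r" "l \<in> cells C" "s1 C l = l" "t1 C l = l"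
    "s0 C l = t0 C r" "t0 C l = s0 C r" "r \<star>\<^bsub>C\<^esub> l = t0 C r" "e \<in> cells C" "s1 C e = l \<star>\<^bsub>C\<^esub> r"
    "t1 C e = s0 C r" "r \<star>\<^bsub>C\<^esub> e = r" "e \<star>\<^bsub>C\<^esub> l = l"
    using assms(2) one_cellD unfolding rali_def by auto
  have R': "r' \<in> cells C" "s1 C r' = r'" "t1 C r' = r'" "l' \<in> cells C" "s1 C l' = l'" "t1 C l' = l'"
    "s0 C l' = t0 C r'" "t0 C l' = s0 C r'" "r' \<star>\<^bsub>C\<^esub> l' = t0 C r'" "e' \<in> cells C" "s1 C e' = l' \<star>\<^bsub>C\<^esub> r'"
    "t1 C e' = s0 C r'" "r' \<star>\<^bsub>C\<^esub> e' = r'" "e' \<star>\<^bsub>C\<^esub> l' = l'"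
    using assms(3) one_cellD unfolding rali_def by auto
  note [simp] = R R'
  have e0: "s0 C e = s0 C r" "t0 C e = s0 C r"
    using mixed(2)[of e] mixed(4)[of e] by auto
  have e0': "s0 C e' = s0 C r'" "t0 C e' = s0 C r'"
    using mixed(2)[of e'] mixed(4)[of e'] by auto
  note [simp] = e0 e0'
  have 1: "e' \<star>\<^bsub>C\<^esub> (u \<star>\<^bsub>C\<^esub> e) = (e' \<star>\<^bsub>C\<^esub> u) \<bullet>\<^bsub>C\<^esub> ((l' \<star>\<^bsub>C\<^esub> r') \<star>\<^bsub>C\<^esub> (u \<star>\<^bsub>C\<^esub> e))"
    using hcomp_left_right(1)[of "u \<star>\<^bsub>C\<^esub> e" e'] by simp
  have 2: "(l' \<star>\<^bsub>C\<^esub> r') \<star>\<^bsub>C\<^esub> (u \<star>\<^bsub>C\<^esub> e) = (l' \<star>\<^bsub>C\<^esub> r') \<star>\<^bsub>C\<^esub> u"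
  proof -
    have "r' \<star>\<^bsub>C\<^esub> (u \<star>\<^bsub>C\<^esub> e) = (r' \<star>\<^bsub>C\<^esub> u) \<star>\<^bsub>C\<^esub> e" by (subst hassoc) auto
    also have "\<dots> = r' \<star>\<^bsub>C\<^esub> u" by (simp add: assms(10) hassoc)
    finally show ?thesis by (simp add: hassoc)
  qed
  have 3: "e' \<star>\<^bsub>C\<^esub> (u \<star>\<^bsub>C\<^esub> e) = (u \<star>\<^bsub>C\<^esub> e) \<bullet>\<^bsub>C\<^esub> (e' \<star>\<^bsub>C\<^esub> (u \<star>\<^bsub>C\<^esub> (l \<star>\<^bsub>C\<^esub> r)))"
    using hcomp_left_right(2)[of "u \<star>\<^bsub>C\<^esub> e" e'] by simp
  have 4: "e' \<star>\<^bsub>C\<^esub> (u \<star>\<^bsub>C\<^esub> (l \<star>\<^bsub>C\<^esub> r)) = u \<star>\<^bsub>C\<^esub> (l \<star>\<^bsub>C\<^esub> r)"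
  proof -
    have "u \<star>\<^bsub>C\<^esub> (l \<star>\<^bsub>C\<^esub> r) = l' \<star>\<^bsub>C\<^esub> (v \<star>\<^bsub>C\<^esub> r)"
      using assms(11) by (metis R(1,4,7,8) R'(4,7) assms(6-9) hassoc one_cellD(1)[OF assms(4)] one_cellD(1)[OF
          assms(5)])
    moreover have "e' \<star>\<^bsub>C\<^esub> (l' \<star>\<^bsub>C\<^esub> (v \<star>\<^bsub>C\<^esub> r)) = (e' \<star>\<^bsub>C\<^esub> l') \<star>\<^bsub>C\<^esub> (v \<star>\<^bsub>C\<^esub> r)" by (subst hassoc) auto
    ultimately show ?thesis by simp
  qed
  have "e' \<star>\<^bsub>C\<^esub> (u \<star>\<^bsub>C\<^esub> e) = e' \<star>\<^bsub>C\<^esub> u" unfolding 1 2 by (simp add: hassoc)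
  moreover have "e' \<star>\<^bsub>C\<^esub> (u \<star>\<^bsub>C\<^esub> e) = u \<star>\<^bsub>C\<^esub> e" unfolding 3 4 by (simp add: hassoc)
  ultimately show ?thesis by simp
qed

section \<open>Lax idempotent monads and the adjunctions carried by their algebras\<close>

section \<open>Lax idempotent 2-monads\<close>

lemma two_functorD:
  assumes "two_functor C D F" "x \<in> cells C"
  shows "F x \<in> cells D" "s0 D (F x) = F (s0 C x)" "t0 D (F x) = F (t0 C x)"
  using assms unfolding two_functor_def is_functor_def by auto

lemma two_functor_verD:
  assumes "two_functor C D F" "x \<in> cells C" "two_category C"
  shows "s1 D (F x) = F (s1 C x)" "t1 D (F x) = F (t1 C x)"
  using assms twocat.arrs_ver[of C] unfolding two_functor_def is_functor_def twocat_def by auto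

lemma two_functor_comp:
  assumes "two_functor C D F" "x \<in> cells C" "y \<in> cells C"
  shows "s0 C y = t0 C x \<Longrightarrow> F (y \<star>\<^bsub>C\<^esub> x) = F y \<star>\<^bsub>D\<^esub> F x"
    and "two_category C \<Longrightarrow> s1 C y = t1 C x \<Longrightarrow> F (y \<bullet>\<^bsub>C\<^esub> x) = F y \<bullet>\<^bsub>D\<^esub> F x"
  using assms twocat.arrs_ver[of C] unfolding two_functor_def is_functor_def twocat_def by auto

lemma two_functor_zero: "two_functor C D F \<Longrightarrow> x \<in> zero_cells C \<Longrightarrow> F x \<in> zero_cells D"
  by (auto simp: zero_cells_iff two_functorD)

context twocat begin

text \<open>In a composite nested to the right, a known composite \<open>a \<star> b\<close> is not
  a subterm when something follows on its right. This form lets the equation be used there.\<close>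

lemma reassoc:
  "a \<star>\<^bsub>C\<^esub> b = c \<Longrightarrow> z \<in> cells C \<Longrightarrow> a \<in> cells C \<Longrightarrow> b \<in> cells C \<Longrightarrow> s0 C a = t0 C b \<Longrightarrow> s0 C b = t0 C z \<Longrightarrow>
   a \<star>\<^bsub>C\<^esub> (b \<star>\<^bsub>C\<^esub> z) = c \<star>\<^bsub>C\<^esub> z"
  by (auto simp: hassoc[symmetric])

lemma zero_simps [simp]:
  assumes "A \<in> zero_cells C"
  shows "A \<in> cells C" "s0 C A = A" "t0 C A = A" "s1 C A = A" "t1 C A = A"
  using zero_cellD[OF assms] by auto

lemmas zero_st [simp] = zero_s0 zero_t0

end

locale monad2 = twocat C for C :: "'c twocat" +
  fixes T :: "'c \<Rightarrow> 'c" and i m :: "'c \<Rightarrow> 'c"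
  assumes monad: "two_monad C T i m"
begin

lemma Tfun: "two_functor C C T" and inat: "two_natural C C (\<lambda>x. x) T i"
  and mnat: "two_natural C C (\<lambda>x. T (T x)) T m"
  using monad unfolding two_monad_def by auto

lemmas T_simps [simp] = two_functorD[OF Tfun] two_functor_verD[OF Tfun _ two_cat]
lemmas T_comp = two_functor_comp(1)[OF Tfun]
lemmas T_vcomp = two_functor_comp(2)[OF Tfun _ _ two_cat]
lemmas T_zero [simp] = two_functor_zero[OF Tfun]

lemma i_simps [simp]:
  assumes "A \<in> zero_cells C"
  shows "i A \<in> cells C" "s1 C (i A) = i A" "t1 C (i A) = i A" "s0 C (i A) = A" "t0 C (i A) = T A"
  using inat assms one_cellD[of "i A"] unfolding two_natural_def by auto

lemma m_simps [simp]:
  assumes "A \<in> zero_cells C"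
  shows "m A \<in> cells C" "s1 C (m A) = m A" "t1 C (m A) = m A" "s0 C (m A) = T (T A)" "t0 C (m A) = T A"
  using mnat assms one_cellD[of "m A"] unfolding two_natural_def by auto

lemma i_nat: "x \<in> cells C \<Longrightarrow> s0 C x = A \<Longrightarrow> t0 C x = B \<Longrightarrow> i B \<star>\<^bsub>C\<^esub> x = T x \<star>\<^bsub>C\<^esub> i A"
  and m_nat: "x \<in> cells C \<Longrightarrow> s0 C x = A \<Longrightarrow> t0 C x = B \<Longrightarrow> m B \<star>\<^bsub>C\<^esub> T (T x) = T x \<star>\<^bsub>C\<^esub> m A"
  using inat mnat unfolding two_natural_def by auto

lemma m_laws:
  assumes "A \<in> zero_cells C"
  shows "m A \<star>\<^bsub>C\<^esub> T (i A) = T A" "m A \<star>\<^bsub>C\<^esub> i (T A) = T A" "m A \<star>\<^bsub>C\<^esub> T (m A) = m A \<star>\<^bsub>C\<^esub> m (T A)"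
  using monad assms unfolding two_monad_def by auto

text \<open>The counit of \<open>T i \<stileturn> m\<close> is \<open>m (T A) \<star> T \<delta>\<close>; it is a modification because counits are
  determined by their adjunctions.\<close>

lemma lax_idempotentI:
  assumes d: "\<And>A. A \<in> zero_cells C \<Longrightarrow> \<exists>d\<in>cells C. s1 C d = T (i A) \<and> t1 C d = i (T A) \<and>
     d \<star>\<^bsub>C\<^esub> i A = T (i A) \<star>\<^bsub>C\<^esub> i A \<and> m A \<star>\<^bsub>C\<^esub> d = T A"
  shows "lax_idempotent_monad C T i m"
proof -
  have "\<exists>e. rali C (m A) (T (i A)) e" if A[simp]: "A \<in> zero_cells C" for A
  proof -
    obtain d where d: "d \<in> cells C" "s1 C d = T (i A)" "t1 C d = i (T A)"
      "d \<star>\<^bsub>C\<^esub> i A = T (i A) \<star>\<^bsub>C\<^esub> i A" "m A \<star>\<^bsub>C\<^esub> d = T A" using d[OF A] by auto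
    have [simp]: "s0 C d = T A" "t0 C d = T (T A)"
      using mixed(1)[of d] mixed(3)[of d] d by auto
    note [simp] = d(1-3)
    define e where "e = m (T A) \<star>\<^bsub>C\<^esub> T d"
    have [simp]: "e \<in> cells C" unfolding e_def by simp
    have se: "s1 C e = T (i A) \<star>\<^bsub>C\<^esub> m A"
      unfolding e_def using m_nat[of "i A" A "T A"] by simp
    have te: "t1 C e = T (T A)"
      unfolding e_def using m_laws(1)[of "T A"] by simp
    have "e \<star>\<^bsub>C\<^esub> T (i A) = m (T A) \<star>\<^bsub>C\<^esub> T (d \<star>\<^bsub>C\<^esub> i A)"
      unfolding e_def by (simp add: hassoc T_comp)
    also have "\<dots> = (T (i A) \<star>\<^bsub>C\<^esub> m A) \<star>\<^bsub>C\<^esub> T (i A)"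
      unfolding d(4) using m_nat[of "i A" A "T A"] by (simp add: T_comp hassoc[symmetric])
    also have "\<dots> = T (i A)" by (simp add: hassoc m_laws)
    finally have 1: "e \<star>\<^bsub>C\<^esub> T (i A) = T (i A)" .
    \<comment> \<open>The second triangle identity: associativity of the monad moves
      \<open>m A\<close> under \<open>T\<close>, where the equation for \<open>m A \<star> d\<close>
      applies.\<close>
    have "m A \<star>\<^bsub>C\<^esub> e = (m A \<star>\<^bsub>C\<^esub> m (T A)) \<star>\<^bsub>C\<^esub> T d"
      unfolding e_def by (simp add: hassoc)
    also have "\<dots> = m A \<star>\<^bsub>C\<^esub> T (m A \<star>\<^bsub>C\<^esub> d)"
      unfolding m_laws(3)[OF A, symmetric] by (simp add: hassoc T_comp)
    also have "\<dots> = m A" unfolding d(5) by simp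
    finally have 2: "m A \<star>\<^bsub>C\<^esub> e = m A" .
    have "rali C (m A) (T (i A)) e"
      unfolding rali_def using se te 1 2 by (simp add: one_cells_iff m_laws)
    then show ?thesis by blast
  qed
  then obtain e where e: "\<And>A. A \<in> zero_cells C \<Longrightarrow> rali C (m A) (T (i A)) (e A)" by metis
  moreover have "e (t0 C x) \<star>\<^bsub>C\<^esub> T (T x) = T (T x) \<star>\<^bsub>C\<^esub> e (s0 C x)" if "x \<in> one_cells C" for x
  proof -
    have [simp]: "x \<in> cells C" "s1 C x = x" using one_cellD[OF that] by auto
    have "T (T x) \<star>\<^bsub>C\<^esub> T (i (s0 C x)) = T (i (t0 C x)) \<star>\<^bsub>C\<^esub> T x"
      using i_nat[of x "s0 C x" "t0 C x"] by (simp add: T_comp[symmetric])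
    then show ?thesis
      by (intro rali_mates[OF two_cat e e, of _ _ _ "T x"])
         (auto simp: one_cells_iff m_nat)
  qed
  ultimately show ?thesis unfolding lax_idempotent_monad_def by blast
qed

lemma algebraD:
  assumes "algebra C T i m a"
  shows "a \<in> cells C" "s1 C a = a" "t1 C a = a" "s0 C a = T (t0 C a)" "a \<star>\<^bsub>C\<^esub> i (t0 C a) = t0 C a"
    "a \<star>\<^bsub>C\<^esub> T a = a \<star>\<^bsub>C\<^esub> m (t0 C a)"
  using assms one_cellD[of a] unfolding algebra_def by auto

lemma free_algebra: "A \<in> zero_cells C \<Longrightarrow> algebra C T i m (m A)"
  unfolding algebra_def by (auto simp: one_cells_iff m_laws)

end

locale lax_monad2 = monad2 +
  assumes lax_idem: "lax_idempotent_monad C T i m"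
begin

text \<open>The 2-cell from \<open>T i\<close> to \<open>i T\<close> that characterises lax
  idempotent monads in the style of Kock. All components are chosen together because the last clause
  relates different components; later steps use only these equations.\<close>

definition del :: "'a \<Rightarrow> 'a" where
  "del = (SOME d. (\<forall>A\<in>zero_cells C. d A \<in> cells C \<and> s1 C (d A) = T (i A) \<and> t1 C (d A) = i (T A) \<and>
     d A \<star>\<^bsub>C\<^esub> i A = T (i A) \<star>\<^bsub>C\<^esub> i A \<and> m A \<star>\<^bsub>C\<^esub> d A = T A) \<and>
     (\<forall>x\<in>one_cells C. d (t0 C x) \<star>\<^bsub>C\<^esub> T x = T (T x) \<star>\<^bsub>C\<^esub> d (s0 C x)))"

text \<open>The witness is the counit of \<open>T i\<close> over \<open>m\<close>, whiskered with
  \<open>i T\<close>: its source \<open>T i \<star> m \<star> i T\<close> collapses to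
  \<open>T i\<close> by a unit law. The triangle identities and the modification axiom of the counit
  give the remaining equations.\<close>

lemma del_ex: "\<exists>d. (\<forall>A\<in>zero_cells C. d A \<in> cells C \<and> s1 C (d A) = T (i A) \<and> t1 C (d A) = i (T A) \<and>
     d A \<star>\<^bsub>C\<^esub> i A = T (i A) \<star>\<^bsub>C\<^esub> i A \<and> m A \<star>\<^bsub>C\<^esub> d A = T A) \<and>
     (\<forall>x\<in>one_cells C. d (t0 C x) \<star>\<^bsub>C\<^esub> T x = T (T x) \<star>\<^bsub>C\<^esub> d (s0 C x))"
proof -
  obtain e where e: "\<And>A. A \<in> zero_cells C \<Longrightarrow> rali C (m A) (T (i A)) (e A)"
    "\<And>x. x \<in> one_cells C \<Longrightarrow> e (t0 C x) \<star>\<^bsub>C\<^esub> T (T x) = T (T x) \<star>\<^bsub>C\<^esub> e (s0 C x)"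
    using lax_idem unfolding lax_idempotent_monad_def by auto
  have E: "e A \<in> cells C" "s1 C (e A) = T (i A) \<star>\<^bsub>C\<^esub> m A" "t1 C (e A) = T (T A)"
    "m A \<star>\<^bsub>C\<^esub> e A = m A" "e A \<star>\<^bsub>C\<^esub> T (i A) = T (i A)" if "A \<in> zero_cells C" for A
    using e(1)[OF that] that unfolding rali_def by auto
  have E2: "s0 C (e A) = T (T A)" "t0 C (e A) = T (T A)" if "A \<in> zero_cells C" for A
    using mixed(2)[of "e A"] mixed(4)[of "e A"] E[OF that] that by auto
  define d where "d A = e A \<star>\<^bsub>C\<^esub> i (T A)" for A
  have "d A \<in> cells C \<and> s1 C (d A) = T (i A) \<and> t1 C (d A) = i (T A) \<and>
     d A \<star>\<^bsub>C\<^esub> i A = T (i A) \<star>\<^bsub>C\<^esub> i A \<and> m A \<star>\<^bsub>C\<^esub> d A = T A" if [simp]: "A \<in> zero_cells C" for A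
  proof -
    note [simp] = E[OF that] E2[OF that]
    have "d A \<star>\<^bsub>C\<^esub> i A = e A \<star>\<^bsub>C\<^esub> (i (T A) \<star>\<^bsub>C\<^esub> i A)" by (simp add: d_def hassoc)
    also have "\<dots> = (e A \<star>\<^bsub>C\<^esub> T (i A)) \<star>\<^bsub>C\<^esub> i A"
      using i_nat[of "i A" A "T A"] by (simp add: reassoc[OF E(5)[OF that]])
    finally have "d A \<star>\<^bsub>C\<^esub> i A = T (i A) \<star>\<^bsub>C\<^esub> i A" by simp
    moreover have "m A \<star>\<^bsub>C\<^esub> d A = T A" by (simp add: d_def hassoc[symmetric] m_laws)
    ultimately show ?thesis by (simp add: d_def hassoc m_laws)
  qed
  moreover have "d (t0 C x) \<star>\<^bsub>C\<^esub> T x = T (T x) \<star>\<^bsub>C\<^esub> d (s0 C x)" if "x \<in> one_cells C" for x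
  proof -
    have [simp]: "x \<in> cells C" "s1 C x = x" using one_cellD[OF that] by auto
    have "d (t0 C x) \<star>\<^bsub>C\<^esub> T x = e (t0 C x) \<star>\<^bsub>C\<^esub> (i (T (t0 C x)) \<star>\<^bsub>C\<^esub> T x)"
      by (simp add: d_def hassoc E E2)
    also have "\<dots> = (e (t0 C x) \<star>\<^bsub>C\<^esub> T (T x)) \<star>\<^bsub>C\<^esub> i (T (s0 C x))"
      by (simp add: hassoc E E2 i_nat[of "T x" "T (s0 C x)"])
    also have "\<dots> = T (T x) \<star>\<^bsub>C\<^esub> d (s0 C x)"
      unfolding e(2)[OF that] by (simp add: d_def hassoc E E2)
    finally show ?thesis .
  qed
  ultimately show ?thesis by blast
qed

lemma del_spec: "(\<forall>A\<in>zero_cells C. del A \<in> cells C \<and> s1 C (del A) = T (i A) \<and> t1 C (del A) = i (T A) \<and>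
     del A \<star>\<^bsub>C\<^esub> i A = T (i A) \<star>\<^bsub>C\<^esub> i A \<and> m A \<star>\<^bsub>C\<^esub> del A = T A) \<and>
     (\<forall>x\<in>one_cells C. del (t0 C x) \<star>\<^bsub>C\<^esub> T x = T (T x) \<star>\<^bsub>C\<^esub> del (s0 C x))"
  unfolding del_def by (rule someI_ex[OF del_ex])

lemma del_simps [simp]:
  assumes "A \<in> zero_cells C"
  shows "del A \<in> cells C" "s1 C (del A) = T (i A)" "t1 C (del A) = i (T A)"
    "s0 C (del A) = T A" "t0 C (del A) = T (T A)"
proof -
  show *: "del A \<in> cells C" "s1 C (del A) = T (i A)" "t1 C (del A) = i (T A)"
    using del_spec assms by auto
  show "s0 C (del A) = T A" "t0 C (del A) = T (T A)"
    using mixed(1)[of "del A"] mixed(3)[of "del A"] * assms by auto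
qed

lemma del_laws:
  "A \<in> zero_cells C \<Longrightarrow> del A \<star>\<^bsub>C\<^esub> i A = T (i A) \<star>\<^bsub>C\<^esub> i A" "A \<in> zero_cells C \<Longrightarrow> m A \<star>\<^bsub>C\<^esub> del A = T A"
  "x \<in> one_cells C \<Longrightarrow> del (t0 C x) \<star>\<^bsub>C\<^esub> T x = T (T x) \<star>\<^bsub>C\<^esub> del (s0 C x)"
  using del_spec by auto

text \<open>The structure map \<open>a\<close> is left adjoint to \<open>i\<close> with identity
  counit, and \<open>eta a\<close> is the unit: its source is \<open>T a \<star> T i = 1\<close>,
  its target \<open>T a \<star> i T = i \<star> a\<close>. The lemmas \<open>eta_i\<close> and
  \<open>eta_left\<close> are the triangle identities.\<close>

definition eta :: "'a \<Rightarrow> 'a" where "eta a = T a \<star>\<^bsub>C\<^esub> del (t0 C a)"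

lemma eta_simps [simp]:
  assumes "algebra C T i m a"
  shows "eta a \<in> cells C" "s1 C (eta a) = T (t0 C a)" "t1 C (eta a) = i (t0 C a) \<star>\<^bsub>C\<^esub> a"
    "s0 C (eta a) = T (t0 C a)" "t0 C (eta a) = T (t0 C a)"
proof -
  note [simp] = algebraD(1-5)[OF assms]
  have "T a \<star>\<^bsub>C\<^esub> T (i (t0 C a)) = T (t0 C a)"
    by (simp flip: T_comp)
  then show "eta a \<in> cells C" "s1 C (eta a) = T (t0 C a)" "t1 C (eta a) = i (t0 C a) \<star>\<^bsub>C\<^esub> a"
    "s0 C (eta a) = T (t0 C a)" "t0 C (eta a) = T (t0 C a)"
    using i_nat[of a "T (t0 C a)" "t0 C a"] by (simp_all add: eta_def)
qed

lemma eta_i: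
  assumes "algebra C T i m a" shows "eta a \<star>\<^bsub>C\<^esub> i (t0 C a) = i (t0 C a)"
proof -
  note [simp] = algebraD(1-5)[OF assms]
  have "eta a \<star>\<^bsub>C\<^esub> i (t0 C a) = T a \<star>\<^bsub>C\<^esub> (T (i (t0 C a)) \<star>\<^bsub>C\<^esub> i (t0 C a))"
    by (simp add: eta_def hassoc del_laws)
  also have "\<dots> = T (a \<star>\<^bsub>C\<^esub> i (t0 C a)) \<star>\<^bsub>C\<^esub> i (t0 C a)"
    by (simp add: T_comp hassoc del: algebraD(5)[OF assms])
  finally show ?thesis by simp
qed

lemma eta_left:
  assumes "algebra C T i m a" shows "a \<star>\<^bsub>C\<^esub> eta a = a"
proof -
  note [simp] = algebraD(1-4)[OF assms]
  have "a \<star>\<^bsub>C\<^esub> eta a = (a \<star>\<^bsub>C\<^esub> T a) \<star>\<^bsub>C\<^esub> del (t0 C a)" by (simp add: eta_def hassoc)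
  also have "\<dots> = a" by (simp add: algebraD(6)[OF assms] hassoc del_laws)
  finally show ?thesis .
qed

text \<open>Naturality of \<open>del\<close> at \<open>x\<close> moves \<open>T x\<close> across,
  and \<open>T\<close> applied to the strictness equation does the rest.\<close>

lemma eta_nat:
  assumes a: "algebra C T i m a" and b: "algebra C T i m b" and x: "x \<in> one_cells C" "s0 C x = t0 C a" "t0 C x = t0 C
      b"
    and s: "x \<star>\<^bsub>C\<^esub> a = b \<star>\<^bsub>C\<^esub> T x"
  shows "eta b \<star>\<^bsub>C\<^esub> T x = T x \<star>\<^bsub>C\<^esub> eta a"
proof -
  note [simp] = algebraD(1-4)[OF a] algebraD(1-4)[OF b] x one_cellD[OF x(1)]
  have "eta b \<star>\<^bsub>C\<^esub> T x = T b \<star>\<^bsub>C\<^esub> (T (T x) \<star>\<^bsub>C\<^esub> del (t0 C a))"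
    using del_laws(3)[OF x(1)] by (simp add: eta_def hassoc)
  also have "\<dots> = T (x \<star>\<^bsub>C\<^esub> a) \<star>\<^bsub>C\<^esub> del (t0 C a)" by (simp add: s T_comp hassoc)
  also have "\<dots> = T x \<star>\<^bsub>C\<^esub> eta a" by (simp add: eta_def hassoc T_comp)
  finally show ?thesis .
qed

text \<open>The 2-cell \<open>m \<star> T (eta a)\<close> from \<open>m\<close> to
  \<open>T a\<close> becomes an identity after \<open>a\<close>, by associativity and a triangle
  identity. Interchanging it with \<open>eta a\<close> therefore leaves exactly this equation, from
  which the lax structures below get their multiplication axiom.\<close>

lemma eta_mult:
  assumes a: "algebra C T i m a"
  shows "(eta a \<star>\<^bsub>C\<^esub> T a) \<bullet>\<^bsub>C\<^esub> (m (t0 C a) \<star>\<^bsub>C\<^esub> T (eta a)) = eta a \<star>\<^bsub>C\<^esub> m (t0 C a)"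
proof -
  note [simp] = algebraD(1-4)[OF a] a
  let ?A = "t0 C a" let ?y = "m ?A \<star>\<^bsub>C\<^esub> T (eta a)"
  have s: "s1 C ?y = m ?A" by simp
  have "t1 C ?y = m ?A \<star>\<^bsub>C\<^esub> (T (i ?A) \<star>\<^bsub>C\<^esub> T a)" by (simp add: T_comp)
  then have t: "t1 C ?y = T a" using m_laws(1)[of ?A] by (simp add: reassoc)
  have "a \<star>\<^bsub>C\<^esub> ?y = (a \<star>\<^bsub>C\<^esub> m ?A) \<star>\<^bsub>C\<^esub> T (eta a)" by (simp add: hassoc)
  also have "\<dots> = a \<star>\<^bsub>C\<^esub> T (a \<star>\<^bsub>C\<^esub> eta a)"
    by (simp add: algebraD(6)[OF a, symmetric] hassoc T_comp)
  finally have ay: "a \<star>\<^bsub>C\<^esub> ?y = a \<star>\<^bsub>C\<^esub> m ?A" by (simp add: eta_left algebraD(6)[OF a])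
  have "(eta a \<star>\<^bsub>C\<^esub> t1 C ?y) \<bullet>\<^bsub>C\<^esub> (s1 C (eta a) \<star>\<^bsub>C\<^esub> ?y) = (t1 C (eta a) \<star>\<^bsub>C\<^esub> ?y) \<bullet>\<^bsub>C\<^esub> (eta a \<star>\<^bsub>C\<^esub> s1 C ?y)"
    by (rule trans[OF hcomp_left_right(1)[symmetric] hcomp_left_right(2)]) simp_all
  also have "t1 C (eta a) \<star>\<^bsub>C\<^esub> ?y = i ?A \<star>\<^bsub>C\<^esub> (a \<star>\<^bsub>C\<^esub> m ?A)" by (simp add: hassoc ay)
  also have "\<dots> = t1 C (eta a \<star>\<^bsub>C\<^esub> m ?A)" by (simp add: hassoc)
  also have "\<dots> \<bullet>\<^bsub>C\<^esub> (eta a \<star>\<^bsub>C\<^esub> s1 C ?y) = eta a \<star>\<^bsub>C\<^esub> m ?A"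
    unfolding s by (rule vcat(8)) simp_all
  finally show ?thesis unfolding t by simp
qed

end

section \<open>Lax morphisms and the algebra structure on a comma object\<close>

section \<open>Comma objects and algebras\<close>

text \<open>The comma object of \<open>h\<close> and the identity, with projections \<open>p\<close>, \<open>q\<close> and universal 2-cell from
  \<open>q\<close> to \<open>h p\<close>. The 1-cells in its universal property are the identity 2-cells.\<close>

definition is_comma :: "'k twocat \<Rightarrow> 'k \<Rightarrow> 'k \<Rightarrow> 'k \<Rightarrow> 'k \<Rightarrow> bool" where
  "is_comma K h p q k \<longleftrightarrow>
     h \<in> one_cells K \<and> p \<in> one_cells K \<and> q \<in> one_cells K \<and> k \<in> cells K \<and>
     t0 K p = s0 K h \<and> s0 K q = s0 K p \<and> t0 K q = t0 K h \<and> s1 K k = q \<and> t1 K k = h \<star>\<^bsub>K\<^esub> p \<and>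
     (\<forall>x\<in>cells K. \<forall>y\<in>cells K. \<forall>l\<in>cells K. \<forall>l'\<in>cells K.
        s0 K y = s0 K x \<and> t0 K x = s0 K h \<and> t0 K y = t0 K h \<and>
        s1 K l = s1 K y \<and> t1 K l = h \<star>\<^bsub>K\<^esub> s1 K x \<and> s1 K l' = t1 K y \<and> t1 K l' = h \<star>\<^bsub>K\<^esub> t1 K x \<and>
        l' \<bullet>\<^bsub>K\<^esub> y = (h \<star>\<^bsub>K\<^esub> x) \<bullet>\<^bsub>K\<^esub> l \<longrightarrow>
        (\<exists>!c. c \<in> cells K \<and> s0 K c = s0 K x \<and> t0 K c = s0 K p \<and> p \<star>\<^bsub>K\<^esub> c = x \<and> q \<star>\<^bsub>K\<^esub> c = y \<and>
           k \<star>\<^bsub>K\<^esub> s1 K c = l \<and> k \<star>\<^bsub>K\<^esub> t1 K c = l'))"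

context twocat begin

lemma vassoc_whisker:
  assumes "x \<in> cells C" "y \<in> cells C" "z \<in> cells C" "f \<in> cells C" "s1 C f = f" "s0 C y = t0 C f"
    and "s1 C x = t1 C y" "s1 C (y \<star>\<^bsub>C\<^esub> f) = t1 C z"
  shows "(x \<star>\<^bsub>C\<^esub> f) \<bullet>\<^bsub>C\<^esub> ((y \<star>\<^bsub>C\<^esub> f) \<bullet>\<^bsub>C\<^esub> z) = ((x \<bullet>\<^bsub>C\<^esub> y) \<star>\<^bsub>C\<^esub> f) \<bullet>\<^bsub>C\<^esub> z"
proof -
  have "s0 C x = s0 C y" using parallel01[OF assms(2,1,7)] by simp
  then show ?thesis using assms vcat(4)[of f]
    by (simp add: whisker_right vassoc[symmetric])
qed

lemma commaD:
  assumes "is_comma C h p q k"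
  shows "h \<in> cells C" "s1 C h = h" "t1 C h = h" "p \<in> cells C" "s1 C p = p" "t1 C p = p"
    "q \<in> cells C" "s1 C q = q" "t1 C q = q" "k \<in> cells C" "s1 C k = q" "t1 C k = h \<star>\<^bsub>C\<^esub> p"
    "t0 C p = s0 C h" "s0 C q = s0 C p" "t0 C q = t0 C h" "s0 C k = s0 C p" "t0 C k = t0 C h"
proof -
  show *: "h \<in> cells C" "s1 C h = h" "t1 C h = h" "p \<in> cells C" "s1 C p = p" "t1 C p = p"
    "q \<in> cells C" "s1 C q = q" "t1 C q = q" "k \<in> cells C" "s1 C k = q" "t1 C k = h \<star>\<^bsub>C\<^esub> p"
    "t0 C p = s0 C h" "s0 C q = s0 C p" "t0 C q = t0 C h"
    using assms one_cellD[of h] one_cellD[of p] one_cellD[of q] unfolding is_comma_def by auto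
  show "s0 C k = s0 C p" "t0 C k = t0 C h"
    using mixed(1)[of k] mixed(3)[of k] * by auto
qed

lemma comma_univ:
  assumes "is_comma C h p q k" "x \<in> cells C" "y \<in> cells C" "l \<in> cells C" "l' \<in> cells C"
    and "s0 C y = s0 C x" "t0 C x = s0 C h" "t0 C y = t0 C h"
    and "s1 C l = s1 C y" "t1 C l = h \<star>\<^bsub>C\<^esub> s1 C x" "s1 C l' = t1 C y" "t1 C l' = h \<star>\<^bsub>C\<^esub> t1 C x"
    and "l' \<bullet>\<^bsub>C\<^esub> y = (h \<star>\<^bsub>C\<^esub> x) \<bullet>\<^bsub>C\<^esub> l"
  shows "\<exists>!c. c \<in> cells C \<and> s0 C c = s0 C x \<and> t0 C c = s0 C p \<and> p \<star>\<^bsub>C\<^esub> c = x \<and> q \<star>\<^bsub>C\<^esub> c = y \<and>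
     k \<star>\<^bsub>C\<^esub> s1 C c = l \<and> k \<star>\<^bsub>C\<^esub> t1 C c = l'"
  using assms(1)[unfolded is_comma_def] assms(2-13)
  by (elim conjE) (drule bspec, assumption, drule bspec, assumption, drule bspec, assumption,
    drule bspec, assumption, drule mp, intro conjI, assumption+)

text \<open>Joint faithfulness of the projections. The universal 2-cell is compared on the source
  and on the target of \<open>c\<close>; the compatibility demanded by the universal property holds
  for the images of any \<open>c\<close>, by interchange with \<open>k\<close>.\<close>

lemma comma_eq:
  assumes "is_comma C h p q k" "c \<in> cells C" "c' \<in> cells C" "t0 C c = s0 C p" "t0 C c' = s0 C p"
    and "p \<star>\<^bsub>C\<^esub> c = p \<star>\<^bsub>C\<^esub> c'" "q \<star>\<^bsub>C\<^esub> c = q \<star>\<^bsub>C\<^esub> c'"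
    and "k \<star>\<^bsub>C\<^esub> s1 C c = k \<star>\<^bsub>C\<^esub> s1 C c'" "k \<star>\<^bsub>C\<^esub> t1 C c = k \<star>\<^bsub>C\<^esub> t1 C c'"
  shows "c = c'"
proof -
  note [simp] = commaD[OF assms(1)] assms(2-5)
  have s: "s0 C c' = s0 C c" using hcat(10)[of c p] hcat(10)[of c' p] assms(6) by simp
  let ?P = "\<lambda>d. d \<in> cells C \<and> s0 C d = s0 C (p \<star>\<^bsub>C\<^esub> c) \<and> t0 C d = s0 C p \<and> p \<star>\<^bsub>C\<^esub> d = p \<star>\<^bsub>C\<^esub> c \<and> q \<star>\<^bsub>C\<^esub> d = q \<star>\<^bsub>C\<^esub> c \<and>
           k \<star>\<^bsub>C\<^esub> s1 C d = k \<star>\<^bsub>C\<^esub> s1 C c \<and> k \<star>\<^bsub>C\<^esub> t1 C d = k \<star>\<^bsub>C\<^esub> t1 C c"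
  have *: "(k \<star>\<^bsub>C\<^esub> t1 C c) \<bullet>\<^bsub>C\<^esub> (s1 C k \<star>\<^bsub>C\<^esub> c) = (t1 C k \<star>\<^bsub>C\<^esub> c) \<bullet>\<^bsub>C\<^esub> (k \<star>\<^bsub>C\<^esub> s1 C c)"
    by (rule trans[OF hcomp_left_right(1)[symmetric] hcomp_left_right(2)]) simp_all
  have "\<exists>!d. ?P d"
    by (rule comma_univ[OF assms(1)]) (use * in \<open>simp_all add: hassoc\<close>)
  moreover have "?P c" by simp
  moreover have "?P c'" using assms(6-9) s by simp
  ultimately show ?thesis by blast
qed

text \<open>The universal property applied to identity 2-cells \<open>x\<close> and \<open>y\<close>
  and a single \<open>l\<close>. The resulting 2-cell is an identity, because it has the same images
  as its own source.\<close>

lemma comma_ex: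
  assumes "is_comma C h p q k" "x \<in> one_cells C" "y \<in> one_cells C" "l \<in> cells C"
    and "s0 C y = s0 C x" "t0 C x = s0 C h" "t0 C y = t0 C h" "s1 C l = y" "t1 C l = h \<star>\<^bsub>C\<^esub> x"
  shows "\<exists>u\<in>one_cells C. s0 C u = s0 C x \<and> t0 C u = s0 C p \<and> p \<star>\<^bsub>C\<^esub> u = x \<and> q \<star>\<^bsub>C\<^esub> u = y \<and> k \<star>\<^bsub>C\<^esub> u = l"
proof -
  note [simp] = commaD[OF assms(1)] assms(2-9) one_cellD[OF assms(2)] one_cellD[OF assms(3)]
  have "\<exists>!c. c \<in> cells C \<and> s0 C c = s0 C x \<and> t0 C c = s0 C p \<and> p \<star>\<^bsub>C\<^esub> c = x \<and> q \<star>\<^bsub>C\<^esub> c = y \<and>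
           k \<star>\<^bsub>C\<^esub> s1 C c = l \<and> k \<star>\<^bsub>C\<^esub> t1 C c = l"
    by (rule comma_univ[OF assms(1)]) simp_all
  then obtain c where c: "c \<in> cells C" "s0 C c = s0 C x" "t0 C c = s0 C p" "p \<star>\<^bsub>C\<^esub> c = x" "q \<star>\<^bsub>C\<^esub> c = y"
           "k \<star>\<^bsub>C\<^esub> s1 C c = l" "k \<star>\<^bsub>C\<^esub> t1 C c = l" by blast
  have "s1 C (p \<star>\<^bsub>C\<^esub> c) = x" "s1 C (q \<star>\<^bsub>C\<^esub> c) = y" by (simp_all add: c(4,5))
  then have *: "p \<star>\<^bsub>C\<^esub> s1 C c = x" "q \<star>\<^bsub>C\<^esub> s1 C c = y" using c(1-3) by simp_all
  have "s1 C c = c"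
    by (rule comma_eq[OF assms(1)]) (use c * in simp_all)
  then show ?thesis using c by (auto simp: one_cells_iff)
qed

end

context lax_monad2 begin

text \<open>The lax morphism structure of \<open>h\<close>, a 2-cell from
  \<open>b \<star> T h\<close> to \<open>h \<star> a\<close>: the mate of the naturality square of
  \<open>i\<close> at \<open>h\<close> under the adjunctions of \<open>a\<close> and of
  \<open>b\<close> with \<open>i\<close>. The unit axiom is \<open>hbar_i\<close>, the
  multiplication axiom \<open>hbar_mult\<close>.\<close>

definition hbar :: "'a \<Rightarrow> 'a \<Rightarrow> 'a \<Rightarrow> 'a" where
  "hbar a b h = b \<star>\<^bsub>C\<^esub> (T h \<star>\<^bsub>C\<^esub> eta a)"

lemma hbar_simps [simp]:
  assumes a: "algebra C T i m a" and b: "algebra C T i m b" and h: "h \<in> one_cells C" "s0 C h = t0 C a" "t0 C h = t0 C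
      b"
  shows "hbar a b h \<in> cells C" "s1 C (hbar a b h) = b \<star>\<^bsub>C\<^esub> T h" "t1 C (hbar a b h) = h \<star>\<^bsub>C\<^esub> a"
    "s0 C (hbar a b h) = T (t0 C a)" "t0 C (hbar a b h) = t0 C b"
proof -
  note [simp] = algebraD(1-5)[OF a] algebraD(1-5)[OF b] h a b one_cellD[OF h(1)]
  show "hbar a b h \<in> cells C" "s1 C (hbar a b h) = b \<star>\<^bsub>C\<^esub> T h"
    "s0 C (hbar a b h) = T (t0 C a)" "t0 C (hbar a b h) = t0 C b"
    by (simp_all add: hbar_def)
  have "t1 C (hbar a b h) = b \<star>\<^bsub>C\<^esub> (T h \<star>\<^bsub>C\<^esub> (i (t0 C a) \<star>\<^bsub>C\<^esub> a))"
    by (simp add: hbar_def)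
  also have "\<dots> = (b \<star>\<^bsub>C\<^esub> i (t0 C b)) \<star>\<^bsub>C\<^esub> (h \<star>\<^bsub>C\<^esub> a)"
    by (simp add: reassoc[OF i_nat[of h "t0 C a" "t0 C b", symmetric]] hassoc del: algebraD(5)[OF b])
  finally show "t1 C (hbar a b h) = h \<star>\<^bsub>C\<^esub> a" by simp
qed

lemma hbar_i:
  assumes a: "algebra C T i m a" and b: "algebra C T i m b" and h: "h \<in> one_cells C" "s0 C h = t0 C a" "t0 C h = t0 C
      b"
  shows "hbar a b h \<star>\<^bsub>C\<^esub> i (t0 C a) = h"
proof -
  note [simp] = algebraD(1-5)[OF a] algebraD(1-5)[OF b] h a b one_cellD[OF h(1)]
  have "hbar a b h \<star>\<^bsub>C\<^esub> i (t0 C a) = b \<star>\<^bsub>C\<^esub> (T h \<star>\<^bsub>C\<^esub> i (t0 C a))"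
    by (simp add: hbar_def hassoc eta_i)
  also have "\<dots> = (b \<star>\<^bsub>C\<^esub> i (t0 C b)) \<star>\<^bsub>C\<^esub> h"
    by (simp add: i_nat[of h "t0 C a" "t0 C b", symmetric] hassoc del: algebraD(5)[OF b])
  finally show ?thesis by simp
qed

text \<open>The two cells on the left are those of \<open>eta_mult\<close> whiskered with
  \<open>b \<star> T h\<close>, by the algebra law of \<open>b\<close> and naturality of
  \<open>m\<close>. So the equation is \<open>eta_mult\<close> whiskered with
  \<open>b \<star> T h\<close>.\<close>

lemma hbar_mult:
  assumes a: "algebra C T i m a" and b: "algebra C T i m b" and h: "h \<in> one_cells C" "s0 C h = t0 C a" "t0 C h = t0 C
      b"
  shows "(hbar a b h \<star>\<^bsub>C\<^esub> T a) \<bullet>\<^bsub>C\<^esub> (b \<star>\<^bsub>C\<^esub> T (hbar a b h)) = hbar a b h \<star>\<^bsub>C\<^esub> m (t0 C a)"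
proof -
  note [simp] = algebraD(1-4)[OF a] algebraD(1-4)[OF b] h a b one_cellD[OF h(1)]
  let ?bh = "b \<star>\<^bsub>C\<^esub> T h"
  have 1: "hbar a b h \<star>\<^bsub>C\<^esub> T a = ?bh \<star>\<^bsub>C\<^esub> (eta a \<star>\<^bsub>C\<^esub> T a)" by (simp add: hbar_def hassoc)
  have "b \<star>\<^bsub>C\<^esub> T (hbar a b h) = (b \<star>\<^bsub>C\<^esub> T b) \<star>\<^bsub>C\<^esub> (T (T h) \<star>\<^bsub>C\<^esub> T (eta a))"
    by (simp add: hbar_def hassoc T_comp)
  also have "\<dots> = b \<star>\<^bsub>C\<^esub> ((m (t0 C b) \<star>\<^bsub>C\<^esub> T (T h)) \<star>\<^bsub>C\<^esub> T (eta a))"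
    by (simp add: algebraD(6)[OF b] hassoc)
  also have "\<dots> = ?bh \<star>\<^bsub>C\<^esub> (m (t0 C a) \<star>\<^bsub>C\<^esub> T (eta a))"
    by (simp add: m_nat[of h "t0 C a" "t0 C b"] hassoc)
  finally have 2: "b \<star>\<^bsub>C\<^esub> T (hbar a b h) = ?bh \<star>\<^bsub>C\<^esub> (m (t0 C a) \<star>\<^bsub>C\<^esub> T (eta a))" .
  have "m (t0 C a) \<star>\<^bsub>C\<^esub> (T (i (t0 C a)) \<star>\<^bsub>C\<^esub> T a) = T a"
    by (simp add: reassoc[OF m_laws(1)[of "t0 C a"]])
  then have "t1 C (m (t0 C a) \<star>\<^bsub>C\<^esub> T (eta a)) = T a" by (simp add: T_comp)
  then have "?bh \<star>\<^bsub>C\<^esub> ((eta a \<star>\<^bsub>C\<^esub> T a) \<bullet>\<^bsub>C\<^esub> (m (t0 C a) \<star>\<^bsub>C\<^esub> T (eta a))) =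
      (?bh \<star>\<^bsub>C\<^esub> (eta a \<star>\<^bsub>C\<^esub> T a)) \<bullet>\<^bsub>C\<^esub> (?bh \<star>\<^bsub>C\<^esub> (m (t0 C a) \<star>\<^bsub>C\<^esub> T (eta a)))"
    by (intro whisker_left) simp_all
  then show ?thesis unfolding 1 2 by (simp add: eta_mult[OF a] hbar_def hassoc)
qed

text \<open>The projections are strict, and \<open>k\<close> is a 2-cell of lax morphisms from
  \<open>q\<close> to \<open>h \<star> p\<close>; as \<open>p\<close> is strict,
  \<open>h \<star> p\<close> carries the structure \<open>hbar a b h \<star> T p\<close>. The last
  three equations together determine \<open>c\<close>.\<close>

definition comma_alg :: "'a \<Rightarrow> 'a \<Rightarrow> 'a \<Rightarrow> 'a \<Rightarrow> 'a \<Rightarrow> 'a \<Rightarrow> 'a \<Rightarrow> bool" where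
  "comma_alg a b h p q k c \<longleftrightarrow> algebra C T i m a \<and> algebra C T i m b \<and> is_comma C h p q k \<and>
     s0 C h = t0 C a \<and> t0 C h = t0 C b \<and> algebra C T i m c \<and> t0 C c = s0 C p \<and>
     p \<star>\<^bsub>C\<^esub> c = a \<star>\<^bsub>C\<^esub> T p \<and> q \<star>\<^bsub>C\<^esub> c = b \<star>\<^bsub>C\<^esub> T q \<and>
     k \<star>\<^bsub>C\<^esub> c = (hbar a b h \<star>\<^bsub>C\<^esub> T p) \<bullet>\<^bsub>C\<^esub> (b \<star>\<^bsub>C\<^esub> T k)"

text \<open>The equations demanded of \<open>c\<close> are exactly the data of a 1-cell into the
  comma object. Compared along \<open>p\<close>, \<open>q\<close> and \<open>k\<close>, the unit and
  associativity laws of \<open>c\<close> reduce to those of \<open>a\<close> and \<open>b\<close>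
  and to the two axioms of the lax morphism \<open>h\<close>.\<close>

lemma comma_alg_ex:
  assumes a: "algebra C T i m a" and b: "algebra C T i m b" and K: "is_comma C h p q k"
    and h: "s0 C h = t0 C a" "t0 C h = t0 C b"
  shows "\<exists>c. comma_alg a b h p q k c"
proof -
  have h1: "h \<in> one_cells C" using K by (simp add: is_comma_def)
  note [simp] = commaD[OF K] algebraD(1-4)[OF a] algebraD(1-4)[OF b] h a b h1
  let ?A = "t0 C a" let ?B = "t0 C b" let ?E = "s0 C p" let ?H = "hbar a b h"
  let ?l = "(?H \<star>\<^bsub>C\<^esub> T p) \<bullet>\<^bsub>C\<^esub> (b \<star>\<^bsub>C\<^esub> T k)"
  have l: "?l \<in> cells C" "s1 C ?l = b \<star>\<^bsub>C\<^esub> T q" "t1 C ?l = h \<star>\<^bsub>C\<^esub> (a \<star>\<^bsub>C\<^esub> T p)" "s0 C ?l = T ?E"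
    by (simp_all add: hassoc T_comp)
  obtain c where c: "c \<in> one_cells C" "s0 C c = T ?E" "t0 C c = ?E" "p \<star>\<^bsub>C\<^esub> c = a \<star>\<^bsub>C\<^esub> T p" "q \<star>\<^bsub>C\<^esub> c = b \<star>\<^bsub>C\<^esub> T q"
    "k \<star>\<^bsub>C\<^esub> c = ?l"
  proof -
    have "\<exists>u\<in>one_cells C. s0 C u = s0 C (a \<star>\<^bsub>C\<^esub> T p) \<and> t0 C u = ?E \<and> p \<star>\<^bsub>C\<^esub> u = a \<star>\<^bsub>C\<^esub> T p \<and>
        q \<star>\<^bsub>C\<^esub> u = b \<star>\<^bsub>C\<^esub> T q \<and> k \<star>\<^bsub>C\<^esub> u = ?l"
      by (rule comma_ex[OF K]) (simp_all only: l, simp_all add: one_cells_iff)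
    then show thesis using that by auto
  qed
  note [simp] = c(1-3) one_cellD[OF c(1)]
  have "c \<star>\<^bsub>C\<^esub> i ?E = ?E"
  proof (rule comma_eq[OF K])
    have "p \<star>\<^bsub>C\<^esub> (c \<star>\<^bsub>C\<^esub> i ?E) = a \<star>\<^bsub>C\<^esub> (T p \<star>\<^bsub>C\<^esub> i ?E)" by (simp add: reassoc[OF c(4)] hassoc)
    also have "\<dots> = p" by (simp add: reassoc[OF algebraD(5)[OF a]] flip: i_nat[of p ?E ?A])
    finally show "p \<star>\<^bsub>C\<^esub> (c \<star>\<^bsub>C\<^esub> i ?E) = p \<star>\<^bsub>C\<^esub> ?E" by simp
    have "q \<star>\<^bsub>C\<^esub> (c \<star>\<^bsub>C\<^esub> i ?E) = b \<star>\<^bsub>C\<^esub> (T q \<star>\<^bsub>C\<^esub> i ?E)" by (simp add: reassoc[OF c(5)] hassoc)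
    also have "\<dots> = q" by (simp add: reassoc[OF algebraD(5)[OF b]] flip: i_nat[of q ?E ?B])
    finally show "q \<star>\<^bsub>C\<^esub> (c \<star>\<^bsub>C\<^esub> i ?E) = q \<star>\<^bsub>C\<^esub> ?E" by simp
    have "k \<star>\<^bsub>C\<^esub> (c \<star>\<^bsub>C\<^esub> i ?E) = ?l \<star>\<^bsub>C\<^esub> i ?E" by (simp add: reassoc[OF c(6)])
    also have "\<dots> = (?H \<star>\<^bsub>C\<^esub> (T p \<star>\<^bsub>C\<^esub> i ?E)) \<bullet>\<^bsub>C\<^esub> (b \<star>\<^bsub>C\<^esub> (T k \<star>\<^bsub>C\<^esub> i ?E))"
      by (subst whisker_right) (simp_all add: hassoc T_comp)
    also have "?H \<star>\<^bsub>C\<^esub> (T p \<star>\<^bsub>C\<^esub> i ?E) = h \<star>\<^bsub>C\<^esub> p"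
      by (simp add: reassoc[OF hbar_i[OF a b]] flip: i_nat[of p ?E ?A])
    also have "b \<star>\<^bsub>C\<^esub> (T k \<star>\<^bsub>C\<^esub> i ?E) = k"
      by (simp add: reassoc[OF algebraD(5)[OF b]] flip: i_nat[of k ?E ?B])
    finally have *: "k \<star>\<^bsub>C\<^esub> (c \<star>\<^bsub>C\<^esub> i ?E) = k" by simp
    then show "k \<star>\<^bsub>C\<^esub> s1 C (c \<star>\<^bsub>C\<^esub> i ?E) = k \<star>\<^bsub>C\<^esub> s1 C ?E" "k \<star>\<^bsub>C\<^esub> t1 C (c \<star>\<^bsub>C\<^esub> i ?E) = k \<star>\<^bsub>C\<^esub> t1 C ?E" by simp_all
  qed simp_all
  moreover have "c \<star>\<^bsub>C\<^esub> T c = c \<star>\<^bsub>C\<^esub> m ?E"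
  proof (rule comma_eq[OF K])
    have "p \<star>\<^bsub>C\<^esub> (c \<star>\<^bsub>C\<^esub> T c) = a \<star>\<^bsub>C\<^esub> T (p \<star>\<^bsub>C\<^esub> c)" by (simp add: reassoc[OF c(4)] hassoc T_comp)
    also have "\<dots> = (a \<star>\<^bsub>C\<^esub> T a) \<star>\<^bsub>C\<^esub> T (T p)" unfolding c(4) by (simp add: hassoc T_comp)
    also have "\<dots> = a \<star>\<^bsub>C\<^esub> (T p \<star>\<^bsub>C\<^esub> m ?E)" unfolding algebraD(6)[OF a] by (simp add: hassoc m_nat[of p ?E ?A])
    also have "\<dots> = p \<star>\<^bsub>C\<^esub> (c \<star>\<^bsub>C\<^esub> m ?E)" by (simp add: reassoc[OF c(4)] hassoc)
    finally show "p \<star>\<^bsub>C\<^esub> (c \<star>\<^bsub>C\<^esub> T c) = p \<star>\<^bsub>C\<^esub> (c \<star>\<^bsub>C\<^esub> m ?E)" .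
    have "q \<star>\<^bsub>C\<^esub> (c \<star>\<^bsub>C\<^esub> T c) = b \<star>\<^bsub>C\<^esub> T (q \<star>\<^bsub>C\<^esub> c)" by (simp add: reassoc[OF c(5)] hassoc T_comp)
    also have "\<dots> = (b \<star>\<^bsub>C\<^esub> T b) \<star>\<^bsub>C\<^esub> T (T q)" unfolding c(5) by (simp add: hassoc T_comp)
    also have "\<dots> = b \<star>\<^bsub>C\<^esub> (T q \<star>\<^bsub>C\<^esub> m ?E)" unfolding algebraD(6)[OF b] by (simp add: hassoc m_nat[of q ?E ?B])
    also have "\<dots> = q \<star>\<^bsub>C\<^esub> (c \<star>\<^bsub>C\<^esub> m ?E)" by (simp add: reassoc[OF c(5)] hassoc)
    finally show "q \<star>\<^bsub>C\<^esub> (c \<star>\<^bsub>C\<^esub> T c) = q \<star>\<^bsub>C\<^esub> (c \<star>\<^bsub>C\<^esub> m ?E)" .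
    have Tl: "T ?l = (T ?H \<star>\<^bsub>C\<^esub> T (T p)) \<bullet>\<^bsub>C\<^esub> (T b \<star>\<^bsub>C\<^esub> T (T k))"
      by (simp add: T_vcomp T_comp hassoc)
    have "k \<star>\<^bsub>C\<^esub> (c \<star>\<^bsub>C\<^esub> T c) = ?l \<star>\<^bsub>C\<^esub> T c" by (simp add: reassoc[OF c(6)])
    also have "\<dots> = (?H \<star>\<^bsub>C\<^esub> T (p \<star>\<^bsub>C\<^esub> c)) \<bullet>\<^bsub>C\<^esub> (b \<star>\<^bsub>C\<^esub> T (k \<star>\<^bsub>C\<^esub> c))"
      by (subst whisker_right) (simp_all add: hassoc T_comp)
    also have "?H \<star>\<^bsub>C\<^esub> T (p \<star>\<^bsub>C\<^esub> c) = (?H \<star>\<^bsub>C\<^esub> T a) \<star>\<^bsub>C\<^esub> T (T p)" unfolding c(4) by (simp add: hassoc T_comp)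
    also have "b \<star>\<^bsub>C\<^esub> T (k \<star>\<^bsub>C\<^esub> c) = ((b \<star>\<^bsub>C\<^esub> T ?H) \<star>\<^bsub>C\<^esub> T (T p)) \<bullet>\<^bsub>C\<^esub> ((b \<star>\<^bsub>C\<^esub> T b) \<star>\<^bsub>C\<^esub> T (T k))"
      unfolding c(6) Tl by (subst whisker_left) (simp_all add: hassoc T_comp)
    \<comment> \<open>Regrouping brings together the two cells on the left of
      \<open>hbar_mult\<close>.\<close>
    also have "((?H \<star>\<^bsub>C\<^esub> T a) \<star>\<^bsub>C\<^esub> T (T p)) \<bullet>\<^bsub>C\<^esub> \<dots> =
        (((?H \<star>\<^bsub>C\<^esub> T a) \<bullet>\<^bsub>C\<^esub> (b \<star>\<^bsub>C\<^esub> T ?H)) \<star>\<^bsub>C\<^esub> T (T p)) \<bullet>\<^bsub>C\<^esub> ((b \<star>\<^bsub>C\<^esub> T b) \<star>\<^bsub>C\<^esub> T (T k))"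
      by (rule vassoc_whisker) (simp_all add: hassoc T_comp)
    also have "\<dots> = (?H \<star>\<^bsub>C\<^esub> (T p \<star>\<^bsub>C\<^esub> m ?E)) \<bullet>\<^bsub>C\<^esub> (b \<star>\<^bsub>C\<^esub> (T k \<star>\<^bsub>C\<^esub> m ?E))"
      using hbar_mult[OF a b h1 h] algebraD(6)[OF b] m_nat[of p ?E ?A] m_nat[of k ?E ?B] by (simp add: hassoc)
    also have "\<dots> = ?l \<star>\<^bsub>C\<^esub> m ?E"
      by (subst whisker_right) (simp_all add: hassoc T_comp)
    also have "\<dots> = k \<star>\<^bsub>C\<^esub> (c \<star>\<^bsub>C\<^esub> m ?E)" by (simp add: reassoc[OF c(6)])
    finally show "k \<star>\<^bsub>C\<^esub> s1 C (c \<star>\<^bsub>C\<^esub> T c) = k \<star>\<^bsub>C\<^esub> s1 C (c \<star>\<^bsub>C\<^esub> m ?E)"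
       "k \<star>\<^bsub>C\<^esub> t1 C (c \<star>\<^bsub>C\<^esub> T c) = k \<star>\<^bsub>C\<^esub> t1 C (c \<star>\<^bsub>C\<^esub> m ?E)" by simp_all
  qed simp_all
  ultimately have "algebra C T i m c" unfolding algebra_def by simp
  then have "comma_alg a b h p q k c" unfolding comma_alg_def using a b K h c by simp
  then show ?thesis by blast
qed

end

context lax_monad2 begin

text \<open>Along the projections the equation is the strictness of \<open>x\<close> and
  \<open>y\<close>. Along the universal 2-cell it needs that lax structures are compatible with
  strict morphisms, \<open>y \<star> hbar a b h = hbar a' b' h' \<star> T x\<close>, which comes
  from \<open>eta_nat\<close>.\<close>

lemma comma_strict1:
  assumes c: "comma_alg a b h p q k c" and c': "comma_alg a' b' h' p' q' k' c'"
    and w: "w \<in> one_cells C" "s0 C w = s0 C p" "t0 C w = s0 C p'"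
    and x: "x \<in> one_cells C" "s0 C x = t0 C a" "t0 C x = t0 C a'"
    and y: "y \<in> one_cells C" "s0 C y = t0 C b" "t0 C y = t0 C b'"
    and eqs: "p' \<star>\<^bsub>C\<^esub> w = x \<star>\<^bsub>C\<^esub> p" "q' \<star>\<^bsub>C\<^esub> w = y \<star>\<^bsub>C\<^esub> q" "k' \<star>\<^bsub>C\<^esub> w = y \<star>\<^bsub>C\<^esub> k"
      "x \<star>\<^bsub>C\<^esub> a = a' \<star>\<^bsub>C\<^esub> T x" "y \<star>\<^bsub>C\<^esub> b = b' \<star>\<^bsub>C\<^esub> T y" "y \<star>\<^bsub>C\<^esub> h = h' \<star>\<^bsub>C\<^esub> x"
  shows "w \<star>\<^bsub>C\<^esub> c = c' \<star>\<^bsub>C\<^esub> T w"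
proof -
  have A: "algebra C T i m a" "algebra C T i m b" "algebra C T i m c" "is_comma C h p q k" "h \<in> one_cells C"
    "s0 C h = t0 C a" "t0 C h = t0 C b" "t0 C c = s0 C p"
    and c1: "p \<star>\<^bsub>C\<^esub> c = a \<star>\<^bsub>C\<^esub> T p" "q \<star>\<^bsub>C\<^esub> c = b \<star>\<^bsub>C\<^esub> T q"
     "k \<star>\<^bsub>C\<^esub> c = (hbar a b h \<star>\<^bsub>C\<^esub> T p) \<bullet>\<^bsub>C\<^esub> (b \<star>\<^bsub>C\<^esub> T k)"
    using c unfolding comma_alg_def is_comma_def by auto
  have A': "algebra C T i m a'" "algebra C T i m b'" "algebra C T i m c'" "is_comma C h' p' q' k'" "h' \<in> one_cells C"
    "s0 C h' = t0 C a'" "t0 C h' = t0 C b'" "t0 C c' = s0 C p'"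
    and c1': "p' \<star>\<^bsub>C\<^esub> c' = a' \<star>\<^bsub>C\<^esub> T p'" "q' \<star>\<^bsub>C\<^esub> c' = b' \<star>\<^bsub>C\<^esub> T q'"
     "k' \<star>\<^bsub>C\<^esub> c' = (hbar a' b' h' \<star>\<^bsub>C\<^esub> T p') \<bullet>\<^bsub>C\<^esub> (b' \<star>\<^bsub>C\<^esub> T k')"
    using c' unfolding comma_alg_def is_comma_def by auto
  note [simp] = A A' w x y one_cellD[OF w(1)] one_cellD[OF x(1)] one_cellD[OF y(1)]
    commaD[OF A(4)] commaD[OF A'(4)] algebraD(1-4)[OF A(1)] algebraD(1-4)[OF A(2)] algebraD(1-4)[OF A(3)]
    algebraD(1-4)[OF A'(1)] algebraD(1-4)[OF A'(2)] algebraD(1-4)[OF A'(3)]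
  let ?H = "hbar a b h" let ?H' = "hbar a' b' h'"
  have H: "y \<star>\<^bsub>C\<^esub> ?H = ?H' \<star>\<^bsub>C\<^esub> T x"
  proof -
    have "y \<star>\<^bsub>C\<^esub> ?H = (y \<star>\<^bsub>C\<^esub> b) \<star>\<^bsub>C\<^esub> (T h \<star>\<^bsub>C\<^esub> eta a)" by (simp add: hbar_def hassoc)
    also have "\<dots> = b' \<star>\<^bsub>C\<^esub> (T (y \<star>\<^bsub>C\<^esub> h) \<star>\<^bsub>C\<^esub> eta a)" unfolding eqs(5) by (simp add: T_comp hassoc)
    also have "\<dots> = b' \<star>\<^bsub>C\<^esub> (T h' \<star>\<^bsub>C\<^esub> (T x \<star>\<^bsub>C\<^esub> eta a))" unfolding eqs(6) by (simp add: T_comp hassoc)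
    also have "T x \<star>\<^bsub>C\<^esub> eta a = eta a' \<star>\<^bsub>C\<^esub> T x" by (rule eta_nat[symmetric]) (simp_all add: eqs)
    finally show ?thesis by (simp add: hbar_def hassoc)
  qed
  have K: "k' \<star>\<^bsub>C\<^esub> (w \<star>\<^bsub>C\<^esub> c) = k' \<star>\<^bsub>C\<^esub> (c' \<star>\<^bsub>C\<^esub> T w)"
  proof -
    have "k' \<star>\<^bsub>C\<^esub> (w \<star>\<^bsub>C\<^esub> c) = y \<star>\<^bsub>C\<^esub> (k \<star>\<^bsub>C\<^esub> c)" by (simp add: reassoc[OF eqs(3)] hassoc)
    also have "\<dots> = (y \<star>\<^bsub>C\<^esub> (?H \<star>\<^bsub>C\<^esub> T p)) \<bullet>\<^bsub>C\<^esub> (y \<star>\<^bsub>C\<^esub> (b \<star>\<^bsub>C\<^esub> T k))"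
      unfolding c1(3) by (rule whisker_left) (simp_all add: hassoc T_comp)
    also have "y \<star>\<^bsub>C\<^esub> (?H \<star>\<^bsub>C\<^esub> T p) = ?H' \<star>\<^bsub>C\<^esub> T (p' \<star>\<^bsub>C\<^esub> w)"
      unfolding eqs(1) by (simp add: reassoc[OF H] T_comp hassoc)
    also have "y \<star>\<^bsub>C\<^esub> (b \<star>\<^bsub>C\<^esub> T k) = b' \<star>\<^bsub>C\<^esub> T (k' \<star>\<^bsub>C\<^esub> w)"
      unfolding eqs(3) by (simp add: reassoc[OF eqs(5)] T_comp hassoc)
    also have "(?H' \<star>\<^bsub>C\<^esub> T (p' \<star>\<^bsub>C\<^esub> w)) \<bullet>\<^bsub>C\<^esub> (b' \<star>\<^bsub>C\<^esub> T (k' \<star>\<^bsub>C\<^esub> w)) =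
        ((?H' \<star>\<^bsub>C\<^esub> T p') \<star>\<^bsub>C\<^esub> T w) \<bullet>\<^bsub>C\<^esub> ((b' \<star>\<^bsub>C\<^esub> T k') \<star>\<^bsub>C\<^esub> T w)"
      by (simp add: T_comp hassoc)
    also have "\<dots> = (k' \<star>\<^bsub>C\<^esub> c') \<star>\<^bsub>C\<^esub> T w"
      unfolding c1'(3) by (rule whisker_right[symmetric]) (simp_all add: hassoc T_comp)
    finally show ?thesis by (simp add: hassoc)
  qed
  show ?thesis
  proof (rule comma_eq[OF A'(4)])
    show "p' \<star>\<^bsub>C\<^esub> (w \<star>\<^bsub>C\<^esub> c) = p' \<star>\<^bsub>C\<^esub> (c' \<star>\<^bsub>C\<^esub> T w)"
    proof -
      have "p' \<star>\<^bsub>C\<^esub> (w \<star>\<^bsub>C\<^esub> c) = x \<star>\<^bsub>C\<^esub> (p \<star>\<^bsub>C\<^esub> c)" by (simp add: reassoc[OF eqs(1)] hassoc)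
      also have "\<dots> = a' \<star>\<^bsub>C\<^esub> T (x \<star>\<^bsub>C\<^esub> p)" unfolding c1 by (simp add: reassoc[OF eqs(4)] hassoc T_comp)
      also have "\<dots> = p' \<star>\<^bsub>C\<^esub> (c' \<star>\<^bsub>C\<^esub> T w)" unfolding eqs(1)[symmetric] by (simp add: reassoc[OF c1'(1)] hassoc
          T_comp)
      finally show ?thesis .
    qed
    show "q' \<star>\<^bsub>C\<^esub> (w \<star>\<^bsub>C\<^esub> c) = q' \<star>\<^bsub>C\<^esub> (c' \<star>\<^bsub>C\<^esub> T w)"
    proof -
      have "q' \<star>\<^bsub>C\<^esub> (w \<star>\<^bsub>C\<^esub> c) = y \<star>\<^bsub>C\<^esub> (q \<star>\<^bsub>C\<^esub> c)" by (simp add: reassoc[OF eqs(2)] hassoc)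
      also have "\<dots> = b' \<star>\<^bsub>C\<^esub> T (y \<star>\<^bsub>C\<^esub> q)" unfolding c1 by (simp add: reassoc[OF eqs(5)] hassoc T_comp)
      also have "\<dots> = q' \<star>\<^bsub>C\<^esub> (c' \<star>\<^bsub>C\<^esub> T w)" unfolding eqs(2)[symmetric] by (simp add: reassoc[OF c1'(2)] hassoc
          T_comp)
      finally show ?thesis .
    qed
  qed (use K in simp_all)
qed

text \<open>A 2-cell into a comma object meets the universal 2-cell only through its source and
  target, and these are 1-cells covered by \<open>comma_strict1\<close>. The version for 2-cells is
  what naturality over a 2-category of generators requires.\<close>

lemma comma_strict:
  assumes c: "comma_alg a b h p q k c" and c': "comma_alg a' b' h' p' q' k' c'"
    and w: "w \<in> cells C" "s0 C w = s0 C p" "t0 C w = s0 C p'"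
    and x: "x \<in> cells C" "s0 C x = t0 C a" "t0 C x = t0 C a'"
    and y: "y \<in> cells C" "s0 C y = t0 C b" "t0 C y = t0 C b'"
    and eqs: "p' \<star>\<^bsub>C\<^esub> w = x \<star>\<^bsub>C\<^esub> p" "q' \<star>\<^bsub>C\<^esub> w = y \<star>\<^bsub>C\<^esub> q"
      "x \<star>\<^bsub>C\<^esub> a = a' \<star>\<^bsub>C\<^esub> T x" "y \<star>\<^bsub>C\<^esub> b = b' \<star>\<^bsub>C\<^esub> T y" "y \<star>\<^bsub>C\<^esub> h = h' \<star>\<^bsub>C\<^esub> x"
    and k: "k' \<star>\<^bsub>C\<^esub> s1 C w = s1 C y \<star>\<^bsub>C\<^esub> k" "k' \<star>\<^bsub>C\<^esub> t1 C w = t1 C y \<star>\<^bsub>C\<^esub> k"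
  shows "w \<star>\<^bsub>C\<^esub> c = c' \<star>\<^bsub>C\<^esub> T w"
proof -
  have A: "algebra C T i m a" "algebra C T i m b" "algebra C T i m c" "is_comma C h p q k"
    "s0 C h = t0 C a" "t0 C h = t0 C b" "t0 C c = s0 C p"
    and c1: "p \<star>\<^bsub>C\<^esub> c = a \<star>\<^bsub>C\<^esub> T p" "q \<star>\<^bsub>C\<^esub> c = b \<star>\<^bsub>C\<^esub> T q"
    using c unfolding comma_alg_def by auto
  have A': "algebra C T i m a'" "algebra C T i m b'" "algebra C T i m c'" "is_comma C h' p' q' k'"
    "s0 C h' = t0 C a'" "t0 C h' = t0 C b'" "t0 C c' = s0 C p'"
    and c1': "p' \<star>\<^bsub>C\<^esub> c' = a' \<star>\<^bsub>C\<^esub> T p'" "q' \<star>\<^bsub>C\<^esub> c' = b' \<star>\<^bsub>C\<^esub> T q'"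
    using c' unfolding comma_alg_def by auto
  note [simp] = A A' w x y
    commaD[OF A(4)] commaD[OF A'(4)] algebraD(1-4)[OF A(1)] algebraD(1-4)[OF A(2)] algebraD(1-4)[OF A(3)]
    algebraD(1-4)[OF A'(1)] algebraD(1-4)[OF A'(2)] algebraD(1-4)[OF A'(3)]
  have S: "s1 C w \<star>\<^bsub>C\<^esub> c = c' \<star>\<^bsub>C\<^esub> T (s1 C w)"
    by (rule comma_strict1[OF c c', of _ "s1 C x" "s1 C y"])
       (use k eqs[THEN arg_cong[of _ _ "s1 C"]] in \<open>simp_all add: one_cells_iff\<close>)
  have T: "t1 C w \<star>\<^bsub>C\<^esub> c = c' \<star>\<^bsub>C\<^esub> T (t1 C w)"
    by (rule comma_strict1[OF c c', of _ "t1 C x" "t1 C y"])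
       (use k eqs[THEN arg_cong[of _ _ "t1 C"]] in \<open>simp_all add: one_cells_iff\<close>)
  show ?thesis
  proof (rule comma_eq[OF A'(4)])
    show "p' \<star>\<^bsub>C\<^esub> (w \<star>\<^bsub>C\<^esub> c) = p' \<star>\<^bsub>C\<^esub> (c' \<star>\<^bsub>C\<^esub> T w)"
    proof -
      have "p' \<star>\<^bsub>C\<^esub> (w \<star>\<^bsub>C\<^esub> c) = x \<star>\<^bsub>C\<^esub> (p \<star>\<^bsub>C\<^esub> c)" by (simp add: reassoc[OF eqs(1)] hassoc)
      also have "\<dots> = a' \<star>\<^bsub>C\<^esub> T (x \<star>\<^bsub>C\<^esub> p)" unfolding c1 by (simp add: reassoc[OF eqs(3)] hassoc T_comp)
      also have "\<dots> = p' \<star>\<^bsub>C\<^esub> (c' \<star>\<^bsub>C\<^esub> T w)" unfolding eqs(1)[symmetric] by (simp add: reassoc[OF c1'(1)] hassoc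
          T_comp)
      finally show ?thesis .
    qed
    show "q' \<star>\<^bsub>C\<^esub> (w \<star>\<^bsub>C\<^esub> c) = q' \<star>\<^bsub>C\<^esub> (c' \<star>\<^bsub>C\<^esub> T w)"
    proof -
      have "q' \<star>\<^bsub>C\<^esub> (w \<star>\<^bsub>C\<^esub> c) = y \<star>\<^bsub>C\<^esub> (q \<star>\<^bsub>C\<^esub> c)" by (simp add: reassoc[OF eqs(2)] hassoc)
      also have "\<dots> = b' \<star>\<^bsub>C\<^esub> T (y \<star>\<^bsub>C\<^esub> q)" unfolding c1 by (simp add: reassoc[OF eqs(4)] hassoc T_comp)
      also have "\<dots> = q' \<star>\<^bsub>C\<^esub> (c' \<star>\<^bsub>C\<^esub> T w)" unfolding eqs(2)[symmetric] by (simp add: reassoc[OF c1'(2)] hassoc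
          T_comp)
      finally show ?thesis .
    qed
  qed (use S T in simp_all)
qed

end

text \<open>The interface between cofibrant generation and the argument on monads. An algebra for
  \<open>R\<close> has an underlying family \<open>st\<close> of algebras for \<open>T\<close> over
  the 2-functors \<open>W j\<close>; the family detects strictness, and comma objects can be given
  an \<open>R\<close>-algebra structure inducing the comma structures of the families.\<close>

locale algebras_pulled_back = R: monad2 K R i m + M: lax_monad2 L T n u
  for K :: "'c twocat" and R i m and L :: "'d twocat" and T n u +
  fixes W :: "'j \<Rightarrow> 'c \<Rightarrow> 'd" and J :: "'j set" and st :: "'c \<Rightarrow> 'j \<Rightarrow> 'd"
  assumes W: "j \<in> J \<Longrightarrow> two_functor K L (W j)"
    and st: "algebra K R i m a \<Longrightarrow> j \<in> J \<Longrightarrow> algebra L T n u (st a j) \<and> t0 L (st a j) = W j (t0 K a)"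
    and strict: "algebra K R i m a \<Longrightarrow> algebra K R i m b \<Longrightarrow> x \<in> cells K \<Longrightarrow> s0 K x = t0 K a \<Longrightarrow> t0 K x = t0 K b \<Longrightarrow>
      x \<star>\<^bsub>K\<^esub> a = b \<star>\<^bsub>K\<^esub> R x \<longleftrightarrow> (\<forall>j\<in>J. W j x \<star>\<^bsub>L\<^esub> st a j = st b j \<star>\<^bsub>L\<^esub> T (W j x))"
    and comma: "algebra K R i m a \<Longrightarrow> algebra K R i m b \<Longrightarrow> h \<in> one_cells K \<Longrightarrow> s0 K h = t0 K a \<Longrightarrow> t0 K h = t0 K b \<Longrightarrow>
      \<exists>p q k c. is_comma K h p q k \<and> algebra K R i m c \<and> t0 K c = s0 K p \<and>
        (\<forall>j\<in>J. M.comma_alg (st a j) (st b j) (W j h) (W j p) (W j q) (W j k) (st c j))"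
begin

text \<open>The comma object of the unit of \<open>R A\<close> is an algebra with strict projections, so freeness of \<open>R A\<close>
  gives the 2-cell from \<open>R i\<close> to \<open>i R\<close>.\<close>

lemma lax_idempotent: "lax_idempotent_monad K R i m"
proof (rule R.lax_idempotentI)
  fix A assume A[simp]: "A \<in> zero_cells K"
  let ?a = "m A" let ?b = "m (R A)" let ?h = "i (R A)"
  have ab: "algebra K R i m ?a" "algebra K R i m ?b" by (simp_all add: R.free_algebra)
  obtain p q k c where K: "is_comma K ?h p q k" and c: "algebra K R i m c" "t0 K c = s0 K p"
    and cj: "\<And>j. j \<in> J \<Longrightarrow> M.comma_alg (st ?a j) (st ?b j) (W j ?h) (W j p) (W j q) (W j k) (st c j)"
    using comma[OF ab, of ?h] by (auto simp: R.one_cells_iff)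
  note [simp] = R.commaD[OF K] R.algebraD(1-4)[OF c(1)] c(2)
  have pc: "p \<star>\<^bsub>K\<^esub> c = ?a \<star>\<^bsub>K\<^esub> R p" and qc: "q \<star>\<^bsub>K\<^esub> c = ?b \<star>\<^bsub>K\<^esub> R q"
    using strict[OF c(1) ab(1), of p] strict[OF c(1) ab(2), of q] cj unfolding M.comma_alg_def by auto
  let ?E = "s0 K p"
  have "\<exists>v\<in>one_cells K. s0 K v = s0 K (i A) \<and> t0 K v = s0 K p \<and> p \<star>\<^bsub>K\<^esub> v = i A \<and> q \<star>\<^bsub>K\<^esub> v = R (i A) \<star>\<^bsub>K\<^esub> i A \<and>
      k \<star>\<^bsub>K\<^esub> v = R (i A) \<star>\<^bsub>K\<^esub> i A"
    by (rule R.comma_ex[OF K]) (simp_all add: R.one_cells_iff R.i_nat[of "i A" A "R A"])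
  then obtain v where v: "v \<in> one_cells K" "s0 K v = A" "t0 K v = ?E" "p \<star>\<^bsub>K\<^esub> v = i A" "q \<star>\<^bsub>K\<^esub> v = R (i A) \<star>\<^bsub>K\<^esub> i A"
    "k \<star>\<^bsub>K\<^esub> v = R (i A) \<star>\<^bsub>K\<^esub> i A" by auto
  note [simp] = v(1-3) R.one_cellD[OF v(1)]
  \<comment> \<open>The strict extension of \<open>v\<close> along the unit of the free algebra. The
    wanted 2-cell is \<open>k \<star> w\<close>.\<close>
  define w where "w = c \<star>\<^bsub>K\<^esub> R v"
  have w[simp]: "w \<in> cells K" "s1 K w = w" "t1 K w = w" "s0 K w = R A" "t0 K w = ?E" by (simp_all add: w_def)
  have pw: "p \<star>\<^bsub>K\<^esub> w = R A"
  proof -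
    have "p \<star>\<^bsub>K\<^esub> w = m A \<star>\<^bsub>K\<^esub> R (p \<star>\<^bsub>K\<^esub> v)" by (simp add: w_def R.reassoc[OF pc] R.hassoc R.T_comp)
    then show ?thesis unfolding v(4) by (simp add: R.m_laws)
  qed
  have qw: "q \<star>\<^bsub>K\<^esub> w = R (i A)"
  proof -
    have "q \<star>\<^bsub>K\<^esub> w = m (R A) \<star>\<^bsub>K\<^esub> R (q \<star>\<^bsub>K\<^esub> v)" by (simp add: w_def R.reassoc[OF qc] R.hassoc R.T_comp)
    also have "\<dots> = (m (R A) \<star>\<^bsub>K\<^esub> R (R (i A))) \<star>\<^bsub>K\<^esub> R (i A)" unfolding v(5) by (simp add: R.T_comp R.hassoc)
    also have "\<dots> = R (i A) \<star>\<^bsub>K\<^esub> (m A \<star>\<^bsub>K\<^esub> R (i A))" by (simp add: R.m_nat[of "i A" A "R A"] R.hassoc)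
    finally show ?thesis by (simp add: R.m_laws)
  qed
  have wi: "w \<star>\<^bsub>K\<^esub> i A = v"
  proof -
    have "w \<star>\<^bsub>K\<^esub> i A = (c \<star>\<^bsub>K\<^esub> i ?E) \<star>\<^bsub>K\<^esub> v"
      by (simp add: w_def R.hassoc R.i_nat[of v A ?E])
    then show ?thesis using R.algebraD(5)[OF c(1)] by simp
  qed
  have wm: "w \<star>\<^bsub>K\<^esub> m A = c \<star>\<^bsub>K\<^esub> R w"
  proof -
    have "w \<star>\<^bsub>K\<^esub> m A = (c \<star>\<^bsub>K\<^esub> m ?E) \<star>\<^bsub>K\<^esub> R (R v)"
      by (simp add: w_def R.hassoc R.m_nat[of v A ?E])
    also have "\<dots> = c \<star>\<^bsub>K\<^esub> R w" by (simp add: w_def R.T_comp R.hassoc R.reassoc[OF R.algebraD(6)[OF c(1)]])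
    finally show ?thesis .
  qed
  \<comment> \<open>As \<open>k \<star> w\<close> goes from \<open>R i\<close> to
    \<open>i R\<close>, the unit laws make \<open>z\<close> an endo-2-cell of the identity of
    \<open>R A\<close>. It has to be trivial, so it is shown to be strict and to restrict to an
    identity along \<open>i A\<close>.\<close>
  define z where "z = m A \<star>\<^bsub>K\<^esub> (k \<star>\<^bsub>K\<^esub> w)"
  have hpw: "?h \<star>\<^bsub>K\<^esub> (p \<star>\<^bsub>K\<^esub> w) = ?h" by (simp add: pw)
  have hpw2: "(?h \<star>\<^bsub>K\<^esub> p) \<star>\<^bsub>K\<^esub> w = ?h" by (simp add: R.hassoc hpw)
  have z[simp]: "z \<in> cells K" "s0 K z = R A" "t0 K z = R A" by (simp_all add: z_def)
  have zi: "z \<star>\<^bsub>K\<^esub> i A = i A"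
  proof -
    have "z \<star>\<^bsub>K\<^esub> i A = m A \<star>\<^bsub>K\<^esub> (k \<star>\<^bsub>K\<^esub> v)" by (simp add: z_def R.hassoc wi)
    also have "\<dots> = (m A \<star>\<^bsub>K\<^esub> R (i A)) \<star>\<^bsub>K\<^esub> i A" unfolding v(6) by (simp add: R.hassoc)
    finally show ?thesis by (simp add: R.m_laws)
  qed
  have "W j z \<star>\<^bsub>L\<^esub> st ?a j = st ?a j \<star>\<^bsub>L\<^esub> T (W j z)" if j: "j \<in> J" for j
  proof -
    note Wj = two_functorD[OF W[OF j]] two_functor_verD[OF W[OF j] _ R.two_cat]
    note Wc = two_functor_comp(1)[OF W[OF j]]
    have S: "algebra L T n u (st ?a j)" "algebra L T n u (st ?b j)" "algebra L T n u (st c j)"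
      "t0 L (st ?a j) = W j (R A)" "t0 L (st ?b j) = W j (R (R A))" "t0 L (st c j) = W j ?E"
      using st[OF ab(1) j] st[OF ab(2) j] st[OF c(1) j] by auto
    have h1: "W j ?h \<in> one_cells L" by (simp add: Wj M.one_cells_iff)
    have z0: "W j (R A) \<in> zero_cells L" "W j ?E \<in> zero_cells L" using two_functor_zero[OF W[OF j]] by auto
    note [simp] = Wj S M.algebraD(1-4)[OF S(1)] M.algebraD(1-4)[OF S(2)] M.algebraD(1-4)[OF S(3)] h1 z0
    let ?H = "M.hbar (st ?a j) (st ?b j) (W j ?h)"
    have kc: "W j k \<star>\<^bsub>L\<^esub> st c j = (?H \<star>\<^bsub>L\<^esub> T (W j p)) \<bullet>\<^bsub>L\<^esub> (st ?b j \<star>\<^bsub>L\<^esub> T (W j k))"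
      using cj[OF j] unfolding M.comma_alg_def by simp
    have ms: "W j (m A) \<star>\<^bsub>L\<^esub> st ?b j = st ?a j \<star>\<^bsub>L\<^esub> T (W j (m A))"
      using strict[OF ab(2,1), of "m A"] j by (simp add: R.m_laws(3))
    have ws: "W j w \<star>\<^bsub>L\<^esub> st ?a j = st c j \<star>\<^bsub>L\<^esub> T (W j w)"
      using strict[OF ab(1) c(1), of w] j by (simp add: wm)
    \<comment> \<open>A strict morphism after a lax one: \<open>W j (m A)\<close> carries the lax
      structure of \<open>W j ?h\<close> to that of \<open>W j (m A \<star> ?h)\<close>. The latter
      is the structure of an identity and is trivial by a triangle identity.\<close>
    have mH: "W j (m A) \<star>\<^bsub>L\<^esub> ?H = st ?a j"
    proof -
      have "W j (m A) \<star>\<^bsub>L\<^esub> ?H = (W j (m A) \<star>\<^bsub>L\<^esub> st ?b j) \<star>\<^bsub>L\<^esub> (T (W j ?h) \<star>\<^bsub>L\<^esub> M.eta (st ?a j))"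
        by (simp add: M.hbar_def M.hassoc)
      also have "\<dots> = st ?a j \<star>\<^bsub>L\<^esub> (T (W j (m A \<star>\<^bsub>K\<^esub> ?h)) \<star>\<^bsub>L\<^esub> M.eta (st ?a j))"
        unfolding ms by (simp add: M.hassoc M.T_comp Wc)
      also have "\<dots> = st ?a j" by (simp add: R.m_laws M.eta_left)
      finally show ?thesis .
    qed
    have "W j z \<star>\<^bsub>L\<^esub> st ?a j = W j (m A) \<star>\<^bsub>L\<^esub> (W j k \<star>\<^bsub>L\<^esub> (W j w \<star>\<^bsub>L\<^esub> st ?a j))"
      by (simp add: z_def Wc M.hassoc)
    also have "\<dots> = W j (m A) \<star>\<^bsub>L\<^esub> ((W j k \<star>\<^bsub>L\<^esub> st c j) \<star>\<^bsub>L\<^esub> T (W j w))"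
      unfolding ws by (simp add: M.hassoc)
    also have "(W j k \<star>\<^bsub>L\<^esub> st c j) \<star>\<^bsub>L\<^esub> T (W j w) =
       ((?H \<star>\<^bsub>L\<^esub> T (W j p)) \<star>\<^bsub>L\<^esub> T (W j w)) \<bullet>\<^bsub>L\<^esub> ((st ?b j \<star>\<^bsub>L\<^esub> T (W j k)) \<star>\<^bsub>L\<^esub> T (W j w))"
      unfolding kc by (rule M.whisker_right) (simp_all add: M.hassoc M.T_comp Wc)
    also have "(?H \<star>\<^bsub>L\<^esub> T (W j p)) \<star>\<^bsub>L\<^esub> T (W j w) = ?H \<star>\<^bsub>L\<^esub> T (W j (p \<star>\<^bsub>K\<^esub> w))"
      by (simp add: M.hassoc M.T_comp Wc)
    also have "\<dots> = ?H" by (simp add: pw)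
    also have "W j (m A) \<star>\<^bsub>L\<^esub> (?H \<bullet>\<^bsub>L\<^esub> ((st ?b j \<star>\<^bsub>L\<^esub> T (W j k)) \<star>\<^bsub>L\<^esub> T (W j w))) =
       (W j (m A) \<star>\<^bsub>L\<^esub> ?H) \<bullet>\<^bsub>L\<^esub> (W j (m A) \<star>\<^bsub>L\<^esub> ((st ?b j \<star>\<^bsub>L\<^esub> T (W j k)) \<star>\<^bsub>L\<^esub> T (W j w)))"
      by (rule M.whisker_left) (simp_all add: M.hassoc M.T_comp[symmetric] Wc[symmetric] pw hpw2)
    also have "W j (m A) \<star>\<^bsub>L\<^esub> ((st ?b j \<star>\<^bsub>L\<^esub> T (W j k)) \<star>\<^bsub>L\<^esub> T (W j w)) = st ?a j \<star>\<^bsub>L\<^esub> T (W j z)"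
      by (simp add: M.hassoc M.reassoc[OF ms] z_def M.T_comp Wc)
    also have "(W j (m A) \<star>\<^bsub>L\<^esub> ?H) \<bullet>\<^bsub>L\<^esub> (st ?a j \<star>\<^bsub>L\<^esub> T (W j z)) = st ?a j \<star>\<^bsub>L\<^esub> T (W j z)"
    proof -
      have "t1 K z = R A" by (simp add: z_def R.hassoc hpw R.m_laws pw)
      then show ?thesis unfolding mH by (intro M.vcat(8)) simp_all
    qed
    finally show ?thesis .
  qed
  then have zm: "z \<star>\<^bsub>K\<^esub> m A = m A \<star>\<^bsub>K\<^esub> R z" using strict[OF ab(1) ab(1), of z] by simp
  \<comment> \<open>A strict 2-cell out of a free algebra is determined by its restriction along the
    unit.\<close>
  have "z = (z \<star>\<^bsub>K\<^esub> m A) \<star>\<^bsub>K\<^esub> R (i A)" by (simp add: R.hassoc R.m_laws)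
  also have "\<dots> = m A \<star>\<^bsub>K\<^esub> R (z \<star>\<^bsub>K\<^esub> i A)" unfolding zm by (simp add: R.hassoc R.T_comp)
  also have "\<dots> = R A" by (simp add: zi R.m_laws)
  finally have "m A \<star>\<^bsub>K\<^esub> (k \<star>\<^bsub>K\<^esub> w) = R A" by (simp add: z_def)
  moreover have "(k \<star>\<^bsub>K\<^esub> w) \<star>\<^bsub>K\<^esub> i A = R (i A) \<star>\<^bsub>K\<^esub> i A" by (simp add: R.hassoc wi v)
  ultimately show "\<exists>d\<in>cells K. s1 K d = R (i A) \<and> t1 K d = i (R A) \<and>
     d \<star>\<^bsub>K\<^esub> i A = R (i A) \<star>\<^bsub>K\<^esub> i A \<and> m A \<star>\<^bsub>K\<^esub> d = R A"
    by (intro bexI[of _ "k \<star>\<^bsub>K\<^esub> w"]) (simp_all add: qw R.hassoc hpw)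
qed

end

section \<open>The 2-category structure on squares\<close>

section \<open>The 2-category of arrows\<close>

lemma Arr_cell_iff:
  "x \<in> cells (Arr C) \<longleftrightarrow> left x \<in> one_cells C \<and> right x \<in> one_cells C \<and> top x \<in> cells C \<and> bot x \<in> cells C \<and>
     s0 C (top x) = s0 C (left x) \<and> t0 C (top x) = s0 C (right x) \<and>
     s0 C (bot x) = t0 C (left x) \<and> t0 C (bot x) = t0 C (right x) \<and>
     right x \<star>\<^bsub>C\<^esub> top x = bot x \<star>\<^bsub>C\<^esub> left x"
  by (cases x) (auto simp: Arr_def Let_def)

lemma Arr_simps [simp]:
  "s0 (Arr C) x = ob C (left x)" "t0 (Arr C) x = ob C (right x)"
  "s1 (Arr C) x = Sq (left x) (s1 C (top x)) (s1 C (bot x)) (right x)"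
  "t1 (Arr C) x = Sq (left x) (t1 C (top x)) (t1 C (bot x)) (right x)"
  "y \<star>\<^bsub>Arr C\<^esub> x = Sq (left x) (top y \<star>\<^bsub>C\<^esub> top x) (bot y \<star>\<^bsub>C\<^esub> bot x) (right y)"
  "y \<bullet>\<^bsub>Arr C\<^esub> x = Sq (left x) (top y \<bullet>\<^bsub>C\<^esub> top x) (bot y \<bullet>\<^bsub>C\<^esub> bot x) (right x)"
  "arrs (ver (Arr C)) = cells (Arr C)"
  by (simp_all add: Arr_def Let_def)

lemma ob_simps [simp]:
  "left (ob C f) = f" "right (ob C f) = f" "top (ob C f) = s0 C f" "bot (ob C f) = t0 C f"
  by (simp_all add: ob_def)

text \<open>Everything is componentwise. Closure under horizontal composition is pasting of squares;
  closure under vertical composition holds because whiskering with \<open>left\<close> and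
  \<open>right\<close> distributes over vertical composites.\<close>

lemma twocat_Arr: assumes "twocat C" shows "twocat (Arr C)"
proof -
  interpret twocat C by fact
  have ob: "ob C f \<in> cells (Arr C)" if "f \<in> one_cells C" for f
    using one_cellD[OF that] that by (simp add: Arr_cell_iff)
  have par: "s0 C y = s0 C x \<and> t0 C y = t0 C x" if "x \<in> cells C" "y \<in> cells C" "s1 C y = t1 C x" for x y
    using parallel01[OF that] .
  have h: "y \<star>\<^bsub>Arr C\<^esub> x \<in> cells (Arr C)"
    if "x \<in> cells (Arr C)" "y \<in> cells (Arr C)" "s0 (Arr C) y = t0 (Arr C) x" for x y
  proof -
    have "left y = right x" using that by (auto simp: ob_def)
    then have *: "right y \<star>\<^bsub>C\<^esub> (top y \<star>\<^bsub>C\<^esub> top x) = (bot y \<star>\<^bsub>C\<^esub> right x) \<star>\<^bsub>C\<^esub> top x"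
      using that hassoc[of "top x" "top y" "right y"] by (simp add: Arr_cell_iff one_cells_iff)
    also have "\<dots> = (bot y \<star>\<^bsub>C\<^esub> bot x) \<star>\<^bsub>C\<^esub> left x"
      using that \<open>left y = right x\<close> by (simp add: Arr_cell_iff one_cells_iff hassoc)
    finally show ?thesis using that \<open>left y = right x\<close> by (simp add: Arr_cell_iff one_cells_iff)
  qed
  have v1: "s1 (Arr C) x \<in> cells (Arr C) \<and> t1 (Arr C) x \<in> cells (Arr C)" if "x \<in> cells (Arr C)" for x
  proof -
    have *: "right x \<star>\<^bsub>C\<^esub> top x = bot x \<star>\<^bsub>C\<^esub> left x"
      and t: "left x \<in> one_cells C" "right x \<in> one_cells C" "top x \<in> cells C" "bot x \<in> cells C"
        "s0 C (top x) = s0 C (left x)" "t0 C (top x) = s0 C (right x)"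
        "s0 C (bot x) = t0 C (left x)" "t0 C (bot x) = t0 C (right x)"
      using that by (simp_all add: Arr_cell_iff)
    note t' = one_cellD[OF t(1)] one_cellD[OF t(2)]
    have "s1 C (right x \<star>\<^bsub>C\<^esub> top x) = s1 C (bot x \<star>\<^bsub>C\<^esub> left x)"
      "t1 C (right x \<star>\<^bsub>C\<^esub> top x) = t1 C (bot x \<star>\<^bsub>C\<^esub> left x)" by (simp_all only: *)
    then show ?thesis using t t' by (simp add: Arr_cell_iff)
  qed
  have v: "y \<bullet>\<^bsub>Arr C\<^esub> x \<in> cells (Arr C)"
    if "x \<in> cells (Arr C)" "y \<in> cells (Arr C)" "s1 (Arr C) y = t1 (Arr C) x" for x y
  proof -
    have e: "left y = left x" "right y = right x" "s1 C (top y) = t1 C (top x)" "s1 C (bot y) = t1 C (bot x)"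
      using that by auto
    have l: "right x \<star>\<^bsub>C\<^esub> (top y \<bullet>\<^bsub>C\<^esub> top x) = (right x \<star>\<^bsub>C\<^esub> top y) \<bullet>\<^bsub>C\<^esub> (right x \<star>\<^bsub>C\<^esub> top x)"
      by (rule whisker_left) (use that e in \<open>auto simp: Arr_cell_iff one_cells_iff\<close>)
    have r: "(bot y \<bullet>\<^bsub>C\<^esub> bot x) \<star>\<^bsub>C\<^esub> left x = (bot y \<star>\<^bsub>C\<^esub> left x) \<bullet>\<^bsub>C\<^esub> (bot x \<star>\<^bsub>C\<^esub> left x)"
      by (rule whisker_right) (use that e in \<open>auto simp: Arr_cell_iff one_cells_iff\<close>)
    show ?thesis using that e l r by (simp add: Arr_cell_iff)
  qed
  have c1: "category (hor (Arr C))"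
    unfolding category_def
  proof (intro conjI ballI impI, goal_cases)
    case (9 f g) then show ?case by (rule h)
  next
    case (12 f g k)
    then show ?case by (auto simp: Arr_cell_iff ob_def intro!: hassoc[symmetric])
  qed (auto simp: ob, auto simp: Arr_cell_iff ob one_cells_iff ob_def sq.expand)
  have c2: "category (ver (Arr C))"
    unfolding category_def
  proof (intro conjI ballI impI, goal_cases)
    case (9 f g) then show ?case using v[of f g] by simp
  next
    case (12 f g k)
    then show ?case by (auto simp: Arr_cell_iff intro!: vassoc[symmetric])
  qed (use v1 in \<open>auto simp: Arr_cell_iff sq.expand\<close>)
  show ?thesis
    unfolding twocat_def two_category_def
  proof (intro conjI ballI impI, goal_cases)
    case (12 x x' y y')
    then have "left y = right x" "left y' = left y" by (auto simp: ob_def)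
    with 12 show ?case by (auto simp: Arr_cell_iff intro!: interchange)
  qed (use c1 c2 in \<open>auto simp: Arr_cell_iff ob_def one_cells_iff\<close>)
qed

lemma (in twocat) Arr_zero_cells: "x \<in> zero_cells (Arr C) \<longleftrightarrow> (\<exists>f\<in>one_cells C. x = ob C f)"
proof -
  have "ob C f \<in> zero_cells (Arr C)" if "f \<in> one_cells C" for f
    using one_cellD[OF that] that unfolding zero_cells_iff by (simp add: Arr_cell_iff)
  moreover have "x = ob C (left x) \<and> left x \<in> one_cells C" if "x \<in> zero_cells (Arr C)"
    using that unfolding zero_cells_iff Arr_cell_iff by simp
  ultimately show ?thesis by metis
qed

lemma (in twocat) Arr_one_cells:
  "x \<in> one_cells (Arr C) \<longleftrightarrow> x \<in> cells (Arr C) \<and> top x \<in> one_cells C \<and> bot x \<in> one_cells C"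
proof -
  interpret A: twocat "Arr C" by (rule twocat_Arr) unfold_locales
  show ?thesis unfolding A.one_cells_iff one_cells_iff by (cases x) (auto simp: Arr_cell_iff)
qed

section \<open>Transfer of lax idempotency from the monad to the comonad\<close>

section \<open>Lax orthogonality\<close>

locale awfs_loc = twocat C for C :: "'c twocat" +
  fixes W :: "'c awfs_data"
  assumes awfs: "awfs C W"
begin

lemma Arr_tc: "twocat (Arr C)" by (rule twocat_Arr) unfold_locales

sublocale R: monad2 "Arr C" "Rfun W" "Lambda C W" "Pi_mult C W"
  using awfs Arr_tc unfolding monad2_def monad2_axioms_def awfs_def by auto

text \<open>The comonad is treated as a monad on the dual that reverses 1-cells, so that the
  criterion \<open>lax_idempotentI\<close> serves both.\<close>

sublocale L: monad2 "op (Arr C)" "Lfun W" "Phi C W" "Sigma C W"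
  using awfs twocat_op[OF Arr_tc] unfolding monad2_def monad2_axioms_def awfs_def two_comonad_def by auto

lemma Kfun: "two_functor (Arr C) C (Kf W)" using awfs by (simp add: awfs_def)

lemmas K_simps = two_functorD[OF Kfun] two_functor_verD[OF Kfun _ R.two_cat]
lemmas K_comp = two_functor_comp(1)[OF Kfun]

lemma ob_cell: "f \<in> one_cells C \<Longrightarrow> ob C f \<in> cells (Arr C)" "f \<in> one_cells C \<Longrightarrow> ob C f \<in> zero_cells (Arr C)"
  using R.zero_simps(1)[of "ob C f"] Arr_zero_cells[of "ob C f"] by auto

lemma lam_rho [simp]:
  assumes "f \<in> one_cells C"
  shows "lam W f \<in> one_cells C" "rho W f \<in> one_cells C" "s0 C (lam W f) = s0 C f" "t0 C (lam W f) = Kf W (ob C f)"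
    "s0 C (rho W f) = Kf W (ob C f)" "t0 C (rho W f) = t0 C f" "rho W f \<star>\<^bsub>C\<^esub> lam W f = f"
  using assms awfs unfolding awfs_def by auto

lemma sig_simps:
  assumes f: "f \<in> one_cells C"
  shows "sig W f \<in> one_cells C" "s0 C (sig W f) = Kf W (ob C f)" "t0 C (sig W f) = Kf W (ob C (lam W f))"
    "sig W f \<star>\<^bsub>C\<^esub> lam W f = lam W (lam W f)"
proof -
  have "Sigma C W (ob C f) \<in> cells (Arr C)" "s1 (Arr C) (Sigma C W (ob C f)) = Sigma C W (ob C f)"
    using L.m_simps(1,2)[of "ob C f"] R.op_zero_cells ob_cell(2)[OF f] by auto
  then show "sig W f \<in> one_cells C" "s0 C (sig W f) = Kf W (ob C f)" "t0 C (sig W f) = Kf W (ob C (lam W f))"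
    "sig W f \<star>\<^bsub>C\<^esub> lam W f = lam W (lam W f)"
    using one_cellD(1)[OF f] one_cellD(1)[OF lam_rho(1)[OF lam_rho(1)[OF f]]] f
    by (auto simp: Sigma_def Arr_cell_iff Let_def one_cells_iff)
qed

lemma pim_simps:
  assumes f: "f \<in> one_cells C"
  shows "pim W f \<in> one_cells C" "s0 C (pim W f) = Kf W (ob C (rho W f))" "t0 C (pim W f) = Kf W (ob C f)"
    "rho W f \<star>\<^bsub>C\<^esub> pim W f = rho W (rho W f)"
proof -
  have D: "Pi_mult C W (ob C f) \<in> cells (Arr C)" "s1 (Arr C) (Pi_mult C W (ob C f)) = Pi_mult C W (ob C f)"
    using R.m_simps(1,2)[of "ob C f"] ob_cell(2)[OF f] by auto
  have E: "pim W f \<in> cells C" "s0 C (pim W f) = s0 C (rho W (rho W f))" "t0 C (pim W f) = s0 C (rho W f)"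
    "rho W f \<star>\<^bsub>C\<^esub> pim W f = t0 C f \<star>\<^bsub>C\<^esub> rho W (rho W f)" "s1 C (pim W f) = pim W f"
    using D(1)[unfolded Arr_cell_iff Pi_mult_def Let_def ob_simps sq.sel]
      D(2)[unfolded Arr_simps Pi_mult_def Let_def ob_simps sq.sel sq.inject] by blast+
  have r: "rho W f \<in> one_cells C" "rho W (rho W f) \<in> one_cells C" using f by simp_all
  show "pim W f \<in> one_cells C" "s0 C (pim W f) = Kf W (ob C (rho W f))" "t0 C (pim W f) = Kf W (ob C f)"
    using E r f by (simp_all add: one_cells_iff[of "pim W f"])
  show "rho W f \<star>\<^bsub>C\<^esub> pim W f = rho W (rho W f)"
    unfolding E(4) by (rule hcat(8)) (use one_cellD(1)[OF r(2)] r f in simp_all)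
qed

lemma naturality:
  assumes "s \<in> cells (Arr C)"
  shows "Kf W s \<star>\<^bsub>C\<^esub> lam W (left s) = lam W (right s) \<star>\<^bsub>C\<^esub> top s"
    and "rho W (right s) \<star>\<^bsub>C\<^esub> Kf W s = bot s \<star>\<^bsub>C\<^esub> rho W (left s)"
    and "Kf W (Lfun W s) \<star>\<^bsub>C\<^esub> sig W (left s) = sig W (right s) \<star>\<^bsub>C\<^esub> Kf W s"
    and "pim W (right s) \<star>\<^bsub>C\<^esub> Kf W (Rfun W s) = Kf W s \<star>\<^bsub>C\<^esub> pim W (left s)"
  using R.i_nat[of s "ob C (left s)" "ob C (right s)"] L.i_nat[of s "ob C (right s)" "ob C (left s)"]
    R.m_nat[of s "ob C (left s)" "ob C (right s)"] L.m_nat[of s "ob C (right s)" "ob C (left s)"] assms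
  by (auto simp: Lambda_def Phi_def Pi_mult_def Sigma_def Rfun_def Lfun_def Let_def)

lemma laws:
  assumes "f \<in> one_cells C"
  shows "Kf W (Phi C W (ob C f)) \<star>\<^bsub>C\<^esub> sig W f = Kf W (ob C f)"
    and "rho W (lam W f) \<star>\<^bsub>C\<^esub> sig W f = Kf W (ob C f)"
    and "pim W f \<star>\<^bsub>C\<^esub> Kf W (Lambda C W (ob C f)) = Kf W (ob C f)"
    and "pim W f \<star>\<^bsub>C\<^esub> lam W (rho W f) = Kf W (ob C f)"
  using R.m_laws(1,2)[of "ob C f"] L.m_laws(1,2)[of "ob C f"] ob_cell(2)[OF assms] R.op_zero_cells
  by (auto simp: Lambda_def Phi_def Pi_mult_def Sigma_def Rfun_def Lfun_def Let_def)

text \<open>The squares involved have identity codomain parts, so the 2-cell required in the arrow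
  2-category is a single 2-cell \<open>d\<close> between middle objects. The equation with
  \<open>rho\<close> is its square condition.\<close>

lemma R_lax_idempotentI:
  assumes "\<And>f. f \<in> one_cells C \<Longrightarrow> \<exists>d\<in>cells C. s1 C d = Kf W (Lambda C W (ob C f)) \<and> t1 C d = lam W (rho W f) \<and>
     d \<star>\<^bsub>C\<^esub> lam W f = lam W (rho W f) \<star>\<^bsub>C\<^esub> lam W f \<and> rho W (rho W f) \<star>\<^bsub>C\<^esub> d = rho W f \<and> pim W f \<star>\<^bsub>C\<^esub> d = Kf W (ob C
         f)"
  shows "lax_idempotent_monad (Arr C) (Rfun W) (Lambda C W) (Pi_mult C W)"
proof (rule R.lax_idempotentI)
  fix A assume "A \<in> zero_cells (Arr C)"
  then obtain f where f: "f \<in> one_cells C" "A = ob C f" using Arr_zero_cells by auto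
  obtain d where d: "d \<in> cells C" "s1 C d = Kf W (Lambda C W (ob C f))" "t1 C d = lam W (rho W f)"
     "d \<star>\<^bsub>C\<^esub> lam W f = lam W (rho W f) \<star>\<^bsub>C\<^esub> lam W f" "rho W (rho W f) \<star>\<^bsub>C\<^esub> d = rho W f" "pim W f \<star>\<^bsub>C\<^esub> d = Kf W (ob C
         f)"
    using assms[OF f(1)] by auto
  have d0: "s0 C d = Kf W (ob C f)" "t0 C d = Kf W (ob C (rho W f))"
    using mixed(2,4)[of d] d f by auto
  have fs: "f \<in> cells C" "s1 C f = f" "t1 C f = f" using one_cellD[OF f(1)] by auto
  let ?D = "Sq (rho W f) d (t0 C f) (rho W (rho W f))"
  have rc: "rho W f \<in> cells C" using one_cellD(1)[of "rho W f"] f by simp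
  have "?D \<in> cells (Arr C)" using f fs d d0 rc by (auto simp: Arr_cell_iff)
  moreover have "Kf W (Sq f (lam W f) (t0 C f) (rho W f)) \<star>\<^bsub>C\<^esub> lam W f = lam W (rho W f) \<star>\<^bsub>C\<^esub> lam W f"
    using R.i_simps(1)[OF ob_cell(2)[OF f(1)]] naturality(1)[of "Lambda C W (ob C f)"] by (simp add: Lambda_def
        Let_def)
  ultimately show "\<exists>d\<in>cells (Arr C). s1 (Arr C) d = Rfun W (Lambda C W A) \<and> t1 (Arr C) d = Lambda C W (Rfun W A) \<and>
     d \<star>\<^bsub>Arr C\<^esub> Lambda C W A = Rfun W (Lambda C W A) \<star>\<^bsub>Arr C\<^esub> Lambda C W A \<and> Pi_mult C W A \<star>\<^bsub>Arr C\<^esub> d = Rfun W A"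
    by (intro bexI[of _ ?D]) (use f fs d in \<open>auto simp: Rfun_def Lambda_def Pi_mult_def Let_def\<close>)
qed

text \<open>The dual of \<open>R\<close> being lax idempotent: the 2-cell from \<open>L \<Phi>\<close> to \<open>\<Phi> L\<close> is the fixed composite \<open>\<beta>\<close>
  of \<open>\<delta>\<close> with \<open>K\<close> and \<open>\<pi>\<close>. The only non-formal point is that \<open>\<alpha> = \<beta> \<sigma>\<close> is an identity; this is the
  interchange law for \<open>\<pi> \<alpha>\<close> and \<open>\<delta>\<close>.\<close>

lemma L_lax_idempotent:
  assumes lax: "lax_idempotent_monad (Arr C) (Rfun W) (Lambda C W) (Pi_mult C W)"
  shows "lax_idempotent_monad (op (Arr C)) (Lfun W) (Phi C W) (Sigma C W)"
proof -
  interpret RL: lax_monad2 "Arr C" "Rfun W" "Lambda C W" "Pi_mult C W"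
    using lax by unfold_locales
  define d where "d f = top (RL.del (ob C f))" for f
  have del: "RL.del (ob C f) \<in> cells (Arr C)" "left (RL.del (ob C f)) = rho W f" "right (RL.del (ob C f)) = rho W (rho
      W f)"
     "s1 C (d f) = Kf W (Lambda C W (ob C f))" "t1 C (d f) = lam W (rho W f)" "s1 C (bot (RL.del (ob C f))) = t0 C f"
     "d f \<star>\<^bsub>C\<^esub> lam W f = Kf W (Lambda C W (ob C f)) \<star>\<^bsub>C\<^esub> lam W f" "pim W f \<star>\<^bsub>C\<^esub> d f = Kf W (ob C f)"
     "t0 C f \<star>\<^bsub>C\<^esub> bot (RL.del (ob C f)) = t0 C f"
    if f: "f \<in> one_cells C" for f
    using RL.del_simps[OF ob_cell(2)[OF f]] RL.del_laws(1,2)[OF ob_cell(2)[OF f]] f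
    by (cases "RL.del (ob C f)"; simp add: Rfun_def Lambda_def Pi_mult_def Let_def d_def ob_def; fail)+
  have d: "d f \<in> cells C" "s0 C (d f) = Kf W (ob C f)" "t0 C (d f) = Kf W (ob C (rho W f))"
     "rho W (rho W f) \<star>\<^bsub>C\<^esub> d f = rho W f" if f: "f \<in> one_cells C" for f
  proof -
    note D = del[OF f]
    have "t0 C (bot (RL.del (ob C f))) = t0 C f" "bot (RL.del (ob C f)) \<in> cells C" using D(1-3) f by (auto simp:
        Arr_cell_iff)
    \<comment> \<open>The multiplication has an identity as codomain part, so its equation with
      \<open>del\<close> forces the codomain part of \<open>del\<close> to be an identity. All
      information is in \<open>d f\<close>.\<close>
    then have b: "bot (RL.del (ob C f)) = t0 C f" using D(9) by simp
    show "d f \<in> cells C" "s0 C (d f) = Kf W (ob C f)" "t0 C (d f) = Kf W (ob C (rho W f))"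
     "rho W (rho W f) \<star>\<^bsub>C\<^esub> d f = rho W f"
      using D(1-3) f b one_cellD(1)[OF lam_rho(2)[OF f]] by (auto simp: Arr_cell_iff d_def)
  qed
  have dnat: "d (right s) \<star>\<^bsub>C\<^esub> Kf W s = Kf W (Rfun W s) \<star>\<^bsub>C\<^esub> d (left s)" if "s \<in> one_cells (Arr C)" for s
    using RL.del_laws(3)[OF that] by (simp add: d_def Rfun_def)
  \<comment> \<open>The square from \<open>rho (lam f)\<close> to \<open>rho f\<close> through which
    the composite of the counit and the unit at \<open>f\<close> factors: \<open>Q f\<close> after
    \<open>Lambda\<close> at \<open>lam f\<close> is \<open>Lambda\<close> at \<open>f\<close> after
    \<open>Phi\<close> at \<open>f\<close>.\<close>
  define Q where "Q f = Sq (rho W (lam W f)) (rho W (lam W f)) (rho W f) (rho W f)" for f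
  have Q: "Q f \<in> cells (Arr C)" "Q f \<in> one_cells (Arr C)" "left (Q f) = rho W (lam W f)" "right (Q f) = rho W f"
    "top (Q f) = rho W (lam W f)" "bot (Q f) = rho W f" "s0 (Arr C) (Q f) = ob C (rho W (lam W f))"
    "t0 (Arr C) (Q f) = ob C (rho W f)"
    if "f \<in> one_cells C" for f
    using that one_cellD(1)[of f] one_cellD(1)[OF lam_rho(2)[OF that]] one_cellD(1)[OF lam_rho(2)[OF lam_rho(1)[OF
        that]]]
    by (auto simp: Q_def Arr_cell_iff Arr_one_cells)
  \<comment> \<open>The 2-cell \<open>d (lam f)\<close>, transported along \<open>Q f\<close> and
    then multiplied by \<open>pim f\<close>. The factorisation through \<open>Q f\<close> and one
    unit law make its source \<open>K \<Phi>\<close>; naturality of \<open>lam\<close> and the other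
    unit law make its target \<open>rho (lam f)\<close>.\<close>
  define \<beta> where "\<beta> f = pim W f \<star>\<^bsub>C\<^esub> (Kf W (Q f) \<star>\<^bsub>C\<^esub> d (lam W f))" for f
  have typs: "pim W f \<in> cells C" "sig W f \<in> cells C" "lam W f \<in> cells C" "rho W f \<in> cells C" "f \<in> cells C"
    "s1 C (pim W f) = pim W f" "t1 C (pim W f) = pim W f" "s1 C (sig W f) = sig W f" "t1 C (sig W f) = sig W f"
    "s1 C (lam W f) = lam W f" "t1 C (lam W f) = lam W f" "s1 C (rho W f) = rho W f" "t1 C (rho W f) = rho W f"
    "s1 C f = f" "t1 C f = f"
    "s0 C (pim W f) = Kf W (ob C (rho W f))" "t0 C (pim W f) = Kf W (ob C f)"
    "s0 C (sig W f) = Kf W (ob C f)" "t0 C (sig W f) = Kf W (ob C (lam W f))"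
    if "f \<in> one_cells C" for f
    using that one_cellD sig_simps[OF that] pim_simps[OF that] lam_rho[OF that] by auto
  have KQ: "Kf W (Q f) \<in> cells C" "s0 C (Kf W (Q f)) = Kf W (ob C (rho W (lam W f)))" "t0 C (Kf W (Q f)) = Kf W (ob C
      (rho W f))"
    "s1 C (Kf W (Q f)) = Kf W (Q f)" "t1 C (Kf W (Q f)) = Kf W (Q f)" if "f \<in> one_cells C" for f
    using K_simps[of "Q f"] Q[OF that] R.one_cellD[OF Q(2)[OF that]] by auto
  have Phi: "Phi C W (ob C f) \<in> cells (Arr C)" "Lambda C W (ob C f) \<in> cells (Arr C)" "Lambda C W (ob C f) \<in> one_cells
      (Arr C)"
    if "f \<in> one_cells C" for f
    using L.i_simps(1)[of "ob C f"] R.i_simps(1,2)[of "ob C f"] R.op_zero_cells ob_cell(2)[OF that] R.one_cells_iff by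
        auto
  have b: "\<beta> f \<in> cells C" "s0 C (\<beta> f) = Kf W (ob C (lam W f))" "t0 C (\<beta> f) = Kf W (ob C f)"
    "s1 C (\<beta> f) = Kf W (Phi C W (ob C f))" "t1 C (\<beta> f) = rho W (lam W f)"
    "\<beta> f \<star>\<^bsub>C\<^esub> lam W (lam W f) = lam W f" "rho W f \<star>\<^bsub>C\<^esub> \<beta> f = rho W f \<star>\<^bsub>C\<^esub> rho W (lam W f)"
    if f[simp]: "f \<in> one_cells C" for f
  proof -
    have l[simp]: "lam W f \<in> one_cells C" "rho W f \<in> one_cells C" "rho W (lam W f) \<in> one_cells C" by simp_all
    note [simp] = typs[OF f] typs[OF l(1)] typs[OF l(2)] typs[OF l(3)] KQ[OF f] d[OF l(1)] del(4,5)[OF l(1)]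
    show "\<beta> f \<in> cells C" "s0 C (\<beta> f) = Kf W (ob C (lam W f))" "t0 C (\<beta> f) = Kf W (ob C f)"
      by (simp_all add: \<beta>_def)
    have "s1 C (\<beta> f) = pim W f \<star>\<^bsub>C\<^esub> (Kf W (Q f) \<star>\<^bsub>C\<^esub> Kf W (Lambda C W (ob C (lam W f))))" by (simp add: \<beta>_def)
    also have "Kf W (Q f) \<star>\<^bsub>C\<^esub> Kf W (Lambda C W (ob C (lam W f))) = Kf W (Q f \<star>\<^bsub>Arr C\<^esub> Lambda C W (ob C (lam W f)))"
      by (rule K_comp[symmetric]) (use Phi[OF l(1)] Q[OF f] in \<open>auto simp: Lambda_def Let_def\<close>)
    also have "Q f \<star>\<^bsub>Arr C\<^esub> Lambda C W (ob C (lam W f)) = Lambda C W (ob C f) \<star>\<^bsub>Arr C\<^esub> Phi C W (ob C f)"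
      by (simp add: Q_def Lambda_def Phi_def Let_def)
    also have "Kf W \<dots> = Kf W (Lambda C W (ob C f)) \<star>\<^bsub>C\<^esub> Kf W (Phi C W (ob C f))"
      by (rule K_comp) (use Phi[OF f] in \<open>auto simp: Lambda_def Phi_def Let_def\<close>)
    also have "pim W f \<star>\<^bsub>C\<^esub> \<dots> = (pim W f \<star>\<^bsub>C\<^esub> Kf W (Lambda C W (ob C f))) \<star>\<^bsub>C\<^esub> Kf W (Phi C W (ob C f))"
      using K_simps[OF Phi(1)[OF f]] K_simps[OF Phi(2)[OF f]]
      by (simp add: hassoc Phi_def Lambda_def Let_def)
    also have "\<dots> = Kf W (Phi C W (ob C f))" unfolding laws(3)[OF f]
      using K_simps[OF Phi(1)[OF f]] by (simp add: Phi_def Let_def)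
    finally show "s1 C (\<beta> f) = Kf W (Phi C W (ob C f))" .
    have n: "Kf W (Q f) \<star>\<^bsub>C\<^esub> lam W (rho W (lam W f)) = lam W (rho W f) \<star>\<^bsub>C\<^esub> rho W (lam W f)"
      using naturality(1)[OF Q(1)[OF f]] by (simp add: Q_def)
    have "t1 C (\<beta> f) = pim W f \<star>\<^bsub>C\<^esub> (lam W (rho W f) \<star>\<^bsub>C\<^esub> rho W (lam W f))" by (simp add: \<beta>_def n)
    also have "\<dots> = rho W (lam W f)" by (simp add: reassoc[OF laws(4)[OF f]])
    finally show t: "t1 C (\<beta> f) = rho W (lam W f)" .
    have LL: "Kf W (Lambda C W (ob C (lam W f))) \<star>\<^bsub>C\<^esub> lam W (lam W f) = lam W (rho W (lam W f)) \<star>\<^bsub>C\<^esub> lam W (lam W f)"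
      using naturality(1)[OF Phi(2)[OF l(1)]] by (simp add: Lambda_def Let_def)
    have "\<beta> f \<star>\<^bsub>C\<^esub> lam W (lam W f) = t1 C (\<beta> f) \<star>\<^bsub>C\<^esub> lam W (lam W f)"
      by (simp add: \<beta>_def hassoc del(7) LL)
    then show "\<beta> f \<star>\<^bsub>C\<^esub> lam W (lam W f) = lam W f" unfolding t by simp
    have r: "rho W (rho W f) \<star>\<^bsub>C\<^esub> Kf W (Q f) = rho W f \<star>\<^bsub>C\<^esub> rho W (rho W (lam W f))"
      using naturality(2)[OF Q(1)[OF f]] by (simp add: Q_def)
    show "rho W f \<star>\<^bsub>C\<^esub> \<beta> f = rho W f \<star>\<^bsub>C\<^esub> rho W (lam W f)"
      by (simp add: \<beta>_def reassoc[OF pim_simps(4)[OF f]] reassoc[OF r] hassoc)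
  qed
  \<comment> \<open>The counit laws of the comonad turn both ends of
    \<open>\<beta> f \<star> sig W f\<close> into the identity of \<open>K f\<close>. The remaining
    law for lax idempotency of \<open>L\<close> is that this endo-2-cell is trivial.\<close>
  define \<alpha> where "\<alpha> f = \<beta> f \<star>\<^bsub>C\<^esub> sig W f" for f
  have a: "\<alpha> f \<in> cells C" "s0 C (\<alpha> f) = Kf W (ob C f)" "t0 C (\<alpha> f) = Kf W (ob C f)"
    "s1 C (\<alpha> f) = Kf W (ob C f)" "t1 C (\<alpha> f) = Kf W (ob C f)" "\<alpha> f \<star>\<^bsub>C\<^esub> lam W f = lam W f"
    if f[simp]: "f \<in> one_cells C" for f
  proof -
    note [simp] = typs[OF f] b[OF f] laws[OF f]
    have l: "lam W f \<in> one_cells C" by simp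
    note [simp] = typs[OF l]
    show "\<alpha> f \<in> cells C" "s0 C (\<alpha> f) = Kf W (ob C f)" "t0 C (\<alpha> f) = Kf W (ob C f)"
      "s1 C (\<alpha> f) = Kf W (ob C f)" "t1 C (\<alpha> f) = Kf W (ob C f)"
      by (simp_all add: \<alpha>_def)
    show "\<alpha> f \<star>\<^bsub>C\<^esub> lam W f = lam W f" by (simp add: \<alpha>_def hassoc sig_simps)
  qed
  have anat: "\<alpha> (right s) \<star>\<^bsub>C\<^esub> Kf W s = Kf W s \<star>\<^bsub>C\<^esub> \<alpha> (left s)" if s: "s \<in> one_cells (Arr C)" for s
  proof -
    have s1[simp]: "s \<in> cells (Arr C)" "s1 (Arr C) s = s" using s R.one_cells_iff by auto
    let ?f = "left s" let ?g = "right s"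
    have fg[simp]: "?f \<in> one_cells C" "?g \<in> one_cells C" using s1(1) by (simp_all only: Arr_cell_iff)
    have l[simp]: "lam W ?f \<in> one_cells C" "rho W ?f \<in> one_cells C" "lam W ?g \<in> one_cells C" "rho W ?g \<in> one_cells C"
        "rho W (lam W ?f) \<in> one_cells C" "rho W (lam W ?g) \<in> one_cells C"
      by simp_all
    have opc: "Lfun W s \<in> cells (Arr C)" "Lfun W s \<in> one_cells (Arr C)"
      using L.T_simps(1)[of s] L.T_simps(4)[of s] s1 R.one_cells_iff by (auto simp del: Arr_simps)
    have rc: "Rfun W s \<in> cells (Arr C)" "Rfun W (Lfun W s) \<in> cells (Arr C)" using R.T_simps(1) opc s1 by blast+
    have lr: "left (Lfun W s) = lam W ?f" "right (Lfun W s) = lam W ?g" "left (Rfun W s) = rho W ?f" "right (Rfun W s)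
        = rho W ?g"
      "left (Rfun W (Lfun W s)) = rho W (lam W ?f)" "right (Rfun W (Lfun W s)) = rho W (lam W ?g)"
      by (simp_all add: Lfun_def Rfun_def)
    have KK: "Kf W x \<in> cells C" "s0 C (Kf W x) = Kf W (ob C (left x))" "t0 C (Kf W x) = Kf W (ob C (right x))"
      if "x \<in> cells (Arr C)" for x using K_simps[OF that] by auto
    note [simp] = typs[OF fg(1)] typs[OF fg(2)] typs[OF l(1)] typs[OF l(2)] typs[OF l(3)] typs[OF l(4)] typs[OF l(5)]
        typs[OF l(6)]
      KQ[OF fg(1)] KQ[OF fg(2)] d[OF l(1)] d[OF l(3)] KK[OF s1(1)] KK[OF opc(1)] KK[OF rc(1)] KK[OF rc(2)] lr
    have 1: "sig W ?g \<star>\<^bsub>C\<^esub> Kf W s = Kf W (Lfun W s) \<star>\<^bsub>C\<^esub> sig W ?f" using naturality(3)[OF s1(1)] by simp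
    have 2: "d (lam W ?g) \<star>\<^bsub>C\<^esub> Kf W (Lfun W s) = Kf W (Rfun W (Lfun W s)) \<star>\<^bsub>C\<^esub> d (lam W ?f)"
      using dnat[OF opc(2)] by simp
    have "Kf W (Q ?g) \<star>\<^bsub>C\<^esub> Kf W (Rfun W (Lfun W s)) = Kf W (Q ?g \<star>\<^bsub>Arr C\<^esub> Rfun W (Lfun W s))"
      by (rule K_comp[symmetric]) (use rc Q[OF fg(2)] in auto)
    also have "Q ?g \<star>\<^bsub>Arr C\<^esub> Rfun W (Lfun W s) = Rfun W s \<star>\<^bsub>Arr C\<^esub> Q ?f"
      using naturality(2)[OF s1(1)] naturality(2)[OF opc(1)] by (simp add: Q_def Rfun_def Lfun_def)
    also have "Kf W \<dots> = Kf W (Rfun W s) \<star>\<^bsub>C\<^esub> Kf W (Q ?f)"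
      by (rule K_comp) (use rc Q[OF fg(1)] in auto)
    finally have 3: "Kf W (Q ?g) \<star>\<^bsub>C\<^esub> Kf W (Rfun W (Lfun W s)) = Kf W (Rfun W s) \<star>\<^bsub>C\<^esub> Kf W (Q ?f)" .
    have 4: "pim W ?g \<star>\<^bsub>C\<^esub> Kf W (Rfun W s) = Kf W s \<star>\<^bsub>C\<^esub> pim W ?f" using naturality(4)[OF s1(1)] .
    show ?thesis
      by (simp add: \<alpha>_def \<beta>_def hassoc 1 reassoc[OF 2] reassoc[OF 3] reassoc[OF 4])
  qed
  have a1: "\<alpha> f = Kf W (ob C f)" if f[simp]: "f \<in> one_cells C" for f
  proof -
    have r[simp]: "rho W f \<in> one_cells C" by simp
    note [simp] = a[OF f] a[OF r] typs[OF f] typs[OF r] d[OF f] del(4,5)[OF f]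
    let ?x = "d f" let ?y = "pim W f \<star>\<^bsub>C\<^esub> \<alpha> (rho W f)"
    have KL: "Kf W (Lambda C W (ob C f)) \<in> cells C" "s0 C (Kf W (Lambda C W (ob C f))) = Kf W (ob C f)"
        "t0 C (Kf W (Lambda C W (ob C f))) = Kf W (ob C (rho W f))"
      using K_simps[OF Phi(2)[OF f]] by (auto simp: Lambda_def Let_def)
    note [simp] = KL
    \<comment> \<open>Three of the four whiskered cells are identities: \<open>?y\<close> after
      \<open>lam (rho f)\<close>, because \<open>\<alpha>\<close> restricts trivially along
      \<open>lam\<close>, and both composites of \<open>pim f\<close> with \<open>d f\<close>, by
      the choice of \<open>\<delta>\<close>. The fourth is \<open>\<alpha> f\<close>, by naturality
      of \<open>\<alpha>\<close> at the unit square.\<close>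
    have "(?y \<star>\<^bsub>C\<^esub> t1 C ?x) \<bullet>\<^bsub>C\<^esub> (s1 C ?y \<star>\<^bsub>C\<^esub> ?x) = (t1 C ?y \<star>\<^bsub>C\<^esub> ?x) \<bullet>\<^bsub>C\<^esub> (?y \<star>\<^bsub>C\<^esub> s1 C ?x)"
      by (rule trans[OF hcomp_left_right(1)[symmetric] hcomp_left_right(2)]) simp_all
    moreover have "s1 C ?y = pim W f" "t1 C ?y = pim W f" by simp_all
    moreover have "?y \<star>\<^bsub>C\<^esub> t1 C ?x = Kf W (ob C f)"
      by (simp add: hassoc laws)
    moreover have "?y \<star>\<^bsub>C\<^esub> s1 C ?x = \<alpha> f"
    proof -
      have n: "\<alpha> (rho W f) \<star>\<^bsub>C\<^esub> Kf W (Lambda C W (ob C f)) = Kf W (Lambda C W (ob C f)) \<star>\<^bsub>C\<^esub> \<alpha> f"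
        using anat[OF Phi(3)[OF f]] by (simp only: Lambda_def Let_def sq.sel ob_simps)
      have "?y \<star>\<^bsub>C\<^esub> s1 C ?x = pim W f \<star>\<^bsub>C\<^esub> (Kf W (Lambda C W (ob C f)) \<star>\<^bsub>C\<^esub> \<alpha> f)"
        by (simp add: hassoc n)
      also have "\<dots> = \<alpha> f" by (simp add: reassoc[OF laws(3)[OF f]])
      finally show ?thesis .
    qed
    ultimately have "Kf W (ob C f) \<bullet>\<^bsub>C\<^esub> Kf W (ob C f) = Kf W (ob C f) \<bullet>\<^bsub>C\<^esub> \<alpha> f"
      using del(8)[OF f] by simp
    moreover have "Kf W (ob C f) \<in> zero_cells C" using two_functor_zero[OF Kfun ob_cell(2)[OF f]] .
    ultimately show ?thesis by simp
  qed
  show ?thesis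
  proof (rule L.lax_idempotentI)
    fix A assume "A \<in> zero_cells (op (Arr C))"
    then obtain f where f: "f \<in> one_cells C" "A = ob C f" using Arr_zero_cells R.op_zero_cells by auto
    let ?D = "Sq (lam W (lam W f)) (s0 C f) (\<beta> f) (lam W f)"
    have l: "lam W f \<in> one_cells C" using f by simp
    have "?D \<in> cells (Arr C)" using f b[OF f(1)] typs[OF f(1)] typs[OF l] by (simp add: Arr_cell_iff)
    moreover have "rho W f \<star>\<^bsub>C\<^esub> Kf W (Sq (lam W f) (s0 C f) (rho W f) f) = rho W f \<star>\<^bsub>C\<^esub> rho W (lam W f)"
      using naturality(2)[OF Phi(1)[OF f(1)]] by (simp add: Phi_def Let_def)
    moreover have "\<beta> f \<star>\<^bsub>C\<^esub> sig W f = Kf W (ob C f)" using a1[OF f(1)] by (simp only: \<alpha>_def)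
    ultimately show "\<exists>d\<in>cells (op (Arr C)). s1 (op (Arr C)) d = Lfun W (Phi C W A) \<and> t1 (op (Arr C)) d = Phi C W (Lfun
        W A) \<and>
       d \<star>\<^bsub>op (Arr C)\<^esub> Phi C W A = Lfun W (Phi C W A) \<star>\<^bsub>op (Arr C)\<^esub> Phi C W A \<and> Sigma C W A \<star>\<^bsub>op (Arr C)\<^esub> d = Lfun W
           A"
      unfolding f(2) op_simps Arr_simps
      by (intro bexI[of _ ?D]) (use f(1) b[OF f(1)] in \<open>simp_all add: Lfun_def Phi_def Sigma_def Let_def typs\<close>)
  qed
qed

lemma lax_orthogonalI:
  assumes lax: "lax_idempotent_monad (Arr C) (Rfun W) (Lambda C W) (Pi_mult C W)"
  shows "lax_orthogonal C W"
  using assms L_lax_idempotent[OF assms] unfolding lax_orthogonal_def lax_idempotent_comonad_def by simp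

end

section \<open>RALIs, lax colimits of arrows, and lax idempotency of the KZ system\<close>

section \<open>KZ-generation\<close>

lemma (in twocat) rali_simps:
  assumes "rali C r l e"
  shows "r \<in> cells C" "s1 C r = r" "t1 C r = r" "l \<in> cells C" "s1 C l = l" "t1 C l = l"
    "s0 C l = t0 C r" "t0 C l = s0 C r" "e \<in> cells C" "s1 C e = l \<star>\<^bsub>C\<^esub> r" "t1 C e = s0 C r"
    "s0 C e = s0 C r" "t0 C e = s0 C r"
proof -
  show *: "r \<in> cells C" "s1 C r = r" "t1 C r = r" "l \<in> cells C" "s1 C l = l" "t1 C l = l"
    "s0 C l = t0 C r" "t0 C l = s0 C r" "e \<in> cells C" "s1 C e = l \<star>\<^bsub>C\<^esub> r" "t1 C e = s0 C r"
    using assms one_cellD unfolding rali_def by auto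
  show "s0 C e = s0 C r" "t0 C e = s0 C r" using mixed(2)[of e] mixed(4)[of e] * by auto
qed

text \<open>The bijection of the adjunction: a 2-cell \<open>g\<close> out of
  \<open>l \<star> x\<close> is recovered from \<open>r \<star> g\<close> as the counit at its
  target after \<open>l \<star> (r \<star> g)\<close>.\<close>

lemma (in twocat) rali_unique:
  assumes R: "rali C r l e" and g: "g \<in> cells C" "g' \<in> cells C" "t0 C g = s0 C r" "t0 C g' = s0 C r"
    and x: "x \<in> cells C" "t0 C x = t0 C r"
    and "s1 C g = l \<star>\<^bsub>C\<^esub> x" "s1 C g' = l \<star>\<^bsub>C\<^esub> x" "t1 C g = t1 C g'" "r \<star>\<^bsub>C\<^esub> g = r \<star>\<^bsub>C\<^esub> g'"
  shows "g = g'"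
proof -
  note [simp] = rali_simps[OF R]
  have rl: "e \<star>\<^bsub>C\<^esub> l = l" using R by (simp add: rali_def)
  have *: "k = (e \<star>\<^bsub>C\<^esub> t1 C k) \<bullet>\<^bsub>C\<^esub> (l \<star>\<^bsub>C\<^esub> (r \<star>\<^bsub>C\<^esub> k))" if k[simp]: "k \<in> cells C" "t0 C k = s0 C r" "s1 C k = l \<star>\<^bsub>C\<^esub>
      x" for k
  proof -
    have "e \<star>\<^bsub>C\<^esub> k = (e \<star>\<^bsub>C\<^esub> t1 C k) \<bullet>\<^bsub>C\<^esub> ((l \<star>\<^bsub>C\<^esub> r) \<star>\<^bsub>C\<^esub> k)" using hcomp_left_right(1)[of k e] by simp
    moreover have "e \<star>\<^bsub>C\<^esub> k = (s0 C r \<star>\<^bsub>C\<^esub> k) \<bullet>\<^bsub>C\<^esub> (e \<star>\<^bsub>C\<^esub> (l \<star>\<^bsub>C\<^esub> x))" using hcomp_left_right(2)[of k e] by simp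
    moreover have "e \<star>\<^bsub>C\<^esub> (l \<star>\<^bsub>C\<^esub> x) = l \<star>\<^bsub>C\<^esub> x" using x by (simp add: reassoc[OF rl])
    ultimately show ?thesis by (simp add: hassoc)
  qed
  show ?thesis using *[of g] *[of g'] assms by simp
qed

lemma (in twocat) lax_colimit_univ:
  assumes L: "is_lax_colimit C f i j t"
    and "h \<in> one_cells C" "k \<in> one_cells C" "a \<in> cells C" "b \<in> cells C"
    and "s0 C h = t0 C i" "s0 C k = t0 C i" "t0 C h = t0 C k"
        "s1 C a = h \<star>\<^bsub>C\<^esub> i" "t1 C a = k \<star>\<^bsub>C\<^esub> i" "s1 C b = h \<star>\<^bsub>C\<^esub> j" "t1 C b = k \<star>\<^bsub>C\<^esub> j"
        "a \<bullet>\<^bsub>C\<^esub> (h \<star>\<^bsub>C\<^esub> t) = (k \<star>\<^bsub>C\<^esub> t) \<bullet>\<^bsub>C\<^esub> (b \<star>\<^bsub>C\<^esub> f)"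
  shows "\<exists>!c. c \<in> cells C \<and> s1 C c = h \<and> t1 C c = k \<and> c \<star>\<^bsub>C\<^esub> i = a \<and> c \<star>\<^bsub>C\<^esub> j = b"
  using L[unfolded is_lax_colimit_def] assms(2-)
  by (elim conjE) (drule bspec[of "one_cells C" _ h], assumption, drule bspec[of "one_cells C" _ k], assumption,
      drule bspec[of "cells C" _ a], assumption, drule bspec[of "cells C" _ b], assumption, drule mp, intro conjI,
          assumption+)

lemma (in twocat) lax_colimit_ex:
  assumes "is_lax_colimit C f i j t"
    and "h \<in> one_cells C" "k \<in> one_cells C" "a \<in> cells C" "b \<in> cells C"
    and "s0 C h = t0 C i" "s0 C k = t0 C i" "t0 C h = t0 C k"
        "s1 C a = h \<star>\<^bsub>C\<^esub> i" "t1 C a = k \<star>\<^bsub>C\<^esub> i" "s1 C b = h \<star>\<^bsub>C\<^esub> j" "t1 C b = k \<star>\<^bsub>C\<^esub> j"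
        "a \<bullet>\<^bsub>C\<^esub> (h \<star>\<^bsub>C\<^esub> t) = (k \<star>\<^bsub>C\<^esub> t) \<bullet>\<^bsub>C\<^esub> (b \<star>\<^bsub>C\<^esub> f)"
  obtains c where "c \<in> cells C" "s1 C c = h" "t1 C c = k" "c \<star>\<^bsub>C\<^esub> i = a" "c \<star>\<^bsub>C\<^esub> j = b"
  using lax_colimit_univ[OF assms] by blast

text \<open>The compatibility that the universal property demands of a pair of restrictions holds
  for the restrictions of a single cell, by interchange with \<open>t\<close>. Hence the pair
  determines the cell.\<close>

lemma (in twocat) lax_colimit_eq:
  assumes L: "is_lax_colimit C f i j t" "f \<in> cells C" and c: "c \<in> cells C" "c' \<in> cells C" "s0 C c = t0 C i" "s0 C c' =
      t0 C i"
    and e: "s1 C c = s1 C c'" "t1 C c = t1 C c'" "c \<star>\<^bsub>C\<^esub> i = c' \<star>\<^bsub>C\<^esub> i" "c \<star>\<^bsub>C\<^esub> j = c' \<star>\<^bsub>C\<^esub> j"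
  shows "c = c'"
proof -
  have t: "i \<in> one_cells C" "j \<in> one_cells C" "t \<in> cells C"
    "s0 C i = s0 C f" "s0 C j = t0 C f" "t0 C i = t0 C j" "s1 C t = j \<star>\<^bsub>C\<^esub> f" "t1 C t = i"
    using L unfolding is_lax_colimit_def by blast+
  note ij = one_cellD[OF t(1)] one_cellD[OF t(2)]
  have t0: "s0 C t = s0 C f" "t0 C t = t0 C i" using mixed(2)[of t] mixed(4)[of t] t ij by auto
  have "(c \<star>\<^bsub>C\<^esub> t1 C t) \<bullet>\<^bsub>C\<^esub> (s1 C c \<star>\<^bsub>C\<^esub> t) = (t1 C c \<star>\<^bsub>C\<^esub> t) \<bullet>\<^bsub>C\<^esub> (c \<star>\<^bsub>C\<^esub> s1 C t)"
    by (rule trans[OF hcomp_left_right(1)[symmetric] hcomp_left_right(2)]) (use t ij t0 c in simp_all)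
  moreover have "c \<star>\<^bsub>C\<^esub> (j \<star>\<^bsub>C\<^esub> f) = (c \<star>\<^bsub>C\<^esub> j) \<star>\<^bsub>C\<^esub> f" by (rule hassoc[symmetric]) (use t ij c L in simp_all)
  ultimately have *: "(c \<star>\<^bsub>C\<^esub> i) \<bullet>\<^bsub>C\<^esub> (s1 C c \<star>\<^bsub>C\<^esub> t) = (t1 C c \<star>\<^bsub>C\<^esub> t) \<bullet>\<^bsub>C\<^esub> ((c \<star>\<^bsub>C\<^esub> j) \<star>\<^bsub>C\<^esub> f)"
    using t by simp
  have "\<exists>!d. d \<in> cells C \<and> s1 C d = s1 C c \<and> t1 C d = t1 C c \<and> d \<star>\<^bsub>C\<^esub> i = c \<star>\<^bsub>C\<^esub> i \<and> d \<star>\<^bsub>C\<^esub> j = c \<star>\<^bsub>C\<^esub> j"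
    by (rule lax_colimit_univ[OF L(1) _ _ _ _ _ _ _ _ _ _ _ *]) (use c t ij one_s1 one_t1 in simp_all)
  then show ?thesis using c e by metis
qed

context awfs_loc begin

lemma RAlg_simps [simp]:
  "AlgC a x b \<in> cells (RAlg C W) \<longleftrightarrow> Ralgebra C W a \<and> Ralgebra C W b \<and> x \<in> cells (Arr C) \<and>
     s0 (Arr C) x = t0 (Arr C) a \<and> t0 (Arr C) x = t0 (Arr C) b \<and> x \<star>\<^bsub>Arr C\<^esub> a = b \<star>\<^bsub>Arr C\<^esub> Rfun W x"
  "s0 (RAlg C W) z = AlgC (alg_src z) (t0 (Arr C) (alg_src z)) (alg_src z)"
  "t0 (RAlg C W) z = AlgC (alg_tgt z) (t0 (Arr C) (alg_tgt z)) (alg_tgt z)"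
  unfolding RAlg_def Ralgebra_def Alg_def Let_def by auto

lemma RAlg_zero:
  assumes a: "Ralgebra C W a"
  shows "AlgC a (t0 (Arr C) a) a \<in> cells (RAlg C W)"
proof -
  note A = R.algebraD[OF a[unfolded Ralgebra_def]]
  have z: "t0 (Arr C) a \<in> zero_cells (Arr C)" using A R.zero_st(2) by blast
  have "t0 (Arr C) a \<star>\<^bsub>Arr C\<^esub> a = a" using A(1) by (intro R.hcat(8)) (auto simp del: Arr_simps)
  moreover have "a \<star>\<^bsub>Arr C\<^esub> Rfun W (t0 (Arr C) a) = a" using A(1,4) by (intro R.hcat(7)) (auto simp del: Arr_simps)
  ultimately show ?thesis using a R.zero_simps[OF z] by (simp del: Arr_simps)
qed

text \<open>\<open>K \<Lambda>\<close> carries the left adjoint of \<open>\<rho> f\<close> to that of \<open>\<rho> (\<rho> f)\<close>. Both left adjoints are isomorphic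
  to the coprojections of the lax colimits, whose universal property yields \<open>\<delta>\<close>.\<close>

lemma KZ_lax_idempotent:
  assumes colim: "\<And>f. f \<in> one_cells C \<Longrightarrow> \<exists>j t. is_lax_colimit C f (lam W f) j t \<and>
        rho W f \<star>\<^bsub>C\<^esub> lam W f = f \<and> rho W f \<star>\<^bsub>C\<^esub> j = t0 C f \<and> rho W f \<star>\<^bsub>C\<^esub> t = f"
    and F: "int_iso_over_sq C (RAlg_int C W) (Rali_int C) F"
  shows "lax_idempotent_monad (Arr C) (Rfun W) (Lambda C W) (Pi_mult C W)"
proof (rule R_lax_idempotentI)
  fix f assume f[simp]: "f \<in> one_cells C"
  have F2: "two_functor (RAlg C W) (Rali C) F" and Ff: "\<And>z. z \<in> cells (RAlg C W) \<Longrightarrow> rali_cell (F z) = alg_cell z"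
    using F unfolding int_iso_over_sq_def by (auto simp: RAlg_int_def Rali_int_def)
  have Rali: "z \<in> cells (Rali C) \<Longrightarrow> rali C (left (rali_cell z)) (ladj_src z) (counit_src z) \<and>
      rali C (right (rali_cell z)) (ladj_tgt z) (counit_tgt z) \<and>
      top (rali_cell z) \<star>\<^bsub>C\<^esub> ladj_src z = ladj_tgt z \<star>\<^bsub>C\<^esub> bot (rali_cell z)"
    "s0 (Rali C) z = Ralic (ladj_src z) (counit_src z) (s0 (Arr C) (rali_cell z)) (ladj_src z) (counit_src z)"
    "t0 (Rali C) z = Ralic (ladj_tgt z) (counit_tgt z) (t0 (Arr C) (rali_cell z)) (ladj_tgt z) (counit_tgt z)" for z
    unfolding Rali_def Let_def by auto
  define \<rho> where "\<rho> = rho W f" define \<rho>' where "\<rho>' = rho W \<rho>"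
  define E where "E = Kf W (ob C f)" define E' where "E' = Kf W (ob C \<rho>)" define B where "B = t0 C f"
  define i where "i = lam W f" define k where "k = Kf W (Lambda C W (ob C f))" define k2 where "k2 = lam W \<rho>"
  define p where "p = pim W f"
  have f1[simp]: "f \<in> cells C" "s1 C f = f" "t1 C f = f" using one_cellD[OF f] by auto
  have Z: "B \<in> zero_cells C" "E \<in> zero_cells C" "E' \<in> zero_cells C"
    using two_functor_zero[OF Kfun] ob_cell(2) unfolding B_def E_def E'_def \<rho>_def by auto
  note [simp] = zero_simps[OF Z(1)] zero_simps[OF Z(2)] zero_simps[OF Z(3)]
  have L: "Lambda C W (ob C f) \<in> one_cells (Arr C)" "Lambda C W (ob C f) \<in> cells (Arr C)"
    using R.i_simps(1,2)[OF ob_cell(2)[OF f]] R.one_cells_iff by auto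
  have k[simp]: "k \<in> cells C" "s1 C k = k" "t1 C k = k" "s0 C k = E" "t0 C k = E'"
    using K_simps[OF L(2)] R.one_cellD[OF L(1)] unfolding k_def E_def E'_def \<rho>_def
    by (auto simp: Lambda_def Let_def)
  have one: "\<rho> \<in> one_cells C" "\<rho>' \<in> one_cells C" "i \<in> one_cells C" "k2 \<in> one_cells C" "p \<in> one_cells C"
    using pim_simps[OF f] by (simp_all add: \<rho>_def \<rho>'_def i_def k2_def p_def)
  note [simp] = one_cellD[OF one(1)] one_cellD[OF one(2)] one_cellD[OF one(3)] one_cellD[OF one(4)] one_cellD[OF
      one(5)]
  have st[simp]: "s0 C \<rho> = E" "t0 C \<rho> = B" "s0 C \<rho>' = E'" "t0 C \<rho>' = B" "s0 C i = s0 C f" "t0 C i = E" "s0 C k2 = E"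
      "t0 C k2 = E'"
    "s0 C p = E'" "t0 C p = E" "t0 C f = B"
    using pim_simps[OF f] by (simp_all add: \<rho>_def \<rho>'_def i_def k2_def p_def E_def E'_def B_def)
  have eqs: "\<rho>' \<star>\<^bsub>C\<^esub> k = \<rho>" "\<rho>' \<star>\<^bsub>C\<^esub> k2 = \<rho>" "k \<star>\<^bsub>C\<^esub> i = k2 \<star>\<^bsub>C\<^esub> i" "p \<star>\<^bsub>C\<^esub> k = E" "p \<star>\<^bsub>C\<^esub> k2 = E" "\<rho> \<star>\<^bsub>C\<^esub> p = \<rho>'"
  proof -
    have "rho W (rho W f) \<star>\<^bsub>C\<^esub> Kf W (Lambda C W (ob C f)) = t0 C f \<star>\<^bsub>C\<^esub> rho W f"
      using naturality(2)[OF L(2)] by (simp only: Lambda_def Let_def sq.sel ob_simps)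
    then have "\<rho>' \<star>\<^bsub>C\<^esub> k = B \<star>\<^bsub>C\<^esub> \<rho>" unfolding k_def \<rho>'_def \<rho>_def B_def .
    then show "\<rho>' \<star>\<^bsub>C\<^esub> k = \<rho>" by simp
    show "\<rho>' \<star>\<^bsub>C\<^esub> k2 = \<rho>" unfolding \<rho>'_def \<rho>_def k2_def by simp
    have "Kf W (Lambda C W (ob C f)) \<star>\<^bsub>C\<^esub> lam W f = lam W (rho W f) \<star>\<^bsub>C\<^esub> lam W f"
      using naturality(1)[OF L(2)] by (simp only: Lambda_def Let_def sq.sel ob_simps)
    then show "k \<star>\<^bsub>C\<^esub> i = k2 \<star>\<^bsub>C\<^esub> i" unfolding k_def \<rho>_def i_def k2_def .
    show "p \<star>\<^bsub>C\<^esub> k = E" "p \<star>\<^bsub>C\<^esub> k2 = E" unfolding p_def k_def k2_def E_def \<rho>_def using laws(3,4)[OF f] by blast+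
    show "\<rho> \<star>\<^bsub>C\<^esub> p = \<rho>'" unfolding p_def \<rho>'_def \<rho>_def using pim_simps(4)[OF f] .
  qed
  \<comment> \<open>The isomorphism with RALIs is applied to the square \<open>R \<Lambda>\<close>,
    a strict morphism of free algebras by naturality of the multiplication. Its image commutes with
    the left adjoints.\<close>
  have "\<exists>l e l' e'. rali C \<rho> l e \<and> rali C \<rho>' l' e' \<and> k \<star>\<^bsub>C\<^esub> l = l' \<star>\<^bsub>C\<^esub> B"
  proof -
    let ?x = "Rfun W (Lambda C W (ob C f))"
    let ?a = "Pi_mult C W (ob C f)" let ?b = "Pi_mult C W (ob C \<rho>)"
    have ab: "Ralgebra C W ?a" "Ralgebra C W ?b"
      unfolding Ralgebra_def using ob_cell(2)[OF f] ob_cell(2)[OF one(1)] R.free_algebra by auto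
    have x: "?x \<in> cells (Arr C)" using R.T_simps(1)[OF L(2)] .
    have "?x \<star>\<^bsub>Arr C\<^esub> ?a = ?b \<star>\<^bsub>Arr C\<^esub> Rfun W ?x"
      using R.m_nat[OF L(2), of "ob C f" "ob C \<rho>"] unfolding \<rho>_def by (simp add: Lambda_def Let_def del: Arr_simps(5)
          st)
    then have z: "AlgC ?a ?x ?b \<in> cells (RAlg C W)"
      using ab x unfolding \<rho>_def by (simp add: Rfun_def Lambda_def Let_def Pi_mult_def del: Arr_simps(5) st)
    note Fz = Rali(1)[OF two_functorD(1)[OF F2 z]]
    have "left (rali_cell (F (AlgC ?a ?x ?b))) = \<rho>" "right (rali_cell (F (AlgC ?a ?x ?b))) = \<rho>'"
       "top (rali_cell (F (AlgC ?a ?x ?b))) = k" "bot (rali_cell (F (AlgC ?a ?x ?b))) = B"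
      unfolding Ff[OF z] unfolding \<rho>_def \<rho>'_def k_def B_def by (simp_all add: Rfun_def Lambda_def Let_def)
    then show ?thesis using Fz by auto
  qed
  then obtain l e l' e' where R: "rali C \<rho> l e" and R': "rali C \<rho>' l' e'" and kl0: "k \<star>\<^bsub>C\<^esub> l = l' \<star>\<^bsub>C\<^esub> B" by auto
  note [simp] = rali_simps[OF R] rali_simps[OF R']
  have kl: "k \<star>\<^bsub>C\<^esub> l = l'" using kl0 by simp
  have RE: "\<rho> \<star>\<^bsub>C\<^esub> l = B" "\<rho> \<star>\<^bsub>C\<^esub> e = \<rho>" "\<rho>' \<star>\<^bsub>C\<^esub> l' = B" "\<rho>' \<star>\<^bsub>C\<^esub> e' = \<rho>'"
    using R R' by (simp_all add: rali_def)
  obtain j t where co: "is_lax_colimit C f i j t" and jt: "\<rho> \<star>\<^bsub>C\<^esub> i = f" "\<rho> \<star>\<^bsub>C\<^esub> j = B" "\<rho> \<star>\<^bsub>C\<^esub> t = f"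
    using colim[OF f] unfolding i_def \<rho>_def B_def by auto
  have j1: "j \<in> one_cells C" "t \<in> cells C" "s0 C j = B" "t0 C j = E" "s1 C t = j \<star>\<^bsub>C\<^esub> f" "t1 C t = i"
    using co unfolding is_lax_colimit_def by auto
  note [simp] = j1 one_cellD[OF j1(1)]
  have t0[simp]: "s0 C t = s0 C f" "t0 C t = E" using mixed(2)[of t] mixed(4)[of t] j1 by auto
  \<comment> \<open>The coprojection \<open>j\<close> is itself left adjoint to
    \<open>\<rho>\<close>: the 2-cell out of the lax colimit with restrictions \<open>t\<close> and
    \<open>j\<close> is a counit.\<close>
  obtain ep where ep: "ep \<in> cells C" "s1 C ep = j \<star>\<^bsub>C\<^esub> \<rho>" "t1 C ep = E" "ep \<star>\<^bsub>C\<^esub> i = t" "ep \<star>\<^bsub>C\<^esub> j = j"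
    by (rule lax_colimit_ex[OF co, of "j \<star>\<^bsub>C\<^esub> \<rho>" E t j])
       (simp_all add: one_cells_iff hassoc jt)
  have ep0: "s0 C ep = E" "t0 C ep = E" using mixed(2)[of ep] mixed(4)[of ep] ep by auto
  note [simp] = ep(1-3) ep0
  have rep: "\<rho> \<star>\<^bsub>C\<^esub> ep = \<rho>"
    by (rule lax_colimit_eq[OF co f1(1)]) (simp_all add: hassoc reassoc[OF jt(2)] jt ep)
  have Rj: "rali C \<rho> j ep" unfolding rali_def using one j1 jt ep rep by simp
  \<comment> \<open>\<open>\<rho>\<close> now has two left adjoints: \<open>l\<close>, compatible
    with \<open>k\<close> but known only through the isomorphism \<open>F\<close>, and
    \<open>j\<close>, known through the lax colimit. The cells \<open>n\<close> and
    \<open>n'\<close> are the comparisons between them.\<close>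
  define n where "n = ep \<star>\<^bsub>C\<^esub> l" define n' where "n' = e \<star>\<^bsub>C\<^esub> j"
  have n: "n \<in> cells C" "s0 C n = B" "t0 C n = E" "s1 C n = j" "t1 C n = l" "\<rho> \<star>\<^bsub>C\<^esub> n = B"
    by (simp_all add: n_def hassoc RE reassoc[OF rep])
  have n': "n' \<in> cells C" "s0 C n' = B" "t0 C n' = E" "s1 C n' = l" "t1 C n' = j" "\<rho> \<star>\<^bsub>C\<^esub> n' = B"
    by (simp_all add: n'_def hassoc RE reassoc[OF RE(2)] jt)
  note [simp] = n(1-5) n'(1-5)
  have nn: "n' \<bullet>\<^bsub>C\<^esub> n = j"
  proof (rule rali_unique[OF Rj, of _ _ B])
    have "\<rho> \<star>\<^bsub>C\<^esub> (n' \<bullet>\<^bsub>C\<^esub> n) = (\<rho> \<star>\<^bsub>C\<^esub> n') \<bullet>\<^bsub>C\<^esub> (\<rho> \<star>\<^bsub>C\<^esub> n)" by (rule whisker_left) simp_all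
    then show "\<rho> \<star>\<^bsub>C\<^esub> (n' \<bullet>\<^bsub>C\<^esub> n) = \<rho> \<star>\<^bsub>C\<^esub> j" by (simp add: n n' jt)
  qed simp_all
  \<comment> \<open>Precomposing with \<open>?m'\<close> brings the source to
    \<open>l' \<star> x\<close>, where the RALI \<open>\<rho>'\<close> gives uniqueness;
    precomposing further with \<open>?m\<close> undoes this. So \<open>k \<star> j\<close> may
    replace \<open>l'\<close>.\<close>
  have uniq: "g = g'" if g[simp]: "g \<in> cells C" "g' \<in> cells C" "t0 C g = E'" "t0 C g' = E'"
    and x[simp]: "x \<in> cells C" "s1 C x = x" "t1 C x = x" "t0 C x = B"
    and g1[simp]: "s1 C g = k \<star>\<^bsub>C\<^esub> (j \<star>\<^bsub>C\<^esub> x)" "s1 C g' = k \<star>\<^bsub>C\<^esub> (j \<star>\<^bsub>C\<^esub> x)" "t1 C g = t1 C g'"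
    and r: "\<rho>' \<star>\<^bsub>C\<^esub> g = \<rho>' \<star>\<^bsub>C\<^esub> g'" for g g' x
  proof -
    let ?m = "k \<star>\<^bsub>C\<^esub> (n \<star>\<^bsub>C\<^esub> x)" let ?m' = "k \<star>\<^bsub>C\<^esub> (n' \<star>\<^bsub>C\<^esub> x)"
    have s: "s0 C g = s0 C x" "s0 C g' = s0 C x" using mixed(1)[of g] mixed(1)[of g'] by simp_all
    note [simp] = s
    have lx: "k \<star>\<^bsub>C\<^esub> (l \<star>\<^bsub>C\<^esub> x) = l' \<star>\<^bsub>C\<^esub> x" by (simp add: reassoc[OF kl])
    have eq: "g \<bullet>\<^bsub>C\<^esub> ?m' = g' \<bullet>\<^bsub>C\<^esub> ?m'"
    proof (rule rali_unique[OF R', of _ _ x])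
      have "\<rho>' \<star>\<^bsub>C\<^esub> (g \<bullet>\<^bsub>C\<^esub> ?m') = (\<rho>' \<star>\<^bsub>C\<^esub> g) \<bullet>\<^bsub>C\<^esub> (\<rho>' \<star>\<^bsub>C\<^esub> ?m')" by (rule whisker_left) simp_all
      moreover have "\<rho>' \<star>\<^bsub>C\<^esub> (g' \<bullet>\<^bsub>C\<^esub> ?m') = (\<rho>' \<star>\<^bsub>C\<^esub> g') \<bullet>\<^bsub>C\<^esub> (\<rho>' \<star>\<^bsub>C\<^esub> ?m')" by (rule whisker_left) simp_all
      ultimately show "\<rho>' \<star>\<^bsub>C\<^esub> (g \<bullet>\<^bsub>C\<^esub> ?m') = \<rho>' \<star>\<^bsub>C\<^esub> (g' \<bullet>\<^bsub>C\<^esub> ?m')" using r by simp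
    qed (simp_all add: lx)
    have "?m' \<bullet>\<^bsub>C\<^esub> ?m = k \<star>\<^bsub>C\<^esub> ((n' \<star>\<^bsub>C\<^esub> x) \<bullet>\<^bsub>C\<^esub> (n \<star>\<^bsub>C\<^esub> x))" by (rule whisker_left[symmetric]) simp_all
    also have "(n' \<star>\<^bsub>C\<^esub> x) \<bullet>\<^bsub>C\<^esub> (n \<star>\<^bsub>C\<^esub> x) = j \<star>\<^bsub>C\<^esub> x" unfolding nn[symmetric] by (rule whisker_right[symmetric])
        simp_all
    finally have mm: "?m' \<bullet>\<^bsub>C\<^esub> ?m = k \<star>\<^bsub>C\<^esub> (j \<star>\<^bsub>C\<^esub> x)" .
    have "g = g \<bullet>\<^bsub>C\<^esub> (?m' \<bullet>\<^bsub>C\<^esub> ?m)" unfolding mm by (rule vcat(7)[symmetric]) simp_all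
    also have "\<dots> = (g \<bullet>\<^bsub>C\<^esub> ?m') \<bullet>\<^bsub>C\<^esub> ?m" by (rule vassoc[symmetric]) simp_all
    also have "\<dots> = g' \<bullet>\<^bsub>C\<^esub> (?m' \<bullet>\<^bsub>C\<^esub> ?m)" unfolding eq by (rule vassoc) simp_all
    also have "\<dots> = g'" unfolding mm by (rule vcat(7)) simp_all
    finally show ?thesis .
  qed
  \<comment> \<open>The restriction of the future 2-cell to \<open>j\<close>: from
    \<open>k \<star> j\<close> to \<open>k \<star> l = l'\<close> by the comparison, then to
    \<open>k2 \<star> j\<close> by the counit of \<open>l'\<close>, whose source is
    \<open>l'\<close> there since \<open>\<rho>' \<star> k2 \<star> j\<close> is an
    identity.\<close>
  define b where "b = (e' \<star>\<^bsub>C\<^esub> (k2 \<star>\<^bsub>C\<^esub> j)) \<bullet>\<^bsub>C\<^esub> (k \<star>\<^bsub>C\<^esub> n)"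
  have b1: "l' \<star>\<^bsub>C\<^esub> (\<rho>' \<star>\<^bsub>C\<^esub> (k2 \<star>\<^bsub>C\<^esub> j)) = l'" by (simp add: reassoc[OF eqs(2)] jt)
  have b: "b \<in> cells C" "s0 C b = B" "t0 C b = E'" "s1 C b = k \<star>\<^bsub>C\<^esub> j" "t1 C b = k2 \<star>\<^bsub>C\<^esub> j"
    by (simp_all add: b_def hassoc b1 kl)
  note [simp] = b
  have rb: "\<rho>' \<star>\<^bsub>C\<^esub> b = B"
  proof -
    have "\<rho>' \<star>\<^bsub>C\<^esub> b = (\<rho>' \<star>\<^bsub>C\<^esub> (e' \<star>\<^bsub>C\<^esub> (k2 \<star>\<^bsub>C\<^esub> j))) \<bullet>\<^bsub>C\<^esub> (\<rho>' \<star>\<^bsub>C\<^esub> (k \<star>\<^bsub>C\<^esub> n))"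
      unfolding b_def by (rule whisker_left) (simp_all add: hassoc b1 kl)
    then show ?thesis by (simp add: reassoc[OF RE(4)] reassoc[OF eqs(1)] reassoc[OF eqs(2)] jt n)
  qed
  \<comment> \<open>The gluing condition at the universal 2-cell \<open>t\<close>, for the identity
    on \<open>i\<close> and \<open>b\<close> on \<open>j\<close>. Both sides start at
    \<open>k \<star> j \<star> f\<close> and become \<open>f\<close> under
    \<open>\<rho>'\<close>.\<close>
  have comp: "(k \<star>\<^bsub>C\<^esub> i) \<bullet>\<^bsub>C\<^esub> (k \<star>\<^bsub>C\<^esub> t) = (k2 \<star>\<^bsub>C\<^esub> t) \<bullet>\<^bsub>C\<^esub> (b \<star>\<^bsub>C\<^esub> f)"
  proof (rule uniq[of _ _ f])
    have "\<rho>' \<star>\<^bsub>C\<^esub> ((k2 \<star>\<^bsub>C\<^esub> t) \<bullet>\<^bsub>C\<^esub> (b \<star>\<^bsub>C\<^esub> f)) = (\<rho>' \<star>\<^bsub>C\<^esub> (k2 \<star>\<^bsub>C\<^esub> t)) \<bullet>\<^bsub>C\<^esub> (\<rho>' \<star>\<^bsub>C\<^esub> (b \<star>\<^bsub>C\<^esub> f))"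
      by (rule whisker_left) (simp_all add: hassoc)
    also have "\<dots> = f" by (simp add: reassoc[OF eqs(2)] reassoc[OF rb] jt)
    also have "f = \<rho>' \<star>\<^bsub>C\<^esub> ((k \<star>\<^bsub>C\<^esub> i) \<bullet>\<^bsub>C\<^esub> (k \<star>\<^bsub>C\<^esub> t))" by (simp add: reassoc[OF eqs(1)] jt)
    finally show "\<rho>' \<star>\<^bsub>C\<^esub> ((k \<star>\<^bsub>C\<^esub> i) \<bullet>\<^bsub>C\<^esub> (k \<star>\<^bsub>C\<^esub> t)) = \<rho>' \<star>\<^bsub>C\<^esub> ((k2 \<star>\<^bsub>C\<^esub> t) \<bullet>\<^bsub>C\<^esub> (b \<star>\<^bsub>C\<^esub> f))" by simp
  qed (simp_all add: hassoc eqs)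
  obtain d where d: "d \<in> cells C" "s1 C d = k" "t1 C d = k2" "d \<star>\<^bsub>C\<^esub> i = k \<star>\<^bsub>C\<^esub> i" "d \<star>\<^bsub>C\<^esub> j = b"
    by (rule lax_colimit_ex[OF co _ _ _ _ _ _ _ _ _ _ _ comp]) (simp_all add: one_cells_iff eqs)
  have d0: "s0 C d = E" "t0 C d = E'" using mixed(1)[of d] mixed(3)[of d] d by auto
  note [simp] = d(1-3) d0
  have "\<rho>' \<star>\<^bsub>C\<^esub> d = \<rho>"
    by (rule lax_colimit_eq[OF co f1(1)]) (simp_all add: hassoc d rb jt eqs(1,2) reassoc[OF eqs(1)])
  \<comment> \<open>On \<open>i\<close> this is a unit law. On \<open>j\<close> the RALI formed by
    \<open>\<rho>\<close> and \<open>j\<close> determines a 2-cell out of \<open>j\<close> by its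
    target and its image under \<open>\<rho>\<close>.\<close>
  moreover have "p \<star>\<^bsub>C\<^esub> d = E"
  proof (rule lax_colimit_eq[OF co f1(1)])
    have "p \<star>\<^bsub>C\<^esub> b = j"
    proof (rule rali_unique[OF Rj, of _ _ B])
      show "\<rho> \<star>\<^bsub>C\<^esub> (p \<star>\<^bsub>C\<^esub> b) = \<rho> \<star>\<^bsub>C\<^esub> j" by (simp add: reassoc[OF eqs(6)] rb jt)
    qed (simp_all add: reassoc[OF eqs(4)] reassoc[OF eqs(5)])
    then show "(p \<star>\<^bsub>C\<^esub> d) \<star>\<^bsub>C\<^esub> j = E \<star>\<^bsub>C\<^esub> j" by (simp add: hassoc d)
  qed (simp_all add: hassoc d eqs(4,5) reassoc[OF eqs(4)])
  moreover have "d \<star>\<^bsub>C\<^esub> i = k2 \<star>\<^bsub>C\<^esub> i" using d(4) eqs(3) by simp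
  ultimately show "\<exists>d\<in>cells C. s1 C d = Kf W (Lambda C W (ob C f)) \<and> t1 C d = lam W (rho W f) \<and>
     d \<star>\<^bsub>C\<^esub> lam W f = lam W (rho W f) \<star>\<^bsub>C\<^esub> lam W f \<and> rho W (rho W f) \<star>\<^bsub>C\<^esub> d = rho W f \<and> pim W f \<star>\<^bsub>C\<^esub> d = Kf W (ob C
         f)"
    using d(1-3) unfolding k_def k2_def i_def \<rho>'_def \<rho>_def p_def E_def by blast
qed

end

section \<open>Categories, functors and transformations as a strict 2-category\<close>

section \<open>The 2-category of categories\<close>

lemma functorD:
  assumes "is_functor X Y F" "f \<in> arrs X"
  shows "F f \<in> arrs Y" "src Y (F f) = F (src X f)" "tgt Y (F f) = F (tgt X f)"
  using assms by (auto simp: is_functor_def)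

lemma functor_comp:
  "is_functor X Y F \<Longrightarrow> f \<in> arrs X \<Longrightarrow> g \<in> arrs X \<Longrightarrow> src X g = tgt X f \<Longrightarrow> F (cmp X g f) = cmp Y (F g) (F f)"
  by (auto simp: is_functor_def)

lemma objsD: "category X \<Longrightarrow> a \<in> objs X \<Longrightarrow> a \<in> arrs X \<and> src X a = a \<and> tgt X a = a"
  unfolding objs_def category_def by (metis (mono_tags, lifting) mem_Collect_eq)

lemma src_tgt_objs: "category X \<Longrightarrow> f \<in> arrs X \<Longrightarrow> src X f \<in> objs X \<and> tgt X f \<in> objs X"
  unfolding objs_def category_def by auto

lemma functor_compose:
  assumes "category X" "is_functor X Y F" "is_functor Y Z G"
  shows "is_functor X Z (\<lambda>f\<in>arrs X. G (F f))"
  unfolding is_functor_def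
  by (auto simp: category_simps[OF assms(1)] functorD[OF assms(2)] functorD[OF assms(3)]
      functor_comp[OF assms(2)] functor_comp[OF assms(3)])

lemma functor_objs: "is_functor X Y F \<Longrightarrow> a \<in> objs X \<Longrightarrow> F a \<in> objs Y"
  by (auto simp: is_functor_def objs_def)

lemma nat_transD:
  assumes "nat_trans X Y F G t" "a \<in> objs X"
  shows "t a \<in> arrs Y" "src Y (t a) = F a" "tgt Y (t a) = G a"
  using assms by (auto simp: nat_trans_def)

lemma nat_trans_nat: "nat_trans X Y F G t \<Longrightarrow> f \<in> arrs X \<Longrightarrow> cmp Y (t (tgt X f)) (F f) = cmp Y (G f) (t (src X f))"
  by (auto simp: nat_trans_def)

lemma Cat2_cell_iff:
  "x \<in> cells (Cat2 V) \<longleftrightarrow> nsrc x \<in> V \<and> ntgt x \<in> V \<and> is_functor (nsrc x) (ntgt x) (nfrom x) \<and>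
     is_functor (nsrc x) (ntgt x) (nto x) \<and> nat_trans (nsrc x) (ntgt x) (nfrom x) (nto x) (nat_at x) \<and>
     nfrom x \<in> extensional (arrs (nsrc x)) \<and> nto x \<in> extensional (arrs (nsrc x)) \<and> nat_at x \<in> extensional (objs (nsrc
         x))"
  by (cases x) (auto simp: Cat2_def Let_def)

lemma Cat2_simps [simp]:
  "s0 (Cat2 V) x = idnt (nsrc x)" "t0 (Cat2 V) x = idnt (ntgt x)"
  "s1 (Cat2 V) x = Nt (nsrc x) (nfrom x) (nfrom x) (\<lambda>a\<in>objs (nsrc x). nfrom x a) (ntgt x)"
  "t1 (Cat2 V) x = Nt (nsrc x) (nto x) (nto x) (\<lambda>a\<in>objs (nsrc x). nto x a) (ntgt x)"
  "y \<star>\<^bsub>Cat2 V\<^esub> x = Nt (nsrc x) (\<lambda>f\<in>arrs (nsrc x). nfrom y (nfrom x f)) (\<lambda>f\<in>arrs (nsrc x). nto y (nto x f))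
     (\<lambda>a\<in>objs (nsrc x). cmp (ntgt y) (nat_at y (nto x a)) (nfrom y (nat_at x a))) (ntgt y)"
  "y \<bullet>\<^bsub>Cat2 V\<^esub> x = Nt (nsrc x) (nfrom x) (nto y) (\<lambda>a\<in>objs (nsrc x). cmp (ntgt x) (nat_at y a) (nat_at x a)) (ntgt x)"
  "arrs (ver (Cat2 V)) = cells (Cat2 V)"
  by (simp_all add: Cat2_def Let_def)

lemma idnt_simps [simp]:
  "nsrc (idnt X) = X" "ntgt (idnt X) = X" "nfrom (idnt X) = (\<lambda>f\<in>arrs X. f)" "nto (idnt X) = (\<lambda>f\<in>arrs X. f)"
  "nat_at (idnt X) = (\<lambda>a\<in>objs X. a)"
  by (simp_all add: idnt_def)

lemma idnt_eq [simp]: "idnt X = idnt Y \<longleftrightarrow> X = Y"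
  by (auto simp: idnt_def)

text \<open>Unit laws hold as equations of data because functors and families of components are
  extensional. Interchange reduces to naturality of the outer transformation at a component of the
  inner one.\<close>

lemma twocat_Cat2:
  assumes V: "\<And>X. X \<in> V \<Longrightarrow> category X"
  shows "twocat (Cat2 V)"
proof -
  have cell: "nsrc x \<in> V" "ntgt x \<in> V" "category (nsrc x)" "category (ntgt x)" "is_functor (nsrc x) (ntgt x) (nfrom
      x)"
     "is_functor (nsrc x) (ntgt x) (nto x)" "nat_trans (nsrc x) (ntgt x) (nfrom x) (nto x) (nat_at x)"
     "nfrom x \<in> extensional (arrs (nsrc x))" "nto x \<in> extensional (arrs (nsrc x))" "nat_at x \<in> extensional (objs (nsrc
         x))"
    if "x \<in> cells (Cat2 V)" for x using that V by (auto simp: Cat2_cell_iff)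
  have id: "idnt X \<in> cells (Cat2 V)" if "X \<in> V" for X
    using V[OF that] that objsD[OF V[OF that]] src_tgt_objs[OF V[OF that]]
    by (auto simp: Cat2_cell_iff is_functor_def nat_trans_def category_simps[OF V[OF that]])
  have s1: "s1 (Cat2 V) x \<in> cells (Cat2 V) \<and> t1 (Cat2 V) x \<in> cells (Cat2 V)" if x: "x \<in> cells (Cat2 V)" for x
    using cell[OF x] objsD[OF cell(3)[OF x]] src_tgt_objs[OF cell(3)[OF x]]
    by (auto simp: Cat2_cell_iff nat_trans_def functorD functor_objs category_simps[OF cell(4)[OF x]])
  have hc: "y \<star>\<^bsub>Cat2 V\<^esub> x \<in> cells (Cat2 V)"
    if x: "x \<in> cells (Cat2 V)" and y: "y \<in> cells (Cat2 V)" and xy: "nsrc y = ntgt x" for x y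
  proof -
    note X = cell[OF x] and Y = cell[OF y, unfolded xy]
    note sx = category_simps[OF X(3)] and sy = category_simps[OF X(4)] and sz = category_simps[OF Y(4)]
    have "is_functor (nsrc x) (ntgt y) (\<lambda>f\<in>arrs (nsrc x). nfrom y (nfrom x f))"
      using functor_compose X Y by blast
    moreover have "is_functor (nsrc x) (ntgt y) (\<lambda>f\<in>arrs (nsrc x). nto y (nto x f))"
      using functor_compose X Y by blast
    moreover have "nat_trans (nsrc x) (ntgt y) (\<lambda>f\<in>arrs (nsrc x). nfrom y (nfrom x f)) (\<lambda>f\<in>arrs (nsrc x). nto y (nto x
        f))
       (\<lambda>a\<in>objs (nsrc x). cmp (ntgt y) (nat_at y (nto x a)) (nfrom y (nat_at x a)))"
      unfolding nat_trans_def
    proof (intro conjI ballI)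
      fix a assume a: "a \<in> objs (nsrc x)"
      note A = objsD[OF X(3) a] nat_transD[OF X(7) a] functor_objs[OF X(6) a]
      note T = nat_transD[OF Y(7) A(5)]
      note G = functorD[OF Y(5) A(2)]
      show "(\<lambda>a\<in>objs (nsrc x). cmp (ntgt y) (nat_at y (nto x a)) (nfrom y (nat_at x a))) a \<in> arrs (ntgt y)"
        "src (ntgt y) ((\<lambda>a\<in>objs (nsrc x). cmp (ntgt y) (nat_at y (nto x a)) (nfrom y (nat_at x a))) a) = (\<lambda>f\<in>arrs
            (nsrc x). nfrom y (nfrom x f)) a"
        "tgt (ntgt y) ((\<lambda>a\<in>objs (nsrc x). cmp (ntgt y) (nat_at y (nto x a)) (nfrom y (nat_at x a))) a) = (\<lambda>f\<in>arrs
            (nsrc x). nto y (nto x f)) a"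
        using a A T G by (auto simp: sz)
    next
      fix f assume f: "f \<in> arrs (nsrc x)"
      let ?a = "src (nsrc x) f" and ?b = "tgt (nsrc x) f"
      have ab: "?a \<in> objs (nsrc x)" "?b \<in> objs (nsrc x)" using src_tgt_objs[OF X(3) f] by auto
      note A = nat_transD[OF X(7) ab(1)] nat_transD[OF X(7) ab(2)] functorD[OF X(5) f] functorD[OF X(6) f]
      note T = nat_transD[OF Y(7) functor_objs[OF X(6) ab(1)]] nat_transD[OF Y(7) functor_objs[OF X(6) ab(2)]]
      note G = functorD[OF Y(5) A(1)] functorD[OF Y(5) A(4)] functorD[OF Y(5) A(7)] functorD[OF Y(5) A(10)]
          functorD[OF Y(6) A(10)]
      have 1: "cmp (ntgt y) (nfrom y (nat_at x ?b)) (nfrom y (nfrom x f)) = cmp (ntgt y) (nfrom y (nto x f)) (nfrom y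
          (nat_at x ?a))"
        using nat_trans_nat[OF X(7) f] A functor_comp[OF Y(5) A(7) A(4)] functor_comp[OF Y(5) A(1) A(10)] by simp
      have 2: "cmp (ntgt y) (nat_at y (nto x ?b)) (nfrom y (nto x f)) = cmp (ntgt y) (nto y (nto x f)) (nat_at y (nto
          x ?a))"
        using nat_trans_nat[OF Y(7) A(10)] A by simp
      have "cmp (ntgt y) (cmp (ntgt y) (nat_at y (nto x ?b)) (nfrom y (nat_at x ?b))) (nfrom y (nfrom x f)) =
         cmp (ntgt y) (nat_at y (nto x ?b)) (cmp (ntgt y) (nfrom y (nto x f)) (nfrom y (nat_at x ?a)))"
        unfolding 1[symmetric] by (rule sz(12)) (use A T G in simp_all)
      also have "\<dots> = cmp (ntgt y) (cmp (ntgt y) (nat_at y (nto x ?b)) (nfrom y (nto x f))) (nfrom y (nat_at x ?a))"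
        by (rule sz(12)[symmetric]) (use A T G in simp_all)
      also have "\<dots> = cmp (ntgt y) (nto y (nto x f)) (cmp (ntgt y) (nat_at y (nto x ?a)) (nfrom y (nat_at x ?a)))"
        unfolding 2 by (rule sz(12)) (use A T G in simp_all)
      finally show "cmp (ntgt y) ((\<lambda>a\<in>objs (nsrc x). cmp (ntgt y) (nat_at y (nto x a)) (nfrom y (nat_at x a))) (tgt
          (nsrc x) f))
           ((\<lambda>f\<in>arrs (nsrc x). nfrom y (nfrom x f)) f) =
          cmp (ntgt y) ((\<lambda>f\<in>arrs (nsrc x). nto y (nto x f)) f)
           ((\<lambda>a\<in>objs (nsrc x). cmp (ntgt y) (nat_at y (nto x a)) (nfrom y (nat_at x a))) (src (nsrc x) f))"
        using f ab by simp
    qed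
    ultimately show ?thesis using X Y by (simp add: Cat2_cell_iff)
  qed
  have vc: "y \<bullet>\<^bsub>Cat2 V\<^esub> x \<in> cells (Cat2 V)"
    if x: "x \<in> cells (Cat2 V)" and y: "y \<in> cells (Cat2 V)" and xy: "nsrc y = nsrc x" "ntgt y = ntgt x" "nfrom y = nto
        x" for x y
  proof -
    note X = cell[OF x] and Y = cell[OF y, unfolded xy]
    note sx = category_simps[OF X(3)] and sy = category_simps[OF X(4)]
    have "nat_trans (nsrc x) (ntgt x) (nfrom x) (nto y) (\<lambda>a\<in>objs (nsrc x). cmp (ntgt x) (nat_at y a) (nat_at x a))"
      unfolding nat_trans_def
    proof (intro conjI ballI)
      fix a assume a: "a \<in> objs (nsrc x)"
      note A = nat_transD[OF X(7) a] nat_transD[OF Y(7) a]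
      show "(\<lambda>a\<in>objs (nsrc x). cmp (ntgt x) (nat_at y a) (nat_at x a)) a \<in> arrs (ntgt x)"
        "src (ntgt x) ((\<lambda>a\<in>objs (nsrc x). cmp (ntgt x) (nat_at y a) (nat_at x a)) a) = nfrom x a"
        "tgt (ntgt x) ((\<lambda>a\<in>objs (nsrc x). cmp (ntgt x) (nat_at y a) (nat_at x a)) a) = nto y a"
        using a A by (auto simp: sy)
    next
      fix f assume f: "f \<in> arrs (nsrc x)"
      let ?a = "src (nsrc x) f" and ?b = "tgt (nsrc x) f"
      have ab: "?a \<in> objs (nsrc x)" "?b \<in> objs (nsrc x)" using src_tgt_objs[OF X(3) f] by auto
      note A = nat_transD[OF X(7) ab(1)] nat_transD[OF X(7) ab(2)] nat_transD[OF Y(7) ab(1)] nat_transD[OF Y(7) ab(2)]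
        functorD[OF X(5) f] functorD[OF X(6) f] functorD[OF Y(6) f]
      have "cmp (ntgt x) (cmp (ntgt x) (nat_at y ?b) (nat_at x ?b)) (nfrom x f) = cmp (ntgt x) (nat_at y ?b) (cmp
          (ntgt x) (nto x f) (nat_at x ?a))"
        unfolding nat_trans_nat[OF X(7) f, symmetric] by (rule sy(12)) (use A in simp_all)
      also have "\<dots> = cmp (ntgt x) (cmp (ntgt x) (nat_at y ?b) (nto x f)) (nat_at x ?a)"
        by (rule sy(12)[symmetric]) (use A in simp_all)
      also have "\<dots> = cmp (ntgt x) (nto y f) (cmp (ntgt x) (nat_at y ?a) (nat_at x ?a))"
        unfolding nat_trans_nat[OF Y(7) f] by (rule sy(12)) (use A in simp_all)
      finally show "cmp (ntgt x) ((\<lambda>a\<in>objs (nsrc x). cmp (ntgt x) (nat_at y a) (nat_at x a)) (tgt (nsrc x) f)) (nfrom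
          x f) =
         cmp (ntgt x) (nto y f) ((\<lambda>a\<in>objs (nsrc x). cmp (ntgt x) (nat_at y a) (nat_at x a)) (src (nsrc x) f))"
        using ab by simp
    qed
    then show ?thesis using X Y by (simp add: Cat2_cell_iff xy)
  qed
  have c1: "category (hor (Cat2 V))"
    unfolding category_def
  proof (intro conjI ballI impI, goal_cases)
    case (7 x)
    note X = cell[OF this]
    have *: "cmp (ntgt x) (nat_at x a) (nfrom x a) = nat_at x a" if "a \<in> objs (nsrc x)" for a
      using nat_transD[OF X(7) that] by (simp add: category_simps[OF X(4)])
    show ?case
      using X(8-10) objsD[OF X(3)] *
      by (cases x) (auto intro!: extensionalityI simp: restrict_def extensional_def)
  next
    case (8 x)
    note X = cell[OF this]
    have *: "cmp (ntgt x) (nto x a) (nat_at x a) = nat_at x a" "nto x a \<in> objs (ntgt x)" "nat_at x a \<in> arrs (ntgt x)"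
      if "a \<in> objs (nsrc x)" for a
      using nat_transD[OF X(7) that] functor_objs[OF X(6) that] by (simp_all add: category_simps[OF X(4)])
    show ?case
      using X(8-10) * functorD(1)[OF X(5)] functorD(1)[OF X(6)]
      by (cases x) (auto intro!: extensionalityI simp: restrict_def extensional_def)
  next
    case (9 x y)
    then show ?case by (intro hc) auto
  next
    case (12 x y z)
    then have e: "nsrc y = ntgt x" "nsrc z = ntgt y" by auto
    note X = cell[OF 12(1)] and Y = cell[OF 12(2), unfolded e(1)] and Z = cell[OF 12(3), unfolded e(2)]
    have "cmp (ntgt z) (nat_at z (nto y (nto x a))) (nfrom z (cmp (ntgt y) (nat_at y (nto x a)) (nfrom y (nat_at x
        a)))) =
      cmp (ntgt z) (cmp (ntgt z) (nat_at z (nto y (nto x a))) (nfrom z (nat_at y (nto x a)))) (nfrom z (nfrom y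
          (nat_at x a)))"
      if a: "a \<in> objs (nsrc x)" for a
    proof -
      note A = nat_transD[OF X(7) a] functor_objs[OF X(6) a]
      note B = nat_transD[OF Y(7) A(4)] functor_objs[OF Y(6) A(4)] functorD[OF Y(5) A(1)]
      note D = nat_transD[OF Z(7) B(4)] functorD[OF Z(5) B(1)] functorD[OF Z(5) B(5)]
      have "nfrom z (cmp (ntgt y) (nat_at y (nto x a)) (nfrom y (nat_at x a))) = cmp (ntgt z) (nfrom z (nat_at y (nto
          x a))) (nfrom z (nfrom y (nat_at x a)))"
        by (rule functor_comp[OF Z(5)]) (use A B in simp_all)
      then show ?thesis using A B D by (simp add: category_simps(12)[OF Z(4)])
    qed
    then show ?case
      using e functorD(1)[OF X(5)] functorD(1)[OF X(6)] functor_objs[OF X(6)] objsD[OF X(3)] nat_transD(1)[OF X(7)]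
      by (auto intro!: restrict_ext)
  qed (use id in \<open>auto simp: cell\<close>)
  have c2: "category (ver (Cat2 V))"
    unfolding category_def
  proof (intro conjI ballI impI, goal_cases)
    case (7 x)
    then have x: "x \<in> cells (Cat2 V)" by simp
    note X = cell[OF x]
    have *: "cmp (ntgt x) (nat_at x a) (nfrom x a) = nat_at x a" if "a \<in> objs (nsrc x)" for a
      using nat_transD[OF X(7) that] by (simp add: category_simps[OF X(4)])
    show ?case using X(8-10) *
      by (cases x) (auto intro!: extensionalityI simp: restrict_def extensional_def)
  next
    case (8 x)
    then have x: "x \<in> cells (Cat2 V)" by simp
    note X = cell[OF x]
    have *: "cmp (ntgt x) (nto x a) (nat_at x a) = nat_at x a" if "a \<in> objs (nsrc x)" for a
      using nat_transD[OF X(7) that] by (simp add: category_simps[OF X(4)])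
    show ?case using X(8-10) *
      by (cases x) (auto intro!: extensionalityI simp: restrict_def extensional_def)
  next
    case (9 x y) then show ?case using vc[of x y] by auto
  next
    case (12 x y z)
    then have e: "nsrc y = nsrc x" "nsrc z = nsrc x" "ntgt y = ntgt x" "ntgt z = ntgt x" "nfrom y = nto x" "nfrom z =
        nto y" by auto
    have m: "x \<in> cells (Cat2 V)" "y \<in> cells (Cat2 V)" "z \<in> cells (Cat2 V)" using 12 by auto
    note X = cell[OF m(1)] and Y = cell[OF m(2), unfolded e] and Z = cell[OF m(3), unfolded e]
    show ?case
      using e nat_transD[OF X(7)] nat_transD[OF Y(7)] nat_transD[OF Z(7)]
      by (auto intro!: restrict_ext simp: category_simps(12)[OF X(4)])
  qed (use s1 in auto)
  show ?thesis
    unfolding twocat_def two_category_def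
  proof (intro conjI ballI impI, goal_cases)
    case (1) show ?case by (rule c1)
  next
    case 2 show ?case by (rule c2)
  next
    case (10 x y)
    then have e: "nsrc y = ntgt x" by auto
    note X = cell[OF 10(1)] and Y = cell[OF 10(2), unfolded e]
    have "nfrom y (nfrom x a) = cmp (ntgt y) (nfrom y (nfrom x a)) (nfrom y (nfrom x a))" "nfrom x a \<in> objs (ntgt x)"
        "a \<in> arrs (nsrc x)"
      if "a \<in> objs (nsrc x)" for a
      using functor_objs[OF Y(5) functor_objs[OF X(5) that]] functor_objs[OF X(5) that] objsD[OF Y(4)] objsD[OF X(3)
          that]
      by (auto simp: category_simps[OF Y(4)])
    then show ?case using e by (auto intro!: restrict_ext)
  next
    case (11 x y)
    then have e: "nsrc y = ntgt x" by auto
    note X = cell[OF 11(1)] and Y = cell[OF 11(2), unfolded e]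
    have "nto y (nto x a) = cmp (ntgt y) (nto y (nto x a)) (nto y (nto x a))" "nto x a \<in> objs (ntgt x)" "a \<in> arrs
        (nsrc x)"
      if "a \<in> objs (nsrc x)" for a
      using functor_objs[OF Y(6) functor_objs[OF X(6) that]] functor_objs[OF X(6) that] objsD[OF Y(4)] objsD[OF X(3)
          that]
      by (auto simp: category_simps[OF Y(4)])
    then show ?case using e by (auto intro!: restrict_ext)
  next
    case (12 x x' y y')
    then have e: "nsrc y = ntgt x" "nsrc x' = nsrc x" "ntgt x' = ntgt x" "nfrom x' = nto x"
      "nsrc y' = ntgt x" "ntgt y' = ntgt y" "nfrom y' = nto y" by auto
    note X = cell[OF 12(1)] and X' = cell[OF 12(2), unfolded e] and Y = cell[OF 12(3), unfolded e] and Y' = cell[OF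
        12(4), unfolded e]
    let ?c = "cmp (ntgt y)"
    have "?c (?c (nat_at y' (nto x' a)) (nat_at y (nto x' a))) (nfrom y (cmp (ntgt x) (nat_at x' a) (nat_at x a))) =
      ?c (?c (nat_at y' (nto x' a)) (nto y (nat_at x' a))) (?c (nat_at y (nto x a)) (nfrom y (nat_at x a)))"
      if a: "a \<in> objs (nsrc x)" for a
    proof -
      note A = nat_transD[OF X(7) a] nat_transD[OF X'(7) a] functor_objs[OF X(6) a] functor_objs[OF X'(6) a]
      note B = nat_transD[OF Y(7) A(7)] nat_transD[OF Y(7) A(8)] nat_transD[OF Y'(7) A(7)] nat_transD[OF Y'(7) A(8)]
        functorD[OF Y(5) A(1)] functorD[OF Y(5) A(4)] functorD[OF Y(6) A(4)]
      have 1: "nfrom y (cmp (ntgt x) (nat_at x' a) (nat_at x a)) = ?c (nfrom y (nat_at x' a)) (nfrom y (nat_at x a))"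
        by (rule functor_comp[OF Y(5)]) (use A in simp_all)
      have 2: "?c (nat_at y (nto x' a)) (nfrom y (nat_at x' a)) = ?c (nto y (nat_at x' a)) (nat_at y (nto x a))"
        using nat_trans_nat[OF Y(7) A(4)] A by simp
      have "?c (nat_at y (nto x' a)) (?c (nfrom y (nat_at x' a)) (nfrom y (nat_at x a))) =
         ?c (nto y (nat_at x' a)) (?c (nat_at y (nto x a)) (nfrom y (nat_at x a)))"
      proof -
        have "?c (nat_at y (nto x' a)) (?c (nfrom y (nat_at x' a)) (nfrom y (nat_at x a))) =
          ?c (?c (nat_at y (nto x' a)) (nfrom y (nat_at x' a))) (nfrom y (nat_at x a))"
          by (rule category_simps(12)[OF Y(4), symmetric]) (use A B in simp_all)
        then show ?thesis unfolding 2 using A B by (simp add: category_simps(12)[OF Y(4)])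
      qed
      then show ?thesis unfolding 1 using A B by (simp add: category_simps(8-12)[OF Y(4)])
    qed
    moreover have "nto x' a \<in> objs (ntgt x)" "nto x a \<in> objs (ntgt x)" if "a \<in> objs (nsrc x)" for a
      using functor_objs[OF X(6) that] functor_objs[OF X'(6) that] by auto
    ultimately show ?case using e by (auto intro!: restrict_ext)
  qed (auto simp: idnt_def objs_def intro!: restrict_ext)
qed

section \<open>Recognising comma objects: componentwise for arrows, arrow by arrow for
  categories\<close>

section \<open>Commas of arrows and of categories\<close>

text \<open>The form in which a square of induced cells is tested: after a projection
  \<open>B\<close> of the codomain comma object, both ways around reduce to the given squares for
  \<open>T\<close> and \<open>X\<close>.\<close>

lemma (in twocat) square_paste:
  assumes "r \<star>\<^bsub>C\<^esub> T = B \<star>\<^bsub>C\<^esub> e" "r \<star>\<^bsub>C\<^esub> X = X' \<star>\<^bsub>C\<^esub> x" "T \<star>\<^bsub>C\<^esub> c = X" "B \<star>\<^bsub>C\<^esub> d = X'"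
    and "r \<in> cells C" "T \<in> cells C" "B \<in> cells C" "e \<in> cells C" "c \<in> cells C" "d \<in> cells C" "x \<in> cells C"
    and "s0 C r = t0 C T" "s0 C T = t0 C c" "s0 C B = t0 C e" "s0 C e = t0 C c" "s0 C B = t0 C d" "s0 C d = t0 C x"
  shows "B \<star>\<^bsub>C\<^esub> (e \<star>\<^bsub>C\<^esub> c) = B \<star>\<^bsub>C\<^esub> (d \<star>\<^bsub>C\<^esub> x)"
proof -
  have "B \<star>\<^bsub>C\<^esub> (e \<star>\<^bsub>C\<^esub> c) = (r \<star>\<^bsub>C\<^esub> T) \<star>\<^bsub>C\<^esub> c" unfolding assms(1) by (rule hassoc[symmetric]) (use assms(5-) in
      simp_all)
  also have "\<dots> = r \<star>\<^bsub>C\<^esub> (T \<star>\<^bsub>C\<^esub> c)" by (rule hassoc) (use assms(5-) in simp_all)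
  also have "\<dots> = (B \<star>\<^bsub>C\<^esub> d) \<star>\<^bsub>C\<^esub> x" unfolding assms(3,2,4) ..
  also have "\<dots> = B \<star>\<^bsub>C\<^esub> (d \<star>\<^bsub>C\<^esub> x)" by (rule hassoc) (use assms(5-) in simp_all)
  finally show ?thesis .
qed

text \<open>The universal properties of the domain and codomain parts induce one cell each. These
  form a square because the codomain comma object separates cells, and after its projections and its
  universal 2-cell the square condition is that of the given data.\<close>

lemma Arr_comma:
  assumes tc: "twocat C" and T: "is_comma C (top h) (top p) (top q) (top k)" and B: "is_comma C (bot h) (bot p) (bot
      q) (bot k)"
    and sq: "h \<in> cells (Arr C)" "p \<in> cells (Arr C)" "q \<in> cells (Arr C)" "k \<in> cells (Arr C)"
    and lr: "left q = left p" "left k = left p" "right p = left h" "right q = right h" "right k = right h"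
  shows "is_comma (Arr C) h p q k"
proof -
  interpret twocat C by fact
  interpret A: twocat "Arr C" by (rule twocat_Arr[OF tc])
  note t = commaD[OF T] and b = commaD[OF B]
  have one: "h \<in> one_cells (Arr C)" "p \<in> one_cells (Arr C)" "q \<in> one_cells (Arr C)"
    using T B sq by (auto simp: Arr_one_cells is_comma_def)
  have fin: "Sq (left k) (s1 C (top k)) (s1 C (bot k)) (right k) = q"
    "Sq (left k) (t1 C (top k)) (t1 C (bot k)) (right k) = h \<star>\<^bsub>Arr C\<^esub> p"
    by (rule sq.expand; simp add: lr t b)+
  show ?thesis
    unfolding is_comma_def
  proof (intro conjI ballI impI, goal_cases)
    case (10 x y l l')
    have X: "left y = left x" "right x = left h" "right y = right h" "left l = left x" "left l' = left x"
      "right l = right h" "right l' = right h"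
      using 10 by (auto simp: ob_def)
    note cx = 10(1)[unfolded Arr_cell_iff] and cy = 10(2)[unfolded Arr_cell_iff] and cl = 10(3)[unfolded Arr_cell_iff]
      and cl' = 10(4)[unfolded Arr_cell_iff] and ch = sq(1)[unfolded Arr_cell_iff] and cp = sq(2)[unfolded
          Arr_cell_iff]
      and cq = sq(3)[unfolded Arr_cell_iff] and ck = sq(4)[unfolded Arr_cell_iff]
    have eqs: "s1 C (top l) = s1 C (top y)" "t1 C (top l) = top h \<star>\<^bsub>C\<^esub> s1 C (top x)"
      "s1 C (top l') = t1 C (top y)" "t1 C (top l') = top h \<star>\<^bsub>C\<^esub> t1 C (top x)"
      "top l' \<bullet>\<^bsub>C\<^esub> top y = (top h \<star>\<^bsub>C\<^esub> top x) \<bullet>\<^bsub>C\<^esub> top l"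
      "s1 C (bot l) = s1 C (bot y)" "t1 C (bot l) = bot h \<star>\<^bsub>C\<^esub> s1 C (bot x)"
      "s1 C (bot l') = t1 C (bot y)" "t1 C (bot l') = bot h \<star>\<^bsub>C\<^esub> t1 C (bot x)"
      "bot l' \<bullet>\<^bsub>C\<^esub> bot y = (bot h \<star>\<^bsub>C\<^esub> bot x) \<bullet>\<^bsub>C\<^esub> bot l"
      using 10(5) by auto
    have ex: "\<exists>!c. c \<in> cells C \<and> s0 C c = s0 C (top x) \<and> t0 C c = s0 C (top p) \<and> top p \<star>\<^bsub>C\<^esub> c = top x \<and> top q \<star>\<^bsub>C\<^esub> c =
        top y \<and>
       top k \<star>\<^bsub>C\<^esub> s1 C c = top l \<and> top k \<star>\<^bsub>C\<^esub> t1 C c = top l'"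
      by (rule comma_univ[OF T]) (use eqs cx cy cl cl' ch X in auto)
    have ex': "\<exists>!c. c \<in> cells C \<and> s0 C c = s0 C (bot x) \<and> t0 C c = s0 C (bot p) \<and> bot p \<star>\<^bsub>C\<^esub> c = bot x \<and> bot q \<star>\<^bsub>C\<^esub> c
        = bot y \<and>
       bot k \<star>\<^bsub>C\<^esub> s1 C c = bot l \<and> bot k \<star>\<^bsub>C\<^esub> t1 C c = bot l'"
      by (rule comma_univ[OF B]) (use eqs cx cy cl cl' ch X in auto)
    obtain c where c: "c \<in> cells C" "s0 C c = s0 C (top x)" "t0 C c = s0 C (top p)" "top p \<star>\<^bsub>C\<^esub> c = top x" "top q \<star>\<^bsub>C\<^esub>
        c = top y"
       "top k \<star>\<^bsub>C\<^esub> s1 C c = top l" "top k \<star>\<^bsub>C\<^esub> t1 C c = top l'" using ex by blast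
    obtain d where d: "d \<in> cells C" "s0 C d = s0 C (bot x)" "t0 C d = s0 C (bot p)" "bot p \<star>\<^bsub>C\<^esub> d = bot x" "bot q \<star>\<^bsub>C\<^esub>
        d = bot y"
       "bot k \<star>\<^bsub>C\<^esub> s1 C d = bot l" "bot k \<star>\<^bsub>C\<^esub> t1 C d = bot l'" using ex' by blast
    have e: "left x \<in> one_cells C" "left p \<in> one_cells C" "right h \<in> one_cells C" "left h \<in> one_cells C" using cx cp
        ch by auto
    note E = one_cellD[OF e(1)] one_cellD[OF e(2)] one_cellD[OF e(3)] one_cellD[OF e(4)]
    have ty: "s0 C (top x) = s0 C (left x)" "s0 C (bot x) = t0 C (left x)" "s0 C (top p) = s0 C (left p)" "s0 C (bot
        p) = t0 C (left p)"
      "s0 C (top h) = s0 C (left h)" "t0 C (top h) = s0 C (right h)" "s0 C (bot h) = t0 C (left h)" "t0 C (bot h) = t0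
          C (right h)"
      using cx cp ch X lr by auto
    have lrq: "left h \<star>\<^bsub>C\<^esub> top p = bot p \<star>\<^bsub>C\<^esub> left p" "right h \<star>\<^bsub>C\<^esub> top q = bot q \<star>\<^bsub>C\<^esub> left p"
      "right h \<star>\<^bsub>C\<^esub> top k = bot k \<star>\<^bsub>C\<^esub> left p"
      "left h \<star>\<^bsub>C\<^esub> top x = bot x \<star>\<^bsub>C\<^esub> left x" "right h \<star>\<^bsub>C\<^esub> top y = bot y \<star>\<^bsub>C\<^esub> left x"
      "right h \<star>\<^bsub>C\<^esub> top l = bot l \<star>\<^bsub>C\<^esub> left x" "right h \<star>\<^bsub>C\<^esub> top l' = bot l' \<star>\<^bsub>C\<^esub> left x"
      using cp cq ck cx cy cl cl' X lr by auto
    note small = c(1-3) d(1-3) E(1,4,7,10) t(4,7,10,13-17) b(4,7,10,13-17) ty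
    have sq_c: "left p \<star>\<^bsub>C\<^esub> c = d \<star>\<^bsub>C\<^esub> left x"
    proof (rule comma_eq[OF B])
      show "bot p \<star>\<^bsub>C\<^esub> (left p \<star>\<^bsub>C\<^esub> c) = bot p \<star>\<^bsub>C\<^esub> (d \<star>\<^bsub>C\<^esub> left x)"
        by (rule square_paste[OF lrq(1,4) c(4) d(4)]) (simp_all add: small)
      show "bot q \<star>\<^bsub>C\<^esub> (left p \<star>\<^bsub>C\<^esub> c) = bot q \<star>\<^bsub>C\<^esub> (d \<star>\<^bsub>C\<^esub> left x)"
        by (rule square_paste[OF lrq(2,5) c(5) d(5)]) (simp_all add: small)
      have "bot k \<star>\<^bsub>C\<^esub> (left p \<star>\<^bsub>C\<^esub> s1 C c) = bot k \<star>\<^bsub>C\<^esub> (s1 C d \<star>\<^bsub>C\<^esub> left x)"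
        by (rule square_paste[OF lrq(3,6) c(6) d(6)]) (simp_all add: small)
      then show "bot k \<star>\<^bsub>C\<^esub> s1 C (left p \<star>\<^bsub>C\<^esub> c) = bot k \<star>\<^bsub>C\<^esub> s1 C (d \<star>\<^bsub>C\<^esub> left x)"
        using small E(1-6) by simp
      have "bot k \<star>\<^bsub>C\<^esub> (left p \<star>\<^bsub>C\<^esub> t1 C c) = bot k \<star>\<^bsub>C\<^esub> (t1 C d \<star>\<^bsub>C\<^esub> left x)"
        by (rule square_paste[OF lrq(3,7) c(7) d(7)]) (simp_all add: small)
      then show "bot k \<star>\<^bsub>C\<^esub> t1 C (left p \<star>\<^bsub>C\<^esub> c) = bot k \<star>\<^bsub>C\<^esub> t1 C (d \<star>\<^bsub>C\<^esub> left x)"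
        using small E(1-6) by simp
    qed (simp_all add: small)
    let ?c = "Sq (left x) c d (left p)"
    let ?P = "\<lambda>c. c \<in> cells (Arr C) \<and> s0 (Arr C) c = s0 (Arr C) x \<and> t0 (Arr C) c = s0 (Arr C) p \<and> p \<star>\<^bsub>Arr C\<^esub> c = x \<and>
         q \<star>\<^bsub>Arr C\<^esub> c = y \<and> k \<star>\<^bsub>Arr C\<^esub> s1 (Arr C) c = l \<and> k \<star>\<^bsub>Arr C\<^esub> t1 (Arr C) c = l'"
    show ?case
    proof (rule ex1I[of ?P ?c])
      show "?P ?c" using c d e ty sq_c X lr by (simp add: Arr_cell_iff sq.expand)
    next
      fix s assume s: "?P s"
      have lrs: "left s = left x" "right s = left p" using s by (auto simp: ob_def)
      have cs: "top s \<in> cells C" "bot s \<in> cells C" "s0 C (top s) = s0 C (left x)" "s0 C (bot s) = t0 C (left x)"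
         "t0 C (top s) = s0 C (left p)" "t0 C (bot s) = t0 C (left p)"
        using s lrs by (auto simp: Arr_cell_iff)
      have px: "p \<star>\<^bsub>Arr C\<^esub> s = x" "q \<star>\<^bsub>Arr C\<^esub> s = y" "k \<star>\<^bsub>Arr C\<^esub> s1 (Arr C) s = l" "k \<star>\<^bsub>Arr C\<^esub> t1 (Arr C) s = l'"
          using s by auto
      have pt: "top p \<star>\<^bsub>C\<^esub> top s = top x" "top q \<star>\<^bsub>C\<^esub> top s = top y"
          "top k \<star>\<^bsub>C\<^esub> s1 C (top s) = top l" "top k \<star>\<^bsub>C\<^esub> t1 C (top s) = top l'"
        using px[THEN arg_cong[of _ _ top]] by simp_all
      have pb: "bot p \<star>\<^bsub>C\<^esub> bot s = bot x" "bot q \<star>\<^bsub>C\<^esub> bot s = bot y"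
          "bot k \<star>\<^bsub>C\<^esub> s1 C (bot s) = bot l" "bot k \<star>\<^bsub>C\<^esub> t1 C (bot s) = bot l'"
        using px[THEN arg_cong[of _ _ bot]] by simp_all
      have "top s = c"
        by (rule comma_eq[OF T]) (simp_all add: cs c ty(1-4) pt)
      moreover have "bot s = d"
        by (rule comma_eq[OF B]) (simp_all add: cs d ty(1-4) pb)
      ultimately show "s = ?c" using lrs by (simp add: sq.expand)
    qed
  qed (simp_all only: fin one sq Arr_simps, simp_all only: lr)
qed

text \<open>The connecting 1-cell \<open>e\<close> is induced by the codomain comma object from the
  projections and the 2-cell of the domain one, transported along \<open>left h\<close> and
  \<open>right h\<close>.\<close>

lemma Arr_comma_ex:
  assumes tc: "twocat C" and h: "h \<in> one_cells (Arr C)"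
    and T: "is_comma C (top h) p q k" and B: "is_comma C (bot h) p' q' k'"
  obtains e where "e \<in> one_cells C" "is_comma (Arr C) h (Sq e p p' (left h)) (Sq e q q' (right h)) (Sq e k k' (right
      h))"
proof -
  interpret twocat C by fact
  interpret A: twocat "Arr C" by (rule twocat_Arr[OF tc])
  note t = commaD[OF T] and b = commaD[OF B]
  have hc: "h \<in> cells (Arr C)" using A.one_cellD[OF h] by simp
  note H = hc[unfolded Arr_cell_iff]
  have lr: "left h \<in> one_cells C" "right h \<in> one_cells C" using H by auto
  note L = one_cellD[OF lr(1)] one_cellD[OF lr(2)]
  have hh: "right h \<star>\<^bsub>C\<^esub> (top h \<star>\<^bsub>C\<^esub> p) = bot h \<star>\<^bsub>C\<^esub> (left h \<star>\<^bsub>C\<^esub> p)"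
    using H t L by (simp add: hassoc[symmetric])
  have "\<exists>u\<in>one_cells C. s0 C u = s0 C (left h \<star>\<^bsub>C\<^esub> p) \<and> t0 C u = s0 C p' \<and> p' \<star>\<^bsub>C\<^esub> u = left h \<star>\<^bsub>C\<^esub> p \<and>
     q' \<star>\<^bsub>C\<^esub> u = right h \<star>\<^bsub>C\<^esub> q \<and> k' \<star>\<^bsub>C\<^esub> u = right h \<star>\<^bsub>C\<^esub> k"
    by (rule comma_ex[OF B]) (use t b H L hh in \<open>simp_all add: one_cells_iff\<close>)
  then obtain e where e: "e \<in> one_cells C" "s0 C e = s0 C (left h \<star>\<^bsub>C\<^esub> p)" "t0 C e = s0 C p'" "p' \<star>\<^bsub>C\<^esub> e = left h \<star>\<^bsub>C\<^esub>
      p"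
     "q' \<star>\<^bsub>C\<^esub> e = right h \<star>\<^bsub>C\<^esub> q" "k' \<star>\<^bsub>C\<^esub> e = right h \<star>\<^bsub>C\<^esub> k" by auto
  have "is_comma (Arr C) h (Sq e p p' (left h)) (Sq e q q' (right h)) (Sq e k k' (right h))"
    by (rule Arr_comma[OF tc]) (use T B hc e t b H L lr in \<open>simp_all add: Arr_cell_iff\<close>)
  then show thesis using that e by blast
qed

lemma Cat2_one_cells: "x \<in> one_cells (Cat2 V) \<longleftrightarrow> x \<in> cells (Cat2 V) \<and> nto x = nfrom x \<and> nat_at x = (\<lambda>a\<in>objs (nsrc x).
    nfrom x a)"
  unfolding objs_def[of "ver (Cat2 V)"] by (cases x) auto

text \<open>An arrow of a comma category is a commuting square, so the universal property can be
  tested on single arrows; uniqueness there makes the choices over a whole test category functorial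
  and natural. In this form the criterion is what the universal property in \<open>C\<close> gives
  on hom-categories, so no explicit comma category inside \<open>V\<close> has to be
  described.\<close>

lemma Cat2_commaI:
  assumes V: "\<And>X. X \<in> V \<Longrightarrow> category X"
    and hpq: "h \<in> one_cells (Cat2 V)" "p \<in> one_cells (Cat2 V)" "q \<in> one_cells (Cat2 V)" "k \<in> cells (Cat2 V)"
    and ty: "ntgt p = nsrc h" "nsrc q = nsrc p" "ntgt q = ntgt h" "s1 (Cat2 V) k = q" "t1 (Cat2 V) k = h \<star>\<^bsub>Cat2 V\<^esub> p"
    and pw: "\<And>a b l l'. a \<in> arrs (nsrc h) \<Longrightarrow> b \<in> arrs (ntgt h) \<Longrightarrow> l \<in> arrs (ntgt h) \<Longrightarrow> l' \<in> arrs (ntgt h) \<Longrightarrow>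
       src (ntgt h) l = src (ntgt h) b \<Longrightarrow> tgt (ntgt h) l = nfrom h (src (nsrc h) a) \<Longrightarrow>
       src (ntgt h) l' = tgt (ntgt h) b \<Longrightarrow> tgt (ntgt h) l' = nfrom h (tgt (nsrc h) a) \<Longrightarrow>
       cmp (ntgt h) l' b = cmp (ntgt h) (nfrom h a) l \<Longrightarrow>
       \<exists>!c. c \<in> arrs (nsrc p) \<and> nfrom p c = a \<and> nfrom q c = b \<and> nat_at k (src (nsrc p) c) = l \<and> nat_at k (tgt (nsrc p)
           c) = l'"
  shows "is_comma (Cat2 V) h p q k"
proof -
  interpret twocat "Cat2 V" by (rule twocat_Cat2[OF V])
  let ?A = "nsrc h" and ?B = "ntgt h" and ?E = "nsrc p"
  have H: "h \<in> cells (Cat2 V)" "nto h = nfrom h" "nat_at h = (\<lambda>a\<in>objs ?A. nfrom h a)"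
    and P: "p \<in> cells (Cat2 V)" "nto p = nfrom p" "nat_at p = (\<lambda>a\<in>objs ?E. nfrom p a)"
    and Q: "q \<in> cells (Cat2 V)" "nto q = nfrom q" "nat_at q = (\<lambda>a\<in>objs ?E. nfrom q a)"
    using hpq ty unfolding Cat2_one_cells by auto
  have K: "nsrc k = ?E" "ntgt k = ?B" "nfrom k = nfrom q" "nto k = (\<lambda>f\<in>arrs ?E. nfrom h (nfrom p f))"
    using ty H P by (cases k; cases q; auto)+
  have cat: "category ?A" "category ?B" "category ?E" and fu: "is_functor ?A ?B (nfrom h)" "is_functor ?E ?A (nfrom
      p)" "is_functor ?E ?B (nfrom q)"
    and ext: "nfrom h \<in> extensional (arrs ?A)" "nfrom p \<in> extensional (arrs ?E)" "nfrom q \<in> extensional (arrs ?E)"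
    and vm: "?A \<in> V" "?B \<in> V" "?E \<in> V"
    using H P Q V ty by (auto simp: Cat2_cell_iff)
  have knat: "nat_trans ?E ?B (nfrom q) (\<lambda>f\<in>arrs ?E. nfrom h (nfrom p f)) (nat_at k)"
    using hpq(4) K by (auto simp: Cat2_cell_iff)
  have kobj: "nat_at k c \<in> arrs ?B" "src ?B (nat_at k c) = nfrom q c" "tgt ?B (nat_at k c) = nfrom h (nfrom p c)"
    "cmp ?B (nat_at k c) (nfrom q c) = nat_at k c" if "c \<in> objs ?E" for c
    using nat_transD[OF knat that] objsD[OF cat(3) that] by (auto simp: category_simps[OF cat(2)])
  show ?thesis
    unfolding is_comma_def
  proof (intro conjI ballI impI, goal_cases)
    case (10 x y l l')
    let ?Z = "nsrc x"
    have X: "nsrc y = ?Z" "nsrc l = ?Z" "nsrc l' = ?Z" "ntgt x = ?A" "ntgt y = ?B" "ntgt l = ?B" "ntgt l' = ?B"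
      "nfrom l = nfrom y" "nto l = (\<lambda>f\<in>arrs ?Z. nfrom h (nfrom x f))" "nfrom l' = nto y" "nto l' = (\<lambda>f\<in>arrs ?Z. nfrom
          h (nto x f))"
    proof -
      from 10(5) have e: "s0 (Cat2 V) y = s0 (Cat2 V) x" "t0 (Cat2 V) x = s0 (Cat2 V) h" "t0 (Cat2 V) y = t0 (Cat2 V)
          h"
        "s1 (Cat2 V) l = s1 (Cat2 V) y" "t1 (Cat2 V) l = h \<star>\<^bsub>Cat2 V\<^esub> s1 (Cat2 V) x"
        "s1 (Cat2 V) l' = t1 (Cat2 V) y" "t1 (Cat2 V) l' = h \<star>\<^bsub>Cat2 V\<^esub> t1 (Cat2 V) x" by blast+
      show "nsrc y = ?Z" "nsrc l = ?Z" "nsrc l' = ?Z" "ntgt x = ?A" "ntgt y = ?B" "ntgt l = ?B" "ntgt l' = ?B"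
        "nfrom l = nfrom y" "nto l = (\<lambda>f\<in>arrs ?Z. nfrom h (nfrom x f))" "nfrom l' = nto y" "nto l' = (\<lambda>f\<in>arrs ?Z.
            nfrom h (nto x f))"
        using e H(2) by simp_all
    qed
    have m: "?Z \<in> V" "category ?Z"
      and fx: "is_functor ?Z ?A (nfrom x)" "is_functor ?Z ?A (nto x)" "is_functor ?Z ?B (nfrom y)" "is_functor ?Z ?B
          (nto y)"
      and nt: "nat_trans ?Z ?A (nfrom x) (nto x) (nat_at x)" "nat_trans ?Z ?B (nfrom y) (nto y) (nat_at y)"
        "nat_trans ?Z ?B (nfrom y) (\<lambda>f\<in>arrs ?Z. nfrom h (nfrom x f)) (nat_at l)"
        "nat_trans ?Z ?B (nto y) (\<lambda>f\<in>arrs ?Z. nfrom h (nto x f)) (nat_at l')"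
      and ex: "nfrom x \<in> extensional (arrs ?Z)" "nto x \<in> extensional (arrs ?Z)" "nfrom y \<in> extensional (arrs ?Z)" "nto
          y \<in> extensional (arrs ?Z)"
        "nat_at x \<in> extensional (objs ?Z)" "nat_at y \<in> extensional (objs ?Z)" "nat_at l \<in> extensional (objs ?Z)"
            "nat_at l' \<in> extensional (objs ?Z)"
      using 10(1-4) X V by (auto simp: Cat2_cell_iff)
    have comp: "cmp ?B (nat_at l' a) (nat_at y a) = cmp ?B (nfrom h (nat_at x a)) (nat_at l a)" if a: "a \<in> objs ?Z"
        for a
    proof -
      have "nat_at (l' \<bullet>\<^bsub>Cat2 V\<^esub> y) a = nat_at ((h \<star>\<^bsub>Cat2 V\<^esub> x) \<bullet>\<^bsub>Cat2 V\<^esub> l) a" using 10(5) by argo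
      moreover have "nto x a \<in> objs ?A" using functor_objs[OF fx(2) a] .
      moreover have "cmp ?B (nfrom h (nto x a)) (nfrom h (nat_at x a)) = nfrom h (nat_at x a)"
        using functorD[OF fu(1) nat_transD(1)[OF nt(1) a]] nat_transD[OF nt(1) a] by (simp add: category_simps[OF
            cat(2)])
      ultimately show ?thesis using a X H by simp
    qed
    have ab: "src ?Z f \<in> objs ?Z" "tgt ?Z f \<in> objs ?Z" if "f \<in> arrs ?Z" for f using src_tgt_objs[OF m(2) that] by auto
    let ?R = "\<lambda>c a b u v. c \<in> arrs ?E \<and> nfrom p c = a \<and> nfrom q c = b \<and> nat_at k (src ?E c) = u \<and> nat_at k (tgt ?E c)
        = v"
    \<comment> \<open>The images of an arrow of \<open>?E\<close> satisfy the hypotheses of the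
      criterion, by functoriality and naturality of \<open>k\<close>; so these images determine the
      arrow.\<close>
    have uq: "c = c'" if "?R c a b u v" "?R c' a b u v" for c c' a b u v
    proof -
      note cc = that(1)
      have so: "src ?E c \<in> objs ?E" "tgt ?E c \<in> objs ?E" using src_tgt_objs[OF cat(3)] cc by auto
      have "cmp ?B (nat_at k (tgt ?E c)) (nfrom q c) = cmp ?B (nfrom h (nfrom p c)) (nat_at k (src ?E c))"
        using nat_trans_nat[OF knat, of c] cc by simp
      then have "\<exists>!c. ?R c a b u v"
        using cc kobj[OF so(1)] kobj[OF so(2)] functorD[OF fu(2), of c] functorD[OF fu(3), of c] functorD[OF fu(1), of
            a]
        by (intro pw) auto
      then show ?thesis using that by blast
    qed
    have e1: "\<exists>c. ?R c (nfrom x f) (nfrom y f) (nat_at l (src ?Z f)) (nat_at l (tgt ?Z f))" if f: "f \<in> arrs ?Z" for f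
    proof -
      have "cmp ?B (nat_at l (tgt ?Z f)) (nfrom y f) = cmp ?B (nfrom h (nfrom x f)) (nat_at l (src ?Z f))"
        using nat_trans_nat[OF nt(3) f] f by simp
      moreover have "src ?Z f \<in> arrs ?Z" "tgt ?Z f \<in> arrs ?Z" using f by (simp_all add: category_simps[OF m(2)])
      ultimately show ?thesis
        using f nat_transD[OF nt(3) ab(1)[OF f]] nat_transD[OF nt(3) ab(2)[OF f]] functorD[OF fx(1) f] functorD[OF
            fx(3) f]
        by (intro ex1_implies_ex pw) auto
    qed
    have e2: "\<exists>c. ?R c (nto x f) (nto y f) (nat_at l' (src ?Z f)) (nat_at l' (tgt ?Z f))" if f: "f \<in> arrs ?Z" for f
    proof -
      have "cmp ?B (nat_at l' (tgt ?Z f)) (nto y f) = cmp ?B (nfrom h (nto x f)) (nat_at l' (src ?Z f))"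
        using nat_trans_nat[OF nt(4) f] f by simp
      moreover have "src ?Z f \<in> arrs ?Z" "tgt ?Z f \<in> arrs ?Z" using f by (simp_all add: category_simps[OF m(2)])
      ultimately show ?thesis
        using f nat_transD[OF nt(4) ab(1)[OF f]] nat_transD[OF nt(4) ab(2)[OF f]] functorD[OF fx(2) f] functorD[OF
            fx(4) f]
        by (intro ex1_implies_ex pw) auto
    qed
    have e3: "\<exists>c. ?R c (nat_at x a) (nat_at y a) (nat_at l a) (nat_at l' a)" if a: "a \<in> objs ?Z" for a
      using comp[OF a] nat_transD[OF nt(1) a] nat_transD[OF nt(2) a] nat_transD[OF nt(3) a] nat_transD[OF nt(4) a]
          objsD[OF m(2) a]
      by (intro ex1_implies_ex pw) auto
    \<comment> \<open>\<open>F\<close> and \<open>G\<close> become the source and target functors of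
      the induced transformation, and \<open>N\<close> its components. Each law they must satisfy is
      checked on the images under \<open>p\<close>, \<open>q\<close> and \<open>k\<close> and then
      follows by \<open>uq\<close>.\<close>
    obtain F where F: "\<And>f. f \<in> arrs ?Z \<Longrightarrow> ?R (F f) (nfrom x f) (nfrom y f) (nat_at l (src ?Z f)) (nat_at l (tgt ?Z f))"
      using e1 by metis
    obtain G where G: "\<And>f. f \<in> arrs ?Z \<Longrightarrow> ?R (G f) (nto x f) (nto y f) (nat_at l' (src ?Z f)) (nat_at l' (tgt ?Z f))"
      using e2 by metis
    obtain N where N: "\<And>a. a \<in> objs ?Z \<Longrightarrow> ?R (N a) (nat_at x a) (nat_at y a) (nat_at l a) (nat_at l' a)"
      using e3 by metis
    note sE = category_simps[OF cat(3)] and sZ = category_simps[OF m(2)]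
    note rwE = functorD(1)[OF fu(2)] functorD(2,3)[OF fu(2), symmetric] functor_comp[OF fu(2)]
      functorD(1)[OF fu(3)] functorD(2,3)[OF fu(3), symmetric] functor_comp[OF fu(3)]
    note rwZ = functorD(1)[OF fx(1)] functorD(2,3)[OF fx(1), symmetric] functor_comp[OF fx(1)]
      functorD(1)[OF fx(2)] functorD(2,3)[OF fx(2), symmetric] functor_comp[OF fx(2)]
      functorD(1)[OF fx(3)] functorD(2,3)[OF fx(3), symmetric] functor_comp[OF fx(3)]
      functorD(1)[OF fx(4)] functorD(2,3)[OF fx(4), symmetric] functor_comp[OF fx(4)]
    note Z = objsD[OF m(2), THEN conjunct1] objsD[OF m(2), THEN conjunct2, THEN conjunct1] objsD[OF m(2), THEN
        conjunct2, THEN conjunct2]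
    note Fr = F[THEN conjunct1] F[THEN conjunct2, THEN conjunct1] F[THEN conjunct2, THEN conjunct2, THEN conjunct1]
      F[THEN conjunct2, THEN conjunct2, THEN conjunct2, THEN conjunct1] F[THEN conjunct2, THEN conjunct2, THEN
          conjunct2, THEN conjunct2]
    note Gr = G[THEN conjunct1] G[THEN conjunct2, THEN conjunct1] G[THEN conjunct2, THEN conjunct2, THEN conjunct1]
      G[THEN conjunct2, THEN conjunct2, THEN conjunct2, THEN conjunct1] G[THEN conjunct2, THEN conjunct2, THEN
          conjunct2, THEN conjunct2]
    note Nr = N[THEN conjunct1] N[THEN conjunct2, THEN conjunct1] N[THEN conjunct2, THEN conjunct2, THEN conjunct1]
      N[THEN conjunct2, THEN conjunct2, THEN conjunct2, THEN conjunct1] N[THEN conjunct2, THEN conjunct2, THEN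
          conjunct2, THEN conjunct2]
    have Fs: "F (src ?Z f) = src ?E (F f)" "F (tgt ?Z f) = tgt ?E (F f)" if f: "f \<in> arrs ?Z" for f
    proof -
      show "F (src ?Z f) = src ?E (F f)"
        by (rule uq[of _ "src ?A (nfrom x f)" "src ?B (nfrom y f)" "nat_at l (src ?Z f)" "nat_at l (src ?Z f)"])
          (simp_all add: f sE sZ rwE rwZ Fr)
      show "F (tgt ?Z f) = tgt ?E (F f)"
        by (rule uq[of _ "tgt ?A (nfrom x f)" "tgt ?B (nfrom y f)" "nat_at l (tgt ?Z f)" "nat_at l (tgt ?Z f)"])
          (simp_all add: f sE sZ rwE rwZ Fr)
    qed
    have Gs: "G (src ?Z f) = src ?E (G f)" "G (tgt ?Z f) = tgt ?E (G f)" if f: "f \<in> arrs ?Z" for f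
    proof -
      show "G (src ?Z f) = src ?E (G f)"
        by (rule uq[of _ "src ?A (nto x f)" "src ?B (nto y f)" "nat_at l' (src ?Z f)" "nat_at l' (src ?Z f)"])
          (simp_all add: f sE sZ rwE rwZ Gr)
      show "G (tgt ?Z f) = tgt ?E (G f)"
        by (rule uq[of _ "tgt ?A (nto x f)" "tgt ?B (nto y f)" "nat_at l' (tgt ?Z f)" "nat_at l' (tgt ?Z f)"])
          (simp_all add: f sE sZ rwE rwZ Gr)
    qed
    have Ns: "src ?E (N a) = F a" "tgt ?E (N a) = G a" if a: "a \<in> objs ?Z" for a
    proof -
      note n = nat_transD(2,3)[OF nt(1) a] nat_transD(2,3)[OF nt(2) a]
      show "src ?E (N a) = F a"
        by (rule uq[of _ "nfrom x a" "nfrom y a" "nat_at l a" "nat_at l a"])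
          (simp_all add: a Z sE rwE Fr Nr n)
      show "tgt ?E (N a) = G a"
        by (rule uq[of _ "nto x a" "nto y a" "nat_at l' a" "nat_at l' a"])
          (simp_all add: a Z sE rwE Gr Nr n)
    qed
    have Fc: "F (cmp ?Z g f) = cmp ?E (F g) (F f)" if fg: "f \<in> arrs ?Z" "g \<in> arrs ?Z" "src ?Z g = tgt ?Z f" for f g
    proof -
      have t: "src ?E (F g) = tgt ?E (F f)" using Fs(1)[OF fg(2)] Fs(2)[OF fg(1)] fg(3) by simp
      show ?thesis
        by (rule uq[of _ "nfrom x (cmp ?Z g f)" "nfrom y (cmp ?Z g f)" "nat_at l (src ?Z f)" "nat_at l (tgt ?Z g)"])
          (simp_all add: fg t sE sZ rwE rwZ Fr)
    qed
    have Gc: "G (cmp ?Z g f) = cmp ?E (G g) (G f)" if fg: "f \<in> arrs ?Z" "g \<in> arrs ?Z" "src ?Z g = tgt ?Z f" for f g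
    proof -
      have t: "src ?E (G g) = tgt ?E (G f)" using Gs(1)[OF fg(2)] Gs(2)[OF fg(1)] fg(3) by simp
      show ?thesis
        by (rule uq[of _ "nto x (cmp ?Z g f)" "nto y (cmp ?Z g f)" "nat_at l' (src ?Z f)" "nat_at l' (tgt ?Z g)"])
          (simp_all add: fg t sE sZ rwE rwZ Gr)
    qed
    have Nn: "cmp ?E (N (tgt ?Z f)) (F f) = cmp ?E (G f) (N (src ?Z f))" if f: "f \<in> arrs ?Z" for f
    proof -
      note o = ab[OF f]
      have t: "src ?E (N (tgt ?Z f)) = tgt ?E (F f)" "src ?E (G f) = tgt ?E (N (src ?Z f))"
        using Ns[OF o(1)] Ns[OF o(2)] Fs[OF f] Gs[OF f] by simp_all
      have u: "src ?E (N (src ?Z f)) = src ?E (F f)" "tgt ?E (N (tgt ?Z f)) = tgt ?E (G f)"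
        using Ns[OF o(1)] Ns[OF o(2)] Fs[OF f] Gs[OF f] by simp_all
      note a = Fr[OF f] Gr[OF f] Nr[OF o(1)] Nr[OF o(2)]
      have 1: "nfrom p (cmp ?E (N (tgt ?Z f)) (F f)) = nfrom p (cmp ?E (G f) (N (src ?Z f)))"
        using nat_trans_nat[OF nt(1) f] by (simp add: a t functor_comp[OF fu(2)])
      have 2: "nfrom q (cmp ?E (N (tgt ?Z f)) (F f)) = nfrom q (cmp ?E (G f) (N (src ?Z f)))"
        using nat_trans_nat[OF nt(2) f] by (simp add: a t functor_comp[OF fu(3)])
      show ?thesis
        by (rule uq[of _ "nfrom p (cmp ?E (G f) (N (src ?Z f)))" "nfrom q (cmp ?E (G f) (N (src ?Z f)))" "nat_at l
            (src ?Z f)" "nat_at l' (tgt ?Z f)"])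
          (use 1 2 in \<open>simp_all add: a t u sE\<close>)
    qed
    let ?c = "Nt ?Z (restrict F (arrs ?Z)) (restrict G (arrs ?Z)) (restrict N (objs ?Z)) ?E"
    have Ff: "is_functor ?Z ?E (restrict F (arrs ?Z))" "is_functor ?Z ?E (restrict G (arrs ?Z))"
      using F G Fs Gs Fc Gc by (auto simp: is_functor_def sZ)
    have Nf: "nat_trans ?Z ?E (restrict F (arrs ?Z)) (restrict G (arrs ?Z)) (restrict N (objs ?Z))"
      using N Ns Nn ab objsD[OF m(2)] by (auto simp: nat_trans_def)
    let ?P = "\<lambda>c. c \<in> cells (Cat2 V) \<and> s0 (Cat2 V) c = s0 (Cat2 V) x \<and> t0 (Cat2 V) c = s0 (Cat2 V) p \<and> p \<star>\<^bsub>Cat2 V\<^esub> c =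
        x \<and>
         q \<star>\<^bsub>Cat2 V\<^esub> c = y \<and> k \<star>\<^bsub>Cat2 V\<^esub> s1 (Cat2 V) c = l \<and> k \<star>\<^bsub>Cat2 V\<^esub> t1 (Cat2 V) c = l'"
    have one_comp: "cmp (ntgt r) (nfrom r (G' a)) (nfrom r u) = nfrom r u"
      if "r \<in> cells (Cat2 V)" "u \<in> arrs (nsrc r)" "tgt (nsrc r) u = G' a" for r :: "'a nt" and G' :: "'a \<Rightarrow> 'a" and u a
    proof -
      have r: "is_functor (nsrc r) (ntgt r) (nfrom r)" "category (ntgt r)" using that V by (auto simp: Cat2_cell_iff)
      show ?thesis using functorD[OF r(1) that(2)] that(3) by (simp add: category_simps[OF r(2)])
    qed
    show ?case
    proof (rule ex1I[of ?P ?c])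
      have "G a \<in> objs ?E" "F a \<in> objs ?E" "nat_at k (F a) = nat_at l a" "nat_at k (G a) = nat_at l' a" if "a \<in> objs
          ?Z" for a
        using functor_objs[OF Ff(1) that] functor_objs[OF Ff(2) that] objsD[OF m(2) that] F[of a] G[of a] Fs[of a]
            Gs[of a] by auto
      note o = this
      have kc: "cmp ?B (nat_at l a) (nfrom q (F a)) = nat_at l a" "cmp ?B (nat_at l' a) (nfrom q (G a)) = nat_at l' a"
        if "a \<in> objs ?Z" for a
        using kobj(4)[OF o(2)[OF that]] kobj(4)[OF o(1)[OF that]] o(3,4)[OF that] by simp_all
      have pc: "cmp ?A (nfrom p (G a)) (nat_at x a) = nat_at x a" if "a \<in> objs ?Z" for a
        using one_comp[OF P(1), of "N a" G a] Nr[OF that] Ns[OF that] ty(1) by simp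
      have qc: "cmp ?B (nfrom q (G a)) (nat_at y a) = nat_at y a" if "a \<in> objs ?Z" for a
        using one_comp[OF Q(1), of "N a" G a] Nr[OF that] Ns[OF that] ty(2,3) by simp
      have "p \<star>\<^bsub>Cat2 V\<^esub> ?c = x"
      proof (rule nt.expand, intro conjI)
        show "nfrom (p \<star>\<^bsub>Cat2 V\<^esub> ?c) = nfrom x"
          by (rule extensionalityI[of _ "arrs ?Z"]) (simp_all add: ex Fr)
        show "nto (p \<star>\<^bsub>Cat2 V\<^esub> ?c) = nto x"
          by (rule extensionalityI[of _ "arrs ?Z"]) (simp_all add: ex Gr P(2))
        show "nat_at (p \<star>\<^bsub>Cat2 V\<^esub> ?c) = nat_at x"
          by (rule extensionalityI[of _ "objs ?Z"]) (simp_all add: ex ty(1) o Nr P(3) pc Z)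
      qed (simp_all add: ty(1) X)
      moreover have "q \<star>\<^bsub>Cat2 V\<^esub> ?c = y"
      proof (rule nt.expand, intro conjI)
        show "nfrom (q \<star>\<^bsub>Cat2 V\<^esub> ?c) = nfrom y"
          by (rule extensionalityI[of _ "arrs ?Z"]) (simp_all add: ex Fr)
        show "nto (q \<star>\<^bsub>Cat2 V\<^esub> ?c) = nto y"
          by (rule extensionalityI[of _ "arrs ?Z"]) (simp_all add: ex Gr Q(2))
        show "nat_at (q \<star>\<^bsub>Cat2 V\<^esub> ?c) = nat_at y"
          by (rule extensionalityI[of _ "objs ?Z"]) (simp_all add: ex ty(3) o Nr Q(3) qc Z)
      qed (simp_all add: ty(3) X)
      moreover have "k \<star>\<^bsub>Cat2 V\<^esub> s1 (Cat2 V) ?c = l"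
      proof (rule nt.expand, intro conjI)
        show "nfrom (k \<star>\<^bsub>Cat2 V\<^esub> s1 (Cat2 V) ?c) = nfrom l"
          by (rule extensionalityI[of _ "arrs ?Z"]) (simp_all add: ex X K Fr)
        show "nto (k \<star>\<^bsub>Cat2 V\<^esub> s1 (Cat2 V) ?c) = nto l"
          by (rule extensionalityI[of _ "arrs ?Z"]) (simp_all add: ex X K Fr)
        show "nat_at (k \<star>\<^bsub>Cat2 V\<^esub> s1 (Cat2 V) ?c) = nat_at l"
          by (rule extensionalityI[of _ "objs ?Z"]) (simp_all add: ex o K kc Z)
      qed (simp_all add: K X)
      moreover have "k \<star>\<^bsub>Cat2 V\<^esub> t1 (Cat2 V) ?c = l'"
      proof (rule nt.expand, intro conjI)
        show "nfrom (k \<star>\<^bsub>Cat2 V\<^esub> t1 (Cat2 V) ?c) = nfrom l'"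
          by (rule extensionalityI[of _ "arrs ?Z"]) (simp_all add: ex X K Gr)
        show "nto (k \<star>\<^bsub>Cat2 V\<^esub> t1 (Cat2 V) ?c) = nto l'"
          by (rule extensionalityI[of _ "arrs ?Z"]) (simp_all add: ex X K Gr)
        show "nat_at (k \<star>\<^bsub>Cat2 V\<^esub> t1 (Cat2 V) ?c) = nat_at l'"
          by (rule extensionalityI[of _ "objs ?Z"]) (simp_all add: ex o K kc Z)
      qed (simp_all add: K X)
      moreover have "?c \<in> cells (Cat2 V)" using Ff Nf m vm by (simp add: Cat2_cell_iff)
      ultimately show "?P ?c" by (simp del: Cat2_simps(3-6))
    next
      fix c assume "?P c"
      then have c: "c \<in> cells (Cat2 V)" "nsrc c = ?Z" "ntgt c = ?E" "p \<star>\<^bsub>Cat2 V\<^esub> c = x" "q \<star>\<^bsub>Cat2 V\<^esub> c = y"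
        "k \<star>\<^bsub>Cat2 V\<^esub> s1 (Cat2 V) c = l" "k \<star>\<^bsub>Cat2 V\<^esub> t1 (Cat2 V) c = l'" by (auto simp del: Cat2_simps(3-6))
      have cf: "is_functor ?Z ?E (nfrom c)" "is_functor ?Z ?E (nto c)" "nat_trans ?Z ?E (nfrom c) (nto c) (nat_at c)"
        "nfrom c \<in> extensional (arrs ?Z)" "nto c \<in> extensional (arrs ?Z)" "nat_at c \<in> extensional (objs ?Z)"
        using c(1-3) by (auto simp: Cat2_cell_iff)
      have pf: "nfrom p (nfrom c f) = nfrom x f" "nfrom p (nto c f) = nto x f" "nfrom q (nfrom c f) = nfrom y f"
          "nfrom q (nto c f) = nto y f"
        if "f \<in> arrs ?Z" for f
        using that c(2) P Q c(4,5)[THEN arg_cong[of _ _ nfrom], THEN fun_cong[of _ _ f]] c(4,5)[THEN arg_cong[of _ _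
            nto], THEN fun_cong[of _ _ f]] by auto
      have ka: "nat_at k (nfrom c a) = nat_at l a" "nat_at k (nto c a) = nat_at l' a"
         "nfrom p (nat_at c a) = nat_at x a" "nfrom q (nat_at c a) = nat_at y a" if a: "a \<in> objs ?Z" for a
      proof -
        note o = functor_objs[OF cf(1) a] functor_objs[OF cf(2) a] nat_transD[OF cf(3) a]
        show "nat_at k (nfrom c a) = nat_at l a"
          using a c(2) K kobj[OF o(1)] arg_cong[OF c(6), of "\<lambda>r. nat_at r a"] by simp
        show "nat_at k (nto c a) = nat_at l' a"
          using a c(2) K kobj[OF o(2)] arg_cong[OF c(7), of "\<lambda>r. nat_at r a"] by simp
        show "nfrom p (nat_at c a) = nat_at x a"
          using a c(2) P o one_comp[OF P(1) o(3), of "nto c" a] arg_cong[OF c(4), of "\<lambda>r. nat_at r a"] ty by simp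
        show "nfrom q (nat_at c a) = nat_at y a"
          using a c(2) Q o one_comp[OF Q(1), of "nat_at c a" "nto c" a] arg_cong[OF c(5), of "\<lambda>r. nat_at r a"] ty by
              simp
      qed
      have "nfrom c f = F f" "nto c f = G f" if f: "f \<in> arrs ?Z" for f
      proof -
        note k = ka(1,2)[OF ab(1)[OF f]] ka(1,2)[OF ab(2)[OF f]] functorD[OF cf(1) f] functorD[OF cf(2) f]
        show "nfrom c f = F f"
          by (rule uq[of _ "nfrom x f" "nfrom y f" "nat_at l (src ?Z f)" "nat_at l (tgt ?Z f)"]) (simp_all add: f Fr
              pf k)
        show "nto c f = G f"
          by (rule uq[of _ "nto x f" "nto y f" "nat_at l' (src ?Z f)" "nat_at l' (tgt ?Z f)"]) (simp_all add: f Gr pf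
              k)
      qed
      moreover have "nat_at c a = N a" if a: "a \<in> objs ?Z" for a
        by (rule uq[of _ "nat_at x a" "nat_at y a" "nat_at l a" "nat_at l' a"])
          (simp_all add: a Nr ka[OF a] nat_transD[OF cf(3) a])
      ultimately have "nfrom c = restrict F (arrs ?Z)" "nto c = restrict G (arrs ?Z)" "nat_at c = restrict N (objs
          ?Z)"
        using cf by (auto intro: extensionalityI)
      then show "c = ?c" using c(2,3) by (simp add: nt.expand)
    qed
  qed (simp_all only: hpq ty Cat2_simps(1,2))
qed

section \<open>Hom-categories transported into the base, and the hom 2-functor in each
  variable\<close>

section \<open>Hom 2-functors\<close>

lemma rep_props:
  assumes "in_base V X"
  shows "robj V X \<in> V" "iso_functor X (robj V X) (enc V X)"
proof -
  have "\<exists>p. fst p \<in> V \<and> iso_functor X (fst p) (snd p)" using assms by (auto simp: in_base_def)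
  from someI_ex[OF this] show "robj V X \<in> V" "iso_functor X (robj V X) (enc V X)"
    by (auto simp: rep_def robj_def enc_def)
qed

context
  fixes V :: "'u cat set" and X :: "'x cat"
  assumes b: "in_base V X" and c: "category X"
begin

lemma enc_fun: "is_functor X (robj V X) (enc V X)" and enc_bij: "bij_betw (enc V X) (arrs X) (arrs (robj V X))"
  using rep_props(2)[OF b] by (auto simp: iso_functor_def)

lemma enc_arrs: "f \<in> arrs X \<Longrightarrow> enc V X f \<in> arrs (robj V X)"
  and src_enc: "f \<in> arrs X \<Longrightarrow> src (robj V X) (enc V X f) = enc V X (src X f)"
  and tgt_enc: "f \<in> arrs X \<Longrightarrow> tgt (robj V X) (enc V X f) = enc V X (tgt X f)"
  and cmp_enc: "f \<in> arrs X \<Longrightarrow> g \<in> arrs X \<Longrightarrow> src X g = tgt X f \<Longrightarrow>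
     cmp (robj V X) (enc V X g) (enc V X f) = enc V X (cmp X g f)"
  using functorD[OF enc_fun] functor_comp[OF enc_fun] by auto

lemma dec_arrs: "u \<in> arrs (robj V X) \<Longrightarrow> dec V X u \<in> arrs X"
  and enc_dec: "u \<in> arrs (robj V X) \<Longrightarrow> enc V X (dec V X u) = u"
  and dec_enc: "f \<in> arrs X \<Longrightarrow> dec V X (enc V X f) = f"
  using enc_bij unfolding dec_def
  by (auto simp: bij_betw_def inv_into_into f_inv_into_f inv_into_f_f)

lemma enc_inj: "f \<in> arrs X \<Longrightarrow> g \<in> arrs X \<Longrightarrow> enc V X f = enc V X g \<longleftrightarrow> f = g"
  using dec_enc by metis

lemma dec_src: "u \<in> arrs (robj V X) \<Longrightarrow> dec V X (src (robj V X) u) = src X (dec V X u)"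
  and dec_tgt: "u \<in> arrs (robj V X) \<Longrightarrow> dec V X (tgt (robj V X) u) = tgt X (dec V X u)"
  using src_enc[of "dec V X u"] tgt_enc[of "dec V X u"] dec_enc category_simps(1,2)[OF c]
  by (simp_all add: dec_arrs enc_dec)

lemma dec_cmp:
  assumes "u \<in> arrs (robj V X)" "v \<in> arrs (robj V X)" "src (robj V X) v = tgt (robj V X) u"
  shows "dec V X (cmp (robj V X) v u) = cmp X (dec V X v) (dec V X u)"
proof -
  have "src X (dec V X v) = tgt X (dec V X u)" using assms dec_src dec_tgt by metis
  then show ?thesis
    using cmp_enc[of "dec V X u" "dec V X v"] dec_enc[of "cmp X (dec V X v) (dec V X u)"] assms
    by (simp add: dec_arrs enc_dec category_simps[OF c])
qed

lemma dec_objs: "a \<in> objs (robj V X) \<Longrightarrow> dec V X a \<in> objs X"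
  using dec_src[of a] dec_arrs[of a] by (auto simp: objs_def)

end

lemma vcell_simps [simp]:
  "nsrc (vcell V X Y F G t) = robj V X" "ntgt (vcell V X Y F G t) = robj V Y"
  "nfrom (vcell V X Y F G t) = (\<lambda>f\<in>arrs (robj V X). enc V Y (F (dec V X f)))"
  "nto (vcell V X Y F G t) = (\<lambda>f\<in>arrs (robj V X). enc V Y (G (dec V X f)))"
  "nat_at (vcell V X Y F G t) = (\<lambda>a\<in>objs (robj V X). enc V Y (t (dec V X a)))"
  by (simp_all add: vcell_def)

lemma vcell_cell:
  assumes b: "in_base V X" "in_base V Y" and c: "category X" "category Y"
    and F: "is_functor X Y F" and G: "is_functor X Y G" and t: "nat_trans X Y F G t"
    and V: "\<And>X. X \<in> V \<Longrightarrow> category X"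
  shows "vcell V X Y F G t \<in> cells (Cat2 V)"
proof -
  note cX = V[OF rep_props(1)[OF b(1)]] and cY = V[OF rep_props(1)[OF b(2)]]
  note d = dec_arrs[OF b(1) c(1)] dec_src[OF b(1) c(1), symmetric] dec_tgt[OF b(1) c(1), symmetric] dec_cmp[OF b(1)
      c(1)]
  note e = enc_arrs[OF b(2) c(2)] src_enc[OF b(2) c(2)] tgt_enc[OF b(2) c(2)] cmp_enc[OF b(2) c(2)]
  have "is_functor (robj V X) (robj V Y) (\<lambda>f\<in>arrs (robj V X). enc V Y (F (dec V X f)))" if F: "is_functor X Y F" for F
    unfolding is_functor_def
    by (auto simp: category_simps[OF cX] category_simps[OF c(1)] d e functorD[OF F] functor_comp[OF F])
  note 1 = this[OF F] this[OF G]
  have "nat_trans (robj V X) (robj V Y) (\<lambda>f\<in>arrs (robj V X). enc V Y (F (dec V X f)))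
     (\<lambda>f\<in>arrs (robj V X). enc V Y (G (dec V X f))) (\<lambda>a\<in>objs (robj V X). enc V Y (t (dec V X a)))"
    unfolding nat_trans_def
  proof (intro conjI ballI)
    fix a assume a: "a \<in> objs (robj V X)"
    note o = dec_objs[OF b(1) c(1) a]
    show "(\<lambda>a\<in>objs (robj V X). enc V Y (t (dec V X a))) a \<in> arrs (robj V Y)"
      "src (robj V Y) ((\<lambda>a\<in>objs (robj V X). enc V Y (t (dec V X a))) a) = (\<lambda>f\<in>arrs (robj V X). enc V Y (F (dec V X
          f))) a"
      "tgt (robj V Y) ((\<lambda>a\<in>objs (robj V X). enc V Y (t (dec V X a))) a) = (\<lambda>f\<in>arrs (robj V X). enc V Y (G (dec V X
          f))) a"
      using a objsD[OF cX a] by (simp_all add: e nat_transD[OF t o])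
  next
    fix f assume f: "f \<in> arrs (robj V X)"
    note o = src_tgt_objs[OF c(1) d(1)[OF f]] src_tgt_objs[OF cX f]
    show "cmp (robj V Y) ((\<lambda>a\<in>objs (robj V X). enc V Y (t (dec V X a))) (tgt (robj V X) f)) ((\<lambda>f\<in>arrs (robj V X). enc
        V Y (F (dec V X f))) f) =
      cmp (robj V Y) ((\<lambda>f\<in>arrs (robj V X). enc V Y (G (dec V X f))) f) ((\<lambda>a\<in>objs (robj V X). enc V Y (t (dec V X a)))
          (src (robj V X) f))"
      using f o nat_trans_nat[OF t d(1)[OF f]]
      by (simp add: d e functorD[OF F] functorD[OF G] nat_transD[OF t])
  qed
  then show ?thesis using 1 rep_props(1)[OF b(1)] rep_props(1)[OF b(2)] by (simp add: Cat2_cell_iff)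
qed

lemma vcell_eqI:
  assumes b: "in_base V X" "category X"
    and "\<And>f. f \<in> arrs X \<Longrightarrow> F f = F' f" "\<And>f. f \<in> arrs X \<Longrightarrow> G f = G' f" "\<And>a. a \<in> objs X \<Longrightarrow> t a = t' a"
  shows "vcell V X Y F G t = vcell V X Y F' G' t'"
  unfolding vcell_def using assms dec_arrs[OF b] dec_objs[OF b] by (auto intro!: restrict_ext)

lemma vcell_s1: "s1 (Cat2 V) (vcell V X Y F G t) = vcell V X Y F F F"
  and vcell_t1: "t1 (Cat2 V) (vcell V X Y F G t) = vcell V X Y G G G"
  by (auto simp: vcell_def objs_def intro!: restrict_ext)

text \<open>In the middle category \<open>dec\<close> cancels \<open>enc\<close>, and in the last
  one \<open>enc\<close> preserves composites. So a composite of transported transformations is the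
  transport of their composite.\<close>

lemma vcell_hcomp:
  assumes b: "in_base V X" "category X" "in_base V Y" "category Y" "in_base V Z" "category Z"
    and F: "\<And>f. f \<in> arrs X \<Longrightarrow> F f \<in> arrs Y" "\<And>f. f \<in> arrs X \<Longrightarrow> G f \<in> arrs Y" "\<And>a. a \<in> objs X \<Longrightarrow> t a \<in> arrs Y"
      "\<And>a. a \<in> objs X \<Longrightarrow> G a \<in> objs Y"
    and F': "\<And>f. f \<in> arrs Y \<Longrightarrow> F' f \<in> arrs Z" "\<And>a. a \<in> objs Y \<Longrightarrow> t' a \<in> arrs Z"
      "\<And>a. a \<in> objs X \<Longrightarrow> src Z (t' (G a)) = tgt Z (F' (t a))"
    and V: "\<And>X. X \<in> V \<Longrightarrow> category X"
  shows "vcell V Y Z F' G' t' \<star>\<^bsub>Cat2 V\<^esub> vcell V X Y F G t =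
    vcell V X Z (\<lambda>f. F' (F f)) (\<lambda>f. G' (G f)) (\<lambda>a. cmp Z (t' (G a)) (F' (t a)))"
proof -
  note d = dec_arrs[OF b(1,2)] dec_objs[OF b(1,2)] dec_enc[OF b(3,4)] enc_arrs[OF b(3,4)] enc_arrs[OF b(5,6)]
      cmp_enc[OF b(5,6)]
  have eo: "enc V Y c \<in> objs (robj V Y)" if "c \<in> objs Y" for c
    using that functor_objs[OF enc_fun[OF b(3,4)]] by auto
  have oY: "c \<in> objs Y \<Longrightarrow> c \<in> arrs Y" for c by (simp add: objs_def)
  have oX: "a \<in> objs (robj V X) \<Longrightarrow> a \<in> arrs (robj V X)" for a by (simp add: objs_def)
  show ?thesis unfolding vcell_def
    using oX oY F F' by (auto intro!: restrict_ext simp: d eo)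
qed

lemma vcell_vcomp:
  assumes b: "in_base V X" "category X" "in_base V Y" "category Y"
    and t: "\<And>a. a \<in> objs X \<Longrightarrow> t a \<in> arrs Y \<and> t' a \<in> arrs Y \<and> src Y (t' a) = tgt Y (t a)"
  shows "vcell V X Y G' H t' \<bullet>\<^bsub>Cat2 V\<^esub> vcell V X Y F G t = vcell V X Y F H (\<lambda>a. cmp Y (t' a) (t a))"
  unfolding vcell_def using t dec_objs[OF b(1,2)] by (auto intro!: restrict_ext simp: cmp_enc[OF b(3,4)])

lemma vcell_id:
  assumes b: "in_base V X" "category X"
    and "\<And>f. f \<in> arrs X \<Longrightarrow> F f = f" "\<And>f. f \<in> arrs X \<Longrightarrow> G f = f" "\<And>a. a \<in> objs X \<Longrightarrow> t a = a"
  shows "vcell V X X F G t = idnt (robj V X)"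
proof -
  have "a \<in> objs (robj V X) \<Longrightarrow> a \<in> arrs (robj V X)" for a by (simp add: objs_def)
  then show ?thesis
    unfolding vcell_def idnt_def using assms(3-) dec_arrs[OF b] dec_objs[OF b] enc_dec[OF b] by (auto intro!:
        restrict_ext)
qed

context twocat begin

lemma Hom_simps [simp]:
  "arrs (Hom C A B) = {x \<in> cells C. s0 C x = A \<and> t0 C x = B}" "src (Hom C A B) = s1 C" "tgt (Hom C A B) = t1 C"
  "cmp (Hom C A B) = cmp (ver C)"
  by (simp_all add: Hom_def)

lemma Hom_objs: "objs (Hom C A B) = {x \<in> cells C. s1 C x = x \<and> t1 C x = x \<and> s0 C x = A \<and> t0 C x = B}"
proof -
  have "t1 C x = x" if "x \<in> cells C" "s1 C x = x" for x using vcat(4)[OF that(1)] that by simp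
  then show ?thesis by (auto simp: objs_def[of "Hom C A B"])
qed

lemma Hom_category: "category (Hom C A B)"
  unfolding category_def by (auto simp: vassoc)

end

lemma two_functorI:
  assumes "twocat C" "twocat D" "\<And>x. x \<in> cells C \<Longrightarrow> F x \<in> cells D"
    "\<And>x. x \<in> cells C \<Longrightarrow> F (s0 C x) = s0 D (F x)" "\<And>x. x \<in> cells C \<Longrightarrow> F (t0 C x) = t0 D (F x)"
    "\<And>x. x \<in> cells C \<Longrightarrow> F (s1 C x) = s1 D (F x)" "\<And>x. x \<in> cells C \<Longrightarrow> F (t1 C x) = t1 D (F x)"
    "\<And>x y. x \<in> cells C \<Longrightarrow> y \<in> cells C \<Longrightarrow> s0 C y = t0 C x \<Longrightarrow> F (y \<star>\<^bsub>C\<^esub> x) = F y \<star>\<^bsub>D\<^esub> F x"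
    "\<And>x y. x \<in> cells C \<Longrightarrow> y \<in> cells C \<Longrightarrow> s1 C y = t1 C x \<Longrightarrow> F (y \<bullet>\<^bsub>C\<^esub> x) = F y \<bullet>\<^bsub>D\<^esub> F x"
  shows "two_functor C D F"
  using assms twocat.arrs_ver[OF assms(1)] twocat.arrs_ver[OF assms(2)]
  unfolding two_functor_def is_functor_def by auto

text \<open>This is \<open>K(X, -)\<close>, and \<open>hpre\<close> is \<open>K(-, A)\<close>, with
  hom-categories replaced by their copies in \<open>V\<close>. Objects and 1-cells are covered as
  identity 2-cells. Each variable is treated separately and \<open>hpost_hpre\<close> relates the
  two.\<close>

definition hpost :: "'u cat set \<Rightarrow> 'k twocat \<Rightarrow> 'k \<Rightarrow> 'k \<Rightarrow> 'u nt" where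
  "hpost V K X x = vcell V (Hom K X (s0 K x)) (Hom K X (t0 K x)) (\<lambda>h. s1 K x \<star>\<^bsub>K\<^esub> h) (\<lambda>h. t1 K x \<star>\<^bsub>K\<^esub> h) (\<lambda>h. x \<star>\<^bsub>K\<^esub>
      h)"

definition hpre :: "'u cat set \<Rightarrow> 'k twocat \<Rightarrow> 'k \<Rightarrow> 'k \<Rightarrow> 'u nt" where
  "hpre V K A y = vcell V (Hom K (t0 K y) A) (Hom K (s0 K y) A) (\<lambda>h. h \<star>\<^bsub>K\<^esub> s1 K y) (\<lambda>h. h \<star>\<^bsub>K\<^esub> t1 K y) (\<lambda>h. h \<star>\<^bsub>K\<^esub>
      y)"

locale Vcat = twocat C for C :: "'c twocat" +
  fixes V :: "'u cat set"
  assumes hom_base: "A \<in> zero_cells C \<Longrightarrow> B \<in> zero_cells C \<Longrightarrow> in_base V (Hom C A B)"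
    and V: "X \<in> V \<Longrightarrow> category X"
begin

lemma hb: "x \<in> cells C \<Longrightarrow> y \<in> cells C \<Longrightarrow> in_base V (Hom C (s0 C x) (s0 C y))"
  "x \<in> cells C \<Longrightarrow> y \<in> cells C \<Longrightarrow> in_base V (Hom C (s0 C x) (t0 C y))"
  "x \<in> cells C \<Longrightarrow> y \<in> cells C \<Longrightarrow> in_base V (Hom C (t0 C x) (s0 C y))"
  "x \<in> cells C \<Longrightarrow> y \<in> cells C \<Longrightarrow> in_base V (Hom C (t0 C x) (t0 C y))"
  by (auto intro: hom_base)

lemma twocat_V: "twocat (Cat2 V)" by (rule twocat_Cat2) (rule V)

lemma hpost_cell:
  assumes X[simp]: "X \<in> zero_cells C" and x[simp]: "x \<in> cells C"
  shows "hpost V C X x \<in> cells (Cat2 V)"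
proof -
  have st: "s0 C x \<in> zero_cells C" "t0 C x \<in> zero_cells C" by simp_all
  have "is_functor (Hom C X (s0 C x)) (Hom C X (t0 C x)) (\<lambda>h. u \<star>\<^bsub>C\<^esub> h)"
    if "u \<in> cells C" "s1 C u = u" "t1 C u = u" "s0 C u = s0 C x" "t0 C u = t0 C x" for u
    unfolding is_functor_def using that by (auto intro!: whisker_left)
  note f = this[of "s1 C x"] this[of "t1 C x"]
  show ?thesis unfolding hpost_def
  proof (rule vcell_cell[OF hom_base[OF X st(1)] hom_base[OF X st(2)] Hom_category Hom_category _ _ _ V])
    show "nat_trans (Hom C X (s0 C x)) (Hom C X (t0 C x)) (\<lambda>h. s1 C x \<star>\<^bsub>C\<^esub> h) (\<lambda>h. t1 C x \<star>\<^bsub>C\<^esub> h) (\<lambda>h. x \<star>\<^bsub>C\<^esub> h)"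
      unfolding nat_trans_def Hom_objs
      by (auto simp: one_cells_iff dest: one_cellD intro!: trans[OF hcomp_left_right(1)[symmetric]
          hcomp_left_right(2)])
  qed (use f in simp_all)
qed

lemma hpre_cell:
  assumes X[simp]: "X \<in> zero_cells C" and x[simp]: "x \<in> cells C"
  shows "hpre V C X x \<in> cells (Cat2 V)"
proof -
  have st: "s0 C x \<in> zero_cells C" "t0 C x \<in> zero_cells C" by simp_all
  have "is_functor (Hom C (t0 C x) X) (Hom C (s0 C x) X) (\<lambda>h. h \<star>\<^bsub>C\<^esub> u)"
    if "u \<in> cells C" "s1 C u = u" "t1 C u = u" "s0 C u = s0 C x" "t0 C u = t0 C x" for u
    unfolding is_functor_def using that by (auto intro!: whisker_right)
  note f = this[of "s1 C x"] this[of "t1 C x"]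
  show ?thesis unfolding hpre_def
  proof (rule vcell_cell[OF hom_base[OF st(2) X] hom_base[OF st(1) X] Hom_category Hom_category _ _ _ V])
    show "nat_trans (Hom C (t0 C x) X) (Hom C (s0 C x) X) (\<lambda>h. h \<star>\<^bsub>C\<^esub> s1 C x) (\<lambda>h. h \<star>\<^bsub>C\<^esub> t1 C x) (\<lambda>h. h \<star>\<^bsub>C\<^esub> x)"
      unfolding nat_trans_def Hom_objs
      by (auto simp: one_cells_iff dest: one_cellD intro!: trans[OF hcomp_left_right(2)[symmetric]
          hcomp_left_right(1)])
  qed (use f in simp_all)
qed

lemma hpost_functor:
  assumes X[simp]: "X \<in> zero_cells C"
  shows "two_functor C (Cat2 V) (hpost V C X)"
proof (rule two_functorI)
  show "twocat C" by unfold_locales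
  show "twocat (Cat2 V)" by (rule twocat_V)
  fix x assume x[simp]: "x \<in> cells C"
  have st: "s0 C x \<in> zero_cells C" "t0 C x \<in> zero_cells C" by simp_all
  note hx = hom_base[OF X st(1)] hom_base[OF X st(2)]
  show "hpost V C X x \<in> cells (Cat2 V)" by (rule hpost_cell) simp_all
  show "hpost V C X (s0 C x) = s0 (Cat2 V) (hpost V C X x)" "hpost V C X (t0 C x) = t0 (Cat2 V) (hpost V C X x)"
    by (simp_all add: hpost_def) (rule vcell_id[OF _ Hom_category]; simp add: hx Hom_objs)+
  show "hpost V C X (s1 C x) = s1 (Cat2 V) (hpost V C X x)" "hpost V C X (t1 C x) = t1 (Cat2 V) (hpost V C X x)"
    by (simp_all add: hpost_def vcell_s1 vcell_t1 del: Cat2_simps)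
next
  fix x y assume x[simp]: "x \<in> cells C" and y[simp]: "y \<in> cells C" and s: "s0 C y = t0 C x"
  have st: "s0 C x \<in> zero_cells C" "t0 C x \<in> zero_cells C" "t0 C y \<in> zero_cells C" by simp_all
  note hx = hom_base[OF X st(1)] hom_base[OF X st(2)] hom_base[OF X st(3)]
  have "hpost V C X y \<star>\<^bsub>Cat2 V\<^esub> hpost V C X x = vcell V (Hom C X (s0 C x)) (Hom C X (t0 C y))
     (\<lambda>h. s1 C y \<star>\<^bsub>C\<^esub> (s1 C x \<star>\<^bsub>C\<^esub> h)) (\<lambda>h. t1 C y \<star>\<^bsub>C\<^esub> (t1 C x \<star>\<^bsub>C\<^esub> h))
     (\<lambda>h. cmp (Hom C X (t0 C y)) (y \<star>\<^bsub>C\<^esub> (t1 C x \<star>\<^bsub>C\<^esub> h)) (s1 C y \<star>\<^bsub>C\<^esub> (x \<star>\<^bsub>C\<^esub> h)))"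
    unfolding hpost_def s
    by (rule vcell_hcomp[OF hx(1) Hom_category hx(2) Hom_category hx(3) Hom_category])
      (auto simp: Hom_objs s V)
  also have "\<dots> = hpost V C X (y \<star>\<^bsub>C\<^esub> x)"
    unfolding hpost_def hcat(10)[OF x y s] hcat(11)[OF x y s]
  proof (rule vcell_eqI[OF hx(1) Hom_category])
    fix h assume "h \<in> objs (Hom C X (s0 C x))"
    then have h: "h \<in> cells C" "s1 C h = h" "t1 C h = h" "s0 C h = X" "t0 C h = s0 C x" by (auto simp: Hom_objs)
    show "cmp (Hom C X (t0 C y)) (y \<star>\<^bsub>C\<^esub> (t1 C x \<star>\<^bsub>C\<^esub> h)) (s1 C y \<star>\<^bsub>C\<^esub> (x \<star>\<^bsub>C\<^esub> h)) = (y \<star>\<^bsub>C\<^esub> x) \<star>\<^bsub>C\<^esub> h"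
      using hcomp_left_right(1)[of "x \<star>\<^bsub>C\<^esub> h" y] h s by (simp add: hassoc)
  qed (simp_all add: s hassoc)
  finally show "hpost V C X (y \<star>\<^bsub>C\<^esub> x) = hpost V C X y \<star>\<^bsub>Cat2 V\<^esub> hpost V C X x" ..
next
  fix x y assume x[simp]: "x \<in> cells C" and y[simp]: "y \<in> cells C" and s: "s1 C y = t1 C x"
  have p: "s0 C y = s0 C x" "t0 C y = t0 C x" using parallel01[OF x y s] by auto
  have st: "s0 C x \<in> zero_cells C" "t0 C x \<in> zero_cells C" by simp_all
  note hx = hom_base[OF X st(1)] hom_base[OF X st(2)]
  have "hpost V C X y \<bullet>\<^bsub>Cat2 V\<^esub> hpost V C X x = vcell V (Hom C X (s0 C x)) (Hom C X (t0 C x))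
     (\<lambda>h. s1 C x \<star>\<^bsub>C\<^esub> h) (\<lambda>h. t1 C y \<star>\<^bsub>C\<^esub> h) (\<lambda>h. cmp (Hom C X (t0 C x)) (y \<star>\<^bsub>C\<^esub> h) (x \<star>\<^bsub>C\<^esub> h))"
    unfolding hpost_def p
    by (rule vcell_vcomp[OF hx(1) Hom_category hx(2) Hom_category]) (auto simp: Hom_objs p s)
  also have "\<dots> = hpost V C X (y \<bullet>\<^bsub>C\<^esub> x)"
    unfolding hpost_def vcomp_s0[OF x y s] vcomp_t0[OF x y s]
    by (rule vcell_eqI[OF hx(1) Hom_category]) (auto simp: s p Hom_objs intro!: whisker_right[symmetric])
  finally show "hpost V C X (y \<bullet>\<^bsub>C\<^esub> x) = hpost V C X y \<bullet>\<^bsub>Cat2 V\<^esub> hpost V C X x" ..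
qed

lemma hpre_functor:
  assumes X[simp]: "X \<in> zero_cells C"
  shows "two_functor (op C) (Cat2 V) (hpre V C X)"
proof (rule two_functorI)
  show "twocat (op C)" by (rule twocat_op) unfold_locales
  show "twocat (Cat2 V)" by (rule twocat_V)
  fix x assume x': "x \<in> cells (op C)"
  then have x[simp]: "x \<in> cells C" by simp
  have st: "s0 C x \<in> zero_cells C" "t0 C x \<in> zero_cells C" by simp_all
  note hx = hom_base[OF st(1) X] hom_base[OF st(2) X]
  show "hpre V C X x \<in> cells (Cat2 V)" by (rule hpre_cell) simp_all
  show "hpre V C X (s0 (op C) x) = s0 (Cat2 V) (hpre V C X x)" "hpre V C X (t0 (op C) x) = t0 (Cat2 V) (hpre V C X x)"
    by (simp_all add: hpre_def) (rule vcell_id[OF _ Hom_category]; simp add: hx Hom_objs)+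
  show "hpre V C X (s1 (op C) x) = s1 (Cat2 V) (hpre V C X x)" "hpre V C X (t1 (op C) x) = t1 (Cat2 V) (hpre V C X x)"
    by (simp_all add: hpre_def vcell_s1 vcell_t1 del: Cat2_simps)
next
  fix y x assume "y \<in> cells (op C)" "x \<in> cells (op C)" "s0 (op C) x = t0 (op C) y"
  then have x[simp]: "x \<in> cells C" and y[simp]: "y \<in> cells C" and s: "s0 C y = t0 C x" by simp_all
  have st: "s0 C x \<in> zero_cells C" "t0 C x \<in> zero_cells C" "t0 C y \<in> zero_cells C" by simp_all
  note hx = hom_base[OF st(1) X] hom_base[OF st(2) X] hom_base[OF st(3) X]
  have "hpre V C X x \<star>\<^bsub>Cat2 V\<^esub> hpre V C X y = vcell V (Hom C (t0 C y) X) (Hom C (s0 C x) X)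
     (\<lambda>h. (h \<star>\<^bsub>C\<^esub> s1 C y) \<star>\<^bsub>C\<^esub> s1 C x) (\<lambda>h. (h \<star>\<^bsub>C\<^esub> t1 C y) \<star>\<^bsub>C\<^esub> t1 C x)
     (\<lambda>h. cmp (Hom C (s0 C x) X) ((h \<star>\<^bsub>C\<^esub> t1 C y) \<star>\<^bsub>C\<^esub> x) ((h \<star>\<^bsub>C\<^esub> y) \<star>\<^bsub>C\<^esub> s1 C x))"
    unfolding hpre_def s
    by (rule vcell_hcomp[OF hx(3) Hom_category hx(2) Hom_category hx(1) Hom_category])
      (auto simp: Hom_objs s V)
  also have "\<dots> = hpre V C X (y \<star>\<^bsub>C\<^esub> x)"
    unfolding hpre_def hcat(10)[OF x y s] hcat(11)[OF x y s]
  proof (rule vcell_eqI[OF hx(3) Hom_category])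
    fix h assume "h \<in> objs (Hom C (t0 C y) X)"
    then have h: "h \<in> cells C" "s1 C h = h" "t1 C h = h" "t0 C h = X" "s0 C h = t0 C y" by (auto simp: Hom_objs)
    have "(h \<star>\<^bsub>C\<^esub> y) \<star>\<^bsub>C\<^esub> x = ((h \<star>\<^bsub>C\<^esub> t1 C y) \<star>\<^bsub>C\<^esub> x) \<bullet>\<^bsub>C\<^esub> ((h \<star>\<^bsub>C\<^esub> y) \<star>\<^bsub>C\<^esub> s1 C x)"
      using hcomp_left_right(2)[of x "h \<star>\<^bsub>C\<^esub> y"] h s by simp
    then show "cmp (Hom C (s0 C x) X) ((h \<star>\<^bsub>C\<^esub> t1 C y) \<star>\<^bsub>C\<^esub> x) ((h \<star>\<^bsub>C\<^esub> y) \<star>\<^bsub>C\<^esub> s1 C x) = h \<star>\<^bsub>C\<^esub> (y \<star>\<^bsub>C\<^esub> x)"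
      using h s by (simp add: hassoc)
  qed (auto simp: s hassoc)
  finally show "hpre V C X (x \<star>\<^bsub>op C\<^esub> y) = hpre V C X x \<star>\<^bsub>Cat2 V\<^esub> hpre V C X y" by simp
next
  fix x y assume "x \<in> cells (op C)" "y \<in> cells (op C)" "s1 (op C) y = t1 (op C) x"
  then have x[simp]: "x \<in> cells C" and y[simp]: "y \<in> cells C" and s: "s1 C y = t1 C x" by simp_all
  have p: "s0 C y = s0 C x" "t0 C y = t0 C x" using parallel01[OF x y s] by auto
  have st: "s0 C x \<in> zero_cells C" "t0 C x \<in> zero_cells C" by simp_all
  note hx = hom_base[OF st(1) X] hom_base[OF st(2) X]
  have "hpre V C X y \<bullet>\<^bsub>Cat2 V\<^esub> hpre V C X x = vcell V (Hom C (t0 C x) X) (Hom C (s0 C x) X)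
     (\<lambda>h. h \<star>\<^bsub>C\<^esub> s1 C x) (\<lambda>h. h \<star>\<^bsub>C\<^esub> t1 C y) (\<lambda>h. cmp (Hom C (s0 C x) X) (h \<star>\<^bsub>C\<^esub> y) (h \<star>\<^bsub>C\<^esub> x))"
    unfolding hpre_def p
    by (rule vcell_vcomp[OF hx(2) Hom_category hx(1) Hom_category]) (auto simp: Hom_objs p s)
  also have "\<dots> = hpre V C X (y \<bullet>\<^bsub>C\<^esub> x)"
    unfolding hpre_def vcomp_s0[OF x y s] vcomp_t0[OF x y s]
    by (rule vcell_eqI[OF hx(2) Hom_category]) (auto simp: s p Hom_objs intro!: whisker_left[symmetric])
  finally show "hpre V C X (y \<bullet>\<^bsub>op C\<^esub> x) = hpre V C X y \<bullet>\<^bsub>Cat2 V\<^esub> hpre V C X x" by simp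
qed

text \<open>At a 1-cell \<open>h\<close> both composites are factorisations of the same cell
  \<open>x \<star> h \<star> y\<close>, namely the two of \<open>hcomp_left_right\<close>.\<close>

lemma hpost_hpre:
  assumes x[simp]: "x \<in> cells C" and y[simp]: "y \<in> cells C"
  shows "hpost V C (s0 C y) x \<star>\<^bsub>Cat2 V\<^esub> hpre V C (s0 C x) y = hpre V C (t0 C x) y \<star>\<^bsub>Cat2 V\<^esub> hpost V C (t0 C y) x"
proof -
  note hx = hb[OF y x]
  have "hpost V C (s0 C y) x \<star>\<^bsub>Cat2 V\<^esub> hpre V C (s0 C x) y = vcell V (Hom C (t0 C y) (s0 C x)) (Hom C (s0 C y) (t0 C
      x))
     (\<lambda>h. s1 C x \<star>\<^bsub>C\<^esub> (h \<star>\<^bsub>C\<^esub> s1 C y)) (\<lambda>h. t1 C x \<star>\<^bsub>C\<^esub> (h \<star>\<^bsub>C\<^esub> t1 C y))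
     (\<lambda>h. cmp (Hom C (s0 C y) (t0 C x)) (x \<star>\<^bsub>C\<^esub> (h \<star>\<^bsub>C\<^esub> t1 C y)) (s1 C x \<star>\<^bsub>C\<^esub> (h \<star>\<^bsub>C\<^esub> y)))"
    unfolding hpost_def hpre_def
    by (rule vcell_hcomp[OF hx(3) Hom_category hx(1) Hom_category hx(2) Hom_category])
      (auto simp: Hom_objs V)
  also have "\<dots> = vcell V (Hom C (t0 C y) (s0 C x)) (Hom C (s0 C y) (t0 C x))
     (\<lambda>h. (s1 C x \<star>\<^bsub>C\<^esub> h) \<star>\<^bsub>C\<^esub> s1 C y) (\<lambda>h. (t1 C x \<star>\<^bsub>C\<^esub> h) \<star>\<^bsub>C\<^esub> t1 C y)
     (\<lambda>h. cmp (Hom C (s0 C y) (t0 C x)) ((t1 C x \<star>\<^bsub>C\<^esub> h) \<star>\<^bsub>C\<^esub> y) ((x \<star>\<^bsub>C\<^esub> h) \<star>\<^bsub>C\<^esub> s1 C y))"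
  proof (rule vcell_eqI[OF hx(3) Hom_category])
    fix h assume "h \<in> objs (Hom C (t0 C y) (s0 C x))"
    then have h: "h \<in> cells C" "s1 C h = h" "t1 C h = h" "t0 C h = s0 C x" "s0 C h = t0 C y" by (auto simp: Hom_objs)
    have "(x \<star>\<^bsub>C\<^esub> (h \<star>\<^bsub>C\<^esub> t1 C y)) \<bullet>\<^bsub>C\<^esub> (s1 C x \<star>\<^bsub>C\<^esub> (h \<star>\<^bsub>C\<^esub> y)) = x \<star>\<^bsub>C\<^esub> (h \<star>\<^bsub>C\<^esub> y)"
      using hcomp_left_right(1)[of "h \<star>\<^bsub>C\<^esub> y" x] h by simp
    also have "\<dots> = (x \<star>\<^bsub>C\<^esub> h) \<star>\<^bsub>C\<^esub> y" using h by (simp add: hassoc)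
    also have "\<dots> = ((t1 C x \<star>\<^bsub>C\<^esub> h) \<star>\<^bsub>C\<^esub> y) \<bullet>\<^bsub>C\<^esub> ((x \<star>\<^bsub>C\<^esub> h) \<star>\<^bsub>C\<^esub> s1 C y)"
      using hcomp_left_right(2)[of y "x \<star>\<^bsub>C\<^esub> h"] h by simp
    finally show "cmp (Hom C (s0 C y) (t0 C x)) (x \<star>\<^bsub>C\<^esub> (h \<star>\<^bsub>C\<^esub> t1 C y)) (s1 C x \<star>\<^bsub>C\<^esub> (h \<star>\<^bsub>C\<^esub> y)) =
        cmp (Hom C (s0 C y) (t0 C x)) ((t1 C x \<star>\<^bsub>C\<^esub> h) \<star>\<^bsub>C\<^esub> y) ((x \<star>\<^bsub>C\<^esub> h) \<star>\<^bsub>C\<^esub> s1 C y)" by simp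
  qed (auto simp: hassoc)
  also have "\<dots> = hpre V C (t0 C x) y \<star>\<^bsub>Cat2 V\<^esub> hpost V C (t0 C y) x"
    unfolding hpost_def hpre_def
    by (rule vcell_hcomp[OF hx(3) Hom_category hx(4) Hom_category hx(2) Hom_category, symmetric])
      (auto simp: Hom_objs V)
  finally show ?thesis .
qed

text \<open>The universal property in \<open>C\<close> is stated for 2-cells out of an arbitrary
  object. For the object \<open>X\<close> it is already the criterion of \<open>Cat2_commaI\<close>
  on arrows of hom-categories, up to transport along \<open>enc\<close> and
  \<open>dec\<close>.\<close>

lemma hpost_comma:
  assumes K: "is_comma C h p q k" and X[simp]: "X \<in> zero_cells C"
  shows "is_comma (Cat2 V) (hpost V C X h) (hpost V C X p) (hpost V C X q) (hpost V C X k)"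
proof -
  interpret CV: twocat "Cat2 V" by (rule twocat_V)
  note D = commaD[OF K]
  note P = hpost_functor[OF X]
  note Pc = two_functorD[OF P] and Pv = two_functor_verD[OF P _ two_cat]
  have st: "s0 C h \<in> zero_cells C" "t0 C h \<in> zero_cells C" "s0 C p \<in> zero_cells C" using D by simp_all
  note hx = hom_base[OF X st(1)] hom_base[OF X st(2)] hom_base[OF X st(3)]
  let ?A = "Hom C X (s0 C h)" and ?B = "Hom C X (t0 C h)" and ?E = "Hom C X (s0 C p)"
  note eA = enc_arrs[OF hx(1) Hom_category] src_enc[OF hx(1) Hom_category] tgt_enc[OF hx(1) Hom_category]
    dec_arrs[OF hx(1) Hom_category] enc_dec[OF hx(1) Hom_category] dec_enc[OF hx(1) Hom_category]
    dec_src[OF hx(1) Hom_category] dec_tgt[OF hx(1) Hom_category]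
  note eB = enc_arrs[OF hx(2) Hom_category] src_enc[OF hx(2) Hom_category] tgt_enc[OF hx(2) Hom_category]
    dec_arrs[OF hx(2) Hom_category] enc_dec[OF hx(2) Hom_category] dec_enc[OF hx(2) Hom_category]
    dec_src[OF hx(2) Hom_category] dec_tgt[OF hx(2) Hom_category]
  note eE = enc_arrs[OF hx(3) Hom_category] src_enc[OF hx(3) Hom_category] tgt_enc[OF hx(3) Hom_category]
    dec_arrs[OF hx(3) Hom_category] enc_dec[OF hx(3) Hom_category] dec_enc[OF hx(3) Hom_category]
    dec_src[OF hx(3) Hom_category] dec_tgt[OF hx(3) Hom_category]
  show ?thesis
  proof (rule Cat2_commaI[OF V])
    show "hpost V C X h \<in> one_cells (Cat2 V)" "hpost V C X p \<in> one_cells (Cat2 V)" "hpost V C X q \<in> one_cells (Cat2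
        V)"
      "hpost V C X k \<in> cells (Cat2 V)"
      using D Pc Pv by (simp_all add: CV.one_cells_iff del: Cat2_simps)
    show "ntgt (hpost V C X p) = nsrc (hpost V C X h)" "nsrc (hpost V C X q) = nsrc (hpost V C X p)"
      "ntgt (hpost V C X q) = ntgt (hpost V C X h)"
      using D by (simp_all add: hpost_def)
    show "s1 (Cat2 V) (hpost V C X k) = hpost V C X q" using D Pv by (simp del: Cat2_simps)
    show "t1 (Cat2 V) (hpost V C X k) = hpost V C X h \<star>\<^bsub>Cat2 V\<^esub> hpost V C X p"
      using D Pv two_functor_comp(1)[OF P] by (simp del: Cat2_simps)
  next
    fix a b l l'
    assume "a \<in> arrs (nsrc (hpost V C X h))" "b \<in> arrs (ntgt (hpost V C X h))" "l \<in> arrs (ntgt (hpost V C X h))"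
      "l' \<in> arrs (ntgt (hpost V C X h))"
      "src (ntgt (hpost V C X h)) l = src (ntgt (hpost V C X h)) b"
      "tgt (ntgt (hpost V C X h)) l = nfrom (hpost V C X h) (src (nsrc (hpost V C X h)) a)"
      "src (ntgt (hpost V C X h)) l' = tgt (ntgt (hpost V C X h)) b"
      "tgt (ntgt (hpost V C X h)) l' = nfrom (hpost V C X h) (tgt (nsrc (hpost V C X h)) a)"
      "cmp (ntgt (hpost V C X h)) l' b = cmp (ntgt (hpost V C X h)) (nfrom (hpost V C X h) a) l"
    then have m: "a \<in> arrs (robj V ?A)" "b \<in> arrs (robj V ?B)" "l \<in> arrs (robj V ?B)" "l' \<in> arrs (robj V ?B)"
      and e: "src (robj V ?B) l = src (robj V ?B) b"
        "tgt (robj V ?B) l = nfrom (hpost V C X h) (src (robj V ?A) a)"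
        "src (robj V ?B) l' = tgt (robj V ?B) b"
        "tgt (robj V ?B) l' = nfrom (hpost V C X h) (tgt (robj V ?A) a)"
        "cmp (robj V ?B) l' b = cmp (robj V ?B) (nfrom (hpost V C X h) a) l"
      by (simp_all add: hpost_def)
    define a' b' u u' where "a' = dec V ?A a" and "b' = dec V ?B b" and "u = dec V ?B l" and "u' = dec V ?B l'"
    have a': "a' \<in> cells C" "s0 C a' = X" "t0 C a' = s0 C h" using eA(4)[OF m(1)] by (auto simp: a'_def)
    have b': "b' \<in> cells C" "s0 C b' = X" "t0 C b' = t0 C h" using eB(4)[OF m(2)] by (auto simp: b'_def)
    have u: "u \<in> cells C" "s0 C u = X" "t0 C u = t0 C h" using eB(4)[OF m(3)] by (auto simp: u_def)
    have u': "u' \<in> cells C" "s0 C u' = X" "t0 C u' = t0 C h" using eB(4)[OF m(4)] by (auto simp: u'_def)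
    have enc: "a = enc V ?A a'" "b = enc V ?B b'" "l = enc V ?B u" "l' = enc V ?B u'"
      using m eA(5) eB(5) by (simp_all add: a'_def b'_def u_def u'_def)
    have hf: "nfrom (hpost V C X h) (enc V ?A x) = enc V ?B (h \<star>\<^bsub>C\<^esub> x)" if "x \<in> cells C" "s0 C x = X" "t0 C x = s0 C
        h" for x
      using that eA D by (simp add: hpost_def)
    have inj: "enc V ?B x = enc V ?B y \<longleftrightarrow> x = y" if "x \<in> cells C" "s0 C x = X" "t0 C x = t0 C h" "y \<in> cells C" "s0 C y
        = X" "t0 C y = t0 C h" for x y
      using enc_inj[OF hx(2) Hom_category, of x y] that by simp
    have c1: "s1 C u = s1 C b'" using e(1) b' u eB unfolding enc by (simp add: inj)
    have c2: "t1 C u = h \<star>\<^bsub>C\<^esub> s1 C a'" using e(2) a' u eB eA D unfolding enc by (simp add: inj hf)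
    have c3: "s1 C u' = t1 C b'" using e(3) b' u' eB unfolding enc by (simp add: inj)
    have c4: "t1 C u' = h \<star>\<^bsub>C\<^esub> t1 C a'" using e(4) a' u' eB eA D unfolding enc by (simp add: inj hf)
    have c5: "u' \<bullet>\<^bsub>C\<^esub> b' = (h \<star>\<^bsub>C\<^esub> a') \<bullet>\<^bsub>C\<^esub> u"
    proof -
      have "cmp (robj V ?B) l' b = enc V ?B (u' \<bullet>\<^bsub>C\<^esub> b')"
        unfolding enc using cmp_enc[OF hx(2) Hom_category, of b' u'] b' u' c3 by simp
      moreover have "cmp (robj V ?B) (nfrom (hpost V C X h) a) l = enc V ?B ((h \<star>\<^bsub>C\<^esub> a') \<bullet>\<^bsub>C\<^esub> u)"
        unfolding enc hf[OF a'] using cmp_enc[OF hx(2) Hom_category, of u "h \<star>\<^bsub>C\<^esub> a'"] a' u c2 D by simp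
      ultimately show ?thesis using e(5) b' u' c3 a' u c2 D by (simp add: inj)
    qed
    have U: "\<exists>!c. c \<in> cells C \<and> s0 C c = s0 C a' \<and> t0 C c = s0 C p \<and> p \<star>\<^bsub>C\<^esub> c = a' \<and> q \<star>\<^bsub>C\<^esub> c = b' \<and>
       k \<star>\<^bsub>C\<^esub> s1 C c = u \<and> k \<star>\<^bsub>C\<^esub> t1 C c = u'"
      by (rule comma_univ[OF K]) (simp_all add: a' b' u u' c1 c2 c3 c4 c5)
    then obtain c where c: "c \<in> cells C" "s0 C c = X" "t0 C c = s0 C p" "p \<star>\<^bsub>C\<^esub> c = a'" "q \<star>\<^bsub>C\<^esub> c = b'"
       "k \<star>\<^bsub>C\<^esub> s1 C c = u" "k \<star>\<^bsub>C\<^esub> t1 C c = u'" using a' by auto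
    have ev: "nfrom (hpost V C X p) d = enc V ?A (p \<star>\<^bsub>C\<^esub> dec V ?E d)" "nfrom (hpost V C X q) d = enc V ?B (q \<star>\<^bsub>C\<^esub> dec
        V ?E d)"
       "nat_at (hpost V C X k) (src (robj V ?E) d) = enc V ?B (k \<star>\<^bsub>C\<^esub> s1 C (dec V ?E d))"
       "nat_at (hpost V C X k) (tgt (robj V ?E) d) = enc V ?B (k \<star>\<^bsub>C\<^esub> t1 C (dec V ?E d))" if d: "d \<in> arrs (robj V ?E)"
           for d
      using d D eE(7,8)[OF d] src_tgt_objs[OF V[OF rep_props(1)[OF hx(3)]] d] by (simp_all add: hpost_def)
    show "\<exists>!c. c \<in> arrs (nsrc (hpost V C X p)) \<and> nfrom (hpost V C X p) c = a \<and> nfrom (hpost V C X q) c = b \<and>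
        nat_at (hpost V C X k) (src (nsrc (hpost V C X p)) c) = l \<and> nat_at (hpost V C X k) (tgt (nsrc (hpost V C X p))
            c) = l'"
    proof -
      have ns: "nsrc (hpost V C X p) = robj V ?E" by (simp add: hpost_def)
      show ?thesis unfolding ns
      proof (rule ex1I[of _ "enc V ?E c"])
        have "enc V ?E c \<in> arrs (robj V ?E)" "dec V ?E (enc V ?E c) = c" using c eE(1)[of c] eE(6)[of c] by auto
        then show "enc V ?E c \<in> arrs (robj V ?E) \<and> nfrom (hpost V C X p) (enc V ?E c) = a \<and> nfrom (hpost V C X q) (enc
            V ?E c) = b \<and>
           nat_at (hpost V C X k) (src (robj V ?E) (enc V ?E c)) = l \<and> nat_at (hpost V C X k) (tgt (robj V ?E) (enc V
               ?E c)) = l'"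
          using ev[of "enc V ?E c"] c enc by simp
      next
        fix d assume d: "d \<in> arrs (robj V ?E) \<and> nfrom (hpost V C X p) d = a \<and> nfrom (hpost V C X q) d = b \<and>
           nat_at (hpost V C X k) (src (robj V ?E) d) = l \<and> nat_at (hpost V C X k) (tgt (robj V ?E) d) = l'"
        let ?d = "dec V ?E d"
        have dd: "?d \<in> cells C" "s0 C ?d = X" "t0 C ?d = s0 C p" using eE(4)[of d] d by auto
        have dm: "d \<in> arrs (robj V ?E)" and d': "nfrom (hpost V C X p) d = a" "nfrom (hpost V C X q) d = b"
          "nat_at (hpost V C X k) (src (robj V ?E) d) = l" "nat_at (hpost V C X k) (tgt (robj V ?E) d) = l'"
          using d by auto
        have pd: "p \<star>\<^bsub>C\<^esub> ?d \<in> arrs ?A" "a' \<in> arrs ?A" using dd a' D(4,13) by simp_all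
        have "enc V ?A (p \<star>\<^bsub>C\<^esub> ?d) = enc V ?A a'" by (rule trans[OF ev(1)[OF dm, symmetric] trans[OF d'(1) enc(1)]])
        then have "p \<star>\<^bsub>C\<^esub> ?d = a'" using enc_inj[OF hx(1) Hom_category pd] by blast
        moreover have "enc V ?B (q \<star>\<^bsub>C\<^esub> ?d) = enc V ?B b'" by (rule trans[OF ev(2)[OF dm, symmetric] trans[OF d'(2)
            enc(2)]])
        then have "q \<star>\<^bsub>C\<^esub> ?d = b'" by (subst (asm) inj) (use dd b' D(7,14,15) in simp_all)
        moreover have "enc V ?B (k \<star>\<^bsub>C\<^esub> s1 C ?d) = enc V ?B u" by (rule trans[OF ev(3)[OF dm, symmetric] trans[OF
            d'(3) enc(3)]])
        then have "k \<star>\<^bsub>C\<^esub> s1 C ?d = u" by (subst (asm) inj) (use dd u D(10,16,17) in simp_all)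
        moreover have "enc V ?B (k \<star>\<^bsub>C\<^esub> t1 C ?d) = enc V ?B u'" by (rule trans[OF ev(4)[OF dm, symmetric] trans[OF
            d'(4) enc(4)]])
        then have "k \<star>\<^bsub>C\<^esub> t1 C ?d = u'" by (subst (asm) inj) (use dd u' D(10,16,17) in simp_all)
        ultimately have P: "p \<star>\<^bsub>C\<^esub> ?d = a' \<and> q \<star>\<^bsub>C\<^esub> ?d = b' \<and> k \<star>\<^bsub>C\<^esub> s1 C ?d = u \<and> k \<star>\<^bsub>C\<^esub> t1 C ?d = u'" by blast
        have "?d = c" by (rule comma_eq[OF K]) (use P c dd in simp_all)
        then show "d = enc V ?E c" using eE(5)[of d] d by auto
      qed
    qed
  qed
qed

end

section \<open>The arrow category, terminal and empty categories and pullbacks inside the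
  base\<close>

section \<open>Limits in the base\<close>

lemma Ex1_unique: "\<exists>!x. P x \<Longrightarrow> P a \<Longrightarrow> P b \<Longrightarrow> a = b"
  by blast

lemma underlying_simps [simp]:
  "arrs (underlying K) = one_cells K" "src (underlying K) = s0 K" "tgt (underlying K) = t0 K"
  "cmp (underlying K) = cmp (hor K)"
  by (simp_all add: underlying_def)

lemma dual_simps [simp]: "arrs (dual X) = arrs X" "src (dual X) = tgt X" "tgt (dual X) = src X" "cmp (dual X) g f =
    cmp X f g"
  by (simp_all add: dual_def)

text \<open>A functor seen as a 1-cell, that is as the identity transformation on it. The
  restrictions make it a cell even if the function is not extensional.\<close>

definition fcell :: "'u cat \<Rightarrow> 'u cat \<Rightarrow> ('u \<Rightarrow> 'u) \<Rightarrow> 'u nt" where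
  "fcell X Y F = Nt X (restrict F (arrs X)) (restrict F (arrs X)) (restrict F (objs X)) Y"

lemma fcell_simps [simp]:
  "nsrc (fcell X Y F) = X" "ntgt (fcell X Y F) = Y" "nfrom (fcell X Y F) = restrict F (arrs X)"
  "nto (fcell X Y F) = restrict F (arrs X)" "nat_at (fcell X Y F) = restrict F (objs X)"
  by (simp_all add: fcell_def)

lemma objs_arrs: "a \<in> objs X \<Longrightarrow> a \<in> arrs X"
  by (simp add: objs_def)

lemma fcell_one_cell:
  assumes "X \<in> S" "Y \<in> S" "category X" "category Y" "is_functor X Y F"
  shows "fcell X Y F \<in> one_cells (Cat2 S)"
proof -
  have "is_functor X Y (restrict F (arrs X))"
    using assms(5) by (auto simp: is_functor_def category_simps[OF assms(3)])
  moreover have "nat_trans X Y (restrict F (arrs X)) (restrict F (arrs X)) (restrict F (objs X))"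
    unfolding nat_trans_def
    by (auto simp: objs_arrs functorD[OF assms(5)] objsD[OF assms(3)] src_tgt_objs[OF assms(3)]
        category_simps[OF assms(3)] category_simps[OF assms(4)])
  ultimately show ?thesis unfolding Cat2_one_cells
    using assms by (auto simp: Cat2_cell_iff objs_arrs intro!: restrict_ext)
qed

lemma fcell_eq: "fcell X Y F = fcell X Y G \<Longrightarrow> f \<in> arrs X \<Longrightarrow> F f = G f"
  by (metis fcell_simps(3) restrict_apply')

lemma one_cell_fcell: "x \<in> one_cells (Cat2 S) \<Longrightarrow> x = fcell (nsrc x) (ntgt x) (nfrom x)"
  unfolding Cat2_one_cells Cat2_cell_iff
  by (rule nt.expand) (auto intro: extensional_restrict[symmetric])

lemma Cat2_one_functor: "x \<in> one_cells (Cat2 S) \<Longrightarrow> is_functor (nsrc x) (ntgt x) (nfrom x) \<and> nsrc x \<in> S \<and> ntgt x \<in> S"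
  unfolding Cat2_one_cells Cat2_cell_iff by simp

lemma fcell_comp:
  assumes "x \<in> one_cells (Cat2 S)" "y \<in> one_cells (Cat2 S)" "nsrc y = ntgt x" "\<And>X. X \<in> S \<Longrightarrow> category X"
  shows "y \<star>\<^bsub>Cat2 S\<^esub> x = fcell (nsrc x) (ntgt y) (\<lambda>f. nfrom y (nfrom x f))"
proof -
  interpret twocat "Cat2 S" by (rule twocat_Cat2[OF assms(4)])
  have "y \<star>\<^bsub>Cat2 S\<^esub> x \<in> one_cells (Cat2 S)"
    using assms(1-3) one_cellD[OF assms(1)] one_cellD[OF assms(2)] unfolding one_cells_iff by (simp del:
        Cat2_simps(3-6))
  from one_cell_fcell[OF this] show ?thesis by (simp add: fcell_def) (auto intro!: restrict_ext simp: objs_arrs)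
qed

locale base =
  fixes V :: "'u cat set"
  assumes base: "base_2category V"
begin

lemma V_small: "V \<subseteq> small_cats"
  and V_lim: "\<And>I D. I \<in> small_cats \<Longrightarrow> is_functor I (underlying (Cat2 V)) (D :: 'u \<Rightarrow> 'u nt) \<Longrightarrow>
        \<exists>X\<in>V. \<exists>p. is_limit (underlying (Cat2 small_cats)) I D (idnt X) p"
  and V_colim: "\<And>I D. I \<in> small_cats \<Longrightarrow> is_functor I (underlying (Cat2 V)) (D :: 'u \<Rightarrow> 'u nt) \<Longrightarrow>
        \<exists>v p. is_limit (dual (underlying (Cat2 V))) (dual I) D v p"
  and V_arrow: "in_base V arrow_cat" and univ: "universe TYPE('u)"
  using base unfolding base_2category_def by blast+

lemma small_category: "X \<in> small_cats \<Longrightarrow> category X"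
  by (simp add: small_cats_def)

lemma V_category: "X \<in> V \<Longrightarrow> category X"
  using V_small small_category by blast

text \<open>For a universe of finite size \<open>n\<close>, the strong limit condition on a subset
  of size \<open>n - 1\<close> would give \<open>2 ^ (n - 1) < n\<close>. Infinity makes finite
  shapes small and supplies distinct names for the objects and arrows of a diagram.\<close>

lemma infinite_universe: "infinite (UNIV :: 'u set)"
proof
  assume fin: "finite (UNIV :: 'u set)"
  obtain a :: 'u where True by simp
  let ?A = "UNIV - {a}"
  have lt: "A \<prec> B \<longleftrightarrow> card A < card B" if "finite A" "finite B" for A :: "'x set" and B :: "'u set"
    using that by (simp add: lesspoll_def lepoll_iff_card_le eqpoll_iff_card) linarith
  have c: "card ?A < card (UNIV :: 'u set)" using fin by (intro psubset_card_mono) auto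
  then have "?A \<prec> (UNIV :: 'u set)" using lt[of ?A UNIV] fin by simp
  then have "Pow ?A \<prec> (UNIV :: 'u set)" using univ unfolding universe_def by blast
  then have "2 ^ card ?A < card (UNIV :: 'u set)" using lt[of "Pow ?A" UNIV] fin by (simp add: card_Pow)
  moreover have "card (UNIV :: 'u set) \<le> Suc (card ?A)" using fin by (simp add: card_Diff_singleton)
  moreover have "card ?A < 2 ^ card ?A" by (rule less_exp)
  ultimately show False by linarith
qed

lemma finite_small: "finite A \<Longrightarrow> A \<prec> (UNIV :: 'u set)"
  by (rule finite_lesspoll_infinite) (rule infinite_universe)

text \<open>The copy of the arrow category in \<open>V\<close>, with names for its three arrows.
  Functors out of it are arrows, its two objects separate constant functors, and it serves both as a
  shape and as a value of a weight for comma objects.\<close>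

definition Y :: "'u cat" where "Y = robj V arrow_cat"
definition o0 :: 'u where "o0 = enc V arrow_cat (False, False)"
definition o1 :: 'u where "o1 = enc V arrow_cat (True, True)"
definition ar :: 'u where "ar = enc V arrow_cat (False, True)"

lemma arrow_category: "category arrow_cat"
  by (auto simp: category_def arrow_cat_def)

lemma YV: "Y \<in> V" "category Y"
  using rep_props(1)[OF V_arrow] V_category by (auto simp: Y_def)

lemma Y_arrs: "arrs Y = {o0, o1, ar}"
proof -
  have "arrs arrow_cat = {(False, False), (True, True), (False, True)}" by (auto simp: arrow_cat_def)
  then show ?thesis using enc_bij[OF V_arrow arrow_category] by (auto simp: bij_betw_def Y_def o0_def o1_def ar_def)
qed

lemma Y_distinct [simp]: "o0 \<noteq> o1" "ar \<noteq> o0" "ar \<noteq> o1" "o1 \<noteq> o0" "o0 \<noteq> ar" "o1 \<noteq> ar"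
  using enc_inj[OF V_arrow arrow_category] by (auto simp: o0_def o1_def ar_def arrow_cat_def)

lemma Y_st [simp]: "src Y o0 = o0" "tgt Y o0 = o0" "src Y o1 = o1" "tgt Y o1 = o1" "src Y ar = o0" "tgt Y ar = o1"
proof -
  have m: "(False, False) \<in> arrs arrow_cat" "(True, True) \<in> arrs arrow_cat" "(False, True) \<in> arrs arrow_cat"
    by (simp_all add: arrow_cat_def)
  note r = src_enc[OF V_arrow arrow_category] tgt_enc[OF V_arrow arrow_category]
  show "src Y o0 = o0" "tgt Y o0 = o0" "src Y o1 = o1" "tgt Y o1 = o1" "src Y ar = o0" "tgt Y ar = o1"
    unfolding Y_def o0_def o1_def ar_def
    by (simp_all add: r m) (simp_all add: arrow_cat_def)
qed

lemma Y_mem [simp]: "o0 \<in> arrs Y" "o1 \<in> arrs Y" "ar \<in> arrs Y"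
  by (simp_all add: Y_arrs)

lemma Y_objs: "objs Y = {o0, o1}"
  by (auto simp: objs_def Y_arrs)

text \<open>The functor out of \<open>Y\<close> that classifies the arrow \<open>a\<close>; it is
  meaningful on the arrows of \<open>Y\<close>.\<close>

definition pick :: "'x cat \<Rightarrow> 'x \<Rightarrow> 'u \<Rightarrow> 'x" where
  "pick X a y = (if y = o0 then src X a else if y = o1 then tgt X a else a)"

lemma pick_simps [simp]: "pick X a o0 = src X a" "pick X a o1 = tgt X a" "pick X a ar = a"
  by (simp_all add: pick_def)

lemma pick_functor:
  assumes "category X" "a \<in> arrs X"
  shows "is_functor Y X (pick X a)"
proof -
  have c: "cmp Y o0 o0 = o0" "cmp Y o1 o1 = o1" "cmp Y ar o0 = ar" "cmp Y o1 ar = ar"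
    by (simp_all add: category_simps(7,8)[OF YV(2)])
  have "pick X a (cmp Y g f) = cmp X (pick X a g) (pick X a f)" if "f \<in> arrs Y" "g \<in> arrs Y" "src Y g = tgt Y f" for f
      g
    using that assms(2) unfolding Y_arrs by (auto simp: c category_simps[OF assms(1)])
  then show ?thesis using assms unfolding is_functor_def by (auto simp: Y_arrs category_simps[OF assms(1)])
qed

lemma functor_pick:
  assumes "is_functor Y X F" "y \<in> arrs Y"
  shows "F y = pick X (F ar) y"
  using functorD(2,3)[OF assms(1), of ar] assms(2) by (auto simp: Y_arrs)

abbreviation "I0 \<equiv> \<lparr>arrs = {}, src = (\<lambda>x. x), tgt = (\<lambda>x. x), cmp = (\<lambda>y x. x)\<rparr> :: 'u cat"

lemma I0: "I0 \<in> small_cats" "is_functor I0 K D" "objs I0 = {}"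
  using finite_small[of "{}"] by (simp_all add: small_cats_def category_def is_functor_def objs_def)

lemma idnt_zero: "X \<in> S \<Longrightarrow> category X \<Longrightarrow> idnt X \<in> one_cells (Cat2 S)"
proof -
  assume a: "X \<in> S" "category X"
  have "is_functor X X (\<lambda>f. f)" by (simp add: is_functor_def)
  from fcell_one_cell[OF a(1,1,2,2) this] show ?thesis by (simp add: fcell_def idnt_def)
qed

text \<open>The limit of the empty diagram. A functor from \<open>Y\<close> to it exists, so it has
  an arrow; such functors are unique and classify arrows, so it has only one.\<close>

lemma terminal_ex: "\<exists>X\<in>V. \<exists>a. arrs X = {a}"
proof -
  obtain X p where X: "X \<in> V" and lim: "is_limit (underlying (Cat2 small_cats)) I0 (\<lambda>x. undefined) (idnt X) p"
    using V_lim[OF I0(1,2)] by blast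
  have cX: "category X" using V_category X .
  have "idnt Y \<in> objs (underlying (Cat2 small_cats))"
    using idnt_zero[of Y small_cats] YV V_small by (auto simp: objs_def[of "underlying _"])
  then have ex: "\<exists>!h. h \<in> one_cells (Cat2 small_cats) \<and> s0 (Cat2 small_cats) h = idnt Y \<and> t0 (Cat2 small_cats) h =
      idnt X"
  proof -
    have "\<forall>w. w \<in> objs (underlying (Cat2 small_cats)) \<longrightarrow> (\<exists>!h. h \<in> one_cells (Cat2 small_cats) \<and> s0 (Cat2 small_cats) h
        = w \<and>
        t0 (Cat2 small_cats) h = idnt X)"
      using lim unfolding is_limit_def Let_def I0(3) by (simp del: Cat2_simps)
    then show ?thesis using \<open>idnt Y \<in> objs _\<close> by blast
  qed
  then obtain h where "h \<in> one_cells (Cat2 small_cats)" "nsrc h = Y" "ntgt h = X" by auto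
  then have ne: "nfrom h ar \<in> arrs X" using functorD(1)[of Y X "nfrom h" ar] Cat2_one_functor by fastforce
  have "a = b" if "a \<in> arrs X" "b \<in> arrs X" for a b
  proof -
    have "fcell Y X (pick X a) \<in> one_cells (Cat2 small_cats)" "fcell Y X (pick X b) \<in> one_cells (Cat2 small_cats)"
      using fcell_one_cell[OF _ _ YV(2) cX pick_functor[OF cX]] that X YV V_small by blast+
    then have "fcell Y X (pick X a) = fcell Y X (pick X b)" using ex by auto
    from fcell_eq[OF this, of ar] show "a = b" by simp
  qed
  then show ?thesis using X ne by (intro bexI[of _ X] exI[of _ "nfrom h ar"]) auto
qed

text \<open>Colimits of the base need not be those of \<open>Cat\<close>, so emptiness of the
  initial object has to be proved. The two constant functors from it to \<open>Y\<close> must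
  coincide, which leaves no room for an arrow.\<close>

lemma empty_ex: "\<exists>X\<in>V. arrs X = {}"
proof -
  obtain v p where lim: "is_limit (dual (underlying (Cat2 V))) (dual I0) (\<lambda>x. undefined) v p"
    using V_colim[OF I0(1,2)] by blast
  have o0': "objs (dual I0) = {}" by (simp add: objs_def)
  have v: "v \<in> one_cells (Cat2 V)" "t0 (Cat2 V) v = v"
    using lim unfolding is_limit_def Let_def by (auto simp: objs_def[of "dual _"])
  then obtain X where X: "v = idnt X" "X \<in> V" using Cat2_one_functor[OF v(1)] by (metis Cat2_simps(2))
  have cX: "category X" using V_category X(2) .
  have "idnt Y \<in> objs (dual (underlying (Cat2 V)))"
    using idnt_zero[OF YV] by (auto simp: objs_def[of "dual _"])
  then have ex: "\<exists>!h. h \<in> one_cells (Cat2 V) \<and> t0 (Cat2 V) h = idnt Y \<and> s0 (Cat2 V) h = idnt X"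
  proof -
    have "\<forall>w. w \<in> objs (dual (underlying (Cat2 V))) \<longrightarrow> (\<exists>!h. h \<in> one_cells (Cat2 V) \<and> t0 (Cat2 V) h = w \<and> s0 (Cat2 V) h
        = v)"
      using lim unfolding is_limit_def Let_def o0' by (simp del: Cat2_simps)
    then show ?thesis using \<open>idnt Y \<in> objs _\<close> unfolding X(1) by blast
  qed
  have "is_functor X Y (\<lambda>x. o0)" "is_functor X Y (\<lambda>x. o1)" by (auto simp: is_functor_def category_simps[OF YV(2)])
  then have "fcell X Y (\<lambda>x. o0) \<in> one_cells (Cat2 V)" "fcell X Y (\<lambda>x. o1) \<in> one_cells (Cat2 V)"
    using fcell_one_cell[OF X(2) YV(1) cX YV(2)] by blast+
  then have "fcell X Y (\<lambda>x. o0) = fcell X Y (\<lambda>x. o1)" using ex by auto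
  from fcell_eq[OF this] have "arrs X = {}" by auto
  then show ?thesis using X by blast
qed

text \<open>Objects and arrows of a limit in the base are functors into it from the terminal category and from
  the arrow category.\<close>

lemma pullback_ex:
  assumes F: "F \<in> one_cells (Cat2 V)" and G: "G \<in> one_cells (Cat2 V)" and FG: "ntgt F = ntgt G"
  shows "\<exists>X\<in>V. \<exists>p q. is_functor X (nsrc F) p \<and> is_functor X (nsrc G) q \<and> (\<forall>x\<in>arrs X. nfrom F (p x) = nfrom G (q x)) \<and>
    (\<forall>a\<in>arrs (nsrc F). \<forall>b\<in>arrs (nsrc G). nfrom F a = nfrom G b \<longrightarrow> (\<exists>!x. x \<in> arrs X \<and> p x = a \<and> q x = b))"
proof -
  interpret CV: twocat "Cat2 V" by (rule twocat_Cat2[OF V_category])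
  interpret S: twocat "Cat2 small_cats" by (rule twocat_Cat2[OF small_category])
  let ?S = "Cat2 small_cats"
  obtain g :: "nat \<Rightarrow> 'u" where g: "inj g" using infinite_countable_subset[OF infinite_universe] by auto
  have gi: "inv g (g n) = n" for n using g by simp
  have gd: "g n = g k \<longleftrightarrow> n = k" for n k using g by (simp add: inj_eq)
  \<comment> \<open>The shape of a cospan. The codes 0, 2, 3 are objects, 4 is an arrow from 0 to 3,
    and 5 one from 2 to 3. In every composable pair one member is an identity, and comparing the
    code of \<open>x\<close> with 3 tells whether it is \<open>x\<close>.\<close>
  define I :: "'u cat" where "I = \<lparr>arrs = g ` {0,2,3,4,5},
     src = (\<lambda>x. g (if inv g x = 4 then 0 else if inv g x = 5 then 2 else inv g x)),
     tgt = (\<lambda>x. g (if inv g x = 4 then 3 else if inv g x = 5 then 3 else inv g x)),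
     cmp = (\<lambda>y x. if inv g x \<le> 3 then y else x)\<rparr>"
  have Is: "arrs I = {g 0, g 2, g 3, g 4, g 5}" "src I (g 0) = g 0" "src I (g 2) = g 2" "src I (g 3) = g 3"
    "src I (g 4) = g 0" "src I (g 5) = g 2" "tgt I (g 0) = g 0" "tgt I (g 2) = g 2" "tgt I (g 3) = g 3"
    "tgt I (g 4) = g 3" "tgt I (g 5) = g 3" "\<And>y n. cmp I y (g n) = (if n \<le> 3 then y else g n)"
    unfolding I_def by (auto simp: gi)
  have Io: "objs I = {g 0, g 2, g 3}" by (auto simp: objs_def Is gd)
  have "category I" unfolding category_def by (auto simp: Is gd)
  then have I: "I \<in> small_cats" using finite_small[of "arrs I"] by (simp add: small_cats_def Is(1))
  let ?A = "nsrc F" and ?B = "nsrc G" and ?C = "ntgt G"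
  have abc: "?A \<in> V" "?B \<in> V" "?C \<in> V" "is_functor ?A ?C (nfrom F)" "is_functor ?B ?C (nfrom G)"
    using Cat2_one_functor[OF F] Cat2_one_functor[OF G] FG by auto
  have idV: "idnt Z \<in> zero_cells (Cat2 V)" if "Z \<in> V" for Z
    using idnt_zero[OF that V_category[OF that]] CV.one_cellD(1) by (auto simp: zero_cells_iff)
  define D where "D x = (if x = g 0 then idnt ?A else if x = g 2 then idnt ?B else if x = g 3 then idnt ?C else if x =
      g 4 then F else G)" for x
  have Ds: "D (g 0) = idnt ?A" "D (g 2) = idnt ?B" "D (g 3) = idnt ?C" "D (g 4) = F" "D (g 5) = G" by (simp_all add:
      D_def gd)
  note z = idV[OF abc(1)] idV[OF abc(2)] idV[OF abc(3)]
  note fgc = CV.one_cellD[OF F] CV.one_cellD[OF G]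
  have st: "s0 (Cat2 V) F = idnt ?A" "t0 (Cat2 V) F = idnt ?C" "s0 (Cat2 V) G = idnt ?B" "t0 (Cat2 V) G = idnt ?C"
      using FG by simp_all
  have "is_functor I (underlying (Cat2 V)) D"
    unfolding is_functor_def
    using F G z CV.zero_cellD(6)[OF z(1)] CV.zero_cellD(6)[OF z(2)] CV.zero_cellD(6)[OF z(3)] fgc st
    by (auto simp: Is Ds gd simp del: Cat2_simps)
  from V_lim[OF I this] obtain X p where X: "X \<in> V" and lim: "is_limit (underlying ?S) I D (idnt X) p" by blast
  have cX: "category X" using V_category X .
  define cone where "cone = (\<lambda>w q. w \<in> objs (underlying ?S) \<and>
            (\<forall>i\<in>objs I. q i \<in> one_cells ?S \<and> s0 ?S (q i) = w \<and> t0 ?S (q i) = D i) \<and>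
            (\<forall>f\<in>arrs I. D f \<star>\<^bsub>?S\<^esub> q (src I f) = q (tgt I f)))"
  have cp: "cone (idnt X) p" and un: "\<And>w q. cone w q \<Longrightarrow> \<exists>!h. h \<in> one_cells ?S \<and> s0 ?S h = w \<and> t0 ?S h = idnt X \<and>
      (\<forall>i\<in>objs I. p i \<star>\<^bsub>?S\<^esub> h = q i)"
    using lim unfolding is_limit_def Let_def cone_def by (simp_all del: Cat2_simps)
  have FS: "F \<in> one_cells ?S" "G \<in> one_cells ?S"
    using F G V_small unfolding Cat2_one_cells Cat2_cell_iff by auto
  have P: "p (g 0) \<in> one_cells ?S" "nsrc (p (g 0)) = X" "ntgt (p (g 0)) = ?A" "p (g 2) \<in> one_cells ?S" "nsrc (p (g 2))
      = X" "ntgt (p (g 2)) = ?B"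
     "F \<star>\<^bsub>?S\<^esub> p (g 0) = p (g 3)" "G \<star>\<^bsub>?S\<^esub> p (g 2) = p (g 3)" "p (g 3) \<in> one_cells ?S" "nsrc (p (g 3)) = X"
    using cp unfolding cone_def Io Is(1) by (auto simp: Is Ds simp del: Cat2_simps(3-6))
  let ?p = "nfrom (p (g 0))" and ?q = "nfrom (p (g 2))"
  have pf: "is_functor X ?A ?p" "is_functor X ?B ?q" using Cat2_one_functor[OF P(1)] Cat2_one_functor[OF P(4)] P by
      auto
  have pq: "nfrom F (?p x) = nfrom G (?q x)" if x: "x \<in> arrs X" for x
  proof -
    have "nfrom (F \<star>\<^bsub>?S\<^esub> p (g 0)) x = nfrom (G \<star>\<^bsub>?S\<^esub> p (g 2)) x" unfolding P(7,8) ..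
    then show ?thesis using x P(2,5) by simp
  qed
  have YS: "Y \<in> small_cats" "X \<in> small_cats" "?A \<in> small_cats" "?B \<in> small_cats" "?C \<in> small_cats" using YV X abc
      V_small by auto
  have "\<exists>!x. x \<in> arrs X \<and> ?p x = a \<and> ?q x = b" if a: "a \<in> arrs ?A" and b: "b \<in> arrs ?B" and ab: "nfrom F a = nfrom G
      b" for a b
  proof -
    have ca: "category ?A" "category ?B" "category ?C" using abc V_category by auto
    have c: "nfrom F a \<in> arrs ?C" using functorD(1)[OF abc(4) a] .
    \<comment> \<open>A pair of arrows with the same image is a cone with vertex \<open>Y\<close>,
      its legs being the functors that classify the two arrows and their common image.\<close>
    define q where "q i = (if i = g 0 then fcell Y ?A (pick ?A a) else if i = g 2 then fcell Y ?B (pick ?B b) else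
        fcell Y ?C (pick ?C (nfrom F a)))" for i
    have qs: "q (g 0) = fcell Y ?A (pick ?A a)" "q (g 2) = fcell Y ?B (pick ?B b)" "q (g 3) = fcell Y ?C (pick ?C
        (nfrom F a))" by (simp_all add: q_def gd)
    have q1: "fcell Y ?A (pick ?A a) \<in> one_cells ?S" "fcell Y ?B (pick ?B b) \<in> one_cells ?S" "fcell Y ?C (pick ?C
        (nfrom F a)) \<in> one_cells ?S"
      using fcell_one_cell[OF YS(1,3) YV(2) ca(1) pick_functor[OF ca(1) a]] fcell_one_cell[OF YS(1,4) YV(2) ca(2)
          pick_functor[OF ca(2) b]]
        fcell_one_cell[OF YS(1,5) YV(2) ca(3) pick_functor[OF ca(3) c]] by auto
    have comp: "F \<star>\<^bsub>?S\<^esub> q (g 0) = q (g 3)" "G \<star>\<^bsub>?S\<^esub> q (g 2) = q (g 3)"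
    proof -
      have "nfrom F (pick ?A a y) = pick ?C (nfrom F a) y" if "y \<in> arrs Y" for y
        using that a functorD(2,3)[OF abc(4) a] by (auto simp: Y_arrs)
      then have "fcell Y ?C (\<lambda>y. nfrom F (nfrom (q (g 0)) y)) = q (g 3)" using FG by (auto simp: qs fcell_def
          objs_arrs intro!: restrict_ext)
      then show "F \<star>\<^bsub>?S\<^esub> q (g 0) = q (g 3)" using fcell_comp[OF q1(1) FS(1) _ small_category] FG by (simp add: qs del:
          Cat2_simps)
      have "nfrom G (pick ?B b y) = pick ?C (nfrom F a) y" if "y \<in> arrs Y" for y
        using that b functorD(2,3)[OF abc(5) b] by (auto simp: Y_arrs ab)
      then have "fcell Y ?C (\<lambda>y. nfrom G (nfrom (q (g 2)) y)) = q (g 3)" by (auto simp: qs fcell_def objs_arrs intro!: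
          restrict_ext)
      then show "G \<star>\<^bsub>?S\<^esub> q (g 2) = q (g 3)" using fcell_comp[OF q1(2) FS(2) _ small_category] by (simp add: qs del:
          Cat2_simps)
    qed
    have "idnt Y \<in> objs (underlying ?S)" using idnt_zero[OF YS(1) YV(2)] by (auto simp: objs_def[of "underlying _"])
    moreover have idl: "idnt Z \<star>\<^bsub>?S\<^esub> x = x" if "x \<in> one_cells ?S" "ntgt x = Z" for x Z
      using S.hcat(8)[of x "idnt Z"] S.one_cellD(1)[OF that(1)] that(2) by (simp del: Cat2_simps(3-6))
    have "idnt ?A \<star>\<^bsub>?S\<^esub> q (g 0) = q (g 0)" "idnt ?B \<star>\<^bsub>?S\<^esub> q (g 2) = q (g 2)" "idnt ?C \<star>\<^bsub>?S\<^esub> q (g 3) = q (g 3)"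
      unfolding qs by (rule idl[OF q1(1)] idl[OF q1(2)] idl[OF q1(3)], simp)+
    ultimately have cq: "cone (idnt Y) q"
      unfolding cone_def Io Is(1) using q1 comp by (simp add: Is Ds qs del: Cat2_simps(3-6))
    note ex = un[OF cq]
    \<comment> \<open>Functors classifying arrows of \<open>X\<close> are tested against the legs of
      the limit by evaluation at \<open>ar\<close>. The leg at 3 agrees once the leg at 0
      does.\<close>
    have iff: "(\<forall>i\<in>objs I. p i \<star>\<^bsub>?S\<^esub> fcell Y X (pick X x) = q i) \<longleftrightarrow> ?p x = a \<and> ?q x = b" if x: "x \<in> arrs X" for x
    proof -
      note fx = fcell_one_cell[OF YS(1,2) YV(2) cX pick_functor[OF cX x]]
      have e0: "p (g 0) \<star>\<^bsub>?S\<^esub> fcell Y X (pick X x) = fcell Y ?A (\<lambda>y. ?p (nfrom (fcell Y X (pick X x)) y))"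
        "p (g 2) \<star>\<^bsub>?S\<^esub> fcell Y X (pick X x) = fcell Y ?B (\<lambda>y. ?q (nfrom (fcell Y X (pick X x)) y))"
        using fcell_comp[OF fx P(1) _ small_category] fcell_comp[OF fx P(4) _ small_category] P by (simp_all del:
            Cat2_simps)
      have "?p (pick X x y) = pick ?A (?p x) y" "?q (pick X x y) = pick ?B (?q x) y" if "y \<in> arrs Y" for y
        using that functorD(2,3)[OF pf(1) x] functorD(2,3)[OF pf(2) x] by (auto simp: Y_arrs)
      then have e: "p (g 0) \<star>\<^bsub>?S\<^esub> fcell Y X (pick X x) = fcell Y ?A (pick ?A (?p x))"
        "p (g 2) \<star>\<^bsub>?S\<^esub> fcell Y X (pick X x) = fcell Y ?B (pick ?B (?q x))"
        unfolding e0 by (auto simp: fcell_def objs_arrs intro!: restrict_ext)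
      have e2: "p (g 3) \<star>\<^bsub>?S\<^esub> fcell Y X (pick X x) = F \<star>\<^bsub>?S\<^esub> (p (g 0) \<star>\<^bsub>?S\<^esub> fcell Y X (pick X x))"
        unfolding P(7)[symmetric]
        by (rule S.hassoc) (use S.one_cellD(1)[OF fx] S.one_cellD(1)[OF P(1)] S.one_cellD(1)[OF FS(1)] P in \<open>simp_all
            del: Cat2_simps(3-6)\<close>)
      show ?thesis
      proof
        assume "\<forall>i\<in>objs I. p i \<star>\<^bsub>?S\<^esub> fcell Y X (pick X x) = q i"
        then have "fcell Y ?A (pick ?A (?p x)) = fcell Y ?A (pick ?A a)" "fcell Y ?B (pick ?B (?q x)) = fcell Y ?B
            (pick ?B b)"
          unfolding Io by (simp_all add: e qs del: Cat2_simps)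
        from fcell_eq[OF this(1), of ar] fcell_eq[OF this(2), of ar] show "?p x = a \<and> ?q x = b" by simp
      next
        assume r: "?p x = a \<and> ?q x = b"
        then show "\<forall>i\<in>objs I. p i \<star>\<^bsub>?S\<^esub> fcell Y X (pick X x) = q i"
          unfolding Io using comp(1) by (simp add: e e2 qs del: Cat2_simps)
      qed
    qed
    obtain h where h: "h \<in> one_cells ?S" "nsrc h = Y" "ntgt h = X" "\<forall>i\<in>objs I. p i \<star>\<^bsub>?S\<^esub> h = q i"
      using ex by (auto simp del: Cat2_simps(3-6))
    have hf: "is_functor Y X (nfrom h)" using Cat2_one_functor[OF h(1)] h by simp
    have hx: "h = fcell Y X (pick X (nfrom h ar))"
    proof -
      have r: "restrict (nfrom h) S = restrict (pick X (nfrom h ar)) S" if "S \<subseteq> arrs Y" for S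
        by (rule restrict_ext) (use functor_pick[OF hf] that in blast)
      have o: "objs Y \<subseteq> arrs Y" by (auto simp: objs_arrs)
      have hh: "h = fcell Y X (nfrom h)" using one_cell_fcell[OF h(1)] unfolding h(2,3) .
      have "fcell Y X (nfrom h) = fcell Y X (pick X (nfrom h ar))" unfolding fcell_def r[OF order_refl] r[OF o] ..
      with hh show ?thesis by (rule trans)
    qed
    have m: "nfrom h ar \<in> arrs X" using functorD(1)[OF hf] by simp
    show ?thesis
    proof (rule ex1I)
      show "nfrom h ar \<in> arrs X \<and> ?p (nfrom h ar) = a \<and> ?q (nfrom h ar) = b"
        using m iff[OF m] h(4) hx by metis
    next
      fix x assume x: "x \<in> arrs X \<and> ?p x = a \<and> ?q x = b"
      then have "\<forall>i\<in>objs I. p i \<star>\<^bsub>?S\<^esub> fcell Y X (pick X x) = q i" using iff by blast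
      moreover have "fcell Y X (pick X x) \<in> one_cells ?S" using fcell_one_cell[OF YS(1,2) YV(2) cX pick_functor[OF
          cX]] x by blast
      ultimately have "fcell Y X (pick X x) = h"
        by (intro Ex1_unique[OF ex]) (use h in \<open>simp_all del: Cat2_simps(3-6)\<close>)
      from arg_cong[OF this, of "\<lambda>z. nfrom z ar"] show "x = nfrom h ar" by simp
    qed
  qed
  then show ?thesis using X pf pq by blast
qed

end

locale baseC = base V + Vcat C V for V :: "'u cat set" and C :: "'c twocat"
begin

text \<open>A hom-category of the arrow 2-category is the pullback of \<open>C(dom f, dom g)\<close>
  and \<open>C(cod f, cod g)\<close> over \<open>C(dom f, cod g)\<close>, so closure under limits
  gives it a copy in \<open>V\<close>.\<close>

lemma Arr_hom_base:
  assumes f: "f \<in> one_cells C" and g: "g \<in> one_cells C"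
  shows "in_base V (Hom (Arr C) (ob C f) (ob C g))"
proof -
  interpret A: twocat "Arr C" by (rule twocat_Arr) unfold_locales
  interpret CV: twocat "Cat2 V" by (rule twocat_V)
  note fg = one_cellD[OF f] one_cellD[OF g]
  let ?A = "Hom C (s0 C f) (s0 C g)" and ?B = "Hom C (t0 C f) (t0 C g)" and ?D = "Hom C (s0 C f) (t0 C g)"
  note b = hb(1)[OF fg(1,4)] hb(4)[OF fg(1,4)] hb(2)[OF fg(1,4)]
  let ?F = "hpost V C (s0 C f) g" and ?G = "hpre V C (t0 C g) f"
  have F: "?F \<in> one_cells (Cat2 V)"
    using two_functorD(1)[OF hpost_functor, of "s0 C f" g] two_functor_verD(1)[OF hpost_functor _ two_cat, of "s0 C f"
        g] fg
    by (simp add: CV.one_cells_iff del: Cat2_simps)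
  have opc: "two_category (op C)" using twocat_op[of C] two_cat by (simp add: twocat_def)
  have G: "?G \<in> one_cells (Cat2 V)"
    using two_functorD(1)[OF hpre_functor, of "t0 C g" f] two_functor_verD(1)[OF hpre_functor, of "t0 C g" f] fg
      opc
    by (simp add: CV.one_cells_iff del: Cat2_simps)
  have n: "nsrc ?F = robj V ?A" "ntgt ?F = robj V ?D" "nsrc ?G = robj V ?B" "ntgt ?G = robj V ?D"
    by (simp_all add: hpost_def hpre_def)
  obtain X p q where X: "X \<in> V" "is_functor X (robj V ?A) p" "is_functor X (robj V ?B) q"
    "\<And>x. x \<in> arrs X \<Longrightarrow> nfrom ?F (p x) = nfrom ?G (q x)"
    and u: "\<And>a b. a \<in> arrs (robj V ?A) \<Longrightarrow> b \<in> arrs (robj V ?B) \<Longrightarrow> nfrom ?F a = nfrom ?G b \<Longrightarrow> \<exists>!x. x \<in> arrs X \<and> p x = a \<and>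
        q x = b"
    using pullback_ex[OF F G] unfolding n by blast
  have cX: "category X" using V_category X(1) .
  let ?P = "Hom (Arr C) (ob C f) (ob C g)"
  have Pm: "s \<in> arrs ?P \<longleftrightarrow> s \<in> cells (Arr C) \<and> left s = f \<and> right s = g" for s
    by (auto simp: A.Hom_simps ob_def)
  note eA = enc_arrs[OF b(1) Hom_category] src_enc[OF b(1) Hom_category] tgt_enc[OF b(1) Hom_category]
    dec_arrs[OF b(1) Hom_category] enc_dec[OF b(1) Hom_category] dec_enc[OF b(1) Hom_category] enc_inj[OF b(1)
        Hom_category]
    cmp_enc[OF b(1) Hom_category]
  note eB = enc_arrs[OF b(2) Hom_category] src_enc[OF b(2) Hom_category] tgt_enc[OF b(2) Hom_category]
    dec_arrs[OF b(2) Hom_category] enc_dec[OF b(2) Hom_category] dec_enc[OF b(2) Hom_category] enc_inj[OF b(2)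
        Hom_category]
    cmp_enc[OF b(2) Hom_category]
  have typs: "top s \<in> arrs ?A" "bot s \<in> arrs ?B" "g \<star>\<^bsub>C\<^esub> top s = bot s \<star>\<^bsub>C\<^esub> f" if "s \<in> arrs ?P" for s
    using that[unfolded Pm] by (auto simp: Arr_cell_iff)
  have Fv: "nfrom ?F (enc V ?A a) = enc V ?D (g \<star>\<^bsub>C\<^esub> a)" if "a \<in> arrs ?A" for a
    using that eA(1)[OF that] eA(6)[OF that] fg by (simp add: hpost_def)
  have Gv: "nfrom ?G (enc V ?B c) = enc V ?D (c \<star>\<^bsub>C\<^esub> f)" if "c \<in> arrs ?B" for c
    using that eB(1)[OF that] eB(6)[OF that] fg by (simp add: hpre_def)
  have ex: "\<exists>x. x \<in> arrs X \<and> p x = enc V ?A (top s) \<and> q x = enc V ?B (bot s)" if s: "s \<in> arrs ?P" for s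
    using u[of "enc V ?A (top s)" "enc V ?B (bot s)"] eA(1) eB(1) typs[OF s] Fv[of "top s"] Gv[of "bot s"] by auto
  then obtain H where H: "\<And>s. s \<in> arrs ?P \<Longrightarrow> H s \<in> arrs X \<and> p (H s) = enc V ?A (top s) \<and> q (H s) = enc V ?B (bot s)" by
      metis
  have uq: "x = y" if "x \<in> arrs X" "y \<in> arrs X" "p x = p y" "q x = q y" for x y
    using u[of "p x" "q x"] that functorD(1)[OF X(2)] functorD(1)[OF X(3)] X(4) by metis
  have sP: "Sq f (s1 C (top s)) (s1 C (bot s)) g \<in> arrs ?P" "Sq f (t1 C (top s)) (t1 C (bot s)) g \<in> arrs ?P" if s: "s
      \<in> arrs ?P" for s
    using A.vcat(1)[of s] A.vcat(2)[of s] s[unfolded Pm] unfolding Pm by auto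
  have "is_functor ?P X H"
    unfolding is_functor_def
  proof (intro conjI ballI impI)
    fix s assume s: "s \<in> arrs ?P"
    note h = H[OF s] and t = typs[OF s]
    show "H s \<in> arrs X" using h by simp
    have l: "left s = f" "right s = g" using s[unfolded Pm] by auto
    show "H (src ?P s) = src X (H s)"
      by (rule uq) (use H[OF sP(1)[OF s]] h functorD[OF X(2), of "H s"] functorD[OF X(3), of "H s"] t l in \<open>simp_all
          add: A.Hom_simps category_simps[OF cX] eA(2) eB(2)\<close>)
    show "H (tgt ?P s) = tgt X (H s)"
      by (rule uq) (use H[OF sP(2)[OF s]] h functorD[OF X(2), of "H s"] functorD[OF X(3), of "H s"] t l in \<open>simp_all
          add: A.Hom_simps category_simps[OF cX] eA(3) eB(3)\<close>)
  next
    fix s r assume s: "s \<in> arrs ?P" and r: "r \<in> arrs ?P" and sr: "src ?P r = tgt ?P s"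
    have l: "left s = f" "right s = g" "left r = f" "right r = g" using s[unfolded Pm] r[unfolded Pm] by auto
    have e: "s1 C (top r) = t1 C (top s)" "s1 C (bot r) = t1 C (bot s)" using sr by (auto simp: A.Hom_simps)
    have c: "cmp ?P r s \<in> arrs ?P" by (rule cat_cmp[OF A.Hom_category s r sr])
    have cs: "cmp ?P r s = Sq f (top r \<bullet>\<^bsub>C\<^esub> top s) (bot r \<bullet>\<^bsub>C\<^esub> bot s) g" by (simp add: A.Hom_simps l)
    have XX: "src X (H r) = tgt X (H s)"
    proof (rule uq)
      show "p (src X (H r)) = p (tgt X (H s))" "q (src X (H r)) = q (tgt X (H s))"
        using H[OF s] H[OF r] typs[OF s] typs[OF r] e functorD[OF X(2), of "H s"] functorD[OF X(2), of "H r"]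
          functorD[OF X(3), of "H s"] functorD[OF X(3), of "H r"] eA(2,3) eB(2,3) by simp_all
    qed (use H[OF s] H[OF r] in \<open>simp_all add: category_simps[OF cX]\<close>)
    show "H (cmp ?P r s) = cmp X (H r) (H s)"
    proof (rule uq)
      show "p (H (cmp ?P r s)) = p (cmp X (H r) (H s))"
        using H[OF c] H[OF s] H[OF r] functor_comp[OF X(2), of "H s" "H r"] XX typs[OF s] typs[OF r] e eA(8)[of "top
            s" "top r"] by (simp add: cs)
      show "q (H (cmp ?P r s)) = q (cmp X (H r) (H s))"
        using H[OF c] H[OF s] H[OF r] functor_comp[OF X(3), of "H s" "H r"] XX typs[OF s] typs[OF r] e eB(8)[of "bot
            s" "bot r"] by (simp add: cs)
    qed (use H[OF s] H[OF r] H[OF c] XX in \<open>simp_all add: category_simps[OF cX]\<close>)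
  qed
  moreover have "bij_betw H (arrs ?P) (arrs X)"
    unfolding bij_betw_def
  proof
    show "inj_on H (arrs ?P)"
    proof (rule inj_onI)
      fix s r assume s: "s \<in> arrs ?P" and r: "r \<in> arrs ?P" and e: "H s = H r"
      have "top s = top r" "bot s = bot r" using H[OF s] H[OF r] e eA(7)[of "top s" "top r"] eB(7)[of "bot s" "bot r"]
          typs[OF s] typs[OF r] by auto
      then show "s = r" using s[unfolded Pm] r[unfolded Pm] by (simp add: sq.expand)
    qed
    show "H ` arrs ?P = arrs X"
    proof
      show "H ` arrs ?P \<subseteq> arrs X" using H by auto
      show "arrs X \<subseteq> H ` arrs ?P"
      proof
        fix x assume x: "x \<in> arrs X"
        let ?s = "Sq f (dec V ?A (p x)) (dec V ?B (q x)) g"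
        note px = functorD(1)[OF X(2) x] and qx = functorD(1)[OF X(3) x]
        note dp = eA(4)[OF px] and dq = eB(4)[OF qx]
        have "enc V ?D (g \<star>\<^bsub>C\<^esub> dec V ?A (p x)) = enc V ?D (dec V ?B (q x) \<star>\<^bsub>C\<^esub> f)"
          using X(4)[OF x] Fv[OF dp] Gv[OF dq] eA(5)[OF px] eB(5)[OF qx] by simp
        then have "g \<star>\<^bsub>C\<^esub> dec V ?A (p x) = dec V ?B (q x) \<star>\<^bsub>C\<^esub> f"
          using enc_inj[OF b(3) Hom_category, of "g \<star>\<^bsub>C\<^esub> dec V ?A (p x)" "dec V ?B (q x) \<star>\<^bsub>C\<^esub> f"] dp dq fg by simp
        then have s: "?s \<in> arrs ?P" unfolding Pm using dp dq f g by (simp add: Arr_cell_iff)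
        have "H ?s = x" by (rule uq) (use H[OF s] x eA(5)[OF px] eB(5)[OF qx] in \<open>auto\<close>)
        then show "x \<in> H ` arrs ?P" using imageI[OF s, of H] by (simp only:)
      qed
    qed
  qed
  ultimately show ?thesis using X(1) unfolding in_base_def iso_functor_def by blast
qed

lemma Vcat_Arr: "Vcat (Arr C) V"
proof -
  have "twocat (Arr C)" by (rule twocat_Arr) unfold_locales
  then show ?thesis
    unfolding Vcat_def Vcat_axioms_def using Arr_hom_base V_category Arr_zero_cells by auto
qed

end

section \<open>Comma objects from weighted limits\<close>

section \<open>Comma objects in complete 2-categories\<close>

lemma Fun2_cell_iff:
  "x \<in> cells (Fun2 P Q) \<longleftrightarrow> two_functor P Q (mfrom x) \<and> mfrom x \<in> extensional (cells P) \<and>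
     two_functor P Q (mto x) \<and> mto x \<in> extensional (cells P) \<and>
     mat x \<in> extensional (zero_cells P) \<and> (\<forall>A\<in>zero_cells P. mat x A \<in> cells Q) \<and>
     two_natural P Q (mfrom x) (mto x) (\<lambda>A. s1 Q (mat x A)) \<and> two_natural P Q (mfrom x) (mto x) (\<lambda>A. t1 Q (mat x A)) \<and>
     (\<forall>y\<in>one_cells P. mat x (t0 P y) \<star>\<^bsub>Q\<^esub> mfrom x y = mto x y \<star>\<^bsub>Q\<^esub> mat x (s0 P y))"
  by (cases x) (auto simp: Fun2_def Let_def)

lemma Fun2_simps [simp]:
  "s0 (Fun2 P Q) x = Mdf (mfrom x) (\<lambda>A\<in>zero_cells P. mfrom x A) (mfrom x)"
  "t0 (Fun2 P Q) x = Mdf (mto x) (\<lambda>A\<in>zero_cells P. mto x A) (mto x)"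
  "s1 (Fun2 P Q) x = Mdf (mfrom x) (\<lambda>A\<in>zero_cells P. s1 Q (mat x A)) (mto x)"
  "t1 (Fun2 P Q) x = Mdf (mfrom x) (\<lambda>A\<in>zero_cells P. t1 Q (mat x A)) (mto x)"
  "y \<star>\<^bsub>Fun2 P Q\<^esub> x = Mdf (mfrom x) (\<lambda>A\<in>zero_cells P. mat y A \<star>\<^bsub>Q\<^esub> mat x A) (mto y)"
  "y \<bullet>\<^bsub>Fun2 P Q\<^esub> x = Mdf (mfrom x) (\<lambda>A\<in>zero_cells P. mat y A \<bullet>\<^bsub>Q\<^esub> mat x A) (mto x)"
  "arrs (ver (Fun2 P Q)) = cells (Fun2 P Q)"
  by (simp_all add: Fun2_def Let_def)

lemma restrict_eq_iff: "m \<in> extensional S \<Longrightarrow> restrict g S = m \<longleftrightarrow> (\<forall>A\<in>S. g A = m A)"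
  by (auto simp: restrict_def extensional_def fun_eq_iff)

lemma Fun2_one_cell:
  "x \<in> one_cells (Fun2 P Q) \<longleftrightarrow> x \<in> cells (Fun2 P Q) \<and> (\<forall>A\<in>zero_cells P. s1 Q (mat x A) = mat x A)"
proof -
  have "s1 (Fun2 P Q) x = x \<longleftrightarrow> (\<forall>A\<in>zero_cells P. s1 Q (mat x A) = mat x A)" if "x \<in> cells (Fun2 P Q)"
  proof -
    have "mat x \<in> extensional (zero_cells P)" using that by (simp add: Fun2_cell_iff)
    then have "(\<lambda>A\<in>zero_cells P. s1 Q (mat x A)) = mat x \<longleftrightarrow> (\<forall>A\<in>zero_cells P. s1 Q (mat x A) = mat x A)"
      by (rule restrict_eq_iff)
    then show ?thesis by (cases x) simp
  qed
  then show ?thesis unfolding objs_def[of "ver (Fun2 P Q)"] by auto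
qed

lemma two_functor_compose:
  assumes "twocat A" "twocat B" "twocat D" "two_functor A B F" "two_functor B D G"
  shows "two_functor A D (\<lambda>x. G (F x))"
proof -
  interpret A: twocat A by fact
  interpret B: twocat B by fact
  note f = two_functorD[OF assms(4)] two_functor_verD[OF assms(4) _ A.two_cat]
  note g = two_functorD[OF assms(5)] two_functor_verD[OF assms(5) _ B.two_cat]
  show ?thesis
    by (rule two_functorI[OF assms(1,3)])
      (simp_all add: f g two_functor_comp(1)[OF assms(4)] two_functor_comp(1)[OF assms(5)]
        two_functor_comp(2)[OF assms(4) _ _ A.two_cat] two_functor_comp(2)[OF assms(5) _ _ B.two_cat])
qed

lemma two_functor_restrict:
  assumes "twocat A" "twocat D" "two_functor A D F"
  shows "two_functor A D (\<lambda>x\<in>cells A. F x)"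
proof -
  interpret A: twocat A by fact
  show ?thesis
    by (rule two_functorI[OF assms(1,2)])
      (simp_all add: two_functorD[OF assms(3)] two_functor_verD[OF assms(3) _ A.two_cat]
        two_functor_comp(1)[OF assms(3)] two_functor_comp(2)[OF assms(3) _ _ A.two_cat])
qed

lemma Fun2_zero_cell:
  assumes "twocat P" "twocat Q" "two_functor P Q F" "F \<in> extensional (cells P)"
  shows "Mdf F (\<lambda>A\<in>zero_cells P. F A) F \<in> zero_cells (Fun2 P Q)"
proof -
  interpret P: twocat P by fact
  interpret Q: twocat Q by fact
  note f = two_functorD[OF assms(3)] two_functor_verD[OF assms(3) _ P.two_cat]
  have "F A \<in> cells Q" "s1 Q (F A) = F A" "t1 Q (F A) = F A" "s0 Q (F A) = F A" "t0 Q (F A) = F A" if "A \<in> zero_cells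
      P" for A
    using that f by simp_all
  then show ?thesis
    using assms f by (simp add: zero_cells_iff[of _ "Fun2 P Q"] Fun2_cell_iff two_natural_def Q.one_cells_iff
        P.one_cells_iff)
qed

lemma (in twocat) Hom_op: "Hom (op C) A B = Hom C B A"
  by (simp add: Hom_def op_def dual_def conj_commute)

context base begin

text \<open>The arrow category as a locally discrete 2-category. It is carried by \<open>Y\<close>,
  hence by the type \<open>'u\<close> over which completeness quantifies its shapes.\<close>

definition arrow_2cat :: "'u twocat" where
  "arrow_2cat = \<lparr>hor = Y, ver = \<lparr>arrs = arrs Y, src = (\<lambda>x. x), tgt = (\<lambda>x. x), cmp = (\<lambda>y x. x)\<rparr>\<rparr>"

lemma arrow_2cat_simps [simp]: "hor arrow_2cat = Y" "s1 arrow_2cat x = x" "t1 arrow_2cat x = x" "y \<bullet>\<^bsub>arrow_2cat\<^esub> x =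
    x" "arrs (ver arrow_2cat) = arrs Y"
  by (simp_all add: arrow_2cat_def)

lemma arrow_2cat_twocat: "twocat arrow_2cat"
  unfolding twocat_def two_category_def
  using YV(2) by (auto simp: category_def[of "ver arrow_2cat"] category_simps[OF YV(2)])

lemma arrow_2cat_cells: "zero_cells arrow_2cat = {o0, o1}" "one_cells arrow_2cat = {o0, o1, ar}"
  using Y_objs by (auto simp: objs_def[of "ver arrow_2cat"] Y_arrs)

lemma arrow_2cat_op_cells: "zero_cells (op arrow_2cat) = {o0, o1}" "one_cells (op arrow_2cat) = {o0, o1, ar}"
  using twocat.op_zero_cells[OF arrow_2cat_twocat] arrow_2cat_cells by auto

lemma Y_cmp: "cmp Y o0 o0 = o0" "cmp Y o1 o1 = o1" "cmp Y ar o0 = ar" "cmp Y o1 ar = ar"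
  by (simp_all add: category_simps(7,8)[OF YV(2)])

text \<open>The hom-category from \<open>o1\<close> to \<open>o0\<close> is empty and the others are
  terminal. This is where an empty category in the base is called for.\<close>

lemma arrow_2cat_small: "small_V_category V arrow_2cat"
proof -
  have "in_base V (Hom arrow_2cat A B)" if "A \<in> {o0, o1}" "B \<in> {o0, o1}" for A B
  proof -
    have arrs: "arrs (Hom arrow_2cat A B) = {x \<in> {o0, o1, ar}. src Y x = A \<and> tgt Y x = B}" by (simp add: Hom_def
        Y_arrs)
    have st: "src (Hom arrow_2cat A B) x = x" "tgt (Hom arrow_2cat A B) x = x" "cmp (Hom arrow_2cat A B) y x = x" for
        x y by (simp_all add: Hom_def)
    show ?thesis
    proof (cases "arrs (Hom arrow_2cat A B) = {}")
      case True
      obtain X where X: "X \<in> V" "arrs X = {}" using empty_ex by blast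
      have "iso_functor (Hom arrow_2cat A B) X (\<lambda>x. x)" using True X by (auto simp: iso_functor_def is_functor_def
          bij_betw_def)
      then show ?thesis using X(1) unfolding in_base_def by blast
    next
      case False
      obtain X a where X: "X \<in> V" "arrs X = {a}" using terminal_ex by blast
      note cX = category_simps[OF V_category[OF X(1)]]
      have a: "src X a = a" "tgt X a = a" using cX(1,2)[of a] X(2) by auto
      have aa: "cmp X a a = a" using cX(7)[of a a] X(2) a by simp
      have "\<exists>x. arrs (Hom arrow_2cat A B) = {x}" using False that unfolding arrs by auto
      then obtain x where x: "arrs (Hom arrow_2cat A B) = {x}" by blast
      have "iso_functor (Hom arrow_2cat A B) X (\<lambda>_. a)"
        using x X(2) a aa by (auto simp: iso_functor_def is_functor_def bij_betw_def)
      then show ?thesis using X(1) unfolding in_base_def by blast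
    qed
  qed
  moreover have "cells arrow_2cat \<prec> (UNIV :: 'u set)" using finite_small[of "arrs Y"] by (simp add: Y_arrs)
  ultimately show ?thesis
    unfolding small_V_category_def V_category_def using arrow_2cat_twocat arrow_2cat_cells by (simp add: twocat_def)
qed

end

context baseC begin

text \<open>The comma object of \<open>h\<close> is the limit of \<open>h\<close>, as a diagram of shape \<open>arrow_2cat\<close>, weighted by the inclusion of
  the codomain into the arrow category.\<close>

lemma comma_ex_complete:
  assumes complete: "V_complete V C" and h[simp]: "h \<in> one_cells C"
  shows "\<exists>p q k. is_comma C h p q k"
proof -
  interpret CV: twocat "Cat2 V" by (rule twocat_V)
  interpret oJ: twocat "op arrow_2cat" by (rule twocat_op[OF arrow_2cat_twocat])
  interpret oC: twocat "op C" by (rule twocat_op) unfold_locales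
  note h1[simp] = one_cellD[OF h]
  define A where "A = s0 C h" define B where "B = t0 C h"
  have AB[simp]: "A \<in> zero_cells C" "B \<in> zero_cells C" "s0 C h = A" "t0 C h = B" by (simp_all add: A_def B_def)
  \<comment> \<open>A limit in \<open>C\<close> is a colimit in \<open>op C\<close>, so the diagram
    takes values in \<open>op C\<close>: the arrow \<open>ar\<close> from \<open>o0\<close> to
    \<open>o1\<close> goes to \<open>h\<close>, which there leads from \<open>B\<close> to
    \<open>A\<close>.\<close>
  define D where "D x = (if x = o0 then B else if x = o1 then A else h)" for x
  have Ds[simp]: "D o0 = B" "D o1 = A" "D ar = h" by (simp_all add: D_def)
  have D: "two_functor arrow_2cat (op C) D"
    by (rule two_functorI[OF arrow_2cat_twocat oC.twocat_axioms]) (auto simp: Y_arrs Y_cmp)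
  have D': "two_functor (op arrow_2cat) C D"
    by (rule two_functorI[OF oJ.twocat_axioms]) (auto simp: Y_arrs Y_cmp, unfold_locales)
  obtain X1 a1 where X1: "X1 \<in> V" "arrs X1 = {a1}" using terminal_ex by blast
  note cX1 = V_category[OF X1(1)]
  have a1: "src X1 a1 = a1" "tgt X1 a1 = a1" "cmp X1 a1 a1 = a1"
    using category_simps(1,2)[OF cX1, of a1] category_simps(7)[OF cX1, of a1 a1] X1(2) by auto
  have oX1: "objs X1 = {a1}" using X1(2) a1 by (auto simp: objs_def)
  define K1 where "K1 = fcell X1 Y (\<lambda>_. o1)"
  have K1: "K1 \<in> one_cells (Cat2 V)" unfolding K1_def
    by (rule fcell_one_cell[OF X1(1) YV(1) cX1 YV(2)]) (auto simp: is_functor_def Y_cmp)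
  note K1c = CV.one_cellD[OF K1]
  have K1s: "nsrc K1 = X1" "ntgt K1 = Y" "nfrom K1 a1 = o1" "nto K1 a1 = o1" "nat_at K1 a1 = o1"
    by (simp_all add: K1_def X1(2) oX1)
  have idz: "idnt Z \<in> zero_cells (Cat2 V)" if "Z \<in> V" for Z
    using idnt_zero[OF that V_category[OF that]] CV.one_cellD(1) by (auto simp: zero_cells_iff)
  note id1 = CV.zero_simps[OF idz[OF YV(1)]] CV.zero_simps[OF idz[OF X1(1)]]
  \<comment> \<open>The weight is the arrow category at \<open>B\<close> and the terminal category
    at \<open>A\<close>, the latter sitting in the former as the codomain \<open>o1\<close>. A
    cylinder with vertex \<open>Z\<close> is thus a 1-cell \<open>x\<close> into \<open>A\<close>
    with a 2-cell into \<open>h \<star> x\<close>.\<close>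
  define \<Phi> where "\<Phi> = (\<lambda>x\<in>arrs Y. if x = o0 then idnt Y else if x = o1 then idnt X1 else K1)"
  have Ps: "\<Phi> o0 = idnt Y" "\<Phi> o1 = idnt X1" "\<Phi> ar = K1" by (simp_all add: \<Phi>_def)
  have K1st: "s0 (Cat2 V) K1 = idnt X1" "t0 (Cat2 V) K1 = idnt Y" using K1s by simp_all
  have P: "two_functor (op arrow_2cat) (Cat2 V) \<Phi>"
    by (rule two_functorI[OF oJ.twocat_axioms CV.twocat_axioms])
      (auto simp: Y_arrs Y_cmp Ps K1c K1st id1 simp del: Cat2_simps)
  have Pe: "\<Phi> \<in> extensional (cells (op arrow_2cat))" by (simp add: \<Phi>_def)
  define \<phi> where "\<phi> = Mdf \<Phi> (\<lambda>A\<in>zero_cells (op arrow_2cat). \<Phi> A) \<Phi>"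
  have phi: "\<phi> \<in> zero_cells (Psh V arrow_2cat)" unfolding \<phi>_def Psh_def
    by (rule Fun2_zero_cell[OF oJ.twocat_axioms CV.twocat_axioms P Pe])
  obtain c \<eta> where co: "is_weighted_colimit V arrow_2cat (op C) D \<phi> c \<eta>"
    using complete arrow_2cat_small D phi unfolding V_complete_def V_cocomplete_def by blast
  have c[simp]: "c \<in> zero_cells C" using co op_zero_cells unfolding is_weighted_colimit_def by simp
  define N where "N Z = nerve_ob V arrow_2cat (op C) D Z" for Z
  have Nv: "N Z y = hpost V C Z (D y)" if "y \<in> arrs Y" for Z y
    using that by (auto simp: N_def nerve_ob_def hpost_def Hom_op Y_arrs)
  have Ne: "N Z \<in> extensional (cells (op arrow_2cat))" for Z by (simp add: N_def nerve_ob_def)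
  have N2: "two_functor (op arrow_2cat) (Cat2 V) (N Z)" if Z: "Z \<in> zero_cells C" for Z
  proof -
    have "(\<lambda>x\<in>cells (op arrow_2cat). hpost V C Z (D x)) = N Z"
      by (rule extensionalityI[of _ "arrs Y"]) (use Ne[of Z] Nv in auto)
    then show ?thesis
      using two_functor_restrict[OF oJ.twocat_axioms CV.twocat_axioms
        two_functor_compose[OF oJ.twocat_axioms twocat_axioms CV.twocat_axioms D' hpost_functor[OF Z]]] by simp
  qed
  have ner: "mfrom (nerve V arrow_2cat (op C) D x) = N (t0 C x)" "mto (nerve V arrow_2cat (op C) D x) = N (s0 C x)"
    "\<And>j. j \<in> {o0, o1} \<Longrightarrow> mat (nerve V arrow_2cat (op C) D x) j = hpre V C (D j) x" for x
    using arrow_2cat_cells by (auto simp: nerve_def N_def hpre_def Hom_op)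
  have \<eta>: "\<eta> \<in> one_cells (Fun2 (op arrow_2cat) (Cat2 V))" "mfrom \<eta> = \<Phi>" "mto \<eta> = N c"
  proof -
    show "\<eta> \<in> one_cells (Fun2 (op arrow_2cat) (Cat2 V))" using co unfolding is_weighted_colimit_def Psh_def by simp
    have "s0 (Fun2 (op arrow_2cat) (Cat2 V)) \<eta> = \<phi>" "t0 (Fun2 (op arrow_2cat) (Cat2 V)) \<eta> = nerve V arrow_2cat (op C)
        D c"
      using co unfolding is_weighted_colimit_def Psh_def by auto
    from this(1) arg_cong[OF this(2), of mfrom] show "mfrom \<eta> = \<Phi>" "mto \<eta> = N c" by (simp_all add: \<phi>_def ner)
  qed
  define m0 where "m0 = mat \<eta> o0" define m1 where "m1 = mat \<eta> o1"
  have ec: "\<eta> \<in> cells (Fun2 (op arrow_2cat) (Cat2 V))" and e1: "s1 (Cat2 V) m0 = m0" "s1 (Cat2 V) m1 = m1"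
    using \<eta>(1) unfolding Fun2_one_cell arrow_2cat_op_cells m0_def m1_def by auto
  have en: "two_natural (op arrow_2cat) (Cat2 V) \<Phi> (N c) (\<lambda>A. s1 (Cat2 V) (mat \<eta> A))" "m0 \<in> cells (Cat2 V)" "m1 \<in>
      cells (Cat2 V)"
    using ec unfolding Fun2_cell_iff \<eta>(2,3) m0_def m1_def arrow_2cat_op_cells by auto
  let ?RB = "\<lambda>Z. robj V (Hom C Z B)" and ?RA = "\<lambda>Z. robj V (Hom C Z A)"
  have No: "N Z o0 = idnt (?RB Z)" "N Z o1 = idnt (?RA Z)" if Z: "Z \<in> zero_cells C" for Z
  proof -
    have "N Z o0 = s0 (Cat2 V) (hpost V C Z B)" "N Z o1 = s0 (Cat2 V) (hpost V C Z A)"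
      using two_functorD(2)[OF hpost_functor[OF Z], of B] two_functorD(2)[OF hpost_functor[OF Z], of A]
      by (simp_all add: Nv del: Cat2_simps)
    then show "N Z o0 = idnt (?RB Z)" "N Z o1 = idnt (?RA Z)" by (simp_all add: hpost_def)
  qed
  have m: "m0 \<in> one_cells (Cat2 V)" "m1 \<in> one_cells (Cat2 V)" "nsrc m0 = Y" "ntgt m0 = ?RB c" "nsrc m1 = X1" "ntgt m1
      = ?RA c"
  proof -
    show "m0 \<in> one_cells (Cat2 V)" "m1 \<in> one_cells (Cat2 V)" using en e1 CV.one_cells_iff by auto
    have "s0 (Cat2 V) m0 = \<Phi> o0" "t0 (Cat2 V) m0 = N c o0" "s0 (Cat2 V) m1 = \<Phi> o1" "t0 (Cat2 V) m1 = N c o1"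
      using en(1) e1 unfolding two_natural_def arrow_2cat_op_cells m0_def m1_def by auto
    then show "nsrc m0 = Y" "ntgt m0 = ?RB c" "nsrc m1 = X1" "ntgt m1 = ?RA c" by (simp_all add: Ps No)
  qed
  have nat: "m0 \<star>\<^bsub>Cat2 V\<^esub> K1 = hpost V C c h \<star>\<^bsub>Cat2 V\<^esub> m1"
  proof -
    have "s1 (Cat2 V) (mat \<eta> (t0 (op arrow_2cat) ar)) \<star>\<^bsub>Cat2 V\<^esub> \<Phi> ar = N c ar \<star>\<^bsub>Cat2 V\<^esub> s1 (Cat2 V) (mat \<eta> (s0 (op
        arrow_2cat) ar))"
      using en(1) unfolding two_natural_def by (metis Y_mem(3) arrow_2cat_simps(1) op_simps(1))
    then show ?thesis using e1 by (simp add: Ps Nv m0_def m1_def del: Cat2_simps)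
  qed
  have mf: "is_functor Y (?RB c) (nfrom m0)" "is_functor X1 (?RA c) (nfrom m1)"
    using Cat2_one_functor[OF m(1)] Cat2_one_functor[OF m(2)] m by auto
  have mo: "nto m0 = nfrom m0" "nto m1 = nfrom m1" "\<And>a. a \<in> {o0, o1} \<Longrightarrow> nat_at m0 a = nfrom m0 a" "nat_at m1 a1 = nfrom
      m1 a1"
    using m(1,2) unfolding Cat2_one_cells m(3,5) Y_objs oX1 by auto
  note hbA = hom_base[OF _ AB(1)] and hbB = hom_base[OF _ AB(2)]
  let ?eA = "\<lambda>Z. enc V (Hom C Z A)" and ?eB = "\<lambda>Z. enc V (Hom C Z B)"
  let ?dA = "dec V (Hom C c A)" and ?dB = "dec V (Hom C c B)"
  note EA = enc_arrs[OF hbA Hom_category] src_enc[OF hbA Hom_category] tgt_enc[OF hbA Hom_category] cmp_enc[OF hbA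
      Hom_category]
    dec_enc[OF hbA Hom_category] enc_inj[OF hbA Hom_category]
  note EB = enc_arrs[OF hbB Hom_category] src_enc[OF hbB Hom_category] tgt_enc[OF hbB Hom_category] cmp_enc[OF hbB
      Hom_category]
    dec_enc[OF hbB Hom_category] enc_inj[OF hbB Hom_category]
  \<comment> \<open>The unit of the limit is decoded: \<open>m1\<close> names a 1-cell into
    \<open>A\<close>, and \<open>m0\<close> an arrow of a hom-category into \<open>B\<close>, that
    is a 2-cell \<open>k\<close> with source \<open>q\<close>.\<close>
  define p where "p = ?dA (nfrom m1 a1)" define k where "k = ?dB (nfrom m0 ar)" define q where "q = ?dB (nfrom m0 o0)"
  have n1: "nfrom m1 a1 \<in> arrs (?RA c)" "nfrom m1 a1 \<in> objs (?RA c)"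
    using functorD(1)[OF mf(2)] functor_objs[OF mf(2)] X1 oX1 by auto
  have n0: "nfrom m0 y \<in> arrs (?RB c)" if "y \<in> arrs Y" for y using functorD(1)[OF mf(1) that] .
  have n0o: "nfrom m0 y \<in> objs (?RB c)" if "y \<in> {o0, o1}" for y using functor_objs[OF mf(1)] that Y_objs by simp
  have p: "p \<in> cells C" "s1 C p = p" "t1 C p = p" "s0 C p = c" "t0 C p = A"
    using dec_objs[OF hbA[OF c] Hom_category n1(2)] by (auto simp: p_def Hom_objs)
  have q: "q \<in> cells C" "s1 C q = q" "t1 C q = q" "s0 C q = c" "t0 C q = B"
    using dec_objs[OF hbB[OF c] Hom_category n0o[of o0]] by (auto simp: q_def Hom_objs)
  have k: "k \<in> cells C" "s0 C k = c" "t0 C k = B"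
    using dec_arrs[OF hbB[OF c] Hom_category n0[of ar]] by (auto simp: k_def)
  have en1: "nfrom m1 a1 = ?eA c p" "nfrom m0 ar = ?eB c k" "nfrom m0 o0 = ?eB c q"
    using enc_dec[OF hbA[OF c] Hom_category n1(1)] enc_dec[OF hbB[OF c] Hom_category n0] by (simp_all add: p_def k_def
        q_def)
  have hpostv: "nfrom (hpost V C Z h) (?eA Z x) = ?eB Z (h \<star>\<^bsub>C\<^esub> x)" if "Z \<in> zero_cells C" "x \<in> cells C" "s0 C x = Z"
      "t0 C x = A" for Z x
    using that EA(1)[OF that(1), of x] EA(5)[OF that(1), of x] by (simp add: hpost_def)
  \<comment> \<open>Naturality of the unit at \<open>ar\<close> is what makes
    \<open>h \<star> p\<close> the target of \<open>k\<close>.\<close>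
  have en2: "nfrom m0 o1 = ?eB c (h \<star>\<^bsub>C\<^esub> p)"
  proof -
    have "nfrom (m0 \<star>\<^bsub>Cat2 V\<^esub> K1) a1 = nfrom (hpost V C c h \<star>\<^bsub>Cat2 V\<^esub> m1) a1" unfolding nat ..
    then show ?thesis using hpostv[OF c p(1,4,5)] by (simp add: K1s m X1 en1)
  qed
  have ks: "s1 C k = q" "t1 C k = h \<star>\<^bsub>C\<^esub> p"
  proof -
    have "?eB c (s1 C k) = ?eB c q" "?eB c (t1 C k) = ?eB c (h \<star>\<^bsub>C\<^esub> p)"
      using functorD(2,3)[OF mf(1), of ar] EB(2,3)[OF c, of k] k by (simp_all add: en1 en2)
    then show "s1 C k = q" "t1 C k = h \<star>\<^bsub>C\<^esub> p" using EB(6)[OF c] k q p by simp_all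
  qed
  have st: "nfrom m0 y = ?eB c (if y = ar then k else if y = o0 then q else h \<star>\<^bsub>C\<^esub> p)" if "y \<in> arrs Y" for y
    using that en1 en2 by (auto simp: Y_arrs)
  have hprev: "nfrom (hpre V C G x) (enc V (Hom C c G) y) = enc V (Hom C Z G) (y \<star>\<^bsub>C\<^esub> s1 C x)"
    "nto (hpre V C G x) (enc V (Hom C c G) y) = enc V (Hom C Z G) (y \<star>\<^bsub>C\<^esub> t1 C x)"
    "s1 C y = y \<Longrightarrow> nat_at (hpre V C G x) (enc V (Hom C c G) y) = enc V (Hom C Z G) (y \<star>\<^bsub>C\<^esub> x)"
    if x: "x \<in> cells C" "s0 C x = Z" "t0 C x = c" and y: "y \<in> cells C" "s0 C y = c" "t0 C y = G" and G: "G \<in>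
        zero_cells C" for G Z x y
  proof -
    note b = hom_base[OF c G]
    have e: "enc V (Hom C c G) y \<in> arrs (robj V (Hom C c G))" "dec V (Hom C c G) (enc V (Hom C c G) y) = y"
      using enc_arrs[OF b Hom_category] dec_enc[OF b Hom_category] y by auto
    show "nfrom (hpre V C G x) (enc V (Hom C c G) y) = enc V (Hom C Z G) (y \<star>\<^bsub>C\<^esub> s1 C x)"
      "nto (hpre V C G x) (enc V (Hom C c G) y) = enc V (Hom C Z G) (y \<star>\<^bsub>C\<^esub> t1 C x)"
      using e x y by (simp_all add: hpre_def)
    assume s: "s1 C y = y"
    have "t1 C y = y" using vcat(4)[OF y(1)] s by simp
    then have "y \<in> objs (Hom C c G)" using y s by (simp add: Hom_objs)
    then have "enc V (Hom C c G) y \<in> objs (robj V (Hom C c G))" using functor_objs[OF enc_fun[OF b Hom_category]] by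
        simp
    then show "nat_at (hpre V C G x) (enc V (Hom C c G) y) = enc V (Hom C Z G) (y \<star>\<^bsub>C\<^esub> x)"
      using e x y by (simp add: hpre_def)
  qed
  \<comment> \<open>Together with \<open>ev0\<close>, this writes the comparison from cells
    \<open>x\<close> into \<open>c\<close> to cylinders in terms of composition with
    \<open>p\<close>, \<open>q\<close> and \<open>k\<close>. Existence and uniqueness for the comma
    object are both read off from these formulas.\<close>
  have ev1: "nfrom (hpre V C A x \<star>\<^bsub>Cat2 V\<^esub> m1) = (\<lambda>_\<in>arrs X1. ?eA Z (p \<star>\<^bsub>C\<^esub> s1 C x))"
      "nto (hpre V C A x \<star>\<^bsub>Cat2 V\<^esub> m1) = (\<lambda>_\<in>arrs X1. ?eA Z (p \<star>\<^bsub>C\<^esub> t1 C x))"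
      "nat_at (hpre V C A x \<star>\<^bsub>Cat2 V\<^esub> m1) = (\<lambda>_\<in>objs X1. ?eA Z (p \<star>\<^bsub>C\<^esub> x))"
    if x: "x \<in> cells C" "s0 C x = Z" "t0 C x = c" for x Z
  proof -
    have Z: "Z \<in> zero_cells C" using x by auto
    have "cmp (?RA Z) (?eA Z (p \<star>\<^bsub>C\<^esub> x)) (?eA Z (p \<star>\<^bsub>C\<^esub> s1 C x)) = ?eA Z (p \<star>\<^bsub>C\<^esub> x)"
      using EA(4)[OF Z, of "p \<star>\<^bsub>C\<^esub> s1 C x" "p \<star>\<^bsub>C\<^esub> x"] x p by simp
    moreover have "ntgt (hpre V C A x) = ?RA Z" using x by (simp add: hpre_def)
    ultimately show "nfrom (hpre V C A x \<star>\<^bsub>Cat2 V\<^esub> m1) = (\<lambda>_\<in>arrs X1. ?eA Z (p \<star>\<^bsub>C\<^esub> s1 C x))"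
      "nto (hpre V C A x \<star>\<^bsub>Cat2 V\<^esub> m1) = (\<lambda>_\<in>arrs X1. ?eA Z (p \<star>\<^bsub>C\<^esub> t1 C x))"
      "nat_at (hpre V C A x \<star>\<^bsub>Cat2 V\<^esub> m1) = (\<lambda>_\<in>objs X1. ?eA Z (p \<star>\<^bsub>C\<^esub> x))"
      unfolding Cat2_simps nt.sel m(5) X1(2) oX1
      by (auto intro!: restrict_ext simp: mo en1 hprev[OF x p(1,4,5) AB(1)] p)
  qed
  have ev0: "nfrom (hpre V C B x \<star>\<^bsub>Cat2 V\<^esub> m0) = (\<lambda>y\<in>arrs Y. ?eB Z ((if y = ar then k else if y = o0 then q else h
      \<star>\<^bsub>C\<^esub> p) \<star>\<^bsub>C\<^esub> s1 C x))"
      "nto (hpre V C B x \<star>\<^bsub>Cat2 V\<^esub> m0) = (\<lambda>y\<in>arrs Y. ?eB Z ((if y = ar then k else if y = o0 then q else h \<star>\<^bsub>C\<^esub> p)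
          \<star>\<^bsub>C\<^esub> t1 C x))"
      "nat_at (hpre V C B x \<star>\<^bsub>Cat2 V\<^esub> m0) = (\<lambda>y\<in>objs Y. ?eB Z ((if y = o0 then q else h \<star>\<^bsub>C\<^esub> p) \<star>\<^bsub>C\<^esub> x))"
    if x: "x \<in> cells C" "s0 C x = Z" "t0 C x = c" for x Z
  proof -
    have Z: "Z \<in> zero_cells C" using x by auto
    let ?w = "\<lambda>y. if y = ar then k else if y = o0 then q else h \<star>\<^bsub>C\<^esub> p"
    have w: "?w y \<in> cells C" "s0 C (?w y) = c" "t0 C (?w y) = B" for y using p q k by auto
    have "cmp (?RB Z) (?eB Z (u \<star>\<^bsub>C\<^esub> x)) (?eB Z (u \<star>\<^bsub>C\<^esub> s1 C x)) = ?eB Z (u \<star>\<^bsub>C\<^esub> x)"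
      if "u \<in> cells C" "s1 C u = u" "s0 C u = c" "t0 C u = B" for u
      using EB(4)[OF Z, of "u \<star>\<^bsub>C\<^esub> s1 C x" "u \<star>\<^bsub>C\<^esub> x"] x that vcat(4)[OF that(1)] by simp
    note cm = this[of q] this[of "h \<star>\<^bsub>C\<^esub> p"]
    have hp: "h \<star>\<^bsub>C\<^esub> p \<in> cells C" "s0 C (h \<star>\<^bsub>C\<^esub> p) = c" "t0 C (h \<star>\<^bsub>C\<^esub> p) = B" "s1 C (h \<star>\<^bsub>C\<^esub> p) = h \<star>\<^bsub>C\<^esub> p" using p by
        simp_all
    have nt: "ntgt (hpre V C B x) = ?RB Z" using x by (simp add: hpre_def)
    show "nfrom (hpre V C B x \<star>\<^bsub>Cat2 V\<^esub> m0) = (\<lambda>y\<in>arrs Y. ?eB Z (?w y \<star>\<^bsub>C\<^esub> s1 C x))"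
      "nto (hpre V C B x \<star>\<^bsub>Cat2 V\<^esub> m0) = (\<lambda>y\<in>arrs Y. ?eB Z (?w y \<star>\<^bsub>C\<^esub> t1 C x))"
      unfolding Cat2_simps nt.sel m(3)
      by (rule restrict_ext, simp only: mo st hprev[OF x w AB(2)])+
    show "nat_at (hpre V C B x \<star>\<^bsub>Cat2 V\<^esub> m0) = (\<lambda>y\<in>objs Y. ?eB Z ((if y = o0 then q else h \<star>\<^bsub>C\<^esub> p) \<star>\<^bsub>C\<^esub> x))"
      unfolding Cat2_simps nt.sel m(3) nt Y_objs
    proof (rule restrict_ext)
      fix y assume y: "y \<in> {o0, o1}"
      show "cmp (?RB Z) (nat_at (hpre V C B x) (nto m0 y)) (nfrom (hpre V C B x) (nat_at m0 y)) =
          ?eB Z ((if y = o0 then q else h \<star>\<^bsub>C\<^esub> p) \<star>\<^bsub>C\<^esub> x)"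
      proof (cases "y = o0")
        case True
        show ?thesis unfolding mo(1) mo(3)[OF y] unfolding True en1(3) hprev(1)[OF x q(1,4,5) AB(2)] hprev(3)[OF x
            q(1,4,5) AB(2) q(2)]
          using cm(1)[OF q(1,2,4,5)] by simp
      next
        case False
        then have y1: "y = o1" using y by simp
        show ?thesis unfolding mo(1) mo(3)[OF y]
          unfolding if_not_P[OF False] unfolding y1 en2 hprev(1)[OF x hp(1-3) AB(2)] hprev(3)[OF x hp(1-3) AB(2)
              hp(4)]
          by (rule cm(2)[OF hp(1,4,2,3)])
      qed
    qed
  qed
  have bij: "bij_betw (\<lambda>x. nerve V arrow_2cat (op C) D x \<star>\<^bsub>Fun2 (op arrow_2cat) (Cat2 V)\<^esub> \<eta>) {x \<in> cells C. s0 C x = Z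
      \<and> t0 C x = c}
      {M \<in> cells (Fun2 (op arrow_2cat) (Cat2 V)). s0 (Fun2 (op arrow_2cat) (Cat2 V)) M = \<phi> \<and> t0 (Fun2 (op arrow_2cat)
          (Cat2 V)) M = nerve V arrow_2cat (op C) D Z}"
    if Z: "Z \<in> zero_cells C" for Z
  proof -
    have "Z \<in> zero_cells (op C)" using Z op_zero_cells by simp
    then have "iso_functor (Hom (op C) c Z) (Hom (Psh V arrow_2cat) \<phi> (nerve V arrow_2cat (op C) D Z)) (\<lambda>x. nerve V
        arrow_2cat (op C) D x \<star>\<^bsub>Psh V arrow_2cat\<^esub> \<eta>)"
      using co unfolding is_weighted_colimit_def by blast
    then show ?thesis unfolding iso_functor_def Hom_op Psh_def by (simp add: Hom_def[of "Fun2 _ _"] del: Fun2_simps)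
  qed
  have "is_comma C h p q k"
    unfolding is_comma_def
  proof (intro conjI ballI impI, goal_cases)
    case (10 x y l l')
    define Z where "Z = s0 C x"
    have Z: "Z \<in> zero_cells C" using 10(1) by (simp add: Z_def)
    have ty: "x \<in> cells C" "y \<in> cells C" "l \<in> cells C" "l' \<in> cells C" "s0 C x = Z" "s0 C y = Z" "t0 C x = A" "t0 C y =
        B"
      "s1 C l = s1 C y" "t1 C l = h \<star>\<^bsub>C\<^esub> s1 C x" "s1 C l' = t1 C y" "t1 C l' = h \<star>\<^bsub>C\<^esub> t1 C x"
      using 10 by (auto simp: Z_def)
    have com: "l' \<bullet>\<^bsub>C\<^esub> y = (h \<star>\<^bsub>C\<^esub> x) \<bullet>\<^bsub>C\<^esub> l" using 10 by blast
    have tl: "s0 C l = Z" "t0 C l = B" "s0 C l' = Z" "t0 C l' = B"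
      using mixed(1,3)[of l] mixed(1,3)[of l'] ty by auto
    note RV = rep_props(1)[OF hbA[OF Z]] rep_props(1)[OF hbB[OF Z]]
    note cR = V_category[OF RV(1)] V_category[OF RV(2)]
    \<comment> \<open>The data of the comma property as a modification. \<open>M0\<close> goes from
      the functor classifying \<open>l\<close> to the one classifying \<open>l'\<close>, with
      components \<open>y\<close> and \<open>h \<star> x\<close>, and its naturality is the
      hypothesis \<open>com\<close>; \<open>M1\<close> is \<open>x\<close>.\<close>
    define M0 where "M0 = Nt Y (restrict (pick (?RB Z) (?eB Z l)) (arrs Y)) (restrict (pick (?RB Z) (?eB Z l')) (arrs
        Y))
       (\<lambda>a\<in>objs Y. if a = o0 then ?eB Z y else ?eB Z (h \<star>\<^bsub>C\<^esub> x)) (?RB Z)"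
    define M1 where "M1 = Nt X1 (\<lambda>_\<in>arrs X1. ?eA Z (s1 C x)) (\<lambda>_\<in>arrs X1. ?eA Z (t1 C x)) (\<lambda>_\<in>objs X1. ?eA Z x) (?RA
        Z)"
    note eZ = EA(1-4)[OF Z] EB(1-4)[OF Z]
    have M0: "M0 \<in> cells (Cat2 V)"
    proof -
      have f: "is_functor Y (?RB Z) (restrict (pick (?RB Z) (?eB Z u)) (arrs Y))" if "u \<in> cells C" "s0 C u = Z" "t0 C
          u = B" for u
        using Cat2_one_functor[OF fcell_one_cell[OF YV(1) RV(2) YV(2) cR(2) pick_functor[OF cR(2)]], of "?eB Z u"]
            eZ(5)[of u] that by simp
      have "nat_trans Y (?RB Z) (restrict (pick (?RB Z) (?eB Z l)) (arrs Y)) (restrict (pick (?RB Z) (?eB Z l')) (arrs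
          Y))
         (\<lambda>a\<in>objs Y. if a = o0 then ?eB Z y else ?eB Z (h \<star>\<^bsub>C\<^esub> x))"
        unfolding nat_trans_def Y_objs Y_arrs using ty tl com by (auto simp: eZ)
      then show ?thesis unfolding M0_def Cat2_cell_iff using f ty tl YV RV by simp
    qed
    have M1: "M1 \<in> cells (Cat2 V)"
    proof -
      define e R where eR: "e = ?eA Z x" "R = ?RA Z"
      have e: "e \<in> arrs R" "src R e = ?eA Z (s1 C x)" "tgt R e = ?eA Z (t1 C x)" "category R" "R \<in> V"
        unfolding eR using EA(1-3)[OF Z, of x] ty(1,5,7) cR(1) RV(1) by simp_all
      note ce = category_simps(1-8)[OF e(4)]
      have u: "src R e \<in> arrs R" "tgt R e \<in> arrs R" "cmp R (src R e) (src R e) = src R e" "cmp R (tgt R e) (tgt R e) =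
          tgt R e"
        "src R (src R e) = src R e" "tgt R (src R e) = src R e" "src R (tgt R e) = tgt R e" "tgt R (tgt R e) = tgt R
            e"
        "cmp R e (src R e) = e" "cmp R (tgt R e) e = e"
        using ce(1-6)[OF e(1)] ce(7)[of "src R e" "src R e"] ce(8)[of "tgt R e" "tgt R e"] ce(7)[OF e(1)] ce(8)[OF
            e(1)] by simp_all
      show ?thesis
        unfolding M1_def eR[symmetric] e(2,3)[symmetric] Cat2_cell_iff is_functor_def nat_trans_def oX1 X1(2)
        using X1(1) e(1,5) u by (simp add: a1 X1(2) oX1)
    qed
    have Mst: "s0 (Cat2 V) M0 = \<Phi> o0" "t0 (Cat2 V) M0 = N Z o0" "s0 (Cat2 V) M1 = \<Phi> o1" "t0 (Cat2 V) M1 = N Z o1"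
      by (simp_all add: M0_def M1_def Ps No[OF Z])
    have Mn: "M0 \<star>\<^bsub>Cat2 V\<^esub> K1 = hpost V C Z h \<star>\<^bsub>Cat2 V\<^esub> M1"
    proof (rule nt.expand, intro conjI)
      have nt: "ntgt (hpost V C Z h) = ?RB Z" by (simp add: hpost_def)
      show "nsrc (M0 \<star>\<^bsub>Cat2 V\<^esub> K1) = nsrc (hpost V C Z h \<star>\<^bsub>Cat2 V\<^esub> M1)" "ntgt (M0 \<star>\<^bsub>Cat2 V\<^esub> K1) = ntgt (hpost V C Z h
          \<star>\<^bsub>Cat2 V\<^esub> M1)"
        by (simp_all add: M0_def M1_def K1s nt)
      have nto: "nto (hpost V C Z h) = nfrom (hpost V C Z h)" by (simp add: hpost_def)
      have o1: "o1 \<in> arrs Y" "o1 \<in> objs Y" "o1 \<noteq> o0" by (auto simp: Y_objs)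
      have f: "nfrom M0 o1 = ?eB Z (h \<star>\<^bsub>C\<^esub> s1 C x)" "nto M0 o1 = ?eB Z (h \<star>\<^bsub>C\<^esub> t1 C x)" "nat_at M0 o1 = ?eB Z (h \<star>\<^bsub>C\<^esub>
          x)"
        "nfrom M1 a1 = ?eA Z (s1 C x)" "nto M1 a1 = ?eA Z (t1 C x)" "nat_at M1 a1 = ?eA Z x" "nsrc M1 = X1" "ntgt M0 =
            ?RB Z"
        using EB(3)[OF Z, of l] EB(3)[OF Z, of l'] tl ty(3,4,10,12) o1 by (simp_all add: M0_def M1_def X1(2) oX1)
      have "?eA Z (t1 C x) \<in> objs (?RA Z)"
        using functor_objs[OF enc_fun[OF hbA[OF Z] Hom_category], of "t1 C x"] ty(1,5,7) by (simp add: Hom_objs)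
      then have at: "nat_at (hpost V C Z h) (?eA Z (t1 C x)) = ?eB Z (h \<star>\<^bsub>C\<^esub> t1 C x)"
        using EA(5)[OF Z, of "t1 C x"] ty(1,5,7) by (simp add: hpost_def)
      have hv: "nfrom (hpost V C Z h) (?eA Z (s1 C x)) = ?eB Z (h \<star>\<^bsub>C\<^esub> s1 C x)" "nfrom (hpost V C Z h) (?eA Z (t1 C
          x)) = ?eB Z (h \<star>\<^bsub>C\<^esub> t1 C x)"
        "nfrom (hpost V C Z h) (?eA Z x) = ?eB Z (h \<star>\<^bsub>C\<^esub> x)"
        using hpostv[OF Z, of "s1 C x"] hpostv[OF Z, of "t1 C x"] hpostv[OF Z, of x] ty(1,5,7) by simp_all
      have cm: "cmp (?RB Z) (?eB Z (h \<star>\<^bsub>C\<^esub> x)) (?eB Z (h \<star>\<^bsub>C\<^esub> s1 C x)) = ?eB Z (h \<star>\<^bsub>C\<^esub> x)"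
        "cmp (?RB Z) (?eB Z (h \<star>\<^bsub>C\<^esub> t1 C x)) (?eB Z (h \<star>\<^bsub>C\<^esub> x)) = ?eB Z (h \<star>\<^bsub>C\<^esub> x)"
        using EB(4)[OF Z, of "h \<star>\<^bsub>C\<^esub> s1 C x" "h \<star>\<^bsub>C\<^esub> x"] EB(4)[OF Z, of "h \<star>\<^bsub>C\<^esub> x" "h \<star>\<^bsub>C\<^esub> t1 C x"] ty(1,5,7) by
            simp_all
      show "nfrom (M0 \<star>\<^bsub>Cat2 V\<^esub> K1) = nfrom (hpost V C Z h \<star>\<^bsub>Cat2 V\<^esub> M1)"
        unfolding Cat2_simps nt.sel K1s(1) f(7) by (rule restrict_ext) (simp add: X1(2) K1s f hv)
      show "nto (M0 \<star>\<^bsub>Cat2 V\<^esub> K1) = nto (hpost V C Z h \<star>\<^bsub>Cat2 V\<^esub> M1)"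
        unfolding Cat2_simps nt.sel K1s(1) f(7) nto by (rule restrict_ext) (simp add: X1(2) K1s f hv)
      show "nat_at (M0 \<star>\<^bsub>Cat2 V\<^esub> K1) = nat_at (hpost V C Z h \<star>\<^bsub>Cat2 V\<^esub> M1)"
        unfolding Cat2_simps nt.sel K1s(1) f(7,8) nt by (rule restrict_ext) (simp add: oX1 K1s f hv at cm)
    qed
    define M where "M = Mdf \<Phi> (\<lambda>j\<in>zero_cells (op arrow_2cat). if j = o0 then M0 else M1) (N Z)"
    have hh: "hpost V C Z h \<in> cells (Cat2 V)" "s1 (Cat2 V) (hpost V C Z h) = hpost V C Z h" "t1 (Cat2 V) (hpost V C Z
        h) = hpost V C Z h"
      "s0 (Cat2 V) (hpost V C Z h) = N Z o1" "t0 (Cat2 V) (hpost V C Z h) = N Z o0"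
      using two_functorD[OF hpost_functor[OF Z], of h] two_functor_verD[OF hpost_functor[OF Z] _ two_cat, of h]
      by (simp_all add: Nv del: Cat2_simps)
    note Mc = M0 M1 Mst hh K1c K1st Ps
    have K1st': "s0 (Cat2 V) K1 = \<Phi> o1" "t0 (Cat2 V) K1 = \<Phi> o0" using K1st Ps by auto
    have natst: "s1 (Cat2 V) M0 \<star>\<^bsub>Cat2 V\<^esub> K1 = hpost V C Z h \<star>\<^bsub>Cat2 V\<^esub> s1 (Cat2 V) M1"
      "t1 (Cat2 V) M0 \<star>\<^bsub>Cat2 V\<^esub> K1 = hpost V C Z h \<star>\<^bsub>Cat2 V\<^esub> t1 (Cat2 V) M1"
      using arg_cong[OF Mn, of "s1 (Cat2 V)"] arg_cong[OF Mn, of "t1 (Cat2 V)"] M0 M1 Mst hh K1c K1st' by (simp_all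
          del: Cat2_simps)
    have Mcell: "M \<in> cells (Fun2 (op arrow_2cat) (Cat2 V))"
    proof -
      have u: "M0 \<star>\<^bsub>Cat2 V\<^esub> \<Phi> o0 = M0" "M1 \<star>\<^bsub>Cat2 V\<^esub> \<Phi> o1 = M1" "N Z o0 \<star>\<^bsub>Cat2 V\<^esub> M0 = M0" "N Z o1 \<star>\<^bsub>Cat2 V\<^esub> M1 = M1"
         using CV.hcat(7)[OF M0 Mst(1)] CV.hcat(7)[OF M1 Mst(3)] CV.hcat(8)[OF M0 Mst(2)] CV.hcat(8)[OF M1 Mst(4)] by
             auto
      have u1: "f (Cat2 V) M0 \<star>\<^bsub>Cat2 V\<^esub> \<Phi> o0 = f (Cat2 V) M0" "f (Cat2 V) M1 \<star>\<^bsub>Cat2 V\<^esub> \<Phi> o1 = f (Cat2 V) M1"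
        "N Z o0 \<star>\<^bsub>Cat2 V\<^esub> f (Cat2 V) M0 = f (Cat2 V) M0" "N Z o1 \<star>\<^bsub>Cat2 V\<^esub> f (Cat2 V) M1 = f (Cat2 V) M1"
        "f (Cat2 V) M0 \<in> one_cells (Cat2 V)" "f (Cat2 V) M1 \<in> one_cells (Cat2 V)"
        "s0 (Cat2 V) (f (Cat2 V) M0) = \<Phi> o0" "t0 (Cat2 V) (f (Cat2 V) M0) = N Z o0"
        "s0 (Cat2 V) (f (Cat2 V) M1) = \<Phi> o1" "t0 (Cat2 V) (f (Cat2 V) M1) = N Z o1" if "f = s1 \<or> f = t1" for f
      proof -
        have c: "f (Cat2 V) M0 \<in> cells (Cat2 V)" "f (Cat2 V) M1 \<in> cells (Cat2 V)" using that M0 M1 by (auto simp del: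
            Cat2_simps)
        show s: "s0 (Cat2 V) (f (Cat2 V) M0) = \<Phi> o0" "t0 (Cat2 V) (f (Cat2 V) M0) = N Z o0"
        "s0 (Cat2 V) (f (Cat2 V) M1) = \<Phi> o1" "t0 (Cat2 V) (f (Cat2 V) M1) = N Z o1" using that M0 M1 Mst by (auto simp
            del: Cat2_simps)
        show "f (Cat2 V) M0 \<in> one_cells (Cat2 V)" "f (Cat2 V) M1 \<in> one_cells (Cat2 V)"
          using that M0 M1 CV.one_s1 CV.one_t1 by blast+
        show "f (Cat2 V) M0 \<star>\<^bsub>Cat2 V\<^esub> \<Phi> o0 = f (Cat2 V) M0" "f (Cat2 V) M1 \<star>\<^bsub>Cat2 V\<^esub> \<Phi> o1 = f (Cat2 V) M1"
          "N Z o0 \<star>\<^bsub>Cat2 V\<^esub> f (Cat2 V) M0 = f (Cat2 V) M0" "N Z o1 \<star>\<^bsub>Cat2 V\<^esub> f (Cat2 V) M1 = f (Cat2 V) M1"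
          using CV.hcat(7)[OF c(1) s(1)] CV.hcat(7)[OF c(2) s(3)] CV.hcat(8)[OF c(1) s(2)] CV.hcat(8)[OF c(2) s(4)] by
              auto
      qed
      note u1s = u1[of s1, OF disjI1[OF refl]] and u1t = u1[of t1, OF disjI2[OF refl]]
      have mM: "mat M o0 = M0" "mat M o1 = M1" by (simp_all add: M_def arrow_2cat_op_cells)
      have nh: "N Z ar = hpost V C Z h" by (simp add: Nv)
      have "two_natural (op arrow_2cat) (Cat2 V) \<Phi> (N Z) (\<lambda>A. s1 (Cat2 V) (mat M A))"
        unfolding two_natural_def arrow_2cat_op_cells using u1s natst by (auto simp: mM Y_arrs Ps(3) nh simp del:
            Cat2_simps)
      moreover have "two_natural (op arrow_2cat) (Cat2 V) \<Phi> (N Z) (\<lambda>A. t1 (Cat2 V) (mat M A))"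
        unfolding two_natural_def arrow_2cat_op_cells using u1t natst by (auto simp: mM Y_arrs Ps(3) nh simp del:
            Cat2_simps)
      moreover have "\<forall>y\<in>one_cells (op arrow_2cat). mat M (t0 (op arrow_2cat) y) \<star>\<^bsub>Cat2 V\<^esub> \<Phi> y = N Z y \<star>\<^bsub>Cat2 V\<^esub> mat M
          (s0 (op arrow_2cat) y)"
        unfolding arrow_2cat_op_cells using u Mn by (auto simp: mM Ps(3) nh simp del: Cat2_simps)
      ultimately show ?thesis
        unfolding Fun2_cell_iff using P Pe N2[OF Z] Ne M0 M1 by (simp add: M_def arrow_2cat_op_cells del: Cat2_simps)
    qed
    have sM: "s0 (Fun2 (op arrow_2cat) (Cat2 V)) M = \<phi>" by (simp add: M_def \<phi>_def)
    have tM: "t0 (Fun2 (op arrow_2cat) (Cat2 V)) M = nerve V arrow_2cat (op C) D Z"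
    proof -
      have "hpre V C G Z = idnt (robj V (Hom C Z G))" if G: "G \<in> zero_cells C" for G
      proof -
        have "hpre V C G Z = s0 (Cat2 V) (hpre V C G Z)" using two_functorD(2)[OF hpre_functor[OF G], of Z] Z by (simp
            del: Cat2_simps)
        then show ?thesis using Z by (simp add: hpre_def)
      qed
      then have "N Z j = hpre V C (D j) Z" if "j \<in> {o0, o1}" for j using that No[OF Z] by auto
      then have "(\<lambda>A\<in>zero_cells (op arrow_2cat). N Z A) = mat (nerve V arrow_2cat (op C) D Z)"
        using ner(3)[of _ Z] arrow_2cat_cells arrow_2cat_op_cells
        by (intro extensionalityI[of _ "{o0, o1}"]) (auto simp: nerve_def)
      then show ?thesis using Z by (intro mdf.expand) (simp add: M_def ner)
    qed
    have evM: "nfrom (mat M o0) ar = ?eB Z l" "nto (mat M o0) ar = ?eB Z l'" "nat_at (mat M o0) o0 = ?eB Z y" "nat_at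
        (mat M o1) a1 = ?eA Z x"
      by (simp_all add: M_def arrow_2cat_op_cells M0_def M1_def oX1 Y_objs)
    have mat_nerve: "mat (nerve V arrow_2cat (op C) D u \<star>\<^bsub>Fun2 (op arrow_2cat) (Cat2 V)\<^esub> \<eta>) o0 = hpre V C B u \<star>\<^bsub>Cat2
        V\<^esub> m0"
      "mat (nerve V arrow_2cat (op C) D u \<star>\<^bsub>Fun2 (op arrow_2cat) (Cat2 V)\<^esub> \<eta>) o1 = hpre V C A u \<star>\<^bsub>Cat2 V\<^esub> m1" for u
      using ner(3)[of o0 u] ner(3)[of o1 u] by (simp_all add: arrow_2cat_op_cells m0_def m1_def del: Cat2_simps)
    \<comment> \<open>Surjectivity of the isomorphism between hom-categories gives the induced cell;
      its injectivity will give uniqueness.\<close>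
    obtain u where u: "u \<in> cells C" "s0 C u = Z" "t0 C u = c" "nerve V arrow_2cat (op C) D u \<star>\<^bsub>Fun2 (op arrow_2cat)
        (Cat2 V)\<^esub> \<eta> = M"
    proof -
      have "M \<in> (\<lambda>x. nerve V arrow_2cat (op C) D x \<star>\<^bsub>Fun2 (op arrow_2cat) (Cat2 V)\<^esub> \<eta>) ` {x \<in> cells C. s0 C x = Z \<and> t0
          C x = c}"
        unfolding bij_betw_imp_surj_on[OF bij[OF Z]] using Mcell sM tM by blast
      then show thesis using that by blast
    qed
    have uA: "hpre V C B u \<star>\<^bsub>Cat2 V\<^esub> m0 = mat M o0" "hpre V C A u \<star>\<^bsub>Cat2 V\<^esub> m1 = mat M o1"
      using mat_nerve[of u] unfolding u(4) by simp_all
    have pu: "p \<star>\<^bsub>C\<^esub> u = x" "q \<star>\<^bsub>C\<^esub> u = y" "k \<star>\<^bsub>C\<^esub> s1 C u = l" "k \<star>\<^bsub>C\<^esub> t1 C u = l'"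
    proof -
      have "?eA Z (p \<star>\<^bsub>C\<^esub> u) = ?eA Z x"
        using arg_cong[OF uA(2), of "\<lambda>z. nat_at z a1"] unfolding ev1[OF u(1-3)] evM by (simp add: oX1)
      then show "p \<star>\<^bsub>C\<^esub> u = x" using EA(6)[OF Z, of "p \<star>\<^bsub>C\<^esub> u" x] p u ty by simp
      have "?eB Z (q \<star>\<^bsub>C\<^esub> u) = ?eB Z y"
        using arg_cong[OF uA(1), of "\<lambda>z. nat_at z o0"] unfolding ev0[OF u(1-3)] evM by (simp add: Y_objs)
      then show "q \<star>\<^bsub>C\<^esub> u = y" using EB(6)[OF Z, of "q \<star>\<^bsub>C\<^esub> u" y] q u ty by simp
      have "?eB Z (k \<star>\<^bsub>C\<^esub> s1 C u) = ?eB Z l"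
        using arg_cong[OF uA(1), of "\<lambda>z. nfrom z ar"] unfolding ev0[OF u(1-3)] evM by simp
      then show "k \<star>\<^bsub>C\<^esub> s1 C u = l" using EB(6)[OF Z, of "k \<star>\<^bsub>C\<^esub> s1 C u" l] k u ty tl by simp
      have "?eB Z (k \<star>\<^bsub>C\<^esub> t1 C u) = ?eB Z l'"
        using arg_cong[OF uA(1), of "\<lambda>z. nto z ar"] unfolding ev0[OF u(1-3)] evM by simp
      then show "k \<star>\<^bsub>C\<^esub> t1 C u = l'" using EB(6)[OF Z, of "k \<star>\<^bsub>C\<^esub> t1 C u" l'] k u ty tl by simp
    qed
    show ?case
    proof (rule ex1I[of _ u])
      show "u \<in> cells C \<and> s0 C u = s0 C x \<and> t0 C u = s0 C p \<and> p \<star>\<^bsub>C\<^esub> u = x \<and> q \<star>\<^bsub>C\<^esub> u = y \<and> k \<star>\<^bsub>C\<^esub> s1 C u = l \<and> k \<star>\<^bsub>C\<^esub>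
          t1 C u = l'"
        using u(1-3) pu p(4) ty(5) by simp
    next
      fix v assume v: "v \<in> cells C \<and> s0 C v = s0 C x \<and> t0 C v = s0 C p \<and> p \<star>\<^bsub>C\<^esub> v = x \<and> q \<star>\<^bsub>C\<^esub> v = y \<and> k \<star>\<^bsub>C\<^esub> s1 C v =
          l \<and> k \<star>\<^bsub>C\<^esub> t1 C v = l'"
      then have v': "v \<in> cells C" "s0 C v = Z" "t0 C v = c" and pv: "p \<star>\<^bsub>C\<^esub> v = p \<star>\<^bsub>C\<^esub> u" "q \<star>\<^bsub>C\<^esub> v = q \<star>\<^bsub>C\<^esub> u"
        "k \<star>\<^bsub>C\<^esub> s1 C v = k \<star>\<^bsub>C\<^esub> s1 C u" "k \<star>\<^bsub>C\<^esub> t1 C v = k \<star>\<^bsub>C\<^esub> t1 C u"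
        using p(4) ty(5) pu by auto
      have pv1: "p \<star>\<^bsub>C\<^esub> s1 C v = p \<star>\<^bsub>C\<^esub> s1 C u" "p \<star>\<^bsub>C\<^esub> t1 C v = p \<star>\<^bsub>C\<^esub> t1 C u" "q \<star>\<^bsub>C\<^esub> s1 C v = q \<star>\<^bsub>C\<^esub> s1 C u" "q
          \<star>\<^bsub>C\<^esub> t1 C v = q \<star>\<^bsub>C\<^esub> t1 C u"
        using s1_hcomp[of v p] s1_hcomp[of u p] t1_hcomp[of v p] t1_hcomp[of u p] s1_hcomp[of v q] s1_hcomp[of u q]
            t1_hcomp[of v q] t1_hcomp[of u q]
          pv(1,2) p q v' u(1-3) by metis+
      have hp: "(h \<star>\<^bsub>C\<^esub> p) \<star>\<^bsub>C\<^esub> z = h \<star>\<^bsub>C\<^esub> (p \<star>\<^bsub>C\<^esub> z)" if "z \<in> cells C" "t0 C z = c" for z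
        using that p by (simp add: hassoc)
      have 0: "hpre V C B v \<star>\<^bsub>Cat2 V\<^esub> m0 = hpre V C B u \<star>\<^bsub>Cat2 V\<^esub> m0"
      proof (rule nt.expand, intro conjI)
        show "nfrom (hpre V C B v \<star>\<^bsub>Cat2 V\<^esub> m0) = nfrom (hpre V C B u \<star>\<^bsub>Cat2 V\<^esub> m0)"
          unfolding ev0[OF v'] ev0[OF u(1-3)] using pv pv1 hp v' u(1-3) by (intro restrict_ext) auto
        show "nto (hpre V C B v \<star>\<^bsub>Cat2 V\<^esub> m0) = nto (hpre V C B u \<star>\<^bsub>Cat2 V\<^esub> m0)"
          unfolding ev0[OF v'] ev0[OF u(1-3)] using pv pv1 hp v' u(1-3) by (intro restrict_ext) auto
        show "nat_at (hpre V C B v \<star>\<^bsub>Cat2 V\<^esub> m0) = nat_at (hpre V C B u \<star>\<^bsub>Cat2 V\<^esub> m0)"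
          unfolding ev0[OF v'] ev0[OF u(1-3)] using pv pv1 hp v' u(1-3) by (intro restrict_ext) auto
      qed (use v' u(1-3) in \<open>simp_all add: hpre_def\<close>)
      have 1: "hpre V C A v \<star>\<^bsub>Cat2 V\<^esub> m1 = hpre V C A u \<star>\<^bsub>Cat2 V\<^esub> m1"
      proof (rule nt.expand, intro conjI)
        show "nfrom (hpre V C A v \<star>\<^bsub>Cat2 V\<^esub> m1) = nfrom (hpre V C A u \<star>\<^bsub>Cat2 V\<^esub> m1)"
          "nto (hpre V C A v \<star>\<^bsub>Cat2 V\<^esub> m1) = nto (hpre V C A u \<star>\<^bsub>Cat2 V\<^esub> m1)"
          "nat_at (hpre V C A v \<star>\<^bsub>Cat2 V\<^esub> m1) = nat_at (hpre V C A u \<star>\<^bsub>Cat2 V\<^esub> m1)"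
          unfolding ev1[OF v'] ev1[OF u(1-3)] using pv pv1 by simp_all
      qed (use v' u(1-3) in \<open>simp_all add: hpre_def\<close>)
      have "nerve V arrow_2cat (op C) D v \<star>\<^bsub>Fun2 (op arrow_2cat) (Cat2 V)\<^esub> \<eta> = nerve V arrow_2cat (op C) D u \<star>\<^bsub>Fun2
          (op arrow_2cat) (Cat2 V)\<^esub> \<eta>"
      proof (rule mdf.expand, intro conjI)
        show "mat (nerve V arrow_2cat (op C) D v \<star>\<^bsub>Fun2 (op arrow_2cat) (Cat2 V)\<^esub> \<eta>) = mat (nerve V arrow_2cat (op C)
            D u \<star>\<^bsub>Fun2 (op arrow_2cat) (Cat2 V)\<^esub> \<eta>)"
          using mat_nerve[of u] mat_nerve[of v] 0 1
          by (intro extensionalityI[of _ "zero_cells (op arrow_2cat)"]) (auto simp: arrow_2cat_op_cells simp del: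
              Cat2_simps)
      qed (use v' u(1-3) in \<open>simp_all add: ner\<close>)
      then show "v = u"
        using inj_onD[OF bij_betw_imp_inj_on[OF bij[OF Z]]] v' u(1-3) by blast
    qed
  qed (use p q k ks in \<open>simp_all add: one_cells_iff\<close>)
  then show ?thesis by blast
qed

end

section \<open>Algebras over a 2-category of 2-functors as natural families of algebras\<close>

section \<open>Pointwise factorisation systems\<close>

lemma Fun2_cellD:
  assumes "x \<in> cells (Fun2 P Q)" "twocat Q" "A \<in> zero_cells P"
  shows "mat x A \<in> cells Q" "s0 Q (mat x A) = mfrom x A" "t0 Q (mat x A) = mto x A"
proof -
  interpret twocat Q by fact
  show c: "mat x A \<in> cells Q" using assms by (simp add: Fun2_cell_iff)
  have "s0 Q (s1 Q (mat x A)) = mfrom x A" "t0 Q (s1 Q (mat x A)) = mto x A"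
    using assms unfolding Fun2_cell_iff two_natural_def by auto
  then show "s0 Q (mat x A) = mfrom x A" "t0 Q (mat x A) = mto x A" using mixed(1,3)[OF c] by auto
qed

lemma Fun2_one_cellD:
  assumes x: "x \<in> one_cells (Fun2 P Q)" and P: "twocat P"
  shows "two_functor P Q (mfrom x)" "two_functor P Q (mto x)" "two_natural P Q (mfrom x) (mto x) (mat x)"
    "\<And>A. A \<in> zero_cells P \<Longrightarrow> mat x A \<in> one_cells Q"
    "mfrom x \<in> extensional (cells P)" "mto x \<in> extensional (cells P)" "mat x \<in> extensional (zero_cells P)"
proof -
  have c: "x \<in> cells (Fun2 P Q)" and s: "\<And>A. A \<in> zero_cells P \<Longrightarrow> s1 Q (mat x A) = mat x A"
    using x unfolding Fun2_one_cell by auto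
  show "two_functor P Q (mfrom x)" "two_functor P Q (mto x)"
    "mfrom x \<in> extensional (cells P)" "mto x \<in> extensional (cells P)" "mat x \<in> extensional (zero_cells P)"
    using c unfolding Fun2_cell_iff by auto
  have n: "two_natural P Q (mfrom x) (mto x) (\<lambda>A. s1 Q (mat x A))" using c unfolding Fun2_cell_iff by blast
  then show o: "mat x A \<in> one_cells Q" if "A \<in> zero_cells P" for A using s[OF that] that unfolding two_natural_def by
      auto
  show "two_natural P Q (mfrom x) (mto x) (mat x)"
    unfolding two_natural_def
  proof (intro conjI ballI)
    fix A assume A: "A \<in> zero_cells P"
    show "mat x A \<in> one_cells Q" "s0 Q (mat x A) = mfrom x A" "t0 Q (mat x A) = mto x A"
      using A n s[OF A] unfolding two_natural_def by auto
  next
    fix y assume y: "y \<in> cells P"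
    interpret P: twocat P by fact
    show "mat x (t0 P y) \<star>\<^bsub>Q\<^esub> mfrom x y = mto x y \<star>\<^bsub>Q\<^esub> mat x (s0 P y)"
      using n y s[of "t0 P y"] s[of "s0 P y"] unfolding two_natural_def by auto
  qed
qed

lemma Fun2_one_cellI:
  assumes "twocat P" "two_functor P Q F" "two_functor P Q G" "F \<in> extensional (cells P)" "G \<in> extensional (cells P)"
    and n: "two_natural P Q F G m" and "twocat Q"
  shows "Mdf F (\<lambda>A\<in>zero_cells P. m A) G \<in> one_cells (Fun2 P Q)"
proof -
  interpret P: twocat P by fact
  interpret Q: twocat Q by fact
  have o: "m A \<in> cells Q" "s1 Q (m A) = m A" "t1 Q (m A) = m A" "m A \<in> one_cells Q" "s0 Q (m A) = F A" "t0 Q (m A) = G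
      A"
    if "A \<in> zero_cells P" for A
    using n that Q.one_cellD[of "m A"] unfolding two_natural_def by auto
  have e: "m (t0 P y) \<star>\<^bsub>Q\<^esub> F y = G y \<star>\<^bsub>Q\<^esub> m (s0 P y)" if "y \<in> cells P" for y using n that unfolding two_natural_def by
      blast
  have "two_natural P Q F G (\<lambda>A. s1 Q (restrict m (zero_cells P) A))" "two_natural P Q F G (\<lambda>A. t1 Q (restrict m
      (zero_cells P) A))"
    unfolding two_natural_def using o e by auto
  moreover have "\<forall>y\<in>one_cells P. restrict m (zero_cells P) (t0 P y) \<star>\<^bsub>Q\<^esub> F y = G y \<star>\<^bsub>Q\<^esub> restrict m (zero_cells P) (s0
      P y)"
    using e P.one_cellD(1) by auto
  ultimately show ?thesis
    unfolding Fun2_one_cell Fun2_cell_iff using assms o by auto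
qed

text \<open>A 2-natural transformation as a 2-functor into the arrow 2-category. In this form it can
  be composed with \<open>Kf\<close>, which makes the pointwise middle object a 2-functor.\<close>

lemma two_natural_functor:
  assumes "twocat A" "twocat D" and F: "two_functor A D F" and G: "two_functor A D G" and n: "two_natural A D F G g"
  shows "two_functor A (Arr D) (\<lambda>x. Sq (g (s0 A x)) (F x) (G x) (g (t0 A x)))"
proof -
  interpret A: twocat A by fact
  interpret D: twocat D by fact
  note f = two_functorD[OF F] two_functor_verD[OF F _ A.two_cat] and g = two_functorD[OF G] two_functor_verD[OF G _
      A.two_cat]
  have o: "g a \<in> one_cells D" "s0 D (g a) = F a" "t0 D (g a) = G a" if "a \<in> zero_cells A" for a
    using n that unfolding two_natural_def by auto
  have e: "g (t0 A y) \<star>\<^bsub>D\<^esub> F y = G y \<star>\<^bsub>D\<^esub> g (s0 A y)" if "y \<in> cells A" for y using n that unfolding two_natural_def by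
      blast
  show ?thesis
    by (rule two_functorI[OF assms(1) twocat_Arr[OF assms(2)]])
      (use f g o e in \<open>auto simp: Arr_cell_iff ob_def two_functor_comp(1)[OF F] two_functor_comp(1)[OF G]
        two_functor_comp(2)[OF F _ _ A.two_cat] two_functor_comp(2)[OF G _ _ A.two_cat] A.parallel01\<close>)
qed

definition ev :: "'p \<Rightarrow> ('p, 'q) mdf sq \<Rightarrow> 'q sq" where
  "ev A s = Sq (mat (left s) A) (mat (top s) A) (mat (bot s) A) (mat (right s) A)"

text \<open>The value at \<open>x\<close> of the 2-functor into the arrow 2-category that
  corresponds to \<open>\<phi>\<close>. These are the squares with respect to which a family of
  algebra structures has to be natural.\<close>

definition nat_square :: "'p twocat \<Rightarrow> ('p, 'q) mdf \<Rightarrow> 'p \<Rightarrow> 'q sq" where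
  "nat_square P \<phi> x = Sq (mat \<phi> (s0 P x)) (mfrom \<phi> x) (mto \<phi> x) (mat \<phi> (t0 P x))"

lemma ev_sel [simp]: "left (ev A s) = mat (left s) A" "top (ev A s) = mat (top s) A"
  "bot (ev A s) = mat (bot s) A" "right (ev A s) = mat (right s) A"
  by (simp_all add: ev_def)

lemma Arr_cellD:
  assumes "s \<in> cells (Arr K)"
  shows "left s \<in> one_cells K" "right s \<in> one_cells K" "top s \<in> cells K" "bot s \<in> cells K"
    "s0 K (top s) = s0 K (left s)" "t0 K (top s) = s0 K (right s)" "s0 K (bot s) = t0 K (left s)" "t0 K (bot s) = t0 K
        (right s)"
    "right s \<star>\<^bsub>K\<^esub> top s = bot s \<star>\<^bsub>K\<^esub> left s"
  using assms unfolding Arr_cell_iff by blast+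

lemma Arr_Fun2_ends:
  assumes "s \<in> cells (Arr (Fun2 P Q))"
  shows "mfrom (top s) = mfrom (left s)" "mto (top s) = mfrom (right s)" "mfrom (bot s) = mto (left s)" "mto (bot s) =
      mto (right s)"
  using Arr_cellD(5-8)[OF assms] by simp_all

locale pointwise_awfs = P: twocat P + awfs_loc Q EM for P :: "'p twocat" and Q :: "'q twocat" and EM
begin

abbreviation "M \<equiv> pointwise P EM"

lemma M_simps:
  "A \<in> zero_cells P \<Longrightarrow> mat (rho M \<phi>) A = rho EM (mat \<phi> A)" "A \<in> zero_cells P \<Longrightarrow> mat (lam M \<phi>) A = lam EM (mat \<phi> A)"
  "A \<in> zero_cells P \<Longrightarrow> mat (pim M \<phi>) A = pim EM (mat \<phi> A)" "A \<in> zero_cells P \<Longrightarrow> mat (Kf M s) A = Kf EM (ev A s)"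
  "mfrom (rho M \<phi>) = pw_mid P EM \<phi>" "mto (rho M \<phi>) = mto \<phi>"
  "mfrom (Kf M s) = pw_mid P EM (left s)" "mto (Kf M s) = pw_mid P EM (right s)"
  "mfrom (lam M \<phi>) = mfrom \<phi>" "mto (lam M \<phi>) = pw_mid P EM \<phi>"
  "mfrom (pim M \<phi>) = pw_mid P EM (rho M \<phi>)" "mto (pim M \<phi>) = pw_mid P EM \<phi>"
  by (simp_all add: pointwise_def ev_def)

lemma pw_mid_nat_square: "x \<in> cells P \<Longrightarrow> pw_mid P EM \<phi> x = Kf EM (nat_square P \<phi> x)"
  by (simp add: pw_mid_def nat_square_def)

lemma ev_cell:
  assumes s: "s \<in> cells (Arr (Fun2 P Q))" and A: "A \<in> zero_cells P"
  shows "ev A s \<in> cells (Arr Q)"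
proof -
  have tc: "twocat Q" by unfold_locales
  note c = Arr_cellD(1-4)[OF s] and e = Arr_cellD(9)[OF s]
  note m = Arr_Fun2_ends[OF s]
  have l: "left s \<in> cells (Fun2 P Q)" "right s \<in> cells (Fun2 P Q)" using c Fun2_one_cell by blast+
  have "mat (right s \<star>\<^bsub>Fun2 P Q\<^esub> top s) A = mat (bot s \<star>\<^bsub>Fun2 P Q\<^esub> left s) A" unfolding e ..
  then show "ev A s \<in> cells (Arr Q)"
    unfolding Arr_cell_iff using Fun2_cellD[OF c(3) tc A] Fun2_cellD[OF c(4) tc A] Fun2_cellD[OF l(1) tc A]
        Fun2_cellD[OF l(2) tc A]
      Fun2_one_cellD(4)[OF c(1) P.twocat_axioms A] Fun2_one_cellD(4)[OF c(2) P.twocat_axioms A] A m by simp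
qed

lemma ev_ob:
  assumes "\<phi> \<in> cells (Fun2 P Q)" "A \<in> zero_cells P"
  shows "ev A (ob (Fun2 P Q) \<phi>) = ob Q (mat \<phi> A)"
  using Fun2_cellD[OF assms(1) twocat_axioms assms(2)] assms by (simp add: ev_def ob_def)

lemma ev_hcomp: "A \<in> zero_cells P \<Longrightarrow> ev A (y \<star>\<^bsub>Arr (Fun2 P Q)\<^esub> x) = ev A y \<star>\<^bsub>Arr Q\<^esub> ev A x"
  by (simp add: ev_def)

lemma ev_Rfun: "A \<in> zero_cells P \<Longrightarrow> ev A (Rfun M s) = Rfun EM (ev A s)"
  by (rule sq.expand) (simp add: Rfun_def M_simps)

lemma ev_unit:
  assumes "\<phi> \<in> cells (Fun2 P Q)" "A \<in> zero_cells P"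
  shows "ev A (Lambda (Fun2 P Q) M (ob (Fun2 P Q) \<phi>)) = Lambda Q EM (ob Q (mat \<phi> A))"
    "ev A (Pi_mult (Fun2 P Q) M (ob (Fun2 P Q) \<phi>)) = Pi_mult Q EM (ob Q (mat \<phi> A))"
  using Fun2_cellD[OF assms(1) twocat_axioms assms(2)] assms(2)
  by (auto simp: Lambda_def Pi_mult_def Let_def M_simps ev_def)

lemma Ralgebra_simps:
  assumes a: "Ralgebra (Fun2 P Q) M a"
  shows "a \<in> cells (Arr (Fun2 P Q))" "a \<in> one_cells (Arr (Fun2 P Q))" "left a = rho M (right a)" "right a \<in> one_cells
      (Fun2 P Q)"
    "right a \<in> cells (Fun2 P Q)" "top a \<in> one_cells (Fun2 P Q)" "bot a \<in> one_cells (Fun2 P Q)"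
    "mfrom (top a) = pw_mid P EM (right a)" "mto (top a) = mfrom (right a)" "mfrom (bot a) = mto (right a)" "mto (bot
        a) = mto (right a)"
proof -
  show o: "a \<in> one_cells (Arr (Fun2 P Q))" using a unfolding Ralgebra_def algebra_def by blast
  then show c: "a \<in> cells (Arr (Fun2 P Q))" and s: "right a \<in> one_cells (Fun2 P Q)" "right a \<in> cells (Fun2 P Q)"
    unfolding objs_def[of "ver (Arr (Fun2 P Q))"] Arr_simps(7) using Arr_cellD(2) Fun2_one_cell by blast+
  have e: "s1 (Arr (Fun2 P Q)) a = a" using o unfolding objs_def[of "ver (Arr (Fun2 P Q))"] by blast
  have "s1 (Fun2 P Q) (top a) = top a" "s1 (Fun2 P Q) (bot a) = bot a"
    using arg_cong[OF e, of top] arg_cong[OF e, of bot] by (simp_all del: Fun2_simps)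
  then show "top a \<in> one_cells (Fun2 P Q)" "bot a \<in> one_cells (Fun2 P Q)"
    using Arr_cellD(3,4)[OF c] unfolding objs_def[of "ver (Fun2 P Q)"] by (simp_all del: Fun2_simps(1-6))
  have "s0 (Arr (Fun2 P Q)) a = Rfun M (t0 (Arr (Fun2 P Q)) a)" using a unfolding Ralgebra_def algebra_def by blast
  from arg_cong[OF this, of left] show l: "left a = rho M (right a)" by (simp add: Rfun_def)
  show "mfrom (top a) = pw_mid P EM (right a)" "mto (top a) = mfrom (right a)" "mfrom (bot a) = mto (right a)" "mto
      (bot a) = mto (right a)"
    using Arr_Fun2_ends[OF c] l by (simp_all add: M_simps)
qed

text \<open>Unit, multiplication and the functor part of the pointwise system are computed at each
  object, so each algebra law can be evaluated at \<open>A\<close>.\<close>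

lemma ev_algebra:
  assumes a: "Ralgebra (Fun2 P Q) M a" and A: "A \<in> zero_cells P"
  shows "Ralgebra Q EM (ev A a)"
proof -
  note r = Ralgebra_simps[OF a]
  let ?P = "Fun2 P Q"
  have alg: "s0 (Arr ?P) a = Rfun M (t0 (Arr ?P) a)" "a \<star>\<^bsub>Arr ?P\<^esub> Lambda ?P M (t0 (Arr ?P) a) = t0 (Arr ?P) a"
    "a \<star>\<^bsub>Arr ?P\<^esub> Rfun M a = a \<star>\<^bsub>Arr ?P\<^esub> Pi_mult ?P M (t0 (Arr ?P) a)"
    using a unfolding Ralgebra_def algebra_def by blast+
  have lc: "left a \<in> cells ?P" using Arr_cellD(1)[OF r(1)] Fun2_one_cell by blast
  have c: "ev A a \<in> cells (Arr Q)" by (rule ev_cell[OF r(1) A])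
  have "mat (top a) A \<in> one_cells Q" "mat (bot a) A \<in> one_cells Q" using Fun2_one_cellD(4)[OF _ P.twocat_axioms A] r
      by auto
  then have 1: "ev A a \<in> one_cells (Arr Q)" using c unfolding Arr_one_cells by simp
  have t: "t0 (Arr ?P) a = ob ?P (right a)" "s0 (Arr ?P) a = ob ?P (left a)" by simp_all
  have 2: "s0 (Arr Q) (ev A a) = Rfun EM (t0 (Arr Q) (ev A a))"
    using arg_cong[OF alg(1), of "ev A"] unfolding t ev_Rfun[OF A] ev_ob[OF r(5) A] ev_ob[OF lc A] by simp
  have 3: "ev A a \<star>\<^bsub>Arr Q\<^esub> Lambda Q EM (t0 (Arr Q) (ev A a)) = t0 (Arr Q) (ev A a)"
    using arg_cong[OF alg(2), of "ev A"] unfolding t ev_hcomp[OF A] ev_ob[OF r(5) A] ev_unit[OF r(5) A] Arr_simps(2)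
        ev_sel(4) .
  have 4: "ev A a \<star>\<^bsub>Arr Q\<^esub> Rfun EM (ev A a) = ev A a \<star>\<^bsub>Arr Q\<^esub> Pi_mult Q EM (t0 (Arr Q) (ev A a))"
    using arg_cong[OF alg(3), of "ev A"] unfolding t ev_hcomp[OF A] ev_Rfun[OF A] ev_unit[OF r(5) A] Arr_simps(2)
        ev_sel(4) .
  show ?thesis unfolding Ralgebra_def algebra_def using 1 2 3 4 by blast
qed

text \<open>The domain and codomain parts of an algebra structure are 2-natural. Their naturality at
  \<open>x\<close> says that the naturality square of the underlying transformation is a strict
  morphism of algebras.\<close>

lemma ev_algebra_nat:
  assumes a: "Ralgebra (Fun2 P Q) M a" and x: "x \<in> cells P"
  shows "nat_square P (right a) x \<star>\<^bsub>Arr Q\<^esub> ev (s0 P x) a = ev (t0 P x) a \<star>\<^bsub>Arr Q\<^esub> Rfun EM (nat_square P (right a) x)"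
proof -
  note r = Ralgebra_simps[OF a]
  have z: "s0 P x \<in> zero_cells P" "t0 P x \<in> zero_cells P" using x by simp_all
  have "mat (top a) (t0 P x) \<star>\<^bsub>Q\<^esub> mfrom (top a) x = mto (top a) x \<star>\<^bsub>Q\<^esub> mat (top a) (s0 P x)"
    "mat (bot a) (t0 P x) \<star>\<^bsub>Q\<^esub> mfrom (bot a) x = mto (bot a) x \<star>\<^bsub>Q\<^esub> mat (bot a) (s0 P x)"
    using Fun2_one_cellD(3)[OF r(6) P.twocat_axioms] Fun2_one_cellD(3)[OF r(7) P.twocat_axioms] x unfolding
        two_natural_def by auto
  then show ?thesis
    using z x by (simp add: r(3,8-) pw_mid_nat_square Rfun_def M_simps) (simp add: nat_square_def)
qed

lemma strict_of_pointwise: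
  assumes a: "Ralgebra (Fun2 P Q) M a" and b: "Ralgebra (Fun2 P Q) M b"
    and x: "x \<in> cells (Arr (Fun2 P Q))" "s0 (Arr (Fun2 P Q)) x = t0 (Arr (Fun2 P Q)) a" "t0 (Arr (Fun2 P Q)) x = t0
        (Arr (Fun2 P Q)) b"
    and e: "\<And>A. A \<in> zero_cells P \<Longrightarrow> ev A x \<star>\<^bsub>Arr Q\<^esub> ev A a = ev A b \<star>\<^bsub>Arr Q\<^esub> Rfun EM (ev A x)"
  shows "AlgC a x b \<in> cells (RAlg (Fun2 P Q) M)"
proof -
  note ra = Ralgebra_simps[OF a] and rb = Ralgebra_simps[OF b]
  have lr: "left x = right a" "right x = right b" using x(2,3) by (auto simp: ob_def)
  have m: "mfrom (top x) = mfrom (left x)" "mto (top x) = mfrom (right x)" "mfrom (bot x) = mto (left x)" "mto (bot x)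
      = mto (right x)"
    by (rule Arr_Fun2_ends[OF x(1)])+
  have "mat (top x) A \<star>\<^bsub>Q\<^esub> mat (top a) A = mat (top b) A \<star>\<^bsub>Q\<^esub> Kf EM (ev A x)"
    "mat (bot x) A \<star>\<^bsub>Q\<^esub> mat (bot a) A = mat (bot b) A \<star>\<^bsub>Q\<^esub> mat (bot x) A" if "A \<in> zero_cells P" for A
    using e[OF that] by (auto simp: Rfun_def)
  then have "x \<star>\<^bsub>Arr (Fun2 P Q)\<^esub> a = b \<star>\<^bsub>Arr (Fun2 P Q)\<^esub> Rfun M x"
    by (simp add: Rfun_def lr ra rb m M_simps cong: restrict_cong)
  then show ?thesis
    using a b x unfolding RAlg_def Alg_def Ralgebra_def by (simp add: Let_def del: Arr_simps)
qed

lemma RAlg_Fun2D: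
  assumes "AlgC a x b \<in> cells (RAlg (Fun2 P Q) M)"
  shows "Ralgebra (Fun2 P Q) M a" "Ralgebra (Fun2 P Q) M b" "x \<in> cells (Arr (Fun2 P Q))"
    "s0 (Arr (Fun2 P Q)) x = t0 (Arr (Fun2 P Q)) a" "t0 (Arr (Fun2 P Q)) x = t0 (Arr (Fun2 P Q)) b"
    "\<And>A. A \<in> zero_cells P \<Longrightarrow> ev A x \<star>\<^bsub>Arr Q\<^esub> ev A a = ev A b \<star>\<^bsub>Arr Q\<^esub> Rfun EM (ev A x)"
proof -
  have *: "Ralgebra (Fun2 P Q) M a \<and> Ralgebra (Fun2 P Q) M b \<and> x \<in> cells (Arr (Fun2 P Q)) \<and>
    s0 (Arr (Fun2 P Q)) x = t0 (Arr (Fun2 P Q)) a \<and> t0 (Arr (Fun2 P Q)) x = t0 (Arr (Fun2 P Q)) b \<and>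
    x \<star>\<^bsub>Arr (Fun2 P Q)\<^esub> a = b \<star>\<^bsub>Arr (Fun2 P Q)\<^esub> Rfun M x"
    using assms unfolding RAlg_def Alg_def Ralgebra_def by (simp add: Let_def del: Arr_simps)
  then show "Ralgebra (Fun2 P Q) M a" "Ralgebra (Fun2 P Q) M b" "x \<in> cells (Arr (Fun2 P Q))"
    "s0 (Arr (Fun2 P Q)) x = t0 (Arr (Fun2 P Q)) a" "t0 (Arr (Fun2 P Q)) x = t0 (Arr (Fun2 P Q)) b" by blast+
  fix A assume A: "A \<in> zero_cells P"
  show "ev A x \<star>\<^bsub>Arr Q\<^esub> ev A a = ev A b \<star>\<^bsub>Arr Q\<^esub> Rfun EM (ev A x)"
    using * ev_hcomp[OF A, of x a] ev_hcomp[OF A, of b "Rfun M x"] ev_Rfun[OF A] by simp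
qed

text \<open>The pointwise middle object is \<open>Kf\<close> composed with
  \<open>nat_square\<close>, restricted to the cells of \<open>P\<close>.\<close>

lemma pw_mid_functor:
  assumes \<phi>: "\<phi> \<in> one_cells (Fun2 P Q)"
  shows "two_functor P Q (pw_mid P EM \<phi>)" "pw_mid P EM \<phi> \<in> extensional (cells P)"
    and "x \<in> cells P \<Longrightarrow> nat_square P \<phi> x \<in> cells (Arr Q)"
proof -
  note f = Fun2_one_cellD[OF \<phi> P.twocat_axioms]
  have t: "twocat P" "twocat Q" by unfold_locales
  have a: "two_functor P (Arr Q) (nat_square P \<phi>)"
    using two_natural_functor[OF t f(1-3)] unfolding nat_square_def .
  have "(\<lambda>x\<in>cells P. Kf EM (nat_square P \<phi> x)) = pw_mid P EM \<phi>" by (simp add: pw_mid_def nat_square_def)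
  then show "two_functor P Q (pw_mid P EM \<phi>)" using two_functor_restrict[OF t two_functor_compose[OF t(1) Arr_tc t(2)
      a Kfun]] by simp
  show "pw_mid P EM \<phi> \<in> extensional (cells P)" by (simp add: pw_mid_def)
  show "x \<in> cells P \<Longrightarrow> nat_square P \<phi> x \<in> cells (Arr Q)" using two_functorD(1)[OF a] .
qed

text \<open>The converse of \<open>ev_algebra\<close> and \<open>ev_algebra_nat\<close>. The unit
  law makes the codomain parts identities, so only the domain parts have to be assembled; that they
  form a 2-natural transformation \<open>\<tau>\<close> is the strictness hypothesis on the
  naturality squares.\<close>

lemma algebra_of_pointwise:
  assumes \<phi>: "\<phi> \<in> one_cells (Fun2 P Q)"
    and c: "\<And>A. A \<in> zero_cells P \<Longrightarrow> Ralgebra Q EM (c A) \<and> right (c A) = mat \<phi> A"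
    and nat: "\<And>x. x \<in> cells P \<Longrightarrow> nat_square P \<phi> x \<star>\<^bsub>Arr Q\<^esub> c (s0 P x) = c (t0 P x) \<star>\<^bsub>Arr Q\<^esub> Rfun EM (nat_square P \<phi> x)"
  obtains s where "Ralgebra (Fun2 P Q) M s" "right s = \<phi>" "\<And>A. A \<in> zero_cells P \<Longrightarrow> ev A s = c A"
proof -
  let ?P = "Fun2 P Q"
  note f = Fun2_one_cellD[OF \<phi> P.twocat_axioms] and pm = pw_mid_functor[OF \<phi>]
  have t: "twocat P" "twocat Q" by unfold_locales
  have fc: "\<phi> \<in> cells ?P" using \<phi> Fun2_one_cell by blast
  have fm: "mat \<phi> A \<in> one_cells Q" "s0 Q (mat \<phi> A) = mfrom \<phi> A" "t0 Q (mat \<phi> A) = mto \<phi> A" if "A \<in> zero_cells P" for A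
    using f(4)[OF that] Fun2_cellD[OF fc t(2) that] by auto
  have ca: "c A \<in> cells (Arr Q)" "c A \<in> one_cells (Arr Q)" "left (c A) = rho EM (mat \<phi> A)" "right (c A) = mat \<phi> A"
      "top (c A) \<in> one_cells Q"
    "bot (c A) = mto \<phi> A" "s0 Q (top (c A)) = pw_mid P EM \<phi> A" "t0 Q (top (c A)) = mfrom \<phi> A"
    "mat \<phi> A \<star>\<^bsub>Q\<^esub> top (c A) = mto \<phi> A \<star>\<^bsub>Q\<^esub> rho EM (mat \<phi> A)"
    "top (c A) \<star>\<^bsub>Q\<^esub> lam EM (mat \<phi> A) = mfrom \<phi> A"
    "top (c A) \<star>\<^bsub>Q\<^esub> Kf EM (c A) = top (c A) \<star>\<^bsub>Q\<^esub> pim EM (mat \<phi> A)" if A: "A \<in> zero_cells P" for A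
  proof -
    have r: "right (c A) = mat \<phi> A" and alg: "c A \<in> one_cells (Arr Q)" "s0 (Arr Q) (c A) = Rfun EM (t0 (Arr Q) (c A))"
      "c A \<star>\<^bsub>Arr Q\<^esub> Lambda Q EM (t0 (Arr Q) (c A)) = t0 (Arr Q) (c A)" "c A \<star>\<^bsub>Arr Q\<^esub> Rfun EM (c A) = c A \<star>\<^bsub>Arr Q\<^esub>
          Pi_mult Q EM (t0 (Arr Q) (c A))"
      using c[OF A] unfolding Ralgebra_def algebra_def by auto
    show o: "c A \<in> cells (Arr Q)" "c A \<in> one_cells (Arr Q)" "top (c A) \<in> one_cells Q" using alg(1) unfolding
        Arr_one_cells by auto
    show l: "left (c A) = rho EM (mat \<phi> A)" using arg_cong[OF alg(2), of left] by (simp add: Rfun_def r)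
    show "right (c A) = mat \<phi> A" by fact
    have cc: "s0 Q (top (c A)) = s0 Q (left (c A))" "t0 Q (top (c A)) = s0 Q (right (c A))" "s0 Q (bot (c A)) = t0 Q
        (left (c A))"
      "bot (c A) \<in> cells Q" "right (c A) \<star>\<^bsub>Q\<^esub> top (c A) = bot (c A) \<star>\<^bsub>Q\<^esub> left (c A)"
      using o(1) unfolding Arr_cell_iff by auto
    have "bot (c A) \<star>\<^bsub>Q\<^esub> t0 Q (mat \<phi> A) = t0 Q (mat \<phi> A)"
      using arg_cong[OF alg(3), of bot] by (simp add: Lambda_def Let_def r)
    moreover have "bot (c A) \<star>\<^bsub>Q\<^esub> t0 Q (mat \<phi> A) = bot (c A)"
      by (rule hcat(7)) (use cc l fm[OF A] in simp_all)
    ultimately show b: "bot (c A) = mto \<phi> A" using fm[OF A] by simp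
    have "nat_square P \<phi> A = ob Q (mat \<phi> A)" using A fm[OF A] by (simp add: nat_square_def ob_def)
    then show "s0 Q (top (c A)) = pw_mid P EM \<phi> A" using cc(1) l fm[OF A] A by (simp add: pw_mid_nat_square)
    show "t0 Q (top (c A)) = mfrom \<phi> A" using cc(2) r fm[OF A] by simp
    show "mat \<phi> A \<star>\<^bsub>Q\<^esub> top (c A) = mto \<phi> A \<star>\<^bsub>Q\<^esub> rho EM (mat \<phi> A)" using cc(5) r l b by simp
    show "top (c A) \<star>\<^bsub>Q\<^esub> lam EM (mat \<phi> A) = mfrom \<phi> A"
      using arg_cong[OF alg(3), of top] fm[OF A] by (simp add: Lambda_def Let_def r)
    show "top (c A) \<star>\<^bsub>Q\<^esub> Kf EM (c A) = top (c A) \<star>\<^bsub>Q\<^esub> pim EM (mat \<phi> A)"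
      using arg_cong[OF alg(4), of top] by (simp add: Rfun_def Pi_mult_def Let_def r)
  qed
  define \<tau> where "\<tau> = Mdf (pw_mid P EM \<phi>) (\<lambda>A\<in>zero_cells P. top (c A)) (mfrom \<phi>)"
  define s where "s = Sq (rho M \<phi>) \<tau> (t0 ?P \<phi>) \<phi>"
  have st: "s0 P x \<in> zero_cells P" "t0 P x \<in> zero_cells P" if "x \<in> cells P" for x using that by simp_all
  have tau: "\<tau> \<in> one_cells ?P" unfolding \<tau>_def
  proof (rule Fun2_one_cellI[OF t(1) pm(1) f(1) pm(2) f(5) _ t(2)])
    show "two_natural P Q (pw_mid P EM \<phi>) (mfrom \<phi>) (\<lambda>A. top (c A))"
      unfolding two_natural_def
    proof (intro conjI ballI)
      fix x assume x: "x \<in> cells P"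
      show "top (c (t0 P x)) \<star>\<^bsub>Q\<^esub> pw_mid P EM \<phi> x = mfrom \<phi> x \<star>\<^bsub>Q\<^esub> top (c (s0 P x))"
        using arg_cong[OF nat[OF x], of top] x by (simp add: pw_mid_nat_square Rfun_def) (simp add: nat_square_def)
    qed (use ca in auto)
  qed
  have rho: "rho M \<phi> \<in> one_cells ?P"
  proof -
    have "two_natural P Q (pw_mid P EM \<phi>) (mto \<phi>) (\<lambda>A. rho EM (mat \<phi> A))"
      unfolding two_natural_def
    proof (intro conjI ballI)
      fix x assume x: "x \<in> cells P"
      show "rho EM (mat \<phi> (t0 P x)) \<star>\<^bsub>Q\<^esub> pw_mid P EM \<phi> x = mto \<phi> x \<star>\<^bsub>Q\<^esub> rho EM (mat \<phi> (s0 P x))"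
        using naturality(2)[OF pm(3)[OF x]] x by (simp add: pw_mid_nat_square) (simp add: nat_square_def)
    next
      fix A assume A: "A \<in> zero_cells P"
      then show "s0 Q (rho EM (mat \<phi> A)) = pw_mid P EM \<phi> A"
        using fm[OF A] by (simp add: pw_mid_nat_square) (simp add: nat_square_def ob_def)
    qed (use fm in simp_all)
    from Fun2_one_cellI[OF t(1) pm(1) f(2) pm(2) f(6) this t(2)] show ?thesis by (simp add: pointwise_def)
  qed
  have t0: "t0 ?P \<phi> \<in> one_cells ?P"
  proof -
    have "mto \<phi> A \<in> one_cells Q" "s0 Q (mto \<phi> A) = mto \<phi> A" "t0 Q (mto \<phi> A) = mto \<phi> A" if "A \<in> zero_cells P" for A
      using two_functor_zero[OF f(2) that] one_cells_iff by auto
    moreover have "mto \<phi> (t0 P x) \<star>\<^bsub>Q\<^esub> mto \<phi> x = mto \<phi> x \<star>\<^bsub>Q\<^esub> mto \<phi> (s0 P x)" if "x \<in> cells P" for x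
    proof -
      note m = two_functorD[OF f(2) that]
      show ?thesis using hcat(7)[OF m(1) m(2)] hcat(8)[OF m(1) m(3)] by simp
    qed
    ultimately have "two_natural P Q (mto \<phi>) (mto \<phi>) (mto \<phi>)" unfolding two_natural_def by blast
    from Fun2_one_cellI[OF t(1) f(2) f(2) f(6) f(6) this t(2)] show ?thesis by simp
  qed
  have tb: "\<tau> \<in> cells ?P" "t0 ?P \<phi> \<in> cells ?P" using tau t0 Fun2_one_cell by blast+
  have sc: "s \<in> cells (Arr ?P)"
    unfolding Arr_cell_iff s_def sq.sel
    using rho \<phi> tb by (simp add: \<tau>_def M_simps ca(9) cong: restrict_cong)
  have so: "s \<in> one_cells (Arr ?P)"
  proof -
    have "s1 ?P \<tau> = \<tau>" "s1 ?P (t0 ?P \<phi>) = t0 ?P \<phi>" using tau t0 unfolding objs_def[of "ver ?P"] by blast+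
    then show ?thesis using sc unfolding objs_def[of "ver (Arr ?P)"] by (simp add: s_def del: Fun2_simps)
  qed
  have evs: "ev A s = c A" if A: "A \<in> zero_cells P" for A
    by (rule sq.expand) (use A ca[OF A] in \<open>simp add: s_def \<tau>_def M_simps\<close>)
  have 2: "s0 (Arr ?P) s = Rfun M (t0 (Arr ?P) s)"
    by (simp add: s_def Rfun_def M_simps ob_def pointwise_def pw_mid_def nat_square_def ev_def cong: restrict_cong)
  have "mto \<phi> A \<star>\<^bsub>Q\<^esub> mto \<phi> A = mto \<phi> A" if "A \<in> zero_cells P" for A using two_functor_zero[OF f(2) that] by simp
  then have 3: "s \<star>\<^bsub>Arr ?P\<^esub> Lambda ?P M (t0 (Arr ?P) s) = t0 (Arr ?P) s"
    by (simp add: s_def \<tau>_def Lambda_def Let_def M_simps ca(10) ob_def cong: restrict_cong)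
  have 4: "s \<star>\<^bsub>Arr ?P\<^esub> Rfun M s = s \<star>\<^bsub>Arr ?P\<^esub> Pi_mult ?P M (t0 (Arr ?P) s)"
  proof (rule sq.expand, intro conjI)
    have l: "left s = rho M \<phi>" "right s = \<phi>" "top s = \<tau>" "bot s = t0 ?P \<phi>" by (simp_all add: s_def)
    show "top (s \<star>\<^bsub>Arr ?P\<^esub> Rfun M s) = top (s \<star>\<^bsub>Arr ?P\<^esub> Pi_mult ?P M (t0 (Arr ?P) s))"
      by (simp add: Rfun_def Pi_mult_def Let_def l M_simps evs \<tau>_def ca(11) cong: restrict_cong)
  qed (simp_all add: s_def Rfun_def Pi_mult_def Let_def)
  show thesis
    by (rule that[of s]) (use so 2 3 4 evs in \<open>simp_all add: Ralgebra_def algebra_def s_def\<close>)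
qed

end

section \<open>The comparison as a 2-functor of the lifted arrow and of the generating arrow\<close>

section \<open>The comparison\<close>

lemma two_functor_op: "two_functor C D F \<Longrightarrow> two_functor (op C) (op D) F"
  unfolding two_functor_def is_functor_def by (auto simp: op_def dual_def)

lemma (in twocat) Arr_part_functors: "two_functor (Arr C) C top" "two_functor (Arr C) C bot"
proof -
  have t: "twocat (Arr C)" "twocat C" by (rule twocat_Arr, unfold_locales)
  show "two_functor (Arr C) C top" by (rule two_functorI[OF t]) (simp_all add: Arr_cellD)
  show "two_functor (Arr C) C bot" by (rule two_functorI[OF t]) (simp_all add: Arr_cellD)
qed

text \<open>The general formula for horizontal composites contains a composite with
  \<open>H (G a)\<close>, which disappears because \<open>G a\<close> is an identity and
  \<open>H\<close> preserves composites.\<close>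

lemma vcell_whisker_left:
  assumes b: "in_base V X" "category X" "in_base V Y" "category Y" "in_base V Z" "category Z"
    and F: "\<And>f. f \<in> arrs X \<Longrightarrow> F f \<in> arrs Y" "\<And>f. f \<in> arrs X \<Longrightarrow> G f \<in> arrs Y" "\<And>a. a \<in> objs X \<Longrightarrow> t a \<in> arrs Y"
      "\<And>a. a \<in> objs X \<Longrightarrow> G a \<in> objs Y" "\<And>a. a \<in> objs X \<Longrightarrow> tgt Y (t a) = G a"
    and H: "is_functor Y Z H" and V: "\<And>X. X \<in> V \<Longrightarrow> category X"
  shows "vcell V Y Z H H H \<star>\<^bsub>Cat2 V\<^esub> vcell V X Y F G t = vcell V X Z (\<lambda>f. H (F f)) (\<lambda>f. H (G f)) (\<lambda>a. H (t a))"
proof -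
  have o: "src Y (G a) = G a" "G a \<in> arrs Y" if "a \<in> objs X" for a using F(4)[OF that] by (auto simp: objs_def)
  have "vcell V Y Z H H H \<star>\<^bsub>Cat2 V\<^esub> vcell V X Y F G t =
    vcell V X Z (\<lambda>f. H (F f)) (\<lambda>f. H (G f)) (\<lambda>a. cmp Z (H (G a)) (H (t a)))"
    by (rule vcell_hcomp[OF b]) (use F o functorD[OF H] V in \<open>auto simp: objs_def\<close>)
  also have "\<dots> = vcell V X Z (\<lambda>f. H (F f)) (\<lambda>f. H (G f)) (\<lambda>a. H (t a))"
  proof (rule vcell_eqI[OF b(1,2)])
    fix a assume a: "a \<in> objs X"
    have "cmp Z (H (G a)) (H (t a)) = H (cmp Y (G a) (t a))"
      using functor_comp[OF H, of "t a" "G a"] F(3,5)[OF a] o[OF a] by simp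
    also have "cmp Y (G a) (t a) = t a" using category_simps(8)[OF b(4), of "t a" "G a"] F(3,5)[OF a] by simp
    finally show "cmp Z (H (G a)) (H (t a)) = H (t a)" .
  qed simp_all
  finally show ?thesis .
qed

lemma vcell_whisker_right:
  assumes b: "in_base V X" "category X" "in_base V Y" "category Y" "in_base V Z" "category Z"
    and F: "\<And>f. f \<in> arrs Y \<Longrightarrow> F f \<in> arrs Z" "\<And>a. a \<in> objs Y \<Longrightarrow> t a \<in> arrs Z" "\<And>a. a \<in> objs Y \<Longrightarrow> src Z (t a) = F a"
    and H: "is_functor X Y H" and V: "\<And>X. X \<in> V \<Longrightarrow> category X" and oF: "\<And>a. a \<in> objs Y \<Longrightarrow> tgt Z (F a) = F a"
  shows "vcell V Y Z F G t \<star>\<^bsub>Cat2 V\<^esub> vcell V X Y H H H = vcell V X Z (\<lambda>f. F (H f)) (\<lambda>f. G (H f)) (\<lambda>a. t (H a))"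
proof -
  have o: "H a \<in> objs Y" if "a \<in> objs X" for a using functor_objs[OF H that] .
  have "vcell V Y Z F G t \<star>\<^bsub>Cat2 V\<^esub> vcell V X Y H H H =
    vcell V X Z (\<lambda>f. F (H f)) (\<lambda>f. G (H f)) (\<lambda>a. cmp Z (t (H a)) (F (H a)))"
    by (rule vcell_hcomp[OF b]) (use F oF o functorD[OF H] V in \<open>auto simp: objs_def\<close>)
  also have "\<dots> = vcell V X Z (\<lambda>f. F (H f)) (\<lambda>f. G (H f)) (\<lambda>a. t (H a))"
  proof (rule vcell_eqI[OF b(1,2)])
    fix a assume a: "a \<in> objs X"
    show "cmp Z (t (H a)) (F (H a)) = t (H a)"
      using category_simps(7)[OF b(6), of "t (H a)" "F (H a)"] F(2,3)[OF o[OF a]] by simp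
  qed simp_all
  finally show ?thesis .
qed

text \<open>Rewrites the nerve along \<open>D\<close> in terms of \<open>hpre\<close> and
  \<open>hpost\<close>, so that its 2-functoriality and naturality become statements on the hom
  2-functor. It is instantiated both for \<open>U\<close> and for its codomain part.\<close>

locale diagram = Vcat C V + J: twocat J for C :: "'c twocat" and V :: "'u cat set" and J :: "'j twocat" +
  fixes D :: "'j \<Rightarrow> 'c"
  assumes D: "two_functor J C D"
begin

lemmas D_simps = two_functorD[OF D] two_functor_verD[OF D _ J.two_cat]

lemma D_zero: "j \<in> zero_cells J \<Longrightarrow> D j \<in> zero_cells C" by (rule two_functor_zero[OF D])

text \<open>On objects the two representables agree: either is the identity of the same copy of
  \<open>C(X, Y)\<close>. This lets sources and targets computed in different variables be
  compared.\<close>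

lemma hom_idnt:
  assumes X: "X \<in> zero_cells C" and Y: "Y \<in> zero_cells C"
  shows "hpost V C X Y = idnt (robj V (Hom C X Y))" "hpre V C Y X = idnt (robj V (Hom C X Y))"
proof -
  have "hpost V C X Y = s0 (Cat2 V) (hpost V C X Y)" "hpre V C Y X = s0 (Cat2 V) (hpre V C Y X)"
    using two_functorD(2)[OF hpost_functor[OF X], of Y] two_functorD(2)[OF hpre_functor[OF Y], of X] X Y
    by (simp_all del: Cat2_simps)
  then show "hpost V C X Y = idnt (robj V (Hom C X Y))" "hpre V C Y X = idnt (robj V (Hom C X Y))"
    using X Y by (simp_all add: hpost_def hpre_def)
qed

lemma nerve_simps:
  "mfrom (nerve V J C D x) = (\<lambda>y\<in>cells J. hpre V C (s0 C x) (D y))"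
  "mto (nerve V J C D x) = (\<lambda>y\<in>cells J. hpre V C (t0 C x) (D y))"
  "j \<in> zero_cells J \<Longrightarrow> mat (nerve V J C D x) j = hpost V C (D j) x"
  by (auto simp: nerve_def nerve_ob_def hpre_def hpost_def D_simps intro!: restrict_ext)

lemma hpre_functor_D:
  assumes X: "X \<in> zero_cells C"
  shows "two_functor (op J) (Cat2 V) (\<lambda>y\<in>cells J. hpre V C X (D y))"
  using two_functor_restrict[OF twocat_op[OF J.twocat_axioms] twocat_V two_functor_compose[OF twocat_op[OF
      J.twocat_axioms]
      twocat_op[OF twocat_axioms] twocat_V two_functor_op[OF D] hpre_functor[OF X]]]
  by simp

lemma zero_op: "zero_cells (op J) = zero_cells J"
  using J.op_zero_cells by auto

text \<open>Naturality over \<open>J\<close> is \<open>hpost_hpre\<close>. It is proved for an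
  arbitrary 1-cell \<open>z\<close> with the same ends, then used at the source and the target of
  \<open>x\<close>; the modification axiom is \<open>hpost_hpre\<close> at \<open>x\<close>
  itself.\<close>

lemma nerve_cell:
  assumes x: "x \<in> cells C"
  shows "nerve V J C D x \<in> cells (Fun2 (op J) (Cat2 V))"
proof -
  interpret CV: twocat "Cat2 V" by (rule twocat_V)
  have st: "s0 C x \<in> zero_cells C" "t0 C x \<in> zero_cells C" using x by simp_all
  have n: "two_natural (op J) (Cat2 V) (mfrom (nerve V J C D x)) (mto (nerve V J C D x)) (\<lambda>j. hpost V C (D j) z)"
    if z: "z \<in> cells C" "s0 C z = s0 C x" "t0 C z = t0 C x" "s1 C z = z" for z
    unfolding two_natural_def nerve_simps zero_op
  proof (intro conjI ballI)
    fix j assume j: "j \<in> zero_cells J"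
    note jc = J.zero_cellD(1)[OF j] and Dj = D_zero[OF j]
    note f = two_functorD[OF hpost_functor[OF Dj] z(1)] two_functor_verD[OF hpost_functor[OF Dj] z(1) two_cat]
    show "hpost V C (D j) z \<in> one_cells (Cat2 V)" using f z(4) unfolding CV.one_cells_iff by (simp del: Cat2_simps)
    show "s0 (Cat2 V) (hpost V C (D j) z) = (\<lambda>y\<in>cells J. hpre V C (s0 C x) (D y)) j"
      "t0 (Cat2 V) (hpost V C (D j) z) = (\<lambda>y\<in>cells J. hpre V C (t0 C x) (D y)) j"
      unfolding f restrict_apply'[OF jc] z hom_idnt[OF Dj st(1)] hom_idnt[OF Dj st(2)] by (rule refl)+
  next
    fix y assume "y \<in> cells (op J)"
    then have y: "y \<in> cells J" by simp
    show "hpost V C (D (t0 (op J) y)) z \<star>\<^bsub>Cat2 V\<^esub> (\<lambda>y\<in>cells J. hpre V C (s0 C x) (D y)) y =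
        (\<lambda>y\<in>cells J. hpre V C (t0 C x) (D y)) y \<star>\<^bsub>Cat2 V\<^esub> hpost V C (D (s0 (op J) y)) z"
      using hpost_hpre[OF z(1), of "D y"] y by (simp add: D_simps z del: Cat2_simps)
  qed
  have cg: "two_natural (op J) (Cat2 V) F G m \<longleftrightarrow> two_natural (op J) (Cat2 V) F G m'"
    if "\<And>j. j \<in> zero_cells J \<Longrightarrow> m j = m' j" for F G m m'
  proof -
    have "s0 J y \<in> zero_cells J" "t0 J y \<in> zero_cells J" if "y \<in> cells J" for y using that by simp_all
    then show ?thesis unfolding two_natural_def zero_op using that by simp
  qed
  have m: "mat (nerve V J C D x) j \<in> cells (Cat2 V)" "s1 (Cat2 V) (mat (nerve V J C D x) j) = hpost V C (D j) (s1 C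
      x)"
    "t1 (Cat2 V) (mat (nerve V J C D x) j) = hpost V C (D j) (t1 C x)" if j: "j \<in> zero_cells J" for j
    unfolding nerve_simps(3)[OF j]
    using two_functorD[OF hpost_functor[OF D_zero[OF j]] x] two_functor_verD[OF hpost_functor[OF D_zero[OF j]] x
        two_cat] by auto
  have "two_natural (op J) (Cat2 V) (mfrom (nerve V J C D x)) (mto (nerve V J C D x)) (\<lambda>j. s1 (Cat2 V) (mat (nerve V J
      C D x) j))"
    by (rule iffD2[OF cg n[of "s1 C x"]]) (use m x in simp_all)
  moreover have "two_natural (op J) (Cat2 V) (mfrom (nerve V J C D x)) (mto (nerve V J C D x)) (\<lambda>j. t1 (Cat2 V) (mat
      (nerve V J C D x) j))"
    by (rule iffD2[OF cg n[of "t1 C x"]]) (use m x in simp_all)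
  moreover have "mat (nerve V J C D x) (t0 (op J) y) \<star>\<^bsub>Cat2 V\<^esub> mfrom (nerve V J C D x) y =
      mto (nerve V J C D x) y \<star>\<^bsub>Cat2 V\<^esub> mat (nerve V J C D x) (s0 (op J) y)" if "y \<in> one_cells (op J)" for y
  proof -
    have y: "y \<in> cells J" using that J.one_cellD(1)[of y] by (simp add: op_def)
    have z: "s0 J y \<in> zero_cells J" "t0 J y \<in> zero_cells J" using y by simp_all
    show ?thesis using hpost_hpre[OF x, of "D y"] y unfolding op_simps nerve_simps(3)[OF z(1)] nerve_simps(3)[OF z(2)]
        nerve_simps(1,2)
      by (simp add: D_simps del: Cat2_simps)
  qed
  moreover have "mat (nerve V J C D x) \<in> extensional (zero_cells J)" by (simp add: nerve_def)
  ultimately show ?thesis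
    unfolding Fun2_cell_iff zero_op using hpre_functor_D[OF st(1)] hpre_functor_D[OF st(2)] m(1) by (simp add:
        nerve_simps(1,2) del: Cat2_simps)
qed

end

context baseC begin

text \<open>The commuting square from \<open>u\<close> to \<open>f\<close> with \<open>h\<close> as
  a diagonal. As a function of \<open>h\<close> it is the comparison from
  \<open>C(cod u, dom f)\<close> to \<open>C\<^sup>2(u, f)\<close>, which \<open>compar\<close>
  transports into the base.\<close>

definition fill_sq :: "'c \<Rightarrow> 'c \<Rightarrow> 'c \<Rightarrow> 'c sq" where
  "fill_sq u f h = Sq u (h \<star>\<^bsub>C\<^esub> u) (f \<star>\<^bsub>C\<^esub> h) f"

definition compar :: "'c \<Rightarrow> 'c \<Rightarrow> 'u nt" where
  "compar u f = vcell V (Hom C (t0 C u) (s0 C f)) (Hom (Arr C) (ob C u) (ob C f)) (fill_sq u f) (fill_sq u f) (fill_sq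
      u f)"

lemma Arr_tc: "twocat (Arr C)" by (rule twocat_Arr) unfold_locales

lemma fill_sq_functor:
  assumes u: "u \<in> one_cells C" and f: "f \<in> one_cells C"
  shows "is_functor (Hom C (t0 C u) (s0 C f)) (Hom (Arr C) (ob C u) (ob C f)) (fill_sq u f)"
proof -
  interpret A: twocat "Arr C" by (rule Arr_tc)
  show ?thesis
    unfolding is_functor_def fill_sq_def
    using u f one_cellD[OF u] one_cellD[OF f]
    by (auto simp: Arr_cell_iff hassoc intro!: whisker_left whisker_right)
qed

lemma compar_cell:
  assumes u: "u \<in> one_cells C" and f: "f \<in> one_cells C"
  shows "compar u f \<in> one_cells (Cat2 V)" "s0 (Cat2 V) (compar u f) = idnt (robj V (Hom C (t0 C u) (s0 C f)))"
    "t0 (Cat2 V) (compar u f) = idnt (robj V (Hom (Arr C) (ob C u) (ob C f)))"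
proof -
  interpret CV: twocat "Cat2 V" by (rule twocat_V)
  interpret A: twocat "Arr C" by (rule Arr_tc)
  note F = fill_sq_functor[OF u f]
  have "t0 C u \<in> zero_cells C" "s0 C f \<in> zero_cells C" using one_cellD(1)[OF u] one_cellD(1)[OF f] by simp_all
  note b = hom_base[OF this] Arr_hom_base[OF u f] Hom_category A.Hom_category
  have "nat_trans (Hom C (t0 C u) (s0 C f)) (Hom (Arr C) (ob C u) (ob C f)) (fill_sq u f) (fill_sq u f) (fill_sq u f)"
    unfolding nat_trans_def
  proof (intro conjI ballI)
    fix a assume "a \<in> objs (Hom C (t0 C u) (s0 C f))"
    from functor_objs[OF F this] show "fill_sq u f a \<in> arrs (Hom (Arr C) (ob C u) (ob C f))"
      "src (Hom (Arr C) (ob C u) (ob C f)) (fill_sq u f a) = fill_sq u f a" "tgt (Hom (Arr C) (ob C u) (ob C f))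
          (fill_sq u f a) = fill_sq u f a"
      unfolding A.Hom_objs by (simp_all del: Arr_simps)
  next
    fix h assume h: "h \<in> arrs (Hom C (t0 C u) (s0 C f))"
    note fh = functorD[OF F h]
    show "cmp (Hom (Arr C) (ob C u) (ob C f)) (fill_sq u f (tgt (Hom C (t0 C u) (s0 C f)) h)) (fill_sq u f h) =
      cmp (Hom (Arr C) (ob C u) (ob C f)) (fill_sq u f h) (fill_sq u f (src (Hom C (t0 C u) (s0 C f)) h))"
      unfolding fh(2,3)[symmetric]
      using category_simps(7,8)[OF A.Hom_category[of "ob C u" "ob C f"] fh(1)] by (simp del: Arr_simps Hom_simps)
  qed
  then have "compar u f \<in> cells (Cat2 V)" unfolding compar_def using vcell_cell[OF b F F] V by blast
  moreover have "s1 (Cat2 V) (compar u f) = compar u f" unfolding compar_def vcell_s1 ..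
  ultimately show "compar u f \<in> one_cells (Cat2 V)" unfolding CV.one_cells_iff by blast
qed (simp_all add: compar_def)

text \<open>On a diagonal \<open>h\<close> both sides give squares with the same domain part; their
  codomain parts agree by the square condition of \<open>x\<close>.\<close>

lemma compar_post:
  assumes u: "u \<in> one_cells C" and x: "x \<in> cells (Arr C)"
  shows "compar u (right x) \<star>\<^bsub>Cat2 V\<^esub> hpost V C (t0 C u) (top x) = hpost V (Arr C) (ob C u) x \<star>\<^bsub>Cat2 V\<^esub> compar u (left
      x)"
proof -
  interpret A: twocat "Arr C" by (rule Arr_tc)
  note X = Arr_cellD[OF x]
  note lr = one_cellD[OF X(1)] one_cellD[OF X(2)] one_cellD[OF u]
  have z: "t0 C u \<in> zero_cells C" "s0 C (left x) \<in> zero_cells C" "s0 C (right x) \<in> zero_cells C" using lr by simp_all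
  note b = hom_base[OF z(1,2)] Hom_category hom_base[OF z(1,3)] Hom_category Arr_hom_base[OF u X(2)] A.Hom_category
  note b' = hom_base[OF z(1,2)] Hom_category Arr_hom_base[OF u X(1)] A.Hom_category Arr_hom_base[OF u X(2)]
      A.Hom_category
  have ob: "s0 (Arr C) x = ob C (left x)" "t0 (Arr C) x = ob C (right x)" by simp_all
  have 1: "compar u (right x) \<star>\<^bsub>Cat2 V\<^esub> hpost V C (t0 C u) (top x) = vcell V (Hom C (t0 C u) (s0 C (left x))) (Hom
      (Arr C) (ob C u) (ob C (right x)))
     (\<lambda>h. fill_sq u (right x) (s1 C (top x) \<star>\<^bsub>C\<^esub> h)) (\<lambda>h. fill_sq u (right x) (t1 C (top x) \<star>\<^bsub>C\<^esub> h)) (\<lambda>h. fill_sq u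
         (right x) (top x \<star>\<^bsub>C\<^esub> h))"
    unfolding compar_def hpost_def X(5,6)
    by (rule vcell_whisker_left[OF b _ _ _ _ _ fill_sq_functor[OF u X(2)]]) (use X V in \<open>simp_all add: Hom_objs\<close>)
  have ac: "y \<in> cells (Arr C) \<Longrightarrow> s0 (Arr C) y = ob C u \<Longrightarrow> t0 (Arr C) y = ob C (left x) \<Longrightarrow>
      z \<in> cells (Arr C) \<Longrightarrow> s0 (Arr C) z = ob C (left x) \<Longrightarrow> t0 (Arr C) z = ob C (right x) \<Longrightarrow>
      z \<star>\<^bsub>Arr C\<^esub> y \<in> cells (Arr C) \<and> s0 (Arr C) (z \<star>\<^bsub>Arr C\<^esub> y) = ob C u \<and> t0 (Arr C) (z \<star>\<^bsub>Arr C\<^esub> y) = ob C (right x) \<and>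
      s1 (Arr C) (z \<star>\<^bsub>Arr C\<^esub> y) = s1 (Arr C) z \<star>\<^bsub>Arr C\<^esub> s1 (Arr C) y \<and> t1 (Arr C) (z \<star>\<^bsub>Arr C\<^esub> y) = t1 (Arr C) z \<star>\<^bsub>Arr
          C\<^esub> t1 (Arr C) y" for y z
    using A.hcat(9-11)[of y z] A.s1_hcomp[of y z] A.t1_hcomp[of y z] by (simp del: Arr_simps)
  have xs: "s1 (Arr C) x \<in> cells (Arr C)" "s0 (Arr C) (s1 (Arr C) x) = ob C (left x)" "t0 (Arr C) (s1 (Arr C) x) = ob
      C (right x)"
    "s1 (Arr C) (s1 (Arr C) x) = s1 (Arr C) x" "t1 (Arr C) (s1 (Arr C) x) = s1 (Arr C) x"
    using x ob by (simp_all del: Arr_simps)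
  have 2: "hpost V (Arr C) (ob C u) x \<star>\<^bsub>Cat2 V\<^esub> compar u (left x) = vcell V (Hom C (t0 C u) (s0 C (left x))) (Hom (Arr
      C) (ob C u) (ob C (right x)))
     (\<lambda>h. s1 (Arr C) x \<star>\<^bsub>Arr C\<^esub> fill_sq u (left x) h) (\<lambda>h. t1 (Arr C) x \<star>\<^bsub>Arr C\<^esub> fill_sq u (left x) h) (\<lambda>h. x \<star>\<^bsub>Arr C\<^esub>
         fill_sq u (left x) h)"
    unfolding compar_def hpost_def ob
  proof (rule vcell_whisker_right[OF b' _ _ _ fill_sq_functor[OF u X(1)] V])
    fix h assume "h \<in> arrs (Hom (Arr C) (ob C u) (ob C (left x)))"
    then show "s1 (Arr C) x \<star>\<^bsub>Arr C\<^esub> h \<in> arrs (Hom (Arr C) (ob C u) (ob C (right x)))"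
      using ac[of h "s1 (Arr C) x"] xs by (simp del: Arr_simps)
  next
    fix h assume "h \<in> objs (Hom (Arr C) (ob C u) (ob C (left x)))"
    then have h: "h \<in> cells (Arr C)" "s1 (Arr C) h = h" "t1 (Arr C) h = h" "s0 (Arr C) h = ob C u" "t0 (Arr C) h = ob
        C (left x)"
      unfolding A.Hom_objs by blast+
    show "x \<star>\<^bsub>Arr C\<^esub> h \<in> arrs (Hom (Arr C) (ob C u) (ob C (right x)))"
      "src (Hom (Arr C) (ob C u) (ob C (right x))) (x \<star>\<^bsub>Arr C\<^esub> h) = s1 (Arr C) x \<star>\<^bsub>Arr C\<^esub> h"
      "tgt (Hom (Arr C) (ob C u) (ob C (right x))) (s1 (Arr C) x \<star>\<^bsub>Arr C\<^esub> h) = s1 (Arr C) x \<star>\<^bsub>Arr C\<^esub> h"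
      using ac[OF h(1,4,5) x ob] ac[OF h(1,4,5) xs(1-3)] xs h by (simp_all del: Arr_simps)
  qed
  have e: "right x \<star>\<^bsub>C\<^esub> (top z \<star>\<^bsub>C\<^esub> h) = bot z \<star>\<^bsub>C\<^esub> (left x \<star>\<^bsub>C\<^esub> h)"
    if "z \<in> cells (Arr C)" "left z = left x" "right z = right x" "h \<in> cells C" "t0 C h = s0 C (left x)" for z h
    using Arr_cellD[OF that(1)] that lr by (simp add: hassoc[symmetric])
  have "s1 (Arr C) x \<in> cells (Arr C)" "t1 (Arr C) x \<in> cells (Arr C)" using x by (simp_all del: Arr_simps)
  then have e': "right x \<star>\<^bsub>C\<^esub> (top x \<star>\<^bsub>C\<^esub> h) = bot x \<star>\<^bsub>C\<^esub> (left x \<star>\<^bsub>C\<^esub> h)"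
    "right x \<star>\<^bsub>C\<^esub> (s1 C (top x) \<star>\<^bsub>C\<^esub> h) = s1 C (bot x) \<star>\<^bsub>C\<^esub> (left x \<star>\<^bsub>C\<^esub> h)"
    "right x \<star>\<^bsub>C\<^esub> (t1 C (top x) \<star>\<^bsub>C\<^esub> h) = t1 C (bot x) \<star>\<^bsub>C\<^esub> (left x \<star>\<^bsub>C\<^esub> h)"
    if "h \<in> cells C" "t0 C h = s0 C (left x)" for h
    using e[OF x _ _ that] e[of "s1 (Arr C) x", OF _ _ _ that] e[of "t1 (Arr C) x", OF _ _ _ that] by simp_all
  show ?thesis unfolding 1 2
    by (rule vcell_eqI[OF b(1,2)]) (use X lr e' in \<open>simp_all add: Hom_objs fill_sq_def hassoc\<close>)
qed

text \<open>Here the codomain parts agree by associativity, and the domain parts by the square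
  condition of \<open>y\<close>.\<close>

lemma compar_pre:
  assumes f: "f \<in> one_cells C" and y: "y \<in> cells (Arr C)"
  shows "compar (left y) f \<star>\<^bsub>Cat2 V\<^esub> hpre V C (s0 C f) (bot y) = hpre V (Arr C) (ob C f) y \<star>\<^bsub>Cat2 V\<^esub> compar (right y)
      f"
proof -
  interpret A: twocat "Arr C" by (rule Arr_tc)
  note X = Arr_cellD[OF y]
  note lr = one_cellD[OF X(1)] one_cellD[OF X(2)] one_cellD[OF f]
  have z: "s0 C f \<in> zero_cells C" "t0 C (left y) \<in> zero_cells C" "t0 C (right y) \<in> zero_cells C" using lr by simp_all
  note b = hom_base[OF z(3,1)] Hom_category hom_base[OF z(2,1)] Hom_category Arr_hom_base[OF X(1) f] A.Hom_category
  note b' = hom_base[OF z(3,1)] Hom_category Arr_hom_base[OF X(2) f] A.Hom_category Arr_hom_base[OF X(1) f]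
      A.Hom_category
  have ob: "s0 (Arr C) y = ob C (left y)" "t0 (Arr C) y = ob C (right y)" by simp_all
  have 1: "compar (left y) f \<star>\<^bsub>Cat2 V\<^esub> hpre V C (s0 C f) (bot y) = vcell V (Hom C (t0 C (right y)) (s0 C f)) (Hom (Arr
      C) (ob C (left y)) (ob C f))
     (\<lambda>h. fill_sq (left y) f (h \<star>\<^bsub>C\<^esub> s1 C (bot y))) (\<lambda>h. fill_sq (left y) f (h \<star>\<^bsub>C\<^esub> t1 C (bot y))) (\<lambda>h. fill_sq (left
         y) f (h \<star>\<^bsub>C\<^esub> bot y))"
    unfolding compar_def hpre_def X(7,8)
    by (rule vcell_whisker_left[OF b _ _ _ _ _ fill_sq_functor[OF X(1) f]]) (use X V in \<open>simp_all add: Hom_objs\<close>)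
  have ac: "h \<in> cells (Arr C) \<Longrightarrow> s0 (Arr C) h = ob C (right y) \<Longrightarrow> t0 (Arr C) h = ob C f \<Longrightarrow>
      z \<in> cells (Arr C) \<Longrightarrow> s0 (Arr C) z = ob C (left y) \<Longrightarrow> t0 (Arr C) z = ob C (right y) \<Longrightarrow>
      h \<star>\<^bsub>Arr C\<^esub> z \<in> cells (Arr C) \<and> s0 (Arr C) (h \<star>\<^bsub>Arr C\<^esub> z) = ob C (left y) \<and> t0 (Arr C) (h \<star>\<^bsub>Arr C\<^esub> z) = ob C f \<and>
      s1 (Arr C) (h \<star>\<^bsub>Arr C\<^esub> z) = s1 (Arr C) h \<star>\<^bsub>Arr C\<^esub> s1 (Arr C) z \<and> t1 (Arr C) (h \<star>\<^bsub>Arr C\<^esub> z) = t1 (Arr C) h \<star>\<^bsub>Arr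
          C\<^esub> t1 (Arr C) z" for h z
    using A.hcat(9-11)[of z h] A.s1_hcomp[of z h] A.t1_hcomp[of z h] by (simp del: Arr_simps)
  have xs: "s1 (Arr C) y \<in> cells (Arr C)" "s0 (Arr C) (s1 (Arr C) y) = ob C (left y)" "t0 (Arr C) (s1 (Arr C) y) = ob
      C (right y)"
    "s1 (Arr C) (s1 (Arr C) y) = s1 (Arr C) y" "t1 (Arr C) (s1 (Arr C) y) = s1 (Arr C) y"
    using y ob by (simp_all del: Arr_simps)
  have 2: "hpre V (Arr C) (ob C f) y \<star>\<^bsub>Cat2 V\<^esub> compar (right y) f = vcell V (Hom C (t0 C (right y)) (s0 C f)) (Hom
      (Arr C) (ob C (left y)) (ob C f))
     (\<lambda>h. fill_sq (right y) f h \<star>\<^bsub>Arr C\<^esub> s1 (Arr C) y) (\<lambda>h. fill_sq (right y) f h \<star>\<^bsub>Arr C\<^esub> t1 (Arr C) y) (\<lambda>h. fill_sq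
         (right y) f h \<star>\<^bsub>Arr C\<^esub> y)"
    unfolding compar_def hpre_def ob
  proof (rule vcell_whisker_right[OF b' _ _ _ fill_sq_functor[OF X(2) f] V])
    fix h assume "h \<in> arrs (Hom (Arr C) (ob C (right y)) (ob C f))"
    then show "h \<star>\<^bsub>Arr C\<^esub> s1 (Arr C) y \<in> arrs (Hom (Arr C) (ob C (left y)) (ob C f))"
      using ac[of h "s1 (Arr C) y"] xs by (simp del: Arr_simps)
  next
    fix h assume "h \<in> objs (Hom (Arr C) (ob C (right y)) (ob C f))"
    then have h: "h \<in> cells (Arr C)" "s1 (Arr C) h = h" "t1 (Arr C) h = h" "s0 (Arr C) h = ob C (right y)" "t0 (Arr C)
        h = ob C f"
      unfolding A.Hom_objs by blast+
    show "h \<star>\<^bsub>Arr C\<^esub> y \<in> arrs (Hom (Arr C) (ob C (left y)) (ob C f))"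
      "src (Hom (Arr C) (ob C (left y)) (ob C f)) (h \<star>\<^bsub>Arr C\<^esub> y) = h \<star>\<^bsub>Arr C\<^esub> s1 (Arr C) y"
      "tgt (Hom (Arr C) (ob C (left y)) (ob C f)) (h \<star>\<^bsub>Arr C\<^esub> s1 (Arr C) y) = h \<star>\<^bsub>Arr C\<^esub> s1 (Arr C) y"
      using ac[OF h(1,4,5) y ob] ac[OF h(1,4,5) xs(1-3)] xs h by (simp_all del: Arr_simps)
  qed
  have "s1 (Arr C) y \<in> cells (Arr C)" "t1 (Arr C) y \<in> cells (Arr C)" using y by (simp_all del: Arr_simps)
  then have e: "right y \<star>\<^bsub>C\<^esub> top y = bot y \<star>\<^bsub>C\<^esub> left y" "right y \<star>\<^bsub>C\<^esub> s1 C (top y) = s1 C (bot y) \<star>\<^bsub>C\<^esub> left y"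
    "right y \<star>\<^bsub>C\<^esub> t1 C (top y) = t1 C (bot y) \<star>\<^bsub>C\<^esub> left y"
    using X(9) Arr_cellD(9)[of "s1 (Arr C) y" C] Arr_cellD(9)[of "t1 (Arr C) y" C] by simp_all
  show ?thesis unfolding 1 2
    by (rule vcell_eqI[OF b(1,2)]) (use X lr e in \<open>simp_all add: Hom_objs fill_sq_def hassoc\<close>)
qed

text \<open>\<open>Wpost u\<close> is the component at \<open>u\<close> of the 2-functor \<open>W\<^sub>U\<close>. With \<open>Wpre\<close>, which varies \<open>u\<close> instead, it
  forms a 2-functor of two variables.\<close>

definition Wpost :: "'c \<Rightarrow> 'c sq \<Rightarrow> 'u nt sq" where
  "Wpost u x = Sq (compar u (left x)) (hpost V C (t0 C u) (top x)) (hpost V (Arr C) (ob C u) x) (compar u (right x))"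

definition Wpre :: "'c \<Rightarrow> 'c sq \<Rightarrow> 'u nt sq" where
  "Wpre f y = Sq (compar (right y) f) (hpre V C (s0 C f) (bot y)) (hpre V (Arr C) (ob C f) y) (compar (left y) f)"

text \<open>By \<open>compar_post\<close> the comparison functors form a 2-natural transformation
  between two representables, and such a transformation is a 2-functor into the arrow
  2-category.\<close>

lemma Wpost_functor:
  assumes u: "u \<in> one_cells C"
  shows "two_functor (Arr C) (Arr (Cat2 V)) (Wpost u)"
proof -
  interpret A: Vcat "Arr C" V by (rule Vcat_Arr)
  have z: "t0 C u \<in> zero_cells C" "ob C u \<in> zero_cells (Arr C)" using one_cellD(1)[OF u] u Arr_zero_cells by auto
  have T: "two_functor (Arr C) (Cat2 V) (\<lambda>x. hpost V C (t0 C u) (top x))"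
    by (rule two_functor_compose[OF Arr_tc twocat_axioms twocat_V Arr_part_functors(1) hpost_functor[OF z(1)]])
  have n: "two_natural (Arr C) (Cat2 V) (\<lambda>x. hpost V C (t0 C u) (top x)) (hpost V (Arr C) (ob C u)) (\<lambda>X. compar u
      (left X))"
    unfolding two_natural_def
  proof (intro conjI ballI)
    fix X assume "X \<in> zero_cells (Arr C)"
    then obtain f where f: "f \<in> one_cells C" "X = ob C f" using Arr_zero_cells by blast
    have X: "X \<in> zero_cells (Arr C)" "s0 C f \<in> zero_cells C" using f Arr_zero_cells one_cellD(1)[OF f(1)] by auto
    show "compar u (left X) \<in> one_cells (Cat2 V)" using compar_cell[OF u f(1)] f by simp
    interpret d: diagram C V C "\<lambda>x. x" by unfold_locales (simp add: two_functor_def is_functor_def)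
    interpret e: diagram "Arr C" V "Arr C" "\<lambda>x. x" by unfold_locales (simp add: two_functor_def is_functor_def del:
        Arr_simps)
    show "s0 (Cat2 V) (compar u (left X)) = hpost V C (t0 C u) (top X)"
      using compar_cell(2)[OF u f(1)] d.hom_idnt(1)[OF z(1) X(2)] f by (simp del: Cat2_simps)
    show "t0 (Cat2 V) (compar u (left X)) = hpost V (Arr C) (ob C u) X"
      using compar_cell(3)[OF u f(1)] e.hom_idnt(1)[OF z(2) X(1)] f by (simp del: Cat2_simps)
  next
    fix x assume x: "x \<in> cells (Arr C)"
    show "compar u (left (t0 (Arr C) x)) \<star>\<^bsub>Cat2 V\<^esub> hpost V C (t0 C u) (top x) =
      hpost V (Arr C) (ob C u) x \<star>\<^bsub>Cat2 V\<^esub> compar u (left (s0 (Arr C) x))"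
      using compar_post[OF u x] by (simp del: Cat2_simps)
  qed
  show ?thesis
    using two_natural_functor[OF Arr_tc twocat_V T A.hpost_functor[OF z(2)] n] unfolding Wpost_def by simp
qed

lemma Wpre_functor:
  assumes f: "f \<in> one_cells C"
  shows "two_functor (op (Arr C)) (Arr (Cat2 V)) (Wpre f)"
    and "two_natural (op (Arr C)) (Cat2 V) (\<lambda>x. hpre V C (s0 C f) (bot x)) (hpre V (Arr C) (ob C f)) (\<lambda>X. compar (left
        X) f)"
proof -
  interpret A: Vcat "Arr C" V by (rule Vcat_Arr)
  have z: "s0 C f \<in> zero_cells C" "ob C f \<in> zero_cells (Arr C)" using one_cellD(1)[OF f] f Arr_zero_cells by auto
  note t = twocat_op[OF Arr_tc] twocat_op[OF twocat_axioms]
  have T: "two_functor (op (Arr C)) (Cat2 V) (\<lambda>x. hpre V C (s0 C f) (bot x))"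
    by (rule two_functor_compose[OF t twocat_V two_functor_op[OF Arr_part_functors(2)] hpre_functor[OF z(1)]])
  show n: "two_natural (op (Arr C)) (Cat2 V) (\<lambda>x. hpre V C (s0 C f) (bot x)) (hpre V (Arr C) (ob C f)) (\<lambda>X. compar
      (left X) f)"
    unfolding two_natural_def
  proof (intro conjI ballI)
    fix X assume "X \<in> zero_cells (op (Arr C))"
    then have X1: "X \<in> zero_cells (Arr C)" using A.op_zero_cells by simp
    then obtain u where u: "u \<in> one_cells C" "X = ob C u" using Arr_zero_cells by blast
    have X: "X \<in> zero_cells (Arr C)" "t0 C u \<in> zero_cells C" using X1 one_cellD(1)[OF u(1)] by auto
    show "compar (left X) f \<in> one_cells (Cat2 V)" using compar_cell[OF u(1) f] u by simp
    interpret d: diagram C V C "\<lambda>x. x" by unfold_locales (simp add: two_functor_def is_functor_def)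
    interpret e: diagram "Arr C" V "Arr C" "\<lambda>x. x" by unfold_locales (simp add: two_functor_def is_functor_def del:
        Arr_simps)
    show "s0 (Cat2 V) (compar (left X) f) = hpre V C (s0 C f) (bot X)"
      using compar_cell(2)[OF u(1) f] d.hom_idnt(2)[OF X(2) z(1)] u by (simp del: Cat2_simps)
    show "t0 (Cat2 V) (compar (left X) f) = hpre V (Arr C) (ob C f) X"
      using compar_cell(3)[OF u(1) f] e.hom_idnt(2)[OF X(1) z(2)] u by (simp del: Cat2_simps)
  next
    fix x assume "x \<in> cells (op (Arr C))"
    then have x: "x \<in> cells (Arr C)" by (simp del: Arr_simps)
    show "compar (left (t0 (op (Arr C)) x)) f \<star>\<^bsub>Cat2 V\<^esub> hpre V C (s0 C f) (bot x) =
      hpre V (Arr C) (ob C f) x \<star>\<^bsub>Cat2 V\<^esub> compar (left (s0 (op (Arr C)) x)) f"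
      using compar_pre[OF f x] by (simp del: Cat2_simps)
  qed
  show "two_functor (op (Arr C)) (Arr (Cat2 V)) (Wpre f)"
    using two_natural_functor[OF t(1) twocat_V T A.hpre_functor[OF z(2)] n] unfolding Wpre_def by simp
qed

text \<open>The domain part is \<open>hpost_hpre\<close> for \<open>C\<close>, the codomain part the
  same law for the arrow 2-category.\<close>

lemma Wpost_Wpre:
  assumes x: "x \<in> cells (Arr C)" and y: "y \<in> cells (Arr C)"
  shows "Wpost (left y) x \<star>\<^bsub>Arr (Cat2 V)\<^esub> Wpre (left x) y = Wpre (right x) y \<star>\<^bsub>Arr (Cat2 V)\<^esub> Wpost (right y) x"
proof -
  interpret A: Vcat "Arr C" V by (rule Vcat_Arr)
  note X = Arr_cellD[OF x] and Y = Arr_cellD[OF y]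
  show ?thesis
    using hpost_hpre[OF X(3) Y(4)] A.hpost_hpre[OF x y] X Y unfolding Wpost_def Wpre_def by (simp del: Cat2_simps)
qed

end

section \<open>Algebras of the generated system as natural families, and the conclusion\<close>

section \<open>Cofibrant generation\<close>

locale lifting = baseC V C + J: twocat J
  for V :: "'u cat set" and C :: "'c twocat" and J :: "'j twocat" +
  fixes U :: "'j \<Rightarrow> 'c sq"
  assumes U: "two_functor J (Arr C) U"
begin

sublocale A: Vcat "Arr C" V by (rule Vcat_Arr)

text \<open>The target of the comparison is the nerve along \<open>U\<close>, and its source the
  nerve along the codomain part of \<open>U\<close>.\<close>

sublocale sqU: diagram "Arr C" V J U by unfold_locales (rule U)

sublocale codU: diagram C V J "\<lambda>y. bot (U y)"
  by unfold_locales (rule two_functor_compose[OF J.twocat_axioms Arr_tc twocat_axioms U Arr_part_functors(2)])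

abbreviation "Ps \<equiv> Fun2 (op J) (Cat2 V)"
abbreviation "cmp_at \<equiv> comparison V J U C"
abbreviation "Wf \<equiv> W_fun V J U C"

lemma U_zero:
  assumes "j \<in> zero_cells J"
  shows "left (U j) \<in> one_cells C" "ob C (left (U j)) = U j" "bot (U j) = t0 C (left (U j))"
proof -
  have "U j \<in> zero_cells (Arr C)" using two_functor_zero[OF U assms] .
  then obtain u where "u \<in> one_cells C" "U j = ob C u" using Arr_zero_cells by blast
  then show "left (U j) \<in> one_cells C" "ob C (left (U j)) = U j" "bot (U j) = t0 C (left (U j))" by simp_all
qed

lemma U_cell:
  assumes "y \<in> cells J"
  shows "U y \<in> cells (Arr C)" "left (U y) = left (U (s0 J y))" "right (U y) = left (U (t0 J y))"
  using two_functorD[OF U assms] by (auto simp del: sqU.D_simps simp flip: two_functorD(2,3)[OF U assms])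

lemma comparison_simps:
  assumes f: "f \<in> one_cells C"
  shows "mfrom (cmp_at f) = (\<lambda>y\<in>cells J. hpre V C (s0 C f) (bot (U y)))"
    "mto (cmp_at f) = (\<lambda>y\<in>cells J. hpre V (Arr C) (ob C f) (U y))"
    "j \<in> zero_cells J \<Longrightarrow> mat (cmp_at f) j = compar (left (U j)) f"
    "mat (cmp_at f) \<in> extensional (zero_cells J)"
proof -
  have z: "s0 C f \<in> zero_cells C" using one_cellD(1)[OF f] by simp
  show "mfrom (cmp_at f) = (\<lambda>y\<in>cells J. hpre V C (s0 C f) (bot (U y)))"
    using z by (simp add: comparison_def cod_nerve_def codU.nerve_simps)
  show "mto (cmp_at f) = (\<lambda>y\<in>cells J. hpre V (Arr C) (ob C f) (U y))"
    by (simp add: comparison_def sq_nerve_def sqU.nerve_simps)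
  show "mat (cmp_at f) \<in> extensional (zero_cells J)" by (simp add: comparison_def)
  have "fill_sq u f = (\<lambda>h. Sq u (h \<star>\<^bsub>C\<^esub> u) (f \<star>\<^bsub>C\<^esub> h) f)" for u by (rule ext) (simp add: fill_sq_def)
  then show "mat (cmp_at f) j = compar (left (U j)) f" if "j \<in> zero_cells J"
    using that by (simp add: comparison_def compar_def Let_def U_zero(2))
qed

lemma comparison_cell:
  assumes f: "f \<in> one_cells C"
  shows "cmp_at f \<in> one_cells Ps"
proof -
  have z: "s0 C f \<in> zero_cells C" "ob C f \<in> zero_cells (Arr C)" using one_cellD(1)[OF f] f Arr_zero_cells by auto
  have n: "two_natural (op J) (Cat2 V) (mfrom (cmp_at f)) (mto (cmp_at f)) (\<lambda>j. compar (left (U j)) f)"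
    unfolding two_natural_def codU.zero_op
  proof (intro conjI ballI)
    fix j assume j: "j \<in> zero_cells J"
    note jc = J.zero_cellD(1)[OF j]
    have "U j \<in> zero_cells (op (Arr C))" using two_functor_zero[OF U j] A.op_zero_cells by simp
    then show "compar (left (U j)) f \<in> one_cells (Cat2 V)" "s0 (Cat2 V) (compar (left (U j)) f) = mfrom (cmp_at f) j"
      "t0 (Cat2 V) (compar (left (U j)) f) = mto (cmp_at f) j"
      using Wpre_functor(2)[OF f] jc unfolding two_natural_def comparison_simps(1,2)[OF f] by (simp_all del:
          Cat2_simps)
  next
    fix y assume "y \<in> cells (op J)"
    then have y: "y \<in> cells J" by simp
    show "compar (left (U (t0 (op J) y))) f \<star>\<^bsub>Cat2 V\<^esub> mfrom (cmp_at f) y = mto (cmp_at f) y \<star>\<^bsub>Cat2 V\<^esub> compar (left (U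
        (s0 (op J) y))) f"
      using compar_pre[OF f U_cell(1)[OF y]] y unfolding op_simps comparison_simps(1,2)[OF f] U_cell(2,3)[OF y]
      by (simp del: Cat2_simps)
  qed
  have "Mdf (mfrom (cmp_at f)) (\<lambda>j\<in>zero_cells (op J). compar (left (U j)) f) (mto (cmp_at f)) \<in> one_cells Ps"
    by (rule Fun2_one_cellI[OF twocat_op[OF J.twocat_axioms] _ _ _ _ n twocat_V])
      (use codU.hpre_functor_D[OF z(1)] sqU.hpre_functor_D[OF z(2)] in \<open>simp_all add: comparison_simps(1,2)[OF f]\<close>)
  moreover have "(\<lambda>j\<in>zero_cells (op J). compar (left (U j)) f) = mat (cmp_at f)"
    using comparison_simps(3,4)[OF f] unfolding codU.zero_op by (subst restrict_eq_iff) auto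
  ultimately show ?thesis by simp
qed

text \<open>Identifies the action of a cell of \<open>J\<close> on the comparison of
  \<open>f\<close> with \<open>Wpre\<close>. Naturality of a family of algebras over
  \<open>J\<close> thereby becomes strictness of the squares \<open>Wpre f (U y)\<close>.\<close>

lemma comparison_at:
  assumes f: "f \<in> one_cells C" and y: "y \<in> cells J"
  shows "nat_square (op J) (cmp_at f) y = Wpre f (U y)"
  using y J.zero_s0[OF y] J.zero_t0[OF y] U_cell(2,3)[OF y]
  by (simp add: nat_square_def Wpre_def comparison_simps[OF f])

text \<open>Evaluated at one object of \<open>J\<close>, the 2-functor \<open>W\<^sub>U\<close> is
  \<open>Wpost\<close>. Statements on presheaf algebras thus turn into statements in the arrow
  2-category of the base.\<close>

lemma ev_W:
  assumes j: "j \<in> zero_cells J" and x: "x \<in> cells (Arr C)"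
  shows "ev j (Wf x) = Wpost (left (U j)) x"
  using j Arr_cellD(1,2)[OF x]
  by (simp add: ev_def W_fun_def Wpost_def comparison_simps cod_nerve_def sq_nerve_def codU.nerve_simps(3)
      sqU.nerve_simps(3) U_zero(2,3))

lemma W_cell:
  assumes x: "x \<in> cells (Arr C)"
  shows "Wf x \<in> cells (Arr Ps)"
proof -
  note X = Arr_cellD[OF x]
  have "mat (cmp_at (right x)) j \<star>\<^bsub>Cat2 V\<^esub> mat (nerve V J C (\<lambda>y. bot (U y)) (top x)) j =
     mat (nerve V J (Arr C) U x) j \<star>\<^bsub>Cat2 V\<^esub> mat (cmp_at (left x)) j" if j: "j \<in> zero_cells J" for j
    using compar_post[OF U_zero(1)[OF j] x] j
    by (simp add: comparison_simps(3)[OF X(1)] comparison_simps(3)[OF X(2)] codU.nerve_simps(3) sqU.nerve_simps(3)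
        U_zero(2,3) del: Cat2_simps)
  then show ?thesis
    unfolding Arr_cell_iff W_fun_def sq.sel cod_nerve_def sq_nerve_def
    using comparison_cell[OF X(1)] comparison_cell[OF X(2)] codU.nerve_cell[OF X(3)] sqU.nerve_cell[OF x]
    by (simp add: codU.nerve_simps(1,2) sqU.nerve_simps(1,2) comparison_simps(1,2)[OF X(1)] comparison_simps(1,2)[OF
        X(2)] X(5,6)
      del: Cat2_simps cong: restrict_cong)
qed

lemma W_ob:
  assumes f: "f \<in> one_cells C"
  shows "Wf (ob C f) = ob Ps (cmp_at f)"
proof -
  have z: "s0 C f \<in> zero_cells C" "ob C f \<in> zero_cells (Arr C)" using one_cellD(1)[OF f] f Arr_zero_cells by auto
  have e: "mat (nerve V J C (\<lambda>y. bot (U y)) x) \<in> extensional (zero_cells J)" "mat (nerve V J (Arr C) U y) \<in>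
      extensional (zero_cells J)" for x y
    by (simp_all add: nerve_def)
  have "nerve V J C (\<lambda>y. bot (U y)) (s0 C f) = s0 Ps (cmp_at f)"
  proof (rule mdf.expand, intro conjI)
    have "(\<lambda>j\<in>zero_cells J. mfrom (cmp_at f) j) = mat (nerve V J C (\<lambda>y. bot (U y)) (s0 C f))"
      by (subst restrict_eq_iff[OF e(1)])
        (auto simp: comparison_simps(1)[OF f] codU.nerve_simps(3) codU.hom_idnt[OF codU.D_zero z(1)] J.zero_cellD(1))
    then show "mat (nerve V J C (\<lambda>y. bot (U y)) (s0 C f)) = mat (s0 Ps (cmp_at f))" by simp
  qed (use z in \<open>simp_all add: codU.nerve_simps comparison_simps[OF f]\<close>)
  moreover have "nerve V J (Arr C) U (ob C f) = t0 Ps (cmp_at f)"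
  proof (rule mdf.expand, intro conjI)
    have "(\<lambda>j\<in>zero_cells J. mto (cmp_at f) j) = mat (nerve V J (Arr C) U (ob C f))"
      by (subst restrict_eq_iff[OF e(2)])
        (auto simp: comparison_simps(2)[OF f] sqU.nerve_simps(3) sqU.hom_idnt[OF sqU.D_zero z(2)] J.zero_cellD(1))
    then show "mat (nerve V J (Arr C) U (ob C f)) = mat (t0 Ps (cmp_at f))" by simp
  qed (simp_all add: sqU.nerve_simps comparison_simps[OF f])
  ultimately show ?thesis by (simp add: W_fun_def ob_def cod_nerve_def sq_nerve_def del: Fun2_simps)
qed

end

lemma RAlg_src_tgt:
  "s0 (RAlg K W) x = AlgC (alg_src x) (t0 (Arr K) (alg_src x)) (alg_src x)"
  "t0 (RAlg K W) x = AlgC (alg_tgt x) (t0 (Arr K) (alg_tgt x)) (alg_tgt x)"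
  by (simp_all add: RAlg_def Alg_def Let_def)

lemma pullback_2cat_simps:
  "z \<in> cells (pullback_2cat A B F G) \<longleftrightarrow> fst z \<in> cells A \<and> snd z \<in> cells B \<and> F (fst z) = G (snd z)"
  "s0 (pullback_2cat A B F G) z = (s0 A (fst z), s0 B (snd z))" "t0 (pullback_2cat A B F G) z = (t0 A (fst z), t0 B
      (snd z))"
  by (cases z; simp add: pullback_2cat_def Let_def)+

locale generated = lifting V C J U + X: awfs_loc C W + E: awfs_loc "Cat2 V" EM
  for V :: "'u cat set" and C :: "'c twocat" and J :: "'j twocat" and U W EM +
  fixes F
  assumes EM_lax: "lax_idempotent_monad (Arr (Cat2 V)) (Rfun EM) (Lambda (Cat2 V) EM) (Pi_mult (Cat2 V) EM)"
    and iso: "int_iso_over_sq C (RAlg_int C W) (Lift_int V EM J U C) F"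
begin

sublocale PW: pointwise_awfs "op J" "Cat2 V" EM
  unfolding pointwise_awfs_def using twocat_op[OF J.twocat_axioms] E.awfs_loc_axioms by blast

sublocale LM: lax_monad2 "Arr (Cat2 V)" "Rfun EM" "Lambda (Cat2 V) EM" "Pi_mult (Cat2 V) EM"
  by unfold_locales (rule EM_lax)

abbreviation "PB \<equiv> pullback_2cat (Arr C) (RAlg Ps (pointwise (op J) EM)) Wf alg_cell"

lemma F: "two_functor (RAlg C W) PB F" "bij_betw F (cells (RAlg C W)) (cells PB)"
  "z \<in> cells (RAlg C W) \<Longrightarrow> fst (F z) = alg_cell z"
  using iso unfolding int_iso_over_sq_def RAlg_int_def Lift_int_def Psh_def by auto

text \<open>The isomorphism \<open>F\<close> on objects: an algebra is the identity cell on itself,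
  and the source of the image of that cell is the corresponding algebra structure on the
  comparison.\<close>

definition psh_alg :: "'c sq \<Rightarrow> ('j, 'u nt) mdf sq" where
  "psh_alg a = alg_src (snd (F (AlgC a (t0 (Arr C) a) a)))"

text \<open>\<open>F\<close> lies over squares, which fixes the underlying cell, and it preserves
  sources and targets, which fixes the two algebras. So its values on objects determine it.\<close>

lemma F_cell:
  assumes z: "AlgC a x b \<in> cells (RAlg C W)"
  shows "F (AlgC a x b) = (x, AlgC (psh_alg a) (Wf x) (psh_alg b))" "AlgC (psh_alg a) (Wf x) (psh_alg b) \<in> cells (RAlg
      Ps (pointwise (op J) EM))"
proof -
  note f = two_functorD[OF F(1) z]
  have 1: "fst (F (AlgC a x b)) = x" using F(3)[OF z] by simp
  have 2: "alg_cell (snd (F (AlgC a x b))) = Wf x" "snd (F (AlgC a x b)) \<in> cells (RAlg Ps (pointwise (op J) EM))"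
    using f(1) 1 unfolding pullback_2cat_simps by auto
  have 3: "alg_src (snd (F (AlgC a x b))) = psh_alg a"
    using arg_cong[OF f(2), of "\<lambda>z. alg_src (snd z)"] by (simp add: psh_alg_def RAlg_src_tgt pullback_2cat_simps del:
        Arr_simps)
  have 4: "alg_tgt (snd (F (AlgC a x b))) = psh_alg b"
    using arg_cong[OF f(3), of "\<lambda>z. alg_src (snd z)"] by (simp add: psh_alg_def RAlg_src_tgt pullback_2cat_simps del:
        Arr_simps)
  have 5: "snd (F (AlgC a x b)) = AlgC (psh_alg a) (Wf x) (psh_alg b)" by (rule algc.expand) (simp add: 2 3 4)
  then show "F (AlgC a x b) = (x, AlgC (psh_alg a) (Wf x) (psh_alg b))" using 1 by (metis prod.collapse)
  show "AlgC (psh_alg a) (Wf x) (psh_alg b) \<in> cells (RAlg Ps (pointwise (op J) EM))" using 2(2) 5 by simp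
qed

lemma Ralgebra_right: "Ralgebra C W a \<Longrightarrow> right a \<in> one_cells C"
  unfolding Ralgebra_def algebra_def Arr_one_cells by (blast dest: Arr_cellD(2))

lemma psh_alg_algebra:
  assumes a: "Ralgebra C W a"
  shows "Ralgebra Ps (pointwise (op J) EM) (psh_alg a)" "right (psh_alg a) = cmp_at (right a)"
proof -
  have r: "right a \<in> one_cells C" by (rule Ralgebra_right[OF a])
  note c = F_cell(2)[OF X.RAlg_zero[OF a]]
  show "Ralgebra Ps (pointwise (op J) EM) (psh_alg a)" by (rule PW.RAlg_Fun2D(1)[OF c])
  have "left (s0 (Arr Ps) (Wf (t0 (Arr C) a))) = left (t0 (Arr Ps) (psh_alg a))" unfolding PW.RAlg_Fun2D(4)[OF c] ..
  then show "right (psh_alg a) = cmp_at (right a)" by (simp add: W_ob[OF r])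
qed

text \<open>One direction is that \<open>F\<close> preserves cells. In the other, surjectivity gives
  a preimage between some algebras \<open>a'\<close> and \<open>b'\<close>; injectivity of
  \<open>F\<close> on identity cells identifies these with \<open>a\<close> and
  \<open>b\<close>.\<close>

lemma strict_iff_psh_alg:
  assumes a: "Ralgebra C W a" and b: "Ralgebra C W b"
    and x: "x \<in> cells (Arr C)" "s0 (Arr C) x = t0 (Arr C) a" "t0 (Arr C) x = t0 (Arr C) b"
  shows "x \<star>\<^bsub>Arr C\<^esub> a = b \<star>\<^bsub>Arr C\<^esub> Rfun W x \<longleftrightarrow> AlgC (psh_alg a) (Wf x) (psh_alg b) \<in> cells (RAlg Ps (pointwise (op J)
      EM))"
proof
  assume "x \<star>\<^bsub>Arr C\<^esub> a = b \<star>\<^bsub>Arr C\<^esub> Rfun W x"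
  then have "AlgC a x b \<in> cells (RAlg C W)" using a b x unfolding X.RAlg_simps by blast
  then show "AlgC (psh_alg a) (Wf x) (psh_alg b) \<in> cells (RAlg Ps (pointwise (op J) EM))" by (rule F_cell(2))
next
  assume "AlgC (psh_alg a) (Wf x) (psh_alg b) \<in> cells (RAlg Ps (pointwise (op J) EM))"
  then have "(x, AlgC (psh_alg a) (Wf x) (psh_alg b)) \<in> cells PB" unfolding pullback_2cat_simps using x by simp
  then obtain z where z: "z \<in> cells (RAlg C W)" "F z = (x, AlgC (psh_alg a) (Wf x) (psh_alg b))"
    using F(2) unfolding bij_betw_def by (metis (no_types, lifting) imageE)
  obtain a' x' b' where zz: "z = AlgC a' x' b'" by (cases z)
  have x': "x' = x" using F(3)[OF z(1)] z(2) zz by simp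
  note zc = z(1)[unfolded zz x']
  note ra = zc[unfolded X.RAlg_simps]
  have s: "psh_alg a' = psh_alg a" "psh_alg b' = psh_alg b" using F_cell(1)[OF zc] z(2) unfolding zz x' by auto
  have "F (AlgC a' (t0 (Arr C) a') a') = F (AlgC a (t0 (Arr C) a) a)" "F (AlgC b' (t0 (Arr C) b') b') = F (AlgC b (t0
      (Arr C) b) b)"
    using F_cell(1)[OF X.RAlg_zero[of a']] F_cell(1)[OF X.RAlg_zero[of b']] F_cell(1)[OF X.RAlg_zero[OF a]]
        F_cell(1)[OF X.RAlg_zero[OF b]] ra s x
    by (simp_all del: Arr_simps)
  then have "a' = a" "b' = b"
    using inj_onD[OF bij_betw_imp_inj_on[OF F(2)]] X.RAlg_zero[of a'] X.RAlg_zero[of b'] X.RAlg_zero[OF a]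
        X.RAlg_zero[OF b] ra by blast+
  then show "x \<star>\<^bsub>Arr C\<^esub> a = b \<star>\<^bsub>Arr C\<^esub> Rfun W x" using ra by blast
qed

text \<open>A structure \<open>s\<close> on the comparison of \<open>e\<close> gives an identity
  cell of the pullback, and the preimage of that cell under \<open>F\<close> provides the algebra.
  That it is a cell of algebras is checked at each \<open>j\<close>.\<close>

lemma algebra_of_psh_alg:
  assumes e: "e \<in> one_cells C" and s: "Ralgebra Ps (pointwise (op J) EM) s" "right s = cmp_at e"
  obtains a where "Ralgebra C W a" "right a = e" "psh_alg a = s"
proof -
  have z: "ob C e \<in> zero_cells (Arr C)" using e Arr_zero_cells by blast
  note zz = A.zero_cellD[OF z]
  have w: "Wf (ob C e) = t0 (Arr Ps) s" "Wf (ob C e) \<in> cells (Arr Ps)" using W_ob[OF e] s(2) W_cell[OF zz(1)] by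
      simp_all
  have "AlgC s (Wf (ob C e)) s \<in> cells (RAlg Ps (pointwise (op J) EM))"
  proof (rule PW.strict_of_pointwise[OF s(1) s(1) w(2)])
    show "s0 (Arr Ps) (Wf (ob C e)) = t0 (Arr Ps) s" "t0 (Arr Ps) (Wf (ob C e)) = t0 (Arr Ps) s"
      unfolding W_ob[OF e] using s(2) by simp_all
    fix j assume j: "j \<in> zero_cells (op J)"
    then have j': "j \<in> zero_cells J" using codU.zero_op by simp
    let ?a = "ev j s"
    have alg: "?a \<in> cells (Arr (Cat2 V))" "s0 (Arr (Cat2 V)) ?a = Rfun EM (t0 (Arr (Cat2 V)) ?a)"
      using PW.ev_algebra[OF s(1) j] E.R.one_cellD(1) unfolding Ralgebra_def algebra_def by auto
    have c: "cmp_at e \<in> cells Ps" using comparison_cell[OF e] Fun2_one_cell by blast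
    have "ev j (Wf (ob C e)) = t0 (Arr (Cat2 V)) ?a"
      using PW.ev_ob[OF c j] unfolding W_ob[OF e] using s(2) by simp
    then show "ev j (Wf (ob C e)) \<star>\<^bsub>Arr (Cat2 V)\<^esub> ?a = ?a \<star>\<^bsub>Arr (Cat2 V)\<^esub> Rfun EM (ev j (Wf (ob C e)))"
      using E.R.hcat(7)[OF alg(1) refl] E.R.hcat(8)[OF alg(1) refl] alg(2) by (simp del: Arr_simps)
  qed
  then have "(ob C e, AlgC s (Wf (ob C e)) s) \<in> cells PB" unfolding pullback_2cat_simps using zz by simp
  then obtain y where y: "y \<in> cells (RAlg C W)" "F y = (ob C e, AlgC s (Wf (ob C e)) s)"
    using F(2) unfolding bij_betw_def by (metis (no_types, lifting) imageE)
  obtain a x b where yy: "y = AlgC a x b" by (cases y)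
  have x: "x = ob C e" using F(3)[OF y(1)] y(2) yy by simp
  note yc = y(1)[unfolded yy x]
  have "psh_alg a = s" using F_cell(1)[OF yc] y(2) unfolding yy x by simp
  moreover have "Ralgebra C W a" "right a = e" using yc[unfolded X.RAlg_simps] by (auto dest: arg_cong[of _ _ left])
  ultimately show thesis using that by blast
qed

text \<open>The algebra structures on comma objects are found for each \<open>j\<close> separately; naturality in \<open>j\<close> is
  \<open>comma_strict\<close>, applied to the action of the cells of \<open>J\<close>.\<close>

lemma comma_algebra:
  assumes complete: "V_complete V C" and a: "Ralgebra C W a" and b: "Ralgebra C W b" and h: "h \<in> one_cells (Arr C)"
    and ab: "s0 (Arr C) h = t0 (Arr C) a" "t0 (Arr C) h = t0 (Arr C) b"
  shows "\<exists>p q k c. is_comma (Arr C) h p q k \<and> Ralgebra C W c \<and> t0 (Arr C) c = s0 (Arr C) p \<and>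
    (\<forall>j\<in>zero_cells J. LM.comma_alg (ev j (psh_alg a)) (ev j (psh_alg b)) (Wpost (left (U j)) h) (Wpost (left (U j)) p)
       (Wpost (left (U j)) q) (Wpost (left (U j)) k) (ev j (psh_alg c)))"
proof -
  have hc: "h \<in> cells (Arr C)" "top h \<in> one_cells C" "bot h \<in> one_cells C" using h unfolding Arr_one_cells by auto
  have lr: "left h = right a" "right h = right b" using ab by (auto dest: arg_cong[of _ _ left])
  \<comment> \<open>Completeness of \<open>C\<close> provides comma objects for the domain and the
    codomain part of \<open>h\<close>; together they form the one in
    \<open>C\<^sup>2\<close>.\<close>
  obtain p0 q0 k0 where T: "is_comma C (top h) p0 q0 k0" using comma_ex_complete[OF complete hc(2)] by blast
  obtain p1 q1 k1 where B: "is_comma C (bot h) p1 q1 k1" using comma_ex_complete[OF complete hc(3)] by blast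
  obtain e where e: "e \<in> one_cells C"
    and K: "is_comma (Arr C) h (Sq e p0 p1 (left h)) (Sq e q0 q1 (right h)) (Sq e k0 k1 (right h))"
    using Arr_comma_ex[OF twocat_axioms h T B] by blast
  define p where "p = Sq e p0 p1 (left h)"
  define q where "q = Sq e q0 q1 (right h)"
  define k where "k = Sq e k0 k1 (right h)"
  note K = K[folded p_def q_def k_def]
  note Kc = A.commaD[OF K]
  have sel: "left p = e" "right p = left h" "top p = p0" "bot p = p1" "left q = e" "right q = right h" "top q = q0"
      "bot q = q1"
    "left k = e" "right k = right h" "top k = k0" "bot k = k1" by (simp_all add: p_def q_def k_def)
  note sa = psh_alg_algebra[OF a] and sb = psh_alg_algebra[OF b]
  note ra = Ralgebra_right[OF a] and rb = Ralgebra_right[OF b]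
  have alg: "algebra (Arr (Cat2 V)) (Rfun EM) (Lambda (Cat2 V) EM) (Pi_mult (Cat2 V) EM) (ev j (psh_alg a))"
    "algebra (Arr (Cat2 V)) (Rfun EM) (Lambda (Cat2 V) EM) (Pi_mult (Cat2 V) EM) (ev j (psh_alg b))"
    "right (ev j (psh_alg a)) = compar (left (U j)) (left h)" "right (ev j (psh_alg b)) = compar (left (U j)) (right
        h)"
    if j: "j \<in> zero_cells J" for j
    using PW.ev_algebra[OF sa(1)] PW.ev_algebra[OF sb(1)] j codU.zero_op unfolding Ralgebra_def
    by (simp_all add: sa(2) sb(2) comparison_simps(3)[OF ra] comparison_simps(3)[OF rb] lr)
  \<comment> \<open>Preservation by the comparison at \<open>u\<close>: its domain part applies
    \<open>C(cod u, -)\<close> to the comma object of domains, its codomain part applies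
    \<open>C\<^sup>2(u, -)\<close> to the comma object of arrows. Both are representable.\<close>
  have Kj: "is_comma (Arr (Cat2 V)) (Wpost (left (U j)) h) (Wpost (left (U j)) p) (Wpost (left (U j)) q) (Wpost (left
      (U j)) k)"
    if j: "j \<in> zero_cells J" for j
  proof -
    note u = U_zero(1)[OF j]
    have z: "t0 C (left (U j)) \<in> zero_cells C" "ob C (left (U j)) \<in> zero_cells (Arr C)"
      using one_cellD(1)[OF u] u Arr_zero_cells by auto
    note wc = two_functorD(1)[OF Wpost_functor[OF u]]
    show ?thesis
      by (rule Arr_comma[OF twocat_V _ _ wc[OF Kc(1)] wc[OF Kc(4)] wc[OF Kc(7)] wc[OF Kc(10)]])
        (use hpost_comma[OF T z(1)] A.hpost_comma[OF K z(2)] in \<open>simp_all add: Wpost_def sel\<close>)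
  qed
  have "\<forall>j\<in>zero_cells J. \<exists>c. LM.comma_alg (ev j (psh_alg a)) (ev j (psh_alg b)) (Wpost (left (U j)) h) (Wpost (left (U
      j)) p)
       (Wpost (left (U j)) q) (Wpost (left (U j)) k) c"
  proof
    fix j assume j: "j \<in> zero_cells J"
    show "\<exists>c. LM.comma_alg (ev j (psh_alg a)) (ev j (psh_alg b)) (Wpost (left (U j)) h) (Wpost (left (U j)) p)
       (Wpost (left (U j)) q) (Wpost (left (U j)) k) c"
      by (rule LM.comma_alg_ex[OF alg(1,2)[OF j] Kj[OF j]]) (use alg(3,4)[OF j] in \<open>simp_all add: Wpost_def\<close>)
  qed
  from bchoice[OF this] obtain c where c: "\<And>j. j \<in> zero_cells J \<Longrightarrow> LM.comma_alg (ev j (psh_alg a)) (ev j (psh_alg b))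
     (Wpost (left (U j)) h) (Wpost (left (U j)) p) (Wpost (left (U j)) q) (Wpost (left (U j)) k) (c j)" by blast
  have cr: "Ralgebra (Cat2 V) EM (c j)" "right (c j) = compar (left (U j)) e" if j: "j \<in> zero_cells J" for j
  proof -
    have "t0 (Arr (Cat2 V)) (c j) = s0 (Arr (Cat2 V)) (Wpost (left (U j)) p)" and r: "Ralgebra (Cat2 V) EM (c j)"
      using c[OF j] unfolding LM.comma_alg_def Ralgebra_def by blast+
    from arg_cong[OF this(1), of left] show "right (c j) = compar (left (U j)) e" by (simp add: Wpost_def sel)
    show "Ralgebra (Cat2 V) EM (c j)" by fact
  qed
  have nat: "nat_square (op J) (cmp_at e) x \<star>\<^bsub>Arr (Cat2 V)\<^esub> c (s0 (op J) x) =
     c (t0 (op J) x) \<star>\<^bsub>Arr (Cat2 V)\<^esub> Rfun EM (nat_square (op J) (cmp_at e) x)" if "x \<in> cells (op J)" for x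
  proof -
    have x: "x \<in> cells J" using that by simp
    have z: "s0 J x \<in> zero_cells J" "t0 J x \<in> zero_cells J" using x by simp_all
    note Y = U_cell[OF x]
    define Y' where "Y' = U x"
    have Y': "Y' \<in> cells (Arr C)" "left (U (s0 J x)) = left Y'" "left (U (t0 J x)) = right Y'" using Y by (simp_all
        add: Y'_def)
    have Yop: "Y' \<in> cells (op (Arr C))" using Y'(1) by (simp del: Arr_simps)
    have W: "Wpre f Y' \<in> cells (Arr (Cat2 V))" "s0 (Arr (Cat2 V)) (Wpre f Y') = ob (Cat2 V) (compar (right Y') f)"
      "t0 (Arr (Cat2 V)) (Wpre f Y') = ob (Cat2 V) (compar (left Y') f)"
      "s1 (Arr (Cat2 V)) (Wpre f Y') = Wpre f (s1 (Arr C) Y')" "t1 (Arr (Cat2 V)) (Wpre f Y') = Wpre f (t1 (Arr C)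
          Y')"
      if f: "f \<in> one_cells C" for f
    proof -
      show "Wpre f Y' \<in> cells (Arr (Cat2 V))" by (rule two_functorD(1)[OF Wpre_functor(1)[OF f] Yop])
      show "s0 (Arr (Cat2 V)) (Wpre f Y') = ob (Cat2 V) (compar (right Y') f)"
        "t0 (Arr (Cat2 V)) (Wpre f Y') = ob (Cat2 V) (compar (left Y') f)" by (simp_all add: Wpre_def)
      show "s1 (Arr (Cat2 V)) (Wpre f Y') = Wpre f (s1 (Arr C) Y')" "t1 (Arr (Cat2 V)) (Wpre f Y') = Wpre f (t1 (Arr
          C) Y')"
        using two_functor_verD[OF Wpre_functor(1)[OF f] Yop] twocat_op[OF Arr_tc] twocat.two_cat unfolding op_simps by
            blast+
    qed
    have lh: "left h \<in> one_cells C" "right h \<in> one_cells C" using Arr_cellD(1,2)[OF hc(1)] .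
    have S: "s1 (Arr C) Y' \<in> cells (Arr C)" "left (s1 (Arr C) Y') = left Y'" "right (s1 (Arr C) Y') = right Y'"
      "t1 (Arr C) Y' \<in> cells (Arr C)" "left (t1 (Arr C) Y') = left Y'" "right (t1 (Arr C) Y') = right Y'"
      using A.vcat(1,2)[OF Y'(1)] by simp_all
    \<comment> \<open>The action of \<open>x\<close> is contravariant, so it leads from the comma
      object at \<open>t0 J x\<close> to the one at \<open>s0 J x\<close>. It is induced by the
      actions on the comparisons of \<open>left h\<close> and \<open>right h\<close>, which are
      strict because \<open>psh_alg a\<close> and \<open>psh_alg b\<close> are natural.\<close>
    have "Wpre e Y' \<star>\<^bsub>Arr (Cat2 V)\<^esub> c (t0 J x) = c (s0 J x) \<star>\<^bsub>Arr (Cat2 V)\<^esub> Rfun EM (Wpre e Y')"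
    proof (rule LM.comma_strict[OF c[OF z(2)] c[OF z(1)] W(1)[OF e] _ _ W(1)[OF lh(1)] _ _ W(1)[OF lh(2)]])
      show "s0 (Arr (Cat2 V)) (Wpre e Y') = s0 (Arr (Cat2 V)) (Wpost (left (U (t0 J x))) p)"
        "t0 (Arr (Cat2 V)) (Wpre e Y') = s0 (Arr (Cat2 V)) (Wpost (left (U (s0 J x))) p)"
        unfolding W[OF e] Y' by (simp_all add: Wpost_def sel)
      show "s0 (Arr (Cat2 V)) (Wpre (left h) Y') = t0 (Arr (Cat2 V)) (ev (t0 J x) (psh_alg a))"
        "t0 (Arr (Cat2 V)) (Wpre (left h) Y') = t0 (Arr (Cat2 V)) (ev (s0 J x) (psh_alg a))"
        "s0 (Arr (Cat2 V)) (Wpre (right h) Y') = t0 (Arr (Cat2 V)) (ev (t0 J x) (psh_alg b))"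
        "t0 (Arr (Cat2 V)) (Wpre (right h) Y') = t0 (Arr (Cat2 V)) (ev (s0 J x) (psh_alg b))"
        unfolding W(2,3)[OF lh(1)] W(2,3)[OF lh(2)] Arr_simps(2) alg(3,4)[OF z(1)] alg(3,4)[OF z(2)] Y' by (simp_all
            add: Wpre_def)
      show "Wpost (left (U (s0 J x))) p \<star>\<^bsub>Arr (Cat2 V)\<^esub> Wpre e Y' = Wpre (left h) Y' \<star>\<^bsub>Arr (Cat2 V)\<^esub> Wpost (left (U
          (t0 J x))) p"
        using Wpost_Wpre[OF Kc(4) Y'(1)] unfolding Y' sel .
      show "Wpost (left (U (s0 J x))) q \<star>\<^bsub>Arr (Cat2 V)\<^esub> Wpre e Y' = Wpre (right h) Y' \<star>\<^bsub>Arr (Cat2 V)\<^esub> Wpost (left (U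
          (t0 J x))) q"
        using Wpost_Wpre[OF Kc(7) Y'(1)] unfolding Y' sel .
      show "Wpre (right h) Y' \<star>\<^bsub>Arr (Cat2 V)\<^esub> Wpost (left (U (t0 J x))) h = Wpost (left (U (s0 J x))) h \<star>\<^bsub>Arr (Cat2
          V)\<^esub> Wpre (left h) Y'"
        using Wpost_Wpre[OF hc(1) Y'(1), symmetric] unfolding Y' .
      show "Wpre (left h) Y' \<star>\<^bsub>Arr (Cat2 V)\<^esub> ev (t0 J x) (psh_alg a) = ev (s0 J x) (psh_alg a) \<star>\<^bsub>Arr (Cat2 V)\<^esub> Rfun EM
          (Wpre (left h) Y')"
        using PW.ev_algebra_nat[OF sa(1) that] unfolding sa(2) op_simps comparison_at[OF ra x] Y'_def[symmetric] lr .
      show "Wpre (right h) Y' \<star>\<^bsub>Arr (Cat2 V)\<^esub> ev (t0 J x) (psh_alg b) = ev (s0 J x) (psh_alg b) \<star>\<^bsub>Arr (Cat2 V)\<^esub> Rfun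
          EM (Wpre (right h) Y')"
        using PW.ev_algebra_nat[OF sb(1) that] unfolding sb(2) op_simps comparison_at[OF rb x] Y'_def[symmetric] lr .
      show "Wpost (left (U (s0 J x))) k \<star>\<^bsub>Arr (Cat2 V)\<^esub> s1 (Arr (Cat2 V)) (Wpre e Y') =
          s1 (Arr (Cat2 V)) (Wpre (right h) Y') \<star>\<^bsub>Arr (Cat2 V)\<^esub> Wpost (left (U (t0 J x))) k"
        using Wpost_Wpre[OF Kc(10) S(1)] unfolding W(4)[OF e] W(4)[OF lh(2)] Y' sel S .
      show "Wpost (left (U (s0 J x))) k \<star>\<^bsub>Arr (Cat2 V)\<^esub> t1 (Arr (Cat2 V)) (Wpre e Y') =
          t1 (Arr (Cat2 V)) (Wpre (right h) Y') \<star>\<^bsub>Arr (Cat2 V)\<^esub> Wpost (left (U (t0 J x))) k"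
        using Wpost_Wpre[OF Kc(10) S(4)] unfolding W(5)[OF e] W(5)[OF lh(2)] Y' sel S .
    qed
    then show ?thesis unfolding comparison_at[OF e x] Y'_def op_simps .
  qed
  have cA: "Ralgebra (Cat2 V) EM (c A) \<and> right (c A) = mat (cmp_at e) A" if "A \<in> zero_cells (op J)" for A
    using cr[of A] that codU.zero_op by (simp add: comparison_simps(3)[OF e])
  \<comment> \<open>The natural family is assembled into an algebra on the presheaf comparison, and
    the isomorphism \<open>F\<close> turns it into an \<open>R\<close>-algebra on the vertex of the
    comma object.\<close>
  obtain s where s: "Ralgebra Ps (pointwise (op J) EM) s" "right s = cmp_at e" "\<And>j. j \<in> zero_cells (op J) \<Longrightarrow> ev j s = c
      j"
    using PW.algebra_of_pointwise[OF comparison_cell[OF e] cA nat] by blast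
  obtain c' where c': "Ralgebra C W c'" "right c' = e" "psh_alg c' = s" by (rule algebra_of_psh_alg[OF e s(1,2)])
  have "t0 (Arr C) c' = s0 (Arr C) p" by (simp add: c' sel)
  moreover have "ev j (psh_alg c') = c j" if "j \<in> zero_cells J" for j using s(3) that codU.zero_op c'(3) by simp
  ultimately show ?thesis using K c'(1) c by (intro exI[of _ p] exI[of _ q] exI[of _ k] exI[of _ c']) simp
qed

text \<open>The 2-functors to which algebras are pulled back are the evaluations of
  \<open>W\<^sub>U\<close> at the objects of \<open>J\<close>. Lax idempotency of the monad is then
  passed to the comonad by \<open>X.lax_orthogonalI\<close>.\<close>

lemma lax_orthogonal:
  assumes complete: "V_complete V C"
  shows "lax_orthogonal C W"
proof -
  interpret pb: algebras_pulled_back "Arr C" "Rfun W" "Lambda C W" "Pi_mult C W"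
    "Arr (Cat2 V)" "Rfun EM" "Lambda (Cat2 V) EM" "Pi_mult (Cat2 V) EM"
    "\<lambda>j. Wpost (left (U j))" "zero_cells J" "\<lambda>a j. ev j (psh_alg a)"
  proof (unfold_locales, goal_cases)
    case (1 j)
    then show ?case using Wpost_functor[OF U_zero(1)] by blast
  next
    case (2 a j)
    then have a: "Ralgebra C W a" and j: "j \<in> zero_cells J" "j \<in> zero_cells (op J)" by (simp_all add: Ralgebra_def)
    note sa = psh_alg_algebra[OF a] and ra = Ralgebra_right[OF a]
    have z: "ob C (right a) \<in> cells (Arr C)" using ra Arr_zero_cells A.zero_cellD(1) by blast
    have "cmp_at (right a) \<in> cells Ps" using comparison_cell[OF ra] Fun2_one_cell by blast
    then have "ob (Cat2 V) (mat (cmp_at (right a)) j) = Wpost (left (U j)) (ob C (right a))"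
      using ev_W[OF j(1) z] PW.ev_ob[OF _ j(2)] unfolding W_ob[OF ra] by simp
    then show ?case using PW.ev_algebra[OF sa(1) j(2)] sa(2) unfolding Ralgebra_def by simp
  next
    case (3 a b x)
    then have ab: "Ralgebra C W a" "Ralgebra C W b" by (simp_all add: Ralgebra_def)
    note sa = psh_alg_algebra[OF ab(1)] and sb = psh_alg_algebra[OF ab(2)]
    note ra = Ralgebra_right[OF ab(1)] Ralgebra_right[OF ab(2)]
    note evx = ev_W[OF _ 3(3)]
    have lr: "left x = right a" "right x = right b" using 3(4,5) by (auto dest: arg_cong[of _ _ left])
    have "s0 (Arr Ps) (Wf x) = t0 (Arr Ps) (psh_alg a)" "t0 (Arr Ps) (Wf x) = t0 (Arr Ps) (psh_alg b)"
      by (simp_all add: W_fun_def sa sb lr)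
    note strict = PW.strict_of_pointwise[OF sa(1) sb(1) W_cell[OF 3(3)] this]
    show ?case unfolding strict_iff_psh_alg[OF ab 3(3-5)]
    proof
      assume "AlgC (psh_alg a) (Wf x) (psh_alg b) \<in> cells (RAlg Ps (pointwise (op J) EM))"
      from PW.RAlg_Fun2D(6)[OF this] show "\<forall>j\<in>zero_cells J. Wpost (left (U j)) x \<star>\<^bsub>Arr (Cat2 V)\<^esub> ev j (psh_alg a) =
          ev j (psh_alg b) \<star>\<^bsub>Arr (Cat2 V)\<^esub> Rfun EM (Wpost (left (U j)) x)"
        using evx codU.zero_op by (simp del: Arr_simps)
    next
      assume "\<forall>j\<in>zero_cells J. Wpost (left (U j)) x \<star>\<^bsub>Arr (Cat2 V)\<^esub> ev j (psh_alg a) =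
          ev j (psh_alg b) \<star>\<^bsub>Arr (Cat2 V)\<^esub> Rfun EM (Wpost (left (U j)) x)"
      then show "AlgC (psh_alg a) (Wf x) (psh_alg b) \<in> cells (RAlg Ps (pointwise (op J) EM))"
        by (intro strict) (use evx codU.zero_op in \<open>simp_all del: Arr_simps\<close>)
    qed
  next
    case (4 a b h)
    then show ?case using comma_algebra[OF complete, of a b h] unfolding Ralgebra_def by blast
  qed
  show ?thesis by (rule X.lax_orthogonalI[OF pb.lax_idempotent])
qed

end

theorem theorem7p1:
  fixes V :: "'u cat set" and C :: "'c twocat"
  assumes "base_2category V"
    and "V_category V C" and "V_complete V C" and "V_cocomplete V C"
  shows "(\<forall>(EM :: 'u nt awfs_data) (J :: 'j twocat) (U :: 'j \<Rightarrow> 'c sq) (W :: 'c awfs_data).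
            lofs (Cat2 V) EM \<and> small_V_category V J \<and> two_functor J (Arr C) U \<and>
            awfs C W \<and> cofibrantly_generated V EM J U C W \<longrightarrow> lax_orthogonal C W) \<and>
         (\<forall>(EM :: 'u nt awfs_data) (J :: 'j twocat) (U :: 'j \<Rightarrow> 'c sq) (W :: 'c awfs_data).
            KZ_awfs V EM \<and> small_V_category V J \<and> two_functor J (Arr C) U \<and>
            awfs C W \<and> cofibrantly_generated V EM J U C W \<longrightarrow> lax_orthogonal C W)"
proof -
  interpret base V by unfold_locales fact
  have C: "twocat C" using assms(2) by (simp add: V_category_def twocat_def)
  interpret baseC V C
    unfolding baseC_def Vcat_def Vcat_axioms_def
    using base_axioms C assms(2) V_category by (auto simp: V_category_def)
  have main: "lax_orthogonal C W"
    if EM: "lofs (Cat2 V) EM" and J: "small_V_category V J" "two_functor J (Arr C) U" and W: "awfs C W"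
        "cofibrantly_generated V EM J U C W"
    for EM and J :: "'j twocat" and U W
  proof -
    have tJ: "twocat J" using J(1) by (simp add: small_V_category_def V_category_def twocat_def)
    obtain F where F: "int_iso_over_sq C (RAlg_int C W) (Lift_int V EM J U C) F"
      using W(2) unfolding cofibrantly_generated_def by blast
    interpret generated V C J U W EM F
      unfolding generated_def lifting_def lifting_axioms_def generated_axioms_def awfs_loc_def awfs_loc_axioms_def
      using baseC_axioms tJ J(2) W(1) EM F C twocat_V unfolding lofs_def lax_orthogonal_def by blast
    show ?thesis by (rule lax_orthogonal[OF assms(3)])
  qed
  \<comment> \<open>The RALI description and the lax colimits make the KZ system lax orthogonal, so
    the second claim is an instance of the first.\<close>
  have KZ: "lofs (Cat2 V) EM" if EM: "KZ_awfs V EM" for EM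
  proof -
    interpret E: awfs_loc "Cat2 V" EM
      using EM twocat_V unfolding awfs_loc_def awfs_loc_axioms_def KZ_awfs_def by blast
    obtain F where F: "int_iso_over_sq (Cat2 V) (RAlg_int (Cat2 V) EM) (Rali_int (Cat2 V)) F"
      using EM unfolding KZ_awfs_def by blast
    have "lax_idempotent_monad (Arr (Cat2 V)) (Rfun EM) (Lambda (Cat2 V) EM) (Pi_mult (Cat2 V) EM)"
      by (rule E.KZ_lax_idempotent[OF _ F]) (use EM in \<open>simp_all add: KZ_awfs_def del: Cat2_simps\<close>)
    then show ?thesis using E.lax_orthogonalI EM unfolding lofs_def KZ_awfs_def by blast
  qed
  show ?thesis using main KZ by blast
qed

end
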